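(* Let $\mathsf J\subseteq[n-1]$. The restriction of $\pi$ to $\mathcal F_\Delta(\mathsf J)$ induces an equivalence (of additive categories) $$\mathcal F_\Delta(\mathsf J)/\operatorname{add}\mathbb T_{\mathsf J}\to\operatorname{Sub}Q_{\mathsf J},\qquad X\mapsto X/\eta X.$$
   Context: Fix an integer $n>1$; $[m]=\{1,\dots,m\}$. All modules are finite dimensional left modules. $D$ is the Auslander algebra of $\mathbb C[t]/(t^n)$: the path algebra over $\mathbb C$ of the quiver with vertices $0,\dots,n-1$ and arrows $b_i\colon i-1\to i$, $a_i\colon i\to i-1$ ($1\le i\le n-1$), with relations $b_{n-1}a_{n-1}=0$ (first $a_{n-1}$, then $b_{n-1}$) and $a_ib_i=b_{i-1}a_{i-1}$ for $2\le i\le n-1$. $e_i$ is the trivial path at $i$, $D_i=De_i$. The standard module $\Delta_i$ ($1\le i\le n$) is one-dimensional at vertices $0,\dots,i-1$ and zero elsewhere, with $a_1,\dots,a_{i-1}$ acting as isomorphisms and all $b_j$ as zero. $\mathcal F_\Delta\subseteq\operatorname{mod}D$ is the full subcategory of modules with a filtration by standard modules. $\mathbb T_n=D_0$, $\mathbb T_i=D_0/D_i$ for $1\le i<n$ (with $D_i$ embedded in $D_0$), $\mathbb T=\bigoplus_{i=1}^n\mathbb T_i$. $\eta M$ is the trace of $\mathbb T$ in $M$ (sum of the images of all maps $\mathbb T\to M$), and $\pi M=M/\eta M$, a module over $\Pi=D/De_0D$, the preprojective algebra of type $\mathbb A_{n-1}$ with vertices $1,\dots,n-1$. $\mathbb T_{\mathsf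 J}=\bigoplus_{j\in\mathsf J}\mathbb T_j$; $\mathcal F_\Delta(\mathsf J)$ is the full subcategory of $M\in\mathcal F_\Delta$ with $\eta M\in\operatorname{add}\mathbb T_{\mathsf J}$. $\Pi_i$ is the indecomposable projective $\Pi$-module with top $S_i$, $Q_{\mathsf J}=\bigoplus_{j\in\mathsf J}\Pi_{n-j}$, and $\operatorname{Sub}Q_{\mathsf J}$ is the full subcategory of $\operatorname{mod}\Pi$ of submodules of modules in $\operatorname{add}Q_{\mathsf J}$. $\mathcal F_\Delta(\mathsf J)/\operatorname{add}\mathbb T_{\mathsf J}$ is the quotient by the ideal of maps factoring through $\operatorname{add}\mathbb T_{\mathsf J}$. *)

theory Defs
  imports
    Complex_Main
    "HOL-Algebra.QuotRing"
    "HOL-Algebra.Module"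
    "HOL-Algebra.Generated_Groups"
    "Graph_Theory.Arc_Walk"
begin

section \<open>Additive categories\<close>

text \<open>
  Morphism groups are commutative groups in the sense of \<^theory>\<open>HOL-Algebra.Group\<close>, hence written
  multiplicatively: in \<open>HomGrp C X Y\<close> the operation \<open>\<otimes>\<close> is the sum of morphisms and \<open>\<one>\<close> is the
  zero morphism. \<open>Cmp C X Y Z g f\<close> is the composite of \<open>f : X \<rightarrow> Y\<close> and \<open>g : Y \<rightarrow> Z\<close>.
\<close>

record ('o, 'f) precat =
  Ob :: "'o set"
  HomGrp :: "'o \<Rightarrow> 'o \<Rightarrow> 'f monoid"
  Cmp :: "'o \<Rightarrow> 'o \<Rightarrow> 'o \<Rightarrow> 'f \<Rightarrow> 'f \<Rightarrow> 'f"
  Idn :: "'o \<Rightarrow> 'f"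

abbreviation Mor :: "('o, 'f) precat \<Rightarrow> 'o \<Rightarrow> 'o \<Rightarrow> 'f set"
  where "Mor C X Y \<equiv> carrier (HomGrp C X Y)"

locale preadditive_category =
  fixes C :: "('o, 'f) precat"
  assumes hom_comm_group: "\<lbrakk>X \<in> Ob C; Y \<in> Ob C\<rbrakk> \<Longrightarrow> comm_group (HomGrp C X Y)"
    and id_closed: "X \<in> Ob C \<Longrightarrow> Idn C X \<in> Mor C X X"
    and cmp_closed:
      "\<lbrakk>X \<in> Ob C; Y \<in> Ob C; Z \<in> Ob C; f \<in> Mor C X Y; g \<in> Mor C Y Z\<rbrakk>
        \<Longrightarrow> Cmp C X Y Z g f \<in> Mor C X Z"
    and id_left: "\<lbrakk>X \<in> Ob C; Y \<in> Ob C; f \<in> Mor C X Y\<rbrakk> \<Longrightarrow> Cmp C X Y Y (Idn C Y) f = f"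
    and id_right: "\<lbrakk>X \<in> Ob C; Y \<in> Ob C; f \<in> Mor C X Y\<rbrakk> \<Longrightarrow> Cmp C X X Y f (Idn C X) = f"
    and cmp_assoc:
      "\<lbrakk>W \<in> Ob C; X \<in> Ob C; Y \<in> Ob C; Z \<in> Ob C;
        f \<in> Mor C W X; g \<in> Mor C X Y; h \<in> Mor C Y Z\<rbrakk>
        \<Longrightarrow> Cmp C W X Z (Cmp C X Y Z h g) f = Cmp C W Y Z h (Cmp C W X Y g f)"
    and cmp_add_left:
      "\<lbrakk>X \<in> Ob C; Y \<in> Ob C; Z \<in> Ob C; f \<in> Mor C X Y; g \<in> Mor C Y Z; g' \<in> Mor C Y Z\<rbrakk>
        \<Longrightarrow> Cmp C X Y Z (g \<otimes>\<^bsub>HomGrp C Y Z\<^esub> g') f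
          = Cmp C X Y Z g f \<otimes>\<^bsub>HomGrp C X Z\<^esub> Cmp C X Y Z g' f"
    and cmp_add_right:
      "\<lbrakk>X \<in> Ob C; Y \<in> Ob C; Z \<in> Ob C; f \<in> Mor C X Y; f' \<in> Mor C X Y; g \<in> Mor C Y Z\<rbrakk>
        \<Longrightarrow> Cmp C X Y Z g (f \<otimes>\<^bsub>HomGrp C X Y\<^esub> f')
          = Cmp C X Y Z g f \<otimes>\<^bsub>HomGrp C X Z\<^esub> Cmp C X Y Z g f'"

locale additive_category = preadditive_category +
  assumes zero_object: "\<exists>Z\<in>Ob C. Idn C Z = \<one>\<^bsub>HomGrp C Z Z\<^esub>"
    and biproducts:
      "\<lbrakk>X \<in> Ob C; Y \<in> Ob C\<rbrakk> \<Longrightarrow>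
        \<exists>P\<in>Ob C. \<exists>i\<in>Mor C X P. \<exists>j\<in>Mor C Y P. \<exists>p\<in>Mor C P X. \<exists>q\<in>Mor C P Y.
          Cmp C X P X p i = Idn C X \<and> Cmp C Y P Y q j = Idn C Y \<and>
          Cmp C Y P X p j = \<one>\<^bsub>HomGrp C Y X\<^esub> \<and> Cmp C X P Y q i = \<one>\<^bsub>HomGrp C X Y\<^esub> \<and>
          Cmp C P X P i p \<otimes>\<^bsub>HomGrp C P P\<^esub> Cmp C P Y P j q = Idn C P"

definition additive_functor ::
  "('o, 'f) precat \<Rightarrow> ('p, 'g) precat \<Rightarrow> ('o \<Rightarrow> 'p) \<Rightarrow> ('o \<Rightarrow> 'o \<Rightarrow> 'f \<Rightarrow> 'g) \<Rightarrow> bool"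
  where "additive_functor C D F \<Phi> \<longleftrightarrow>
    (\<forall>X\<in>Ob C. F X \<in> Ob D) \<and>
    (\<forall>X\<in>Ob C. \<forall>Y\<in>Ob C. \<Phi> X Y \<in> hom (HomGrp C X Y) (HomGrp D (F X) (F Y))) \<and>
    (\<forall>X\<in>Ob C. \<Phi> X X (Idn C X) = Idn D (F X)) \<and>
    (\<forall>X\<in>Ob C. \<forall>Y\<in>Ob C. \<forall>Z\<in>Ob C. \<forall>f\<in>Mor C X Y. \<forall>g\<in>Mor C Y Z.
      \<Phi> X Z (Cmp C X Y Z g f) = Cmp D (F X) (F Y) (F Z) (\<Phi> Y Z g) (\<Phi> X Y f))"

definition iso_mor :: "('o, 'f) precat \<Rightarrow> 'o \<Rightarrow> 'o \<Rightarrow> 'f \<Rightarrow> bool"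
  where "iso_mor C X Y f \<longleftrightarrow>
    f \<in> Mor C X Y \<and> (\<exists>g\<in>Mor C Y X. Cmp C X Y X g f = Idn C X \<and> Cmp C Y X Y f g = Idn C Y)"

definition naturally_isomorphic ::
  "('o, 'f) precat \<Rightarrow> ('p, 'g) precat \<Rightarrow> ('o \<Rightarrow> 'p) \<Rightarrow> ('o \<Rightarrow> 'o \<Rightarrow> 'f \<Rightarrow> 'g)
    \<Rightarrow> ('o \<Rightarrow> 'p) \<Rightarrow> ('o \<Rightarrow> 'o \<Rightarrow> 'f \<Rightarrow> 'g) \<Rightarrow> bool"
  where "naturally_isomorphic C D F \<Phi> G \<Psi> \<longleftrightarrow>
    (\<exists>\<tau>. (\<forall>X\<in>Ob C. iso_mor D (F X) (G X) (\<tau> X)) \<and>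
      (\<forall>X\<in>Ob C. \<forall>Y\<in>Ob C. \<forall>f\<in>Mor C X Y.
        Cmp D (F X) (F Y) (G Y) (\<tau> Y) (\<Phi> X Y f) = Cmp D (F X) (G X) (G Y) (\<Psi> X Y f) (\<tau> X)))"

definition additive_equivalence ::
  "('o, 'f) precat \<Rightarrow> ('p, 'g) precat \<Rightarrow> ('o \<Rightarrow> 'p) \<Rightarrow> ('o \<Rightarrow> 'o \<Rightarrow> 'f \<Rightarrow> 'g) \<Rightarrow> bool"
  where "additive_equivalence C D F \<Phi> \<longleftrightarrow>
    additive_category C \<and> additive_category D \<and> additive_functor C D F \<Phi> \<and>
    (\<exists>G \<Psi>. additive_functor D C G \<Psi> \<and>
      naturally_isomorphic C C (\<lambda>X. G (F X)) (\<lambda>X Y f. \<Psi> (F X) (F Y) (\<Phi> X Y f)) (\<lambda>X. X) (\<lambda>X Y f. f) \<and>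
      naturally_isomorphic D D (\<lambda>X. F (G X)) (\<lambda>X Y f. \<Phi> (G X) (G Y) (\<Psi> X Y f)) (\<lambda>X. X) (\<lambda>X Y f. f))"

definition full_subcategory :: "('o, 'f) precat \<Rightarrow> ('o \<Rightarrow> bool) \<Rightarrow> ('o, 'f) precat"
  where "full_subcategory C P = C\<lparr>Ob := {X \<in> Ob C. P X}\<rparr>"

definition factoring_mor ::
  "('o, 'f) precat \<Rightarrow> ('o \<Rightarrow> bool) \<Rightarrow> 'o \<Rightarrow> 'o \<Rightarrow> 'f set"
  where "factoring_mor C P X Y =
    {Cmp C X Z Y h g | Z g h. Z \<in> Ob C \<and> P Z \<and> g \<in> Mor C X Z \<and> h \<in> Mor C Z Y}"

definition quotient_category ::
  "('o, 'f) precat \<Rightarrow> ('o \<Rightarrow> 'o \<Rightarrow> 'f set) \<Rightarrow> ('o, 'f set) precat"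
  where "quotient_category C I =
    \<lparr>Ob = Ob C,
     HomGrp = (\<lambda>X Y. HomGrp C X Y Mod I X Y),
     Cmp = (\<lambda>X Y Z g f. \<Union>g'\<in>g. \<Union>f'\<in>f. I X Z #>\<^bsub>HomGrp C X Z\<^esub> Cmp C X Y Z g' f'),
     Idn = (\<lambda>X. I X X #>\<^bsub>HomGrp C X X\<^esub> Idn C X)\<rparr>"


section \<open>Left modules\<close>

text \<open>
  The locale \<^locale>\<open>module\<close> requires a commutative base ring. The fields \<^const>\<open>mult\<close> and
  \<^const>\<open>one\<close> of a module record play no role below.
\<close>

locale left_module = R?: ring R + M?: abelian_group M
  for R :: "('a, 'r) ring_scheme" (structure) and M :: "('a, 'b, 'm) module_scheme" (structure) +
  assumes smult_closed: "\<lbrakk>a \<in> carrier R; x \<in> carrier M\<rbrakk> \<Longrightarrow> a \<odot>\<^bsub>M\<^esub> x \<in> carrier M"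
    and smult_l_distr:
      "\<lbrakk>a \<in> carrier R; b \<in> carrier R; x \<in> carrier M\<rbrakk>
        \<Longrightarrow> (a \<oplus>\<^bsub>R\<^esub> b) \<odot>\<^bsub>M\<^esub> x = a \<odot>\<^bsub>M\<^esub> x \<oplus>\<^bsub>M\<^esub> b \<odot>\<^bsub>M\<^esub> x"
    and smult_r_distr:
      "\<lbrakk>a \<in> carrier R; x \<in> carrier M; y \<in> carrier M\<rbrakk>
        \<Longrightarrow> a \<odot>\<^bsub>M\<^esub> (x \<oplus>\<^bsub>M\<^esub> y) = a \<odot>\<^bsub>M\<^esub> x \<oplus>\<^bsub>M\<^esub> a \<odot>\<^bsub>M\<^esub> y"
    and smult_assoc:
      "\<lbrakk>a \<in> carrier R; b \<in> carrier R; x \<in> carrier M\<rbrakk>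
        \<Longrightarrow> (a \<otimes>\<^bsub>R\<^esub> b) \<odot>\<^bsub>M\<^esub> x = a \<odot>\<^bsub>M\<^esub> (b \<odot>\<^bsub>M\<^esub> x)"
    and smult_one: "x \<in> carrier M \<Longrightarrow> \<one>\<^bsub>R\<^esub> \<odot>\<^bsub>M\<^esub> x = x"

definition lmod_hom ::
  "('a, 'r) ring_scheme \<Rightarrow> ('a, 'b) module \<Rightarrow> ('a, 'c) module \<Rightarrow> ('b \<Rightarrow> 'c) set"
  where "lmod_hom R M N =
    {f \<in> carrier M \<rightarrow>\<^sub>E carrier N.
      (\<forall>x\<in>carrier M. \<forall>y\<in>carrier M. f (x \<oplus>\<^bsub>M\<^esub> y) = f x \<oplus>\<^bsub>N\<^esub> f y) \<and>
      (\<forall>a\<in>carrier R. \<forall>x\<in>carrier M. f (a \<odot>\<^bsub>M\<^esub> x) = a \<odot>\<^bsub>N\<^esub> f x)}"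

abbreviation restrict_carrier :: "('a, 'b) module \<Rightarrow> 'b set \<Rightarrow> ('a, 'b) module"
  where "restrict_carrier M H \<equiv> M\<lparr>carrier := H\<rparr>"

definition quotient_module :: "('a, 'b) module \<Rightarrow> 'b set \<Rightarrow> ('a, 'b set) module"
  where "quotient_module M H =
    \<lparr>carrier = a_rcosets\<^bsub>M\<^esub> H, mult = undefined, one = undefined,
     zero = H, add = set_add M,
     smult = (\<lambda>a X. \<Union>x\<in>X. H +>\<^bsub>M\<^esub> (a \<odot>\<^bsub>M\<^esub> x))\<rparr>"

definition direct_sum :: "'i set \<Rightarrow> ('i \<Rightarrow> ('a, 'b) module) \<Rightarrow> ('a, 'i \<Rightarrow> 'b) module"
  \<comment> \<open>for finite index sets\<close>
  where "direct_sum I X =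
    \<lparr>carrier = (\<Pi>\<^sub>E i\<in>I. carrier (X i)), mult = undefined, one = undefined,
     zero = (\<lambda>i\<in>I. \<zero>\<^bsub>X i\<^esub>),
     add = (\<lambda>x y. \<lambda>i\<in>I. x i \<oplus>\<^bsub>X i\<^esub> y i),
     smult = (\<lambda>a x. \<lambda>i\<in>I. a \<odot>\<^bsub>X i\<^esub> x i)\<rparr>"

definition left_ideal_module :: "('c, 'a) module \<Rightarrow> 'a \<Rightarrow> ('a, 'a) module"
  \<comment> \<open>the left ideal \<open>A e\<close>\<close>
  where "left_ideal_module A e =
    \<lparr>carrier = {x \<otimes>\<^bsub>A\<^esub> e | x. x \<in> carrier A}, mult = undefined, one = undefined,
     zero = \<zero>\<^bsub>A\<^esub>, add = add A, smult = mult A\<rparr>"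

text \<open>\<open>M\<close> is a direct summand of a finite direct sum of copies of \<open>X\<close>.\<close>

definition in_add :: "('a, 'r) ring_scheme \<Rightarrow> ('a, 'x) module \<Rightarrow> ('a, 'b) module \<Rightarrow> bool"
  where "in_add R X M \<longleftrightarrow>
    (\<exists>k::nat. \<exists>i \<in> lmod_hom R M (direct_sum {..<k} (\<lambda>_. X)).
      \<exists>p \<in> lmod_hom R (direct_sum {..<k} (\<lambda>_. X)) M. \<forall>m\<in>carrier M. p (i m) = m)"

text \<open>The sum of the images of all homomorphisms \<open>X \<rightarrow> M\<close>.\<close>

definition mod_trace :: "('a, 'r) ring_scheme \<Rightarrow> ('a, 'x) module \<Rightarrow> ('a, 'b) module \<Rightarrow> 'b set"
  where "mod_trace R X M = generate (add_monoid M) (\<Union>f\<in>lmod_hom R X M. f ` carrier X)"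


section \<open>Algebras over the complex numbers and path algebras\<close>

text \<open>
  A complex algebra is a record of type \<open>(complex, 'a) module\<close>; its scalars act on modules
  through \<open>c \<mapsto> c 1\<close>.
\<close>

definition scal :: "(complex, 'a) module \<Rightarrow> ('a, 'b) module \<Rightarrow> complex \<Rightarrow> 'b \<Rightarrow> 'b"
  where "scal A M c x = (c \<odot>\<^bsub>A\<^esub> \<one>\<^bsub>A\<^esub>) \<odot>\<^bsub>M\<^esub> x"

definition finite_dimensional :: "(complex, 'a) module \<Rightarrow> ('a, 'b) module \<Rightarrow> bool"
  where "finite_dimensional A M \<longleftrightarrow>
    (\<exists>S. finite S \<and> S \<subseteq> carrier M \<and>
      (\<forall>x\<in>carrier M. \<exists>c. x = (\<Oplus>\<^bsub>M\<^esub>s\<in>S. scal A M (c s) s)))"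

definition mod_category :: "(complex, 'a) module \<Rightarrow> (('a, 'b) module, 'b \<Rightarrow> 'b) precat"
  where "mod_category A =
    \<lparr>Ob = {M. left_module A M \<and> finite_dimensional A M},
     HomGrp = (\<lambda>M N. \<lparr>carrier = lmod_hom A M N,
       mult = (\<lambda>f g. \<lambda>x\<in>carrier M. f x \<oplus>\<^bsub>N\<^esub> g x), one = (\<lambda>x\<in>carrier M. \<zero>\<^bsub>N\<^esub>)\<rparr>),
     Cmp = (\<lambda>L M N g f. compose (carrier L) g f),
     Idn = (\<lambda>M. \<lambda>x\<in>carrier M. x)\<rparr>"

definition quotient_algebra :: "(complex, 'a) module \<Rightarrow> 'a set \<Rightarrow> (complex, 'a set) module"
  where "quotient_algebra A I =
    ring.extend (A Quot I) (module.fields (\<lambda>c X. \<Union>x\<in>X. I +>\<^bsub>A\<^esub> (c \<odot>\<^bsub>A\<^esub> x)))"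

text \<open>
  A path \<open>(u, w, v)\<close> runs from \<open>u\<close> to \<open>v\<close>, the arrows being listed in the order in which they are
  traversed. In the product \<open>q \<cdot> p\<close> of the path algebra, \<open>p\<close> is traversed first and then \<open>q\<close>;
  elements of the path algebra are finitely supported functions on the set of paths.
\<close>

type_synonym ('v, 'e) path = "'v \<times> 'e list \<times> 'v"

definition paths :: "('v, 'e) pre_digraph \<Rightarrow> ('v, 'e) path set"
  where "paths G = {(u, w, v). pre_digraph.awalk G u w v}"

definition path_elem :: "('v, 'e) path \<Rightarrow> ('v, 'e) path \<Rightarrow> complex"
  where "path_elem p = (\<lambda>r. if r = p then 1 else 0)"

fun path_mult :: "('v, 'e) path \<Rightarrow> ('v, 'e) path \<Rightarrow> ('v, 'e) path \<Rightarrow> complex"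
  where "path_mult (u', w', v') (u, w, v) =
    (if v = u' then path_elem (u, w @ w', v') else (\<lambda>_. 0))"

definition path_algebra ::
  "('v, 'e) pre_digraph \<Rightarrow> (complex, ('v, 'e) path \<Rightarrow> complex) module"
  where "path_algebra G =
    \<lparr>carrier = {f. finite {p. f p \<noteq> 0} \<and> {p. f p \<noteq> 0} \<subseteq> paths G},
     mult = (\<lambda>f g r. \<Sum>q | f q \<noteq> 0. \<Sum>p | g p \<noteq> 0. f q * g p * path_mult q p r),
     one = (\<lambda>(u, w, v). if u \<in> verts G \<and> w = [] \<and> v = u then 1 else 0),
     zero = (\<lambda>_. 0),
     add = (\<lambda>f g p. f p + g p),
     smult = (\<lambda>c f p. c * f p)\<rparr>"


section \<open>The algebras \<open>D\<close> and \<open>\<Pi>\<close>\<close>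

datatype arrow = Arr_a nat | Arr_b nat

definition aus_quiver :: "nat \<Rightarrow> (nat, arrow) pre_digraph"
  where "aus_quiver n =
    \<lparr>verts = {0..<n},
     arcs = Arr_a ` {1..n-1} \<union> Arr_b ` {1..n-1},
     tail = (\<lambda>x. case x of Arr_a i \<Rightarrow> i | Arr_b i \<Rightarrow> i - 1),
     head = (\<lambda>x. case x of Arr_a i \<Rightarrow> i - 1 | Arr_b i \<Rightarrow> i)\<rparr>"

abbreviation aus_path_algebra ::
  "nat \<Rightarrow> (complex, (nat, arrow) path \<Rightarrow> complex) module"
  where "aus_path_algebra n \<equiv> path_algebra (aus_quiver n)"

definition aus_relations :: "nat \<Rightarrow> ((nat, arrow) path \<Rightarrow> complex) set"
  where "aus_relations n =
    {path_elem (n-1, [Arr_a (n-1), Arr_b (n-1)], n-1)} \<union>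
    {path_elem (i-1, [Arr_b i, Arr_a i], i-1)
      \<ominus>\<^bsub>aus_path_algebra n\<^esub> path_elem (i-1, [Arr_a (i-1), Arr_b (i-1)], i-1) | i. i \<in> {2..n-1}}"

definition aus_ideal :: "nat \<Rightarrow> ((nat, arrow) path \<Rightarrow> complex) set"
  where "aus_ideal n = Idl\<^bsub>aus_path_algebra n\<^esub> (aus_relations n)"

type_synonym D_elem = "((nat, arrow) path \<Rightarrow> complex) set"

definition D_alg :: "nat \<Rightarrow> (complex, D_elem) module"
  where "D_alg n = quotient_algebra (aus_path_algebra n) (aus_ideal n)"

definition D_path :: "nat \<Rightarrow> (nat, arrow) path \<Rightarrow> D_elem"
  where "D_path n p = aus_ideal n +>\<^bsub>aus_path_algebra n\<^esub> path_elem p"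

definition D_e :: "nat \<Rightarrow> nat \<Rightarrow> D_elem"
  where "D_e n i = D_path n (i, [], i)"

definition D_a :: "nat \<Rightarrow> nat \<Rightarrow> D_elem"
  where "D_a n i = D_path n (i, [Arr_a i], i - 1)"

definition D_b :: "nat \<Rightarrow> nat \<Rightarrow> D_elem"
  where "D_b n i = D_path n (i - 1, [Arr_b i], i)"

definition D_proj :: "nat \<Rightarrow> nat \<Rightarrow> (D_elem, D_elem) module"
  where "D_proj n i = left_ideal_module (D_alg n) (D_e n i)"

text \<open>The two-sided ideal \<open>D e\<^sub>0 D\<close> is the ideal generated by \<open>e\<^sub>0\<close>.\<close>

definition Pi_ideal :: "nat \<Rightarrow> D_elem set"
  where "Pi_ideal n = Idl\<^bsub>D_alg n\<^esub> {D_e n 0}"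

type_synonym Pi_elem = "D_elem set"

definition Pi_alg :: "nat \<Rightarrow> (complex, Pi_elem) module"
  where "Pi_alg n = quotient_algebra (D_alg n) (Pi_ideal n)"

text \<open>The indecomposable projective with top the simple module at vertex \<open>i\<close> is \<open>\<Pi> e\<^sub>i\<close>.\<close>

definition Pi_proj :: "nat \<Rightarrow> nat \<Rightarrow> (Pi_elem, Pi_elem) module"
  where "Pi_proj n i = left_ideal_module (Pi_alg n) (Pi_ideal n +>\<^bsub>D_alg n\<^esub> D_e n i)"


section \<open>Standard modules, the modules \<open>T\<^sub>i\<close>, and the functor \<open>\<pi>\<close>\<close>

definition at_vertex :: "nat \<Rightarrow> (D_elem, 'b) module \<Rightarrow> nat \<Rightarrow> 'b set"
  where "at_vertex n M j = {D_e n j \<odot>\<^bsub>M\<^esub> x | x. x \<in> carrier M}"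

text \<open>\<open>M\<close> is isomorphic to the standard module \<open>\<Delta>\<^sub>i\<close>, which is determined by these conditions.\<close>

definition is_standard :: "nat \<Rightarrow> nat \<Rightarrow> (D_elem, 'b) module \<Rightarrow> bool"
  where "is_standard n i M \<longleftrightarrow>
    left_module (D_alg n) M \<and>
    (\<forall>j<i. \<exists>v. v \<noteq> \<zero>\<^bsub>M\<^esub> \<and> v \<in> at_vertex n M j \<and> at_vertex n M j = range (\<lambda>c. scal (D_alg n) M c v)) \<and>
    (\<forall>j\<in>{i..<n}. at_vertex n M j = {\<zero>\<^bsub>M\<^esub>}) \<and>
    (\<forall>k\<in>{1..i-1}. bij_betw (\<lambda>x. D_a n k \<odot>\<^bsub>M\<^esub> x) (at_vertex n M k) (at_vertex n M (k - 1))) \<and>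
    (\<forall>k\<in>{1..n-1}. \<forall>x\<in>carrier M. D_b n k \<odot>\<^bsub>M\<^esub> x = \<zero>\<^bsub>M\<^esub>)"

definition has_standard_filtration :: "nat \<Rightarrow> (D_elem, 'b) module \<Rightarrow> bool"
  where "has_standard_filtration n M \<longleftrightarrow>
    (\<exists>(r::nat) H.
      (\<forall>k\<le>r. submodule (H k) (D_alg n) M) \<and> H 0 = {\<zero>\<^bsub>M\<^esub>} \<and> H r = carrier M \<and>
      (\<forall>k<r. H k \<subseteq> H (Suc k) \<and>
        (\<exists>i\<in>{1..n}. is_standard n i (quotient_module (restrict_carrier M (H (Suc k))) (H k)))))"

text \<open>
  \<open>D\<^sub>i\<close> is embedded in \<open>D\<^sub>0\<close> by right multiplication with the path \<open>b\<^sub>i \<cdots> b\<^sub>1\<close> from \<open>0\<close> to \<open>i\<close>; for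
  \<open>i = n\<close> we put \<open>D\<^sub>n = 0\<close>, so that \<open>T\<^sub>n = D\<^sub>0 / 0\<close> lives in the same type as the other \<open>T\<^sub>i\<close>.
\<close>

definition D_proj_in_D0 :: "nat \<Rightarrow> nat \<Rightarrow> D_elem set"
  where "D_proj_in_D0 n i =
    (if i < n
     then (\<lambda>x. x \<otimes>\<^bsub>D_alg n\<^esub> D_path n (0, map Arr_b [1..<Suc i], i)) ` carrier (D_proj n i)
     else {\<zero>\<^bsub>D_alg n\<^esub>})"

definition T_mod :: "nat \<Rightarrow> nat \<Rightarrow> (D_elem, D_elem set) module"
  where "T_mod n i = quotient_module (D_proj n 0) (D_proj_in_D0 n i)"

definition T_sum :: "nat \<Rightarrow> nat set \<Rightarrow> (D_elem, nat \<Rightarrow> D_elem set) module"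
  where "T_sum n J = direct_sum J (T_mod n)"

definition eta :: "nat \<Rightarrow> (D_elem, 'b) module \<Rightarrow> 'b set"
  where "eta n M = mod_trace (D_alg n) (T_sum n {1..n}) M"

definition pi_obj :: "nat \<Rightarrow> (D_elem, 'b) module \<Rightarrow> (Pi_elem, 'b set) module"
  \<comment> \<open>\<open>M / \<eta> M\<close> with the induced action of cosets in \<open>D / D e\<^sub>0 D\<close>\<close>
  where "pi_obj n M =
    \<lparr>carrier = a_rcosets\<^bsub>M\<^esub> (eta n M), mult = undefined, one = undefined,
     zero = eta n M, add = set_add M,
     smult = (\<lambda>A X. \<Union>a\<in>A. \<Union>x\<in>X. eta n M +>\<^bsub>M\<^esub> (a \<odot>\<^bsub>M\<^esub> x))\<rparr>"

definition pi_mor ::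
  "nat \<Rightarrow> (D_elem, 'b) module \<Rightarrow> (D_elem, 'b) module \<Rightarrow> ('b \<Rightarrow> 'b) \<Rightarrow> 'b set \<Rightarrow> 'b set"
  where "pi_mor n M N f =
    (\<lambda>X\<in>carrier (pi_obj n M). \<Union>x\<in>X. eta n N +>\<^bsub>N\<^esub> f x)"


section \<open>The categories \<open>F\<^sub>\<Delta>(J)\<close> and \<open>Sub Q\<^sub>J\<close>\<close>

text \<open>
  The type variables \<open>'b\<close> are universes for the carriers of modules: the categories consist of the
  modules whose carrier is a set of elements of \<open>'b\<close>. If there is an injection from the complex
  numbers into \<open>'b\<close>, then every finite-dimensional module is isomorphic to one with carrier in \<open>'b\<close>.
\<close>

definition F_Delta_cat :: "nat \<Rightarrow> nat set \<Rightarrow> ((D_elem, 'b) module, 'b \<Rightarrow> 'b) precat"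
  where "F_Delta_cat n J = full_subcategory (mod_category (D_alg n))
    (\<lambda>M. has_standard_filtration n M \<and>
      in_add (D_alg n) (T_sum n J) (restrict_carrier M (eta n M)))"

definition add_T_ideal ::
  "nat \<Rightarrow> nat set \<Rightarrow> (D_elem, 'b) module \<Rightarrow> (D_elem, 'b) module \<Rightarrow> ('b \<Rightarrow> 'b) set"
  where "add_T_ideal n J =
    factoring_mor (mod_category (D_alg n)) (in_add (D_alg n) (T_sum n J))"

definition Q_mod :: "nat \<Rightarrow> nat set \<Rightarrow> (Pi_elem, nat \<Rightarrow> Pi_elem) module"
  where "Q_mod n J = direct_sum J (\<lambda>j. Pi_proj n (n - j))"

definition Sub_Q_cat :: "nat \<Rightarrow> nat set \<Rightarrow> ((Pi_elem, 'b) module, 'b \<Rightarrow> 'b) precat"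
  where "Sub_Q_cat n J = full_subcategory (mod_category (Pi_alg n))
    (\<lambda>N. \<exists>Y \<in> Ob (mod_category (Pi_alg n) :: ((Pi_elem, 'b) module, 'b \<Rightarrow> 'b) precat).
      in_add (Pi_alg n) (Q_mod n J) Y \<and>
      (\<exists>f\<in>lmod_hom (Pi_alg n) N Y. inj_on f (carrier N)))"

end

theory Submission
 imports Defs
begin

text \<open>
 Write \<open>\<eta> M\<close> for the trace of \<open>T\<close> in \<open>M\<close>. As \<open>T\<^sub>n = D\<^sub>0\<close> and all \<open>T\<^sub>j\<close> are quotients of \<open>D\<^sub>0\<close>, it is
 \<open>D e\<^sub>0 M\<close> (\<open>eta_eq\<close>), so \<open>\<pi> M = M / D e\<^sub>0 M\<close>. A full and dense additive functor on an additive category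
 induces an equivalence from the quotient by its kernel (\<open>quotient_by_kernel_equivalence\<close>). The
 theorem therefore says that \<open>\<pi>\<close> takes values in \<open>Sub Q\<^sub>J\<close> and is full and dense there, and that
 the maps killed by \<open>\<pi>\<close> are those that factor through \<open>add T\<^sub>J\<close>.

 Kernel. The image of \<open>f : M \<rightarrow> N\<close> under \<open>\<pi>\<close> vanishes iff \<open>f\<close> has image in \<open>\<eta> N\<close>. Such a map factors
 through \<open>\<eta> N\<close>, which is in \<open>add T\<^sub>J\<close>; conversely a module in \<open>add T\<^sub>J\<close> equals its trace, and traces are
 mapped to traces (\<open>add_T_ideal_kernel\<close>).

 Fullness. A map from \<open>M\<close> to \<open>N / \<eta> N\<close> is lifted to \<open>N\<close> along a standard filtration of \<open>M\<close>. A step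
 with factor \<open>\<Delta>\<^sub>i\<close> adjoins a generator at the vertex \<open>i - 1\<close> with a single relation, which prescribes
 the value of \<open>b\<^sub>i\<close> on it. The obstruction lies in the cokernel of \<open>b\<^sub>i\<close> on \<open>\<eta> N\<close>. This cokernel is
 zero, because \<open>\<eta> N\<close> is generated at the vertex \<open>0\<close> and every path from \<open>0\<close> to \<open>i\<close> may be rewritten
 to end with \<open>b\<^sub>i\<close> (\<open>lift_hom\<close>).

 Objects. The paths that go up from \<open>i\<close> to \<open>m\<close> and then down to \<open>k\<close>, for \<open>i, k \<le> m < n\<close>, form a basis
 of \<open>D\<close>. In coordinates one sees for \<open>1 \<le> j < n\<close> that right multiplication by a path from \<open>n - j\<close>
 down to \<open>0\<close> identifies \<open>T\<^sub>j\<close> with \<open>\<eta> D\<^sub>n\<^sub>-\<^sub>j\<close>, and that \<open>D\<^sub>n\<^sub>-\<^sub>j\<close> is as large as its space at the vertex \<open>0\<close>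
 permits (\<open>coinduced\<close>). Moreover \<open>\<pi> D\<^sub>n\<^sub>-\<^sub>j = \<Pi>\<^sub>n\<^sub>-\<^sub>j\<close>. A power \<open>P\<close> of the sum of the \<open>D\<^sub>n\<^sub>-\<^sub>j\<close> with
 \<open>j \<in> J\<close> thus satisfies \<open>\<eta> P \<in> add T\<^sub>J\<close> and \<open>\<pi> P \<in> add Q\<^sub>J\<close> (\<open>T_sum_power_resolves\<close>). For \<open>M\<close> in
 \<open>F\<^sub>\<Delta>(J)\<close> a split embedding of \<open>\<eta> M\<close> into some \<open>\<eta> P\<close> extends to \<open>M \<rightarrow> P\<close>, and \<open>\<eta> M\<close> is
 the preimage of \<open>\<eta> P\<close> since the arrows \<open>a\<^sub>k\<close> act injectively on \<open>M\<close>; so \<open>\<pi> M\<close> embeds into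
 \<open>\<pi> P\<close> (\<open>pi_embeds\<close>). Conversely a submodule of \<open>\<pi> P\<close> is \<open>\<pi>\<close> of its preimage in \<open>P\<close> (\<open>pi_preimage\<close>).
 The preimage has a standard filtration, because the \<open>a\<^sub>k\<close> act injectively on \<open>P\<close> and this
 characterizes the finite-dimensional modules with such a filtration (\<open>standard_filtration_exists\<close>).
\<close>

section \<open>Notation\<close>

text \<open>A plain subscript names the structure of an operation; \<open>res M H\<close> is the submodule \<open>H\<close> of \<open>M\<close> as a module.\<close>

abbreviation (input) add_sub (\<open>_ \<oplus>\<^sub>_ _\<close> [65, 1000, 66] 65) where "x \<oplus>\<^sub>M y \<equiv> x \<oplus>\<^bsub>M\<^esub> y"
abbreviation (input) mult_sub (\<open>_ \<otimes>\<^sub>_ _\<close> [70, 1000, 71] 70) where "x \<otimes>\<^sub>M y \<equiv> x \<otimes>\<^bsub>M\<^esub> y"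
abbreviation (input) smult_sub (\<open>_ \<odot>\<^sub>_ _\<close> [71, 1000, 70] 70) where "a \<odot>\<^sub>M x \<equiv> a \<odot>\<^bsub>M\<^esub> x"
abbreviation (input) minus_sub (\<open>_ \<ominus>\<^sub>_ _\<close> [65, 1000, 66] 65) where "x \<ominus>\<^sub>M y \<equiv> x \<ominus>\<^bsub>M\<^esub> y"
abbreviation (input) uminus_sub (\<open>\<ominus>\<^sub>_ _\<close> [1000, 81] 80) where "\<ominus>\<^sub>M x \<equiv> \<ominus>\<^bsub>M\<^esub> x"
abbreviation (input) zero_sub (\<open>\<zero>\<^sub>_\<close> [1000] 1000) where "\<zero>\<^sub>M \<equiv> \<zero>\<^bsub>M\<^esub>"
abbreviation (input) one_sub (\<open>\<one>\<^sub>_\<close> [1000] 1000) where "\<one>\<^sub>M \<equiv> \<one>\<^bsub>M\<^esub>"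
abbreviation (input) coset_sub (\<open>_ +>\<^sub>_ _\<close> [60, 1000, 61] 60) where "H +>\<^sub>M x \<equiv> H +>\<^bsub>M\<^esub> x"
abbreviation (input) res where "res M H \<equiv> restrict_carrier M H"

section \<open>Quotients of additive categories by kernels of functors\<close>

lemma additive_functorD:
 assumes "additive_functor C D F \<Phi>"
 shows "X \<in> Ob C ==> F X \<in> Ob D"
  and "X \<in> Ob C ==> Y \<in> Ob C ==> \<Phi> X Y \<in> hom (HomGrp C X Y) (HomGrp D (F X) (F Y))"
  and "X \<in> Ob C ==> Y \<in> Ob C ==> f \<in> Mor C X Y ==> \<Phi> X Y f \<in> Mor D (F X) (F Y)"
  and "X \<in> Ob C ==> \<Phi> X X (Idn C X) = Idn D (F X)"
  and "X \<in> Ob C ==> Y \<in> Ob C ==> Z \<in> Ob C ==> f \<in> Mor C X Y ==> g \<in> Mor C Y Z ==>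
   \<Phi> X Z (Cmp C X Y Z g f) = Cmp D (F X) (F Y) (F Z) (\<Phi> Y Z g) (\<Phi> X Y f)"
 using assms unfolding additive_functor_def by (auto simp: hom_def Pi_def)

context preadditive_category
begin

lemma hom_group: "X \<in> Ob C ==> Y \<in> Ob C ==> group (HomGrp C X Y)"
 using hom_comm_group comm_group.axioms by blast

lemma one_mor: "X \<in> Ob C ==> Y \<in> Ob C ==> \<one>\<^bsub>HomGrp C X Y\<^esub> \<in> Mor C X Y"
 using hom_group by (simp add: group.is_monoid)

lemma cmp_zero_right:
 assumes "X \<in> Ob C" "Y \<in> Ob C" "Z \<in> Ob C" "g \<in> Mor C Y Z"
 shows "Cmp C X Y Z g \<one>\<^bsub>HomGrp C X Y\<^esub> = \<one>\<^bsub>HomGrp C X Z\<^esub>"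
proof -
 let ?o = "\<one>\<^bsub>HomGrp C X Y\<^esub>" and ?c = "Cmp C X Y Z g \<one>\<^bsub>HomGrp C X Y\<^esub>"
 interpret A: group "HomGrp C X Y" using assms hom_group by blast
 interpret B: group "HomGrp C X Z" using assms hom_group by blast
 have "?c \<otimes>\<^bsub>HomGrp C X Z\<^esub> ?c = ?c"
  using cmp_add_right[of X Y Z ?o ?o g] assms one_mor by simp
 moreover have "?c \<in> Mor C X Z" using cmp_closed assms one_mor by blast
 ultimately show ?thesis by (metis B.l_cancel_one')
qed

lemma cmp_zero_left:
 assumes "X \<in> Ob C" "Y \<in> Ob C" "Z \<in> Ob C" "f \<in> Mor C X Y"
 shows "Cmp C X Y Z \<one>\<^bsub>HomGrp C Y Z\<^esub> f = \<one>\<^bsub>HomGrp C X Z\<^esub>"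
proof -
 let ?o = "\<one>\<^bsub>HomGrp C Y Z\<^esub>" and ?c = "Cmp C X Y Z \<one>\<^bsub>HomGrp C Y Z\<^esub> f"
 interpret A: group "HomGrp C Y Z" using assms hom_group by blast
 interpret B: group "HomGrp C X Z" using assms hom_group by blast
 have "?c \<otimes>\<^bsub>HomGrp C X Z\<^esub> ?c = ?c"
  using cmp_add_left[of X Y Z f ?o ?o] assms one_mor by simp
 moreover have "?c \<in> Mor C X Z" using cmp_closed assms one_mor by blast
 ultimately show ?thesis by (metis B.l_cancel_one')
qed

end

lemma preadditive_full_subcategory:
 assumes "preadditive_category C"
 shows "preadditive_category (full_subcategory C P)"
proof -
 interpret preadditive_category C by fact
 show ?thesis
  by (rule preadditive_category.intro)
   (auto simp: full_subcategory_def hom_comm_group id_closed cmp_closed id_left id_right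
    cmp_assoc cmp_add_left cmp_add_right)
qed

text \<open>
 The isomorphisms transport zero objects and biproducts along \<open>F\<close>, so additivity of the target
 costs nothing beyond density.
\<close>

lemma additive_category_of_dense:
 assumes C: "additive_category C" and D: "preadditive_category D"
  and F: "additive_functor C D F \<Phi>"
  and dense: "\<And>Y. Y \<in> Ob D ==> \<exists>X\<in>Ob C. \<exists>f. iso_mor D (F X) Y f"
 shows "additive_category D"
proof -
 interpret C: additive_category C by fact
 interpret D: preadditive_category D by fact
 note FF = additive_functorD[OF F]
 have Phi_one: "\<Phi> X Y \<one>\<^bsub>HomGrp C X Y\<^esub> = \<one>\<^bsub>HomGrp D (F X) (F Y)\<^esub>"
  if "X \<in> Ob C" "Y \<in> Ob C" for X Y
  using hom_one[OF FF(2) C.hom_group D.hom_group] that FF(1) by blast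
 show ?thesis
 proof (rule additive_category.intro[OF D], rule additive_category_axioms.intro)
  obtain Z where "Z \<in> Ob C" "Idn C Z = \<one>\<^bsub>HomGrp C Z Z\<^esub>" using C.zero_object by blast
  then show "\<exists>Z\<in>Ob D. Idn D Z = \<one>\<^bsub>HomGrp D Z Z\<^esub>"
   using FF(1) FF(4)[of Z] Phi_one[of Z Z] by metis
 next
  fix Y1 Y2 assume Y: "Y1 \<in> Ob D" "Y2 \<in> Ob D"
  obtain X1 u1 v1 where 1: "X1 \<in> Ob C" "u1 \<in> Mor D (F X1) Y1" "v1 \<in> Mor D Y1 (F X1)"
   "Cmp D (F X1) Y1 (F X1) v1 u1 = Idn D (F X1)" "Cmp D Y1 (F X1) Y1 u1 v1 = Idn D Y1"
   using dense[OF Y(1)] unfolding iso_mor_def by blast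
  obtain X2 u2 v2 where 2: "X2 \<in> Ob C" "u2 \<in> Mor D (F X2) Y2" "v2 \<in> Mor D Y2 (F X2)"
   "Cmp D (F X2) Y2 (F X2) v2 u2 = Idn D (F X2)" "Cmp D Y2 (F X2) Y2 u2 v2 = Idn D Y2"
   using dense[OF Y(2)] unfolding iso_mor_def by blast
  obtain P i j p q where P: "P \<in> Ob C" "i \<in> Mor C X1 P" "j \<in> Mor C X2 P" "p \<in> Mor C P X1"
   "q \<in> Mor C P X2"
   "Cmp C X1 P X1 p i = Idn C X1" "Cmp C X2 P X2 q j = Idn C X2"
   "Cmp C X2 P X1 p j = \<one>\<^bsub>HomGrp C X2 X1\<^esub>" "Cmp C X1 P X2 q i = \<one>\<^bsub>HomGrp C X1 X2\<^esub>"
   "Cmp C P X1 P i p \<otimes>\<^bsub>HomGrp C P P\<^esub> Cmp C P X2 P j q = Idn C P"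
   using C.biproducts[OF 1(1) 2(1)] by metis
  define i' where "i' = Cmp D Y1 (F X1) (F P) (\<Phi> X1 P i) v1"
  define j' where "j' = Cmp D Y2 (F X2) (F P) (\<Phi> X2 P j) v2"
  define p' where "p' = Cmp D (F P) (F X1) Y1 u1 (\<Phi> P X1 p)"
  define q' where "q' = Cmp D (F P) (F X2) Y2 u2 (\<Phi> P X2 q)"
  note ob = Y FF(1)[OF 1(1)] FF(1)[OF 2(1)] FF(1)[OF P(1)]
  note mo = FF(3)[OF 1(1) P(1) P(2)] FF(3)[OF 2(1) P(1) P(3)]
   FF(3)[OF P(1) 1(1) P(4)] FF(3)[OF P(1) 2(1) P(5)]
  have mor: "i' \<in> Mor D Y1 (F P)" "j' \<in> Mor D Y2 (F P)" "p' \<in> Mor D (F P) Y1" "q' \<in> Mor D (F P) Y2"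
   unfolding i'_def j'_def p'_def q'_def using ob mo 1 2 by (auto intro!: D.cmp_closed)
  have conj: "Cmp D A (F P) B (Cmp D (F P) (F X) B u (\<Phi> P X s)) (Cmp D A (F Z) (F P) (\<Phi> Z P r) v)
    = Cmp D A (F X) B u (Cmp D A (F Z) (F X) (\<Phi> Z X (Cmp C Z P X s r)) v)"
   if "A \<in> Ob D" "B \<in> Ob D" "X \<in> Ob C" "Z \<in> Ob C" "u \<in> Mor D (F X) B" "v \<in> Mor D A (F Z)"
    "s \<in> Mor C P X" "r \<in> Mor C Z P" for A B X Z u v s r
  proof -
   note o = that(1,2) FF(1)[OF that(3)] FF(1)[OF that(4)] FF(1)[OF P(1)]
   note m = that(5,6) FF(3)[OF P(1) that(3) that(7)] FF(3)[OF that(4) P(1) that(8)]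
   have "Cmp D A (F P) B (Cmp D (F P) (F X) B u (\<Phi> P X s)) (Cmp D A (F Z) (F P) (\<Phi> Z P r) v)
    = Cmp D A (F X) B u (Cmp D A (F P) (F X) (\<Phi> P X s) (Cmp D A (F Z) (F P) (\<Phi> Z P r) v))"
    using o m by (intro D.cmp_assoc D.cmp_closed) auto
   also have "Cmp D A (F P) (F X) (\<Phi> P X s) (Cmp D A (F Z) (F P) (\<Phi> Z P r) v)
    = Cmp D A (F Z) (F X) (Cmp D (F Z) (F P) (F X) (\<Phi> P X s) (\<Phi> Z P r)) v"
    using o m by (intro D.cmp_assoc[symmetric]) auto
   also have "Cmp D (F Z) (F P) (F X) (\<Phi> P X s) (\<Phi> Z P r) = \<Phi> Z X (Cmp C Z P X s r)"
    using FF(5)[of Z P X r s] that P(1) by simp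
   finally show ?thesis .
  qed
  have sum: "Cmp D (F P) Y (F P) (Cmp D Y (F X) (F P) (\<Phi> X P r) v) (Cmp D (F P) (F X) Y u (\<Phi> P X s))
    = \<Phi> P P (Cmp C P X P r s)"
   if "Y \<in> Ob D" "X \<in> Ob C" "u \<in> Mor D (F X) Y" "v \<in> Mor D Y (F X)"
    "Cmp D (F X) Y (F X) v u = Idn D (F X)" "r \<in> Mor C X P" "s \<in> Mor C P X" for Y X u v r s
  proof -
   note o = that(1) FF(1)[OF that(2)] FF(1)[OF P(1)]
   note m = that(3,4) FF(3)[OF P(1) that(2) that(7)] FF(3)[OF that(2) P(1) that(6)]
   have "Cmp D (F P) Y (F P) (Cmp D Y (F X) (F P) (\<Phi> X P r) v) (Cmp D (F P) (F X) Y u (\<Phi> P X s))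
    = Cmp D (F P) (F X) (F P) (\<Phi> X P r) (Cmp D (F P) Y (F X) v (Cmp D (F P) (F X) Y u (\<Phi> P X s)))"
    using o m by (intro D.cmp_assoc D.cmp_closed) auto
   also have "Cmp D (F P) Y (F X) v (Cmp D (F P) (F X) Y u (\<Phi> P X s))
    = Cmp D (F P) (F X) (F X) (Cmp D (F X) Y (F X) v u) (\<Phi> P X s)"
    using o m by (intro D.cmp_assoc[symmetric]) auto
   also have "\<dots> = \<Phi> P X s" using that(5) o m D.id_left by simp
   also have "Cmp D (F P) (F X) (F P) (\<Phi> X P r) (\<Phi> P X s) = \<Phi> P P (Cmp C P X P r s)"
    using FF(5)[of P X P s r] that P(1) by simp
   finally show ?thesis .
  qed
  have e1: "Cmp D Y1 (F P) Y1 p' i' = Idn D Y1"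
   unfolding p'_def i'_def
   using conj[OF Y(1) Y(1) 1(1) 1(1) 1(2) 1(3) P(4) P(2)] P(6) FF(4)[OF 1(1)]
    D.id_left[OF Y(1) ob(3) 1(3)] 1(5) by simp
  have e2: "Cmp D Y2 (F P) Y2 q' j' = Idn D Y2"
   unfolding q'_def j'_def
   using conj[OF Y(2) Y(2) 2(1) 2(1) 2(2) 2(3) P(5) P(3)] P(7) FF(4)[OF 2(1)]
    D.id_left[OF Y(2) ob(4) 2(3)] 2(5) by simp
  have e3: "Cmp D Y2 (F P) Y1 p' j' = \<one>\<^bsub>HomGrp D Y2 Y1\<^esub>"
   unfolding p'_def j'_def
   using conj[OF Y(2) Y(1) 1(1) 2(1) 1(2) 2(3) P(4) P(3)] P(8) Phi_one[OF 2(1) 1(1)]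
    D.cmp_zero_left[OF Y(2) ob(4) ob(3) 2(3)] D.cmp_zero_right[OF Y(2) ob(3) Y(1) 1(2)] by simp
  have e4: "Cmp D Y1 (F P) Y2 q' i' = \<one>\<^bsub>HomGrp D Y1 Y2\<^esub>"
   unfolding q'_def i'_def
   using conj[OF Y(1) Y(2) 2(1) 1(1) 2(2) 1(3) P(5) P(2)] P(9) Phi_one[OF 1(1) 2(1)]
    D.cmp_zero_left[OF Y(1) ob(3) ob(4) 1(3)] D.cmp_zero_right[OF Y(1) ob(4) Y(2) 2(2)] by simp
  have "Cmp D (F P) Y1 (F P) i' p' \<otimes>\<^bsub>HomGrp D (F P) (F P)\<^esub> Cmp D (F P) Y2 (F P) j' q'
    = \<Phi> P P (Cmp C P X1 P i p) \<otimes>\<^bsub>HomGrp D (F P) (F P)\<^esub> \<Phi> P P (Cmp C P X2 P j q)"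
   unfolding p'_def i'_def q'_def j'_def
   using sum[OF Y(1) 1(1) 1(2) 1(3) 1(4) P(2) P(4)] sum[OF Y(2) 2(1) 2(2) 2(3) 2(4) P(3) P(5)] by simp
  also have "\<dots> = \<Phi> P P (Cmp C P X1 P i p \<otimes>\<^bsub>HomGrp C P P\<^esub> Cmp C P X2 P j q)"
   by (rule hom_mult[OF FF(2)[OF P(1) P(1)] C.cmp_closed[OF P(1) 1(1) P(1) P(4) P(2)]
      C.cmp_closed[OF P(1) 2(1) P(1) P(5) P(3)], symmetric])
  also have "\<dots> = Idn D (F P)" using P(10) FF(4)[OF P(1)] by simp
  finally have e5: "Cmp D (F P) Y1 (F P) i' p' \<otimes>\<^bsub>HomGrp D (F P) (F P)\<^esub> Cmp D (F P) Y2 (F P) j' q'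
    = Idn D (F P)" .
  show "\<exists>P\<in>Ob D. \<exists>i\<in>Mor D Y1 P. \<exists>j\<in>Mor D Y2 P. \<exists>p\<in>Mor D P Y1. \<exists>q\<in>Mor D P Y2.
     Cmp D Y1 P Y1 p i = Idn D Y1 \<and> Cmp D Y2 P Y2 q j = Idn D Y2 \<and>
     Cmp D Y2 P Y1 p j = \<one>\<^bsub>HomGrp D Y2 Y1\<^esub> \<and> Cmp D Y1 P Y2 q i = \<one>\<^bsub>HomGrp D Y1 Y2\<^esub> \<and>
     Cmp D P Y1 P i p \<otimes>\<^bsub>HomGrp D P P\<^esub> Cmp D P Y2 P j q = Idn D P"
   using ob(5) mor e1 e2 e3 e4 e5 by blast
 qed
qed

text \<open>
 The inverse functor is obtained by choosing, for each \<open>Y\<close>, an isomorphism \<open>F (G Y) \<cong> Y\<close> and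
 pulling morphisms back along the bijections \<open>\<Phi>\<close>.
\<close>

lemma additive_equivalence_of_fully_faithful_dense:
 assumes C: "additive_category C" and D: "additive_category D"
  and F: "additive_functor C D F \<Phi>"
  and bij: "\<And>X Y. X \<in> Ob C ==> Y \<in> Ob C ==> bij_betw (\<Phi> X Y) (Mor C X Y) (Mor D (F X) (F Y))"
  and dense: "\<And>Y. Y \<in> Ob D ==> \<exists>X\<in>Ob C. \<exists>f. iso_mor D (F X) Y f"
 shows "additive_equivalence C D F \<Phi>"
proof -
 interpret C: additive_category C by fact
 interpret D: additive_category D by fact
 note FF = additive_functorD[OF F]
 obtain G \<epsilon> where G: "\<And>Y. Y \<in> Ob D ==> G Y \<in> Ob C"
  and eps_iso: "\<And>Y. Y \<in> Ob D ==> iso_mor D (F (G Y)) Y (\<epsilon> Y)"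
  using dense by metis
 obtain \<delta> where de: "\<And>Y. Y \<in> Ob D ==> \<delta> Y \<in> Mor D Y (F (G Y)) \<and>
   Cmp D (F (G Y)) Y (F (G Y)) (\<delta> Y) (\<epsilon> Y) = Idn D (F (G Y)) \<and>
   Cmp D Y (F (G Y)) Y (\<epsilon> Y) (\<delta> Y) = Idn D Y"
  using eps_iso unfolding iso_mor_def by metis
 have ep: "\<And>Y. Y \<in> Ob D ==> \<epsilon> Y \<in> Mor D (F (G Y)) Y" using eps_iso unfolding iso_mor_def by blast
 note [simp] = G FF(1)
 define lft where "lft X Y = inv_into (Mor C X Y) (\<Phi> X Y)" for X Y
 have lft: "lft X Y g \<in> Mor C X Y" "\<Phi> X Y (lft X Y g) = g"
  if "X \<in> Ob C" "Y \<in> Ob C" "g \<in> Mor D (F X) (F Y)" for X Y g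
  using bij[OF that(1,2)] that(3) unfolding lft_def
  by (auto simp: bij_betw_def inv_into_into f_inv_into_f)
 have inj: "f = g" if "X \<in> Ob C" "Y \<in> Ob C" "f \<in> Mor C X Y" "g \<in> Mor C X Y" "\<Phi> X Y f = \<Phi> X Y g"
  for X Y f g using bij[OF that(1,2)] that(3-5) by (auto simp: bij_betw_def inj_on_def)
 define conj where "conj Y Z g = Cmp D (F (G Y)) Z (F (G Z)) (\<delta> Z) (Cmp D (F (G Y)) Y Z g (\<epsilon> Y))" for Y Z g
 define \<Psi> where "\<Psi> Y Z g = lft (G Y) (G Z) (conj Y Z g)" for Y Z g
 have conj: "conj Y Z g \<in> Mor D (F (G Y)) (F (G Z))" if "Y \<in> Ob D" "Z \<in> Ob D" "g \<in> Mor D Y Z" for Y Z g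
  unfolding conj_def using that ep de by (auto intro!: D.cmp_closed)
 have Psi: "\<Psi> Y Z g \<in> Mor C (G Y) (G Z)" "\<Phi> (G Y) (G Z) (\<Psi> Y Z g) = conj Y Z g"
  if "Y \<in> Ob D" "Z \<in> Ob D" "g \<in> Mor D Y Z" for Y Z g
  unfolding \<Psi>_def using lft conj that by auto
 have nat: "Cmp D (F (G Y)) (F (G Z)) Z (\<epsilon> Z) (conj Y Z g) = Cmp D (F (G Y)) Y Z g (\<epsilon> Y)"
  if "Y \<in> Ob D" "Z \<in> Ob D" "g \<in> Mor D Y Z" for Y Z g
 proof -
  have c: "Cmp D (F (G Y)) Y Z g (\<epsilon> Y) \<in> Mor D (F (G Y)) Z" using that ep by (auto intro!: D.cmp_closed)
  have "Cmp D (F (G Y)) (F (G Z)) Z (\<epsilon> Z) (conj Y Z g)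
    = Cmp D (F (G Y)) Z Z (Cmp D Z (F (G Z)) Z (\<epsilon> Z) (\<delta> Z)) (Cmp D (F (G Y)) Y Z g (\<epsilon> Y))"
   unfolding conj_def using that ep de c by (intro D.cmp_assoc[symmetric]) auto
  then show ?thesis using de that c D.id_left by simp
 qed
 have conj_mult: "conj Y Z (g \<otimes>\<^bsub>HomGrp D Y Z\<^esub> h)
   = conj Y Z g \<otimes>\<^bsub>HomGrp D (F (G Y)) (F (G Z))\<^esub> conj Y Z h"
  if "Y \<in> Ob D" "Z \<in> Ob D" "g \<in> Mor D Y Z" "h \<in> Mor D Y Z" for Y Z g h
  unfolding conj_def using that ep de D.cmp_add_left[of "F (G Y)" Y Z "\<epsilon> Y" g h]
   D.cmp_add_right[of "F (G Y)" Z "F (G Z)" "Cmp D (F (G Y)) Y Z g (\<epsilon> Y)" "Cmp D (F (G Y)) Y Z h (\<epsilon> Y)" "\<delta> Z"]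
  by (simp add: D.cmp_closed)
 have conj_id: "conj Y Y (Idn D Y) = Idn D (F (G Y))" if "Y \<in> Ob D" for Y
  unfolding conj_def using that de ep D.id_left by simp
 have conj_cmp: "conj X Z (Cmp D X Y Z g f) = Cmp D (F (G X)) (F (G Y)) (F (G Z)) (conj Y Z g) (conj X Y f)"
  if "X \<in> Ob D" "Y \<in> Ob D" "Z \<in> Ob D" "f \<in> Mor D X Y" "g \<in> Mor D Y Z" for X Y Z f g
 proof -
  have "Cmp D (F (G X)) (F (G Y)) (F (G Z)) (conj Y Z g) (conj X Y f)
    = Cmp D (F (G X)) Z (F (G Z)) (\<delta> Z)
      (Cmp D (F (G X)) (F (G Y)) Z (Cmp D (F (G Y)) Y Z g (\<epsilon> Y)) (conj X Y f))"
   unfolding conj_def[of Y Z] using that ep de conj[OF that(1,2,4)]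
   by (intro D.cmp_assoc D.cmp_closed) (auto intro: D.cmp_closed)
  also have "Cmp D (F (G X)) (F (G Y)) Z (Cmp D (F (G Y)) Y Z g (\<epsilon> Y)) (conj X Y f)
    = Cmp D (F (G X)) Y Z g (Cmp D (F (G X)) (F (G Y)) Y (\<epsilon> Y) (conj X Y f))"
   using that ep de conj[OF that(1,2,4)] by (intro D.cmp_assoc) auto
  also have "\<dots> = Cmp D (F (G X)) Y Z g (Cmp D (F (G X)) X Y f (\<epsilon> X))" using nat that by simp
  also have "\<dots> = Cmp D (F (G X)) X Z (Cmp D X Y Z g f) (\<epsilon> X)"
   using that ep by (intro D.cmp_assoc[symmetric]) auto
  finally show ?thesis by (simp add: conj_def)
 qed
 have Gf: "additive_functor D C G \<Psi>"
  unfolding additive_functor_def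
 proof (intro conjI ballI)
  fix X Y assume XY: "X \<in> Ob D" "Y \<in> Ob D"
  show "\<Psi> X Y \<in> hom (HomGrp D X Y) (HomGrp C (G X) (G Y))"
  proof (rule homI)
   fix g h assume gh: "g \<in> Mor D X Y" "h \<in> Mor D X Y"
   have m: "g \<otimes>\<^bsub>HomGrp D X Y\<^esub> h \<in> Mor D X Y"
    using gh D.hom_group[OF XY] by (simp add: group.is_monoid monoid.m_closed)
   have m': "\<Psi> X Y g \<otimes>\<^bsub>HomGrp C (G X) (G Y)\<^esub> \<Psi> X Y h \<in> Mor C (G X) (G Y)"
    using Psi(1) gh XY C.hom_group by (simp add: group.is_monoid monoid.m_closed)
   show "\<Psi> X Y (g \<otimes>\<^bsub>HomGrp D X Y\<^esub> h) = \<Psi> X Y g \<otimes>\<^bsub>HomGrp C (G X) (G Y)\<^esub> \<Psi> X Y h"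
    by (rule inj[OF _ _ Psi(1)[OF XY m] m'])
     (use XY gh m Psi conj_mult hom_mult[OF FF(2)] in auto)
  qed (use Psi XY in auto)
 next
  fix X assume X: "X \<in> Ob D"
  show "\<Psi> X X (Idn D X) = Idn C (G X)"
   by (rule inj[of "G X" "G X"]) (use X Psi conj_id FF(4) D.id_closed C.id_closed in auto)
 next
  fix X Y Z f g assume a: "X \<in> Ob D" "Y \<in> Ob D" "Z \<in> Ob D" "f \<in> Mor D X Y" "g \<in> Mor D Y Z"
  show "\<Psi> X Z (Cmp D X Y Z g f) = Cmp C (G X) (G Y) (G Z) (\<Psi> Y Z g) (\<Psi> X Y f)"
  proof (rule inj[of "G X" "G Z"])
   note c = D.cmp_closed[OF a]
   show "\<Psi> X Z (Cmp D X Y Z g f) \<in> Mor C (G X) (G Z)" using Psi(1) a c by blast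
   show "Cmp C (G X) (G Y) (G Z) (\<Psi> Y Z g) (\<Psi> X Y f) \<in> Mor C (G X) (G Z)"
    using C.cmp_closed Psi(1) a G by blast
   show "\<Phi> (G X) (G Z) (\<Psi> X Z (Cmp D X Y Z g f))
    = \<Phi> (G X) (G Z) (Cmp C (G X) (G Y) (G Z) (\<Psi> Y Z g) (\<Psi> X Y f))"
    using Psi(2)[OF a(1,3) c] Psi(2)[OF a(1,2,4)] Psi(2)[OF a(2,3,5)] conj_cmp[OF a]
     FF(5)[OF G[OF a(1)] G[OF a(2)] G[OF a(3)] Psi(1)[OF a(1,2,4)] Psi(1)[OF a(2,3,5)]] by simp
  qed (use a in auto)
 qed simp
 define \<tau> where "\<tau> X = lft (G (F X)) X (\<epsilon> (F X))" for X
 have tau: "\<tau> X \<in> Mor C (G (F X)) X" "\<Phi> (G (F X)) X (\<tau> X) = \<epsilon> (F X)" if "X \<in> Ob C" for X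
  unfolding \<tau>_def using lft that ep by auto
 have "naturally_isomorphic C C (\<lambda>X. G (F X)) (\<lambda>X Y f. \<Psi> (F X) (F Y) (\<Phi> X Y f)) (\<lambda>X. X) (\<lambda>X Y f. f)"
  unfolding naturally_isomorphic_def
 proof (intro exI[of _ \<tau>] conjI ballI)
  fix X assume X: "X \<in> Ob C"
  define \<sigma> where "\<sigma> = lft X (G (F X)) (\<delta> (F X))"
  have sig: "\<sigma> \<in> Mor C X (G (F X))" "\<Phi> X (G (F X)) \<sigma> = \<delta> (F X)"
   unfolding \<sigma>_def using lft X de by auto
  have "Cmp C (G (F X)) X (G (F X)) \<sigma> (\<tau> X) = Idn C (G (F X))"
   by (rule inj[of "G (F X)" "G (F X)"])
    (use X sig tau FF(4,5) de C.id_closed in \<open>auto intro!: C.cmp_closed\<close>)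
  moreover have "Cmp C X (G (F X)) X (\<tau> X) \<sigma> = Idn C X"
   by (rule inj[of X X])
    (use X sig tau FF(4,5) de C.id_closed in \<open>auto intro!: C.cmp_closed\<close>)
  ultimately show "iso_mor C (G (F X)) X (\<tau> X)" unfolding iso_mor_def using tau X sig by blast
 next
  fix X Y f assume a: "X \<in> Ob C" "Y \<in> Ob C" "f \<in> Mor C X Y"
  note ps = Psi[OF FF(1)[OF a(1)] FF(1)[OF a(2)] FF(3)[OF a]]
  show "Cmp C (G (F X)) (G (F Y)) Y (\<tau> Y) (\<Psi> (F X) (F Y) (\<Phi> X Y f)) = Cmp C (G (F X)) X Y f (\<tau> X)"
  proof (rule inj[of "G (F X)" Y])
   show "\<Phi> (G (F X)) Y (Cmp C (G (F X)) (G (F Y)) Y (\<tau> Y) (\<Psi> (F X) (F Y) (\<Phi> X Y f)))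
    = \<Phi> (G (F X)) Y (Cmp C (G (F X)) X Y f (\<tau> X))"
    using a ps tau FF(5)[of "G (F X)" "G (F Y)" Y] FF(5)[of "G (F X)" X Y] nat[of "F X" "F Y" "\<Phi> X Y f"] FF(3)[OF a]
    by simp
  qed (use a ps tau in \<open>auto intro!: C.cmp_closed\<close>)
 qed
 moreover have "naturally_isomorphic D D (\<lambda>X. F (G X)) (\<lambda>X Y f. \<Phi> (G X) (G Y) (\<Psi> X Y f)) (\<lambda>X. X) (\<lambda>X Y f. f)"
  unfolding naturally_isomorphic_def using eps_iso Psi nat by (intro exI[of _ \<epsilon>]) simp
 ultimately show ?thesis
  unfolding additive_equivalence_def using C D F Gf by blast
qed

text \<open>The quotient category has the cosets of the kernel as morphisms, so the induced functor is
 bijective on morphisms; the target inherits additivity from \<open>C\<close> by density.\<close>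

theorem quotient_by_kernel_equivalence:
 assumes C: "additive_category C" and D: "preadditive_category D"
  and F: "additive_functor C D F \<Phi>"
  and full: "\<And>X Y g. X \<in> Ob C ==> Y \<in> Ob C ==> g \<in> Mor D (F X) (F Y) ==>
   \<exists>f\<in>Mor C X Y. \<Phi> X Y f = g"
  and ker: "\<And>X Y. X \<in> Ob C ==> Y \<in> Ob C ==>
   I X Y = {f \<in> Mor C X Y. \<Phi> X Y f = \<one>\<^bsub>HomGrp D (F X) (F Y)\<^esub>}"
  and dense: "\<And>Y. Y \<in> Ob D ==> \<exists>X\<in>Ob C. \<exists>f. iso_mor D (F X) Y f"
 shows "\<exists>\<Phi>'. (\<forall>X\<in>Ob C. \<forall>Y\<in>Ob C. \<forall>f\<in>Mor C X Y. \<Phi>' X Y (I X Y #>\<^bsub>HomGrp C X Y\<^esub> f) = \<Phi> X Y f) \<and>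
  additive_equivalence (quotient_category C I) D F \<Phi>'"
proof -
 interpret C: additive_category C by fact
 interpret D: preadditive_category D by fact
 have D_add: "additive_category D" using additive_category_of_dense[OF C D F dense] .
 note FF = additive_functorD[OF F]
 let ?Q = "quotient_category C I"
 define cls where "cls X Y f = I X Y #>\<^bsub>HomGrp C X Y\<^esub> f" for X Y f
 define \<Phi>' where "\<Phi>' X Y K = the_elem (\<Phi> X Y ` K)" for X Y K
 have ObQ: "Ob ?Q = Ob C" by (simp add: quotient_category_def)
 have gh: "group_hom (HomGrp C X Y) (HomGrp D (F X) (F Y)) (\<Phi> X Y)" if "X \<in> Ob C" "Y \<in> Ob C" for X Y
  by (intro group_hom.intro group_hom_axioms.intro C.hom_group D.hom_group FF(1,2) that)
 have kerI: "kernel (HomGrp C X Y) (HomGrp D (F X) (F Y)) (\<Phi> X Y) = I X Y" if "X \<in> Ob C" "Y \<in> Ob C" for X Y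
  using ker[OF that] by (simp add: kernel_def)
 have HQ: "HomGrp ?Q X Y = HomGrp C X Y Mod I X Y" for X Y by (simp add: quotient_category_def)
 have MorQ: "Mor ?Q X Y = cls X Y ` Mor C X Y" for X Y
  by (auto simp: HQ FactGroup_def RCOSETS_def cls_def)
 have norm: "I X Y \<lhd> HomGrp C X Y" if "X \<in> Ob C" "Y \<in> Ob C" for X Y
  using group_hom.normal_kernel[OF gh[OF that]] kerI[OF that] by simp
 have im: "\<Phi> X Y ` cls X Y f = {\<Phi> X Y f}" if "X \<in> Ob C" "Y \<in> Ob C" "f \<in> Mor C X Y" for X Y f
 proof -
  interpret group_hom "HomGrp C X Y" "HomGrp D (F X) (F Y)" "\<Phi> X Y" using gh that by blast
  have "\<Phi> X Y h = \<Phi> X Y f" if "h \<in> cls X Y f" for h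
  proof -
   from that obtain z where "z \<in> I X Y" "h = z \<otimes>\<^bsub>HomGrp C X Y\<^esub> f" unfolding cls_def r_coset_def by blast
   then show ?thesis using ker \<open>X \<in> Ob C\<close> \<open>Y \<in> Ob C\<close> \<open>f \<in> Mor C X Y\<close> by auto
  qed
  moreover have "f \<in> cls X Y f" unfolding cls_def
   using G.rcos_self that norm[OF that(1,2)] by (simp add: normal_imp_subgroup)
  ultimately show ?thesis by blast
 qed
 have Phi': "\<Phi>' X Y (cls X Y f) = \<Phi> X Y f" if "X \<in> Ob C" "Y \<in> Ob C" "f \<in> Mor C X Y" for X Y f
  unfolding \<Phi>'_def using im[OF that] by simp
 have fact: "inj_on (\<Phi>' X Y) (Mor ?Q X Y)" "\<Phi>' X Y \<in> hom (HomGrp ?Q X Y) (HomGrp D (F X) (F Y))"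
  if "X \<in> Ob C" "Y \<in> Ob C" for X Y
  using group_hom.FactGroup_inj_on[OF gh[OF that]] group_hom.FactGroup_hom[OF gh[OF that]] kerI[OF that]
  by (simp_all add: HQ \<Phi>'_def[abs_def])
 have clsI: "cls X Y f \<in> Mor ?Q X Y" if "f \<in> Mor C X Y" for X Y f
  unfolding MorQ by (rule imageI[OF that])
 have cls_eq: "cls X Y f = cls X Y g"
  if "X \<in> Ob C" "Y \<in> Ob C" "f \<in> Mor C X Y" "g \<in> Mor C X Y" "\<Phi> X Y f = \<Phi> X Y g" for X Y f g
  using inj_onD[OF fact(1)[OF that(1,2)] _ clsI[OF that(3)] clsI[OF that(4)]]
   Phi'[OF that(1-3)] Phi'[OF that(1,2,4)] that(5) by simp
 have cls_sub: "cls X Y f \<subseteq> Mor C X Y" if "X \<in> Ob C" "Y \<in> Ob C" "f \<in> Mor C X Y" for X Y f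
  using that ker C.hom_group[OF that(1,2)]
  by (auto simp: cls_def r_coset_def group.is_monoid monoid.m_closed)
 have cls_ne: "f \<in> cls X Y f" if "X \<in> Ob C" "Y \<in> Ob C" "f \<in> Mor C X Y" for X Y f
  unfolding cls_def using group.rcos_self[OF C.hom_group] that norm[OF that(1,2)]
  by (simp add: normal_imp_subgroup)
 have mult: "cls X Y f \<otimes>\<^bsub>HomGrp ?Q X Y\<^esub> cls X Y g = cls X Y (f \<otimes>\<^bsub>HomGrp C X Y\<^esub> g)"
  if "X \<in> Ob C" "Y \<in> Ob C" "f \<in> Mor C X Y" "g \<in> Mor C X Y" for X Y f g
  using normal.rcos_sum[OF norm[OF that(1,2)] that(3,4)] by (simp add: cls_def HQ FactGroup_def)
 have oneQ: "\<one>\<^bsub>HomGrp ?Q X Y\<^esub> = cls X Y \<one>\<^bsub>HomGrp C X Y\<^esub>" if "X \<in> Ob C" "Y \<in> Ob C" for X Y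
 proof -
  have "I X Y \<subseteq> Mor C X Y" unfolding ker[OF that] by blast
  then show ?thesis
   using group.coset_mult_one[OF C.hom_group[OF that]] by (simp add: HQ FactGroup_def cls_def)
 qed
 have cmp: "Cmp ?Q X Y Z (cls Y Z g) (cls X Y f) = cls X Z (Cmp C X Y Z g f)"
  if a: "X \<in> Ob C" "Y \<in> Ob C" "Z \<in> Ob C" "f \<in> Mor C X Y" "g \<in> Mor C Y Z" for X Y Z f g
 proof -
  have "cls X Z (Cmp C X Y Z g' f') = cls X Z (Cmp C X Y Z g f)"
   if "g' \<in> cls Y Z g" "f' \<in> cls X Y f" for g' f'
  proof (rule cls_eq)
   have m: "g' \<in> Mor C Y Z" "f' \<in> Mor C X Y"
    using that cls_sub[OF a(2,3,5)] cls_sub[OF a(1,2,4)] by auto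
   have "\<Phi> Y Z g' = \<Phi> Y Z g" "\<Phi> X Y f' = \<Phi> X Y f"
    using imageI[OF that(1), of "\<Phi> Y Z"] imageI[OF that(2), of "\<Phi> X Y"]
     im[OF a(2,3,5)] im[OF a(1,2,4)] by auto
   then show "\<Phi> X Z (Cmp C X Y Z g' f') = \<Phi> X Z (Cmp C X Y Z g f)"
    using FF(5)[OF a] FF(5)[OF a(1-3) m(2,1)] by simp
   show "Cmp C X Y Z g' f' \<in> Mor C X Z" "Cmp C X Y Z g f \<in> Mor C X Z"
    using C.cmp_closed[OF a] C.cmp_closed[OF a(1-3) m(2,1)] by auto
  qed (use a in auto)
  then have "(\<Union>g'\<in>cls Y Z g. \<Union>f'\<in>cls X Y f. cls X Z (Cmp C X Y Z g' f'))
    = (\<Union>g'\<in>cls Y Z g. \<Union>f'\<in>cls X Y f. cls X Z (Cmp C X Y Z g f))"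
   by (intro SUP_cong refl) blast
  also have "\<dots> = cls X Z (Cmp C X Y Z g f)"
   using cls_ne[OF a(1,2,4)] cls_ne[OF a(2,3,5)] by (metis SUP_const empty_iff)
  finally show ?thesis by (simp add: quotient_category_def cls_def)
 qed
 have idQ: "Idn ?Q X = cls X X (Idn C X)" for X by (simp add: quotient_category_def cls_def)
 have preQ: "preadditive_category ?Q"
 proof (rule preadditive_category.intro, unfold ObQ)
  fix X Y assume "X \<in> Ob C" "Y \<in> Ob C"
  then show "comm_group (HomGrp ?Q X Y)"
   using comm_group.abelian_FactGroup[OF C.hom_comm_group] norm
   by (simp add: HQ normal_imp_subgroup)
 next
  fix X Y Z f g assume a: "X \<in> Ob C" "Y \<in> Ob C" "Z \<in> Ob C"
   and "f \<in> Mor ?Q X Y" "g \<in> Mor ?Q Y Z"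
  then obtain u v where m: "u \<in> Mor C X Y" "v \<in> Mor C Y Z"
   and e: "f = cls X Y u" "g = cls Y Z v" unfolding MorQ by blast
  show "Cmp ?Q X Y Z g f \<in> Mor ?Q X Z"
   unfolding e using cmp[OF a m] clsI[OF C.cmp_closed[OF a m]] by simp
 next
  fix W X Y Z f g h assume a: "W \<in> Ob C" "X \<in> Ob C" "Y \<in> Ob C" "Z \<in> Ob C"
   and "f \<in> Mor ?Q W X" "g \<in> Mor ?Q X Y" "h \<in> Mor ?Q Y Z"
  then obtain f' g' h' where m: "f' \<in> Mor C W X" "g' \<in> Mor C X Y" "h' \<in> Mor C Y Z"
   and e: "f = cls W X f'" "g = cls X Y g'" "h = cls Y Z h'" unfolding MorQ by blast
  show "Cmp ?Q W X Z (Cmp ?Q X Y Z h g) f = Cmp ?Q W Y Z h (Cmp ?Q W X Y g f)"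
   unfolding e using a m by (simp add: cmp C.cmp_closed C.cmp_assoc)
 next
  fix X Y Z f g g' assume a: "X \<in> Ob C" "Y \<in> Ob C" "Z \<in> Ob C"
   and "f \<in> Mor ?Q X Y" "g \<in> Mor ?Q Y Z" "g' \<in> Mor ?Q Y Z"
  then obtain u v w where m: "u \<in> Mor C X Y" "v \<in> Mor C Y Z" "w \<in> Mor C Y Z"
   and e: "f = cls X Y u" "g = cls Y Z v" "g' = cls Y Z w" unfolding MorQ by blast
  have "v \<otimes>\<^bsub>HomGrp C Y Z\<^esub> w \<in> Mor C Y Z"
   using m monoid.m_closed[OF group.is_monoid[OF C.hom_group]] a by blast
  then show "Cmp ?Q X Y Z (g \<otimes>\<^bsub>HomGrp ?Q Y Z\<^esub> g') f
     = Cmp ?Q X Y Z g f \<otimes>\<^bsub>HomGrp ?Q X Z\<^esub> Cmp ?Q X Y Z g' f"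
   unfolding e using a m by (simp add: cmp mult C.cmp_closed C.cmp_add_left)
 next
  fix X Y Z f f' g assume a: "X \<in> Ob C" "Y \<in> Ob C" "Z \<in> Ob C"
   and "f \<in> Mor ?Q X Y" "f' \<in> Mor ?Q X Y" "g \<in> Mor ?Q Y Z"
  then obtain u v w where m: "u \<in> Mor C X Y" "v \<in> Mor C X Y" "w \<in> Mor C Y Z"
   and e: "f = cls X Y u" "f' = cls X Y v" "g = cls Y Z w" unfolding MorQ by blast
  have "u \<otimes>\<^bsub>HomGrp C X Y\<^esub> v \<in> Mor C X Y"
   using m monoid.m_closed[OF group.is_monoid[OF C.hom_group]] a by blast
  then show "Cmp ?Q X Y Z g (f \<otimes>\<^bsub>HomGrp ?Q X Y\<^esub> f')
     = Cmp ?Q X Y Z g f \<otimes>\<^bsub>HomGrp ?Q X Z\<^esub> Cmp ?Q X Y Z g f'"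
   unfolding e using a m by (simp add: cmp mult C.cmp_closed C.cmp_add_right)
 next
  fix X assume X: "X \<in> Ob C"
  show "Idn ?Q X \<in> Mor ?Q X X" using clsI C.id_closed[OF X] idQ by simp
 next
  fix X Y f assume a: "X \<in> Ob C" "Y \<in> Ob C" and "f \<in> Mor ?Q X Y"
  then obtain f' where "f' \<in> Mor C X Y" "f = cls X Y f'" using MorQ by blast
  then show "Cmp ?Q X Y Y (Idn ?Q Y) f = f" "Cmp ?Q X X Y f (Idn ?Q X) = f"
   using cmp[OF a(1) a(2) a(2)] cmp[OF a(1) a(1) a(2)] a
   by (simp_all add: idQ C.id_closed C.id_left C.id_right)
 qed
 have addQ: "additive_category ?Q"
 proof (rule additive_category.intro[OF preQ], rule additive_category_axioms.intro, unfold ObQ)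
  obtain Z where "Z \<in> Ob C" "Idn C Z = \<one>\<^bsub>HomGrp C Z Z\<^esub>" using C.zero_object by blast
  then show "\<exists>Z\<in>Ob C. Idn ?Q Z = \<one>\<^bsub>HomGrp ?Q Z Z\<^esub>" using idQ oneQ by metis
 next
  fix X Y assume XY: "X \<in> Ob C" "Y \<in> Ob C"
  obtain P i j p q where P: "P \<in> Ob C" "i \<in> Mor C X P" "j \<in> Mor C Y P" "p \<in> Mor C P X"
   "q \<in> Mor C P Y"
   "Cmp C X P X p i = Idn C X" "Cmp C Y P Y q j = Idn C Y"
   "Cmp C Y P X p j = \<one>\<^bsub>HomGrp C Y X\<^esub>" "Cmp C X P Y q i = \<one>\<^bsub>HomGrp C X Y\<^esub>"
   "Cmp C P X P i p \<otimes>\<^bsub>HomGrp C P P\<^esub> Cmp C P Y P j q = Idn C P"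
   using C.biproducts[OF XY] by metis
  show "\<exists>P\<in>Ob C. \<exists>i\<in>Mor ?Q X P. \<exists>j\<in>Mor ?Q Y P. \<exists>p\<in>Mor ?Q P X. \<exists>q\<in>Mor ?Q P Y.
     Cmp ?Q X P X p i = Idn ?Q X \<and> Cmp ?Q Y P Y q j = Idn ?Q Y \<and>
     Cmp ?Q Y P X p j = \<one>\<^bsub>HomGrp ?Q Y X\<^esub> \<and> Cmp ?Q X P Y q i = \<one>\<^bsub>HomGrp ?Q X Y\<^esub> \<and>
     Cmp ?Q P X P i p \<otimes>\<^bsub>HomGrp ?Q P P\<^esub> Cmp ?Q P Y P j q = Idn ?Q P"
   by (rule bexI[OF _ P(1)], rule bexI[OF _ clsI[OF P(2)]], rule bexI[OF _ clsI[OF P(3)]],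
     rule bexI[OF _ clsI[OF P(4)]], rule bexI[OF _ clsI[OF P(5)]])
    (use XY P in \<open>simp add: cmp idQ oneQ mult C.cmp_closed\<close>)
 qed
 have FQ: "additive_functor ?Q D F \<Phi>'"
  unfolding additive_functor_def ObQ
  using fact(2) FF by (auto simp: MorQ cmp Phi' idQ C.id_closed C.cmp_closed)
 have "additive_equivalence ?Q D F \<Phi>'"
 proof (rule additive_equivalence_of_fully_faithful_dense[OF addQ D_add FQ], unfold ObQ)
  fix X Y assume XY: "X \<in> Ob C" "Y \<in> Ob C"
  show "bij_betw (\<Phi>' X Y) (Mor ?Q X Y) (Mor D (F X) (F Y))"
   unfolding bij_betw_def
  proof (intro conjI fact(1) XY equalityI subsetI)
   fix g assume "g \<in> Mor D (F X) (F Y)"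
   then obtain f where "f \<in> Mor C X Y" "\<Phi> X Y f = g" using full[OF XY] by blast
   then show "g \<in> \<Phi>' X Y ` Mor ?Q X Y" using Phi'[OF XY] clsI[of f X Y] by force
  next
   fix g assume "g \<in> \<Phi>' X Y ` Mor ?Q X Y"
   then show "g \<in> Mor D (F X) (F Y)" using hom_carrier[OF fact(2)[OF XY]] by blast
  qed
 qed (rule dense)
 then show ?thesis using Phi' unfolding cls_def by blast
qed

section \<open>Left modules\<close>

lemma left_module_ring: "left_module R M ==> ring R"
 by (simp add: left_module_def)

lemma left_module_abelian_group: "left_module R M ==> abelian_group M"
 by (simp add: left_module_def)

lemma left_module_add_closed:
 "left_module R M ==> x \<in> carrier M ==> y \<in> carrier M ==> x \<oplus>\<^sub>M y \<in> carrier M"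
 by (rule abelian_groupE(1)[OF left_module_abelian_group])

text \<open>
 The constructions on modules below need plain module records.
\<close>

locale lmod = left_module R M
 for R :: "('a, 'r) ring_scheme" (structure) and M :: "('a, 'b) module" (structure)
begin

lemma smult_l_null [simp]: "x \<in> carrier M ==> \<zero>\<^sub>R \<odot>\<^sub>M x = \<zero>\<^sub>M"
 using smult_l_distr[of "\<zero>\<^sub>R" "\<zero>\<^sub>R" x] smult_closed[of "\<zero>\<^sub>R" x]
 by (metis M.add.l_cancel_one' R.add.one_closed R.add.r_one)

lemma smult_r_null [simp]: "a \<in> carrier R ==> a \<odot>\<^sub>M \<zero>\<^sub>M = \<zero>\<^sub>M"
 using smult_r_distr[of a "\<zero>\<^sub>M" "\<zero>\<^sub>M"] smult_closed[of a "\<zero>\<^sub>M"]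
 by (metis M.add.l_cancel_one' M.add.one_closed M.add.r_one)

lemma smult_r_minus: "a \<in> carrier R ==> x \<in> carrier M ==> a \<odot>\<^sub>M (\<ominus>\<^sub>M x) = \<ominus>\<^sub>M (a \<odot>\<^sub>M x)"
 using smult_r_distr[of a "\<ominus>\<^sub>M x" x] M.minus_equality[of "a \<odot>\<^sub>M (\<ominus>\<^sub>M x)" "a \<odot>\<^sub>M x"]
 by (simp add: smult_closed M.l_neg)

lemma smult_uminus_one: "x \<in> carrier M ==> (\<ominus>\<^sub>R \<one>\<^sub>R) \<odot>\<^sub>M x = \<ominus>\<^sub>M x"
 using smult_l_distr[of "\<ominus>\<^sub>R \<one>\<^sub>R" "\<one>\<^sub>R" x]
 by (simp add: R.l_neg smult_one smult_closed M.minus_equality)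

lemma smult_r_diff:
 "a \<in> carrier R ==> x \<in> carrier M ==> y \<in> carrier M ==>
  a \<odot>\<^sub>M (x \<ominus>\<^sub>M y) = a \<odot>\<^sub>M x \<ominus>\<^sub>M a \<odot>\<^sub>M y"
 by (simp add: a_minus_def smult_r_distr smult_r_minus)

lemma diff_add_cancel: "x \<in> carrier M ==> y \<in> carrier M ==> (x \<ominus>\<^sub>M y) \<oplus>\<^sub>M y = x"
 by (simp add: a_minus_def M.a_assoc M.l_neg)

lemma add_diff_cancel: "x \<in> carrier M ==> y \<in> carrier M ==> (x \<oplus>\<^sub>M y) \<ominus>\<^sub>M x = y"
 using M.a_comm[of x y] by (simp add: a_minus_def M.a_assoc M.r_neg)

lemma add_add_swap:
 assumes "a \<in> carrier M" "b \<in> carrier M" "c \<in> carrier M" "d \<in> carrier M"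
 shows "(a \<oplus>\<^sub>M b) \<oplus>\<^sub>M (c \<oplus>\<^sub>M d) = (a \<oplus>\<^sub>M c) \<oplus>\<^sub>M (b \<oplus>\<^sub>M d)"
 using assms by (simp add: M.a_ac)

lemma diff_zero: "x \<in> carrier M ==> x \<ominus>\<^sub>M \<zero>\<^sub>M = x"
 using M.l_neg[of "\<zero>\<^sub>M"] by (simp add: a_minus_def)

lemma diff_zero_iff:
 assumes "x \<in> carrier M" "y \<in> carrier M"
 shows "x \<ominus>\<^sub>M y = \<zero>\<^sub>M \<longleftrightarrow> x = y"
 using diff_add_cancel[OF assms] assms by (auto simp: a_minus_def M.r_neg)

lemma submodule_intro:
 assumes "H \<subseteq> carrier M" "\<zero>\<^sub>M \<in> H"
  and "\<And>x y. x \<in> H ==> y \<in> H ==> x \<oplus>\<^sub>M y \<in> H"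
  and sm: "\<And>a x. a \<in> carrier R ==> x \<in> H ==> a \<odot>\<^sub>M x \<in> H"
 shows "submodule H R M"
proof (intro submodule.intro subgroup.intro submodule_axioms.intro sm)
 fix x assume x: "x \<in> H"
 then have "(\<ominus>\<^sub>R \<one>\<^sub>R) \<odot>\<^sub>M x \<in> H" by (intro sm) simp
 then show "inv\<^bsub>add_monoid M\<^esub> x \<in> H"
  using smult_uminus_one[of x] x assms(1) unfolding a_inv_def by auto
qed (use assms in auto)

lemma submoduleD:
 assumes "submodule H R M"
 shows "H \<subseteq> carrier M" "\<zero>\<^sub>M \<in> H" "x \<in> H ==> x \<in> carrier M"
  and "x \<in> H ==> y \<in> H ==> x \<oplus>\<^sub>M y \<in> H"
  and "x \<in> H ==> \<ominus>\<^sub>M x \<in> H"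
  and "x \<in> H ==> y \<in> H ==> x \<ominus>\<^sub>M y \<in> H"
  and "a \<in> carrier R ==> x \<in> H ==> a \<odot>\<^sub>M x \<in> H"
proof -
 interpret H: submodule H R M by fact
 interpret H: additive_subgroup H M by (rule additive_subgroup.intro) (rule H.subgroup_axioms)
 show "H \<subseteq> carrier M" "\<zero>\<^sub>M \<in> H" "x \<in> H ==> x \<in> carrier M"
  "x \<in> H ==> y \<in> H ==> x \<oplus>\<^sub>M y \<in> H"
  "x \<in> H ==> \<ominus>\<^sub>M x \<in> H" "x \<in> H ==> y \<in> H ==> x \<ominus>\<^sub>M y \<in> H"
  "a \<in> carrier R ==> x \<in> H ==> a \<odot>\<^sub>M x \<in> H"
  using H.a_subset by (auto simp: a_minus_def)
qed

lemma submodule_abelian_subgroup: "submodule H R M ==> abelian_subgroup H M"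
 by (intro abelian_subgroupI3 additive_subgroup.intro M.abelian_group_axioms)
  (simp add: submodule_def)

lemma submodule_zero: "submodule {\<zero>\<^sub>M} R M"
 by (rule submodule_intro) auto

lemma coset_eq_iff:
 assumes "submodule H R M" "x \<in> carrier M" "y \<in> carrier M"
 shows "H +>\<^sub>M x = H +>\<^sub>M y \<longleftrightarrow> x \<ominus>\<^sub>M y \<in> H"
proof -
 interpret H: abelian_subgroup H M using submodule_abelian_subgroup assms(1) .
 show ?thesis
  using H.a_rcos_module[OF assms(3,2)] H.a_repr_independence'[of x y] H.a_rcos_self[OF assms(2)] assms
  unfolding a_minus_def by metis
qed

lemma coset_zero_iff:
 assumes "submodule H R M" "x \<in> carrier M"
 shows "H +>\<^sub>M x = H \<longleftrightarrow> x \<in> H"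
proof -
 have "H +>\<^sub>M \<zero>\<^sub>M = H" using submoduleD(1)[OF assms(1)] by simp
 then show ?thesis using coset_eq_iff[OF assms M.zero_closed] assms(2)
  by (simp add: diff_zero)
qed

lemma coset_self: "submodule H R M ==> x \<in> carrier M ==> x \<in> H +>\<^sub>M x"
 by (rule abelian_subgroup.a_rcos_self[OF submodule_abelian_subgroup])

lemma coset_memD:
 assumes "submodule H R M" "x \<in> carrier M" "y \<in> H +>\<^sub>M x"
 shows "y \<in> carrier M" "y \<ominus>\<^sub>M x \<in> H" "H +>\<^sub>M y = H +>\<^sub>M x"
proof -
 interpret H: abelian_subgroup H M using submodule_abelian_subgroup assms(1) .
 show y: "y \<in> carrier M" using H.a_elemrcos_carrier assms by blast
 show "y \<ominus>\<^sub>M x \<in> H" using H.a_rcos_module[OF assms(2) y] assms(3) by (simp add: a_minus_def)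
 then show "H +>\<^sub>M y = H +>\<^sub>M x" using coset_eq_iff[OF assms(1) y assms(2)] by simp
qed

lemma coset_add:
 assumes "submodule H R M" "x \<in> carrier M" "y \<in> carrier M"
 shows "(H +>\<^sub>M x) <+>\<^bsub>M\<^esub> (H +>\<^sub>M y) = H +>\<^sub>M (x \<oplus>\<^sub>M y)"
 by (rule abelian_subgroup.a_rcos_sum[OF submodule_abelian_subgroup[OF assms(1)] assms(2,3)])

lemma a_rcosets_image: "a_rcosets\<^bsub>M\<^esub> H = (\<lambda>x. H +>\<^sub>M x) ` carrier M"
 by (auto simp: A_RCOSETS_def')

lemma left_module_restrict:
 assumes H: "submodule H R M"
 shows "left_module R (res M H)"
proof -
 note D = submoduleD[OF H]
 have "abelian_group (res M H)"
 proof (rule abelian_groupI)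
  fix x assume "x \<in> carrier (res M H)"
  then show "\<exists>y\<in>carrier (res M H).
    y \<oplus>\<^bsub>res M H\<^esub> x = \<zero>\<^bsub>res M H\<^esub>"
   using D by (intro bexI[of _ "\<ominus>\<^sub>M x"]) (auto simp: M.l_neg)
 next
  fix x y assume "x \<in> carrier (res M H)" "y \<in> carrier (res M H)"
  then show "x \<oplus>\<^bsub>res M H\<^esub> y = y \<oplus>\<^bsub>res M H\<^esub> x"
   using D(3) M.a_comm by simp
 qed (use D in \<open>auto simp: M.a_assoc\<close>)
 then show ?thesis
  by (intro left_module.intro left_module_axioms.intro R.ring_axioms)
   (use D in \<open>auto simp: smult_l_distr smult_r_distr smult_assoc smult_one\<close>)
qed

lemma submodule_restrict_iff:
 assumes H: "submodule H R M" and "K \<subseteq> H"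
 shows "submodule K R (res M H) \<longleftrightarrow> submodule K R M"
proof -
 interpret H: lmod R "res M H" by (rule lmod.intro) (rule left_module_restrict[OF H])
 show ?thesis
 proof
  assume K: "submodule K R (res M H)"
  show "submodule K R M"
   using H.submoduleD[OF K] submoduleD(1)[OF H] by (intro submodule_intro) auto
 next
  assume K: "submodule K R M"
  show "submodule K R (res M H)"
   using submoduleD[OF K] assms(2) by (intro H.submodule_intro) auto
 qed
qed

end

text \<open>
 A surjection that is semilinear along a surjective ring homomorphism \<open>\<sigma>\<close> transports the module
 axioms. This one principle gives quotient modules, modules copied along a bijection, and
 the \<open>\<Pi>\<close>-module structure on \<open>M / \<eta> M\<close>.
\<close>

lemma left_module_image:
 fixes R :: "('a, 'r) ring_scheme" and R' :: "('b, 's) ring_scheme"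
  and M :: "('a, 'c) module" and N :: "('b, 'd) module"
 assumes M: "left_module R M" and R': "ring R'"
  and \<sigma>: "\<sigma> \<in> ring_hom R R'" "\<sigma> ` carrier R = carrier R'"
  and \<phi>: "\<phi> ` carrier M = carrier N"
  and add: "\<And>x y. x \<in> carrier M ==> y \<in> carrier M ==> \<phi> (x \<oplus>\<^sub>M y) = \<phi> x \<oplus>\<^sub>N \<phi> y"
  and smult: "\<And>a x. a \<in> carrier R ==> x \<in> carrier M ==> \<phi> (a \<odot>\<^sub>M x) = \<sigma> a \<odot>\<^sub>N \<phi> x"
  and zero: "\<phi> \<zero>\<^sub>M = \<zero>\<^sub>N"
 shows "left_module R' N"
proof -
 interpret M: lmod R M by (rule lmod.intro) fact
 have N: "\<exists>u\<in>carrier M. y = \<phi> u" if "y \<in> carrier N" for y using that \<phi> by blast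
 have S: "\<exists>c\<in>carrier R. a = \<sigma> c" if "a \<in> carrier R'" for a using that \<sigma>(2) by blast
 have cl: "\<phi> x \<in> carrier N" if "x \<in> carrier M" for x using \<phi> that by blast
 have "abelian_group N"
 proof (rule abelian_groupI)
  fix x y assume xy: "x \<in> carrier N" "y \<in> carrier N"
  from N[OF xy(1)] N[OF xy(2)] obtain u v where u: "u \<in> carrier M" "v \<in> carrier M" and x: "x = \<phi> u" "y = \<phi> v" by blast
  show "x \<oplus>\<^sub>N y \<in> carrier N"
   unfolding x add[OF u, symmetric] by (rule cl[OF M.M.add.m_closed[OF u]])
  show "x \<oplus>\<^sub>N y = y \<oplus>\<^sub>N x"
   unfolding x add[OF u, symmetric] add[OF u(2,1), symmetric] M.M.a_comm[OF u] ..
 next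
  fix x y z assume as: "x \<in> carrier N" "y \<in> carrier N" "z \<in> carrier N"
  from N[OF as(1)] N[OF as(2)] N[OF as(3)] obtain u v w where "u \<in> carrier M" "v \<in> carrier M" "w \<in> carrier M"
   "x = \<phi> u" "y = \<phi> v" "z = \<phi> w" by blast
  then show "x \<oplus>\<^sub>N y \<oplus>\<^sub>N z = x \<oplus>\<^sub>N (y \<oplus>\<^sub>N z)"
   by (simp add: add[symmetric] M.M.a_assoc)
 next
  show "\<zero>\<^sub>N \<in> carrier N" using zero cl[of "\<zero>\<^sub>M"] by simp
 next
  fix x assume as: "x \<in> carrier N"
  from N[OF as] obtain u where u: "u \<in> carrier M" "x = \<phi> u" by blast
  show "\<zero>\<^sub>N \<oplus>\<^sub>N x = x"
   unfolding u(2) zero[symmetric] add[OF M.M.zero_closed u(1), symmetric] M.M.l_zero[OF u(1)] ..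
  have "\<phi> (\<ominus>\<^sub>M u) \<oplus>\<^sub>N x = \<zero>\<^sub>N"
   unfolding u(2) add[OF M.M.a_inv_closed[OF u(1)] u(1), symmetric] M.M.l_neg[OF u(1)] by (rule zero)
  then show "\<exists>y\<in>carrier N. y \<oplus>\<^sub>N x = \<zero>\<^sub>N"
   using cl[OF M.M.a_inv_closed[OF u(1)]] by blast
 qed
 moreover have "left_module_axioms R' N"
 proof (rule left_module_axioms.intro)
  fix a x assume as: "a \<in> carrier R'" "x \<in> carrier N"
  from S[OF as(1)] N[OF as(2)] obtain c u where c: "c \<in> carrier R" "u \<in> carrier M" "a = \<sigma> c" "x = \<phi> u" by blast
  then show "a \<odot>\<^sub>N x \<in> carrier N" using smult[of c u] cl[of "c \<odot>\<^sub>M u"] M.smult_closed by simp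
 next
  fix a b x assume as: "a \<in> carrier R'" "b \<in> carrier R'" "x \<in> carrier N"
  from S[OF as(1)] S[OF as(2)] N[OF as(3)] obtain c d u where c: "c \<in> carrier R" "d \<in> carrier R" "u \<in> carrier M" "a = \<sigma> c" "b = \<sigma> d" "x = \<phi> u" by blast
  then show "(a \<oplus>\<^bsub>R'\<^esub> b) \<odot>\<^sub>N x = a \<odot>\<^sub>N x \<oplus>\<^sub>N b \<odot>\<^sub>N x"
   by (simp add: ring_hom_add[OF \<sigma>(1), symmetric] smult[symmetric] add[symmetric] M.smult_closed M.smult_l_distr)
  show "(a \<otimes>\<^bsub>R'\<^esub> b) \<odot>\<^sub>N x = a \<odot>\<^sub>N (b \<odot>\<^sub>N x)"
   using c by (simp add: ring_hom_mult[OF \<sigma>(1), symmetric] smult[symmetric] M.smult_closed M.smult_assoc)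
 next
  fix a x y assume as: "a \<in> carrier R'" "x \<in> carrier N" "y \<in> carrier N"
  from S[OF as(1)] N[OF as(2)] N[OF as(3)] obtain c u v where c: "c \<in> carrier R" "u \<in> carrier M" "v \<in> carrier M" "a = \<sigma> c" "x = \<phi> u" "y = \<phi> v" by blast
  then show "a \<odot>\<^sub>N (x \<oplus>\<^sub>N y) = a \<odot>\<^sub>N x \<oplus>\<^sub>N a \<odot>\<^sub>N y"
   by (simp add: smult[symmetric] add[symmetric] M.smult_closed M.smult_r_distr)
 next
  fix x assume as: "x \<in> carrier N"
  from N[OF as] obtain u where u: "u \<in> carrier M" "x = \<phi> u" by blast
  have "\<one>\<^bsub>R'\<^esub> \<odot>\<^sub>N \<phi> u = \<phi> (\<one>\<^sub>R \<odot>\<^sub>M u)"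
   using smult[OF M.R.one_closed u(1)] ring_hom_one[OF \<sigma>(1)] by simp
  then show "\<one>\<^bsub>R'\<^esub> \<odot>\<^sub>N x = x" unfolding u(2) M.smult_one[OF u(1)] .
 qed
 ultimately show ?thesis using R' by (simp add: left_module_def)
qed

lemma ring_hom_ident: "(\<lambda>x. x) \<in> ring_hom R R"
 by (rule ring_hom_memI) auto

context lmod
begin

lemma quotient_module_simps:
 assumes H: "submodule H R M"
 shows "carrier (quotient_module M H) = (\<lambda>x. H +>\<^sub>M x) ` carrier M"
  and "zero (quotient_module M H) = H"
  and "x \<in> carrier M ==> y \<in> carrier M ==>
   (H +>\<^sub>M x) \<oplus>\<^bsub>quotient_module M H\<^esub> (H +>\<^sub>M y) = H +>\<^sub>M (x \<oplus>\<^sub>M y)"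
  and "a \<in> carrier R ==> x \<in> carrier M ==>
   a \<odot>\<^bsub>quotient_module M H\<^esub> (H +>\<^sub>M x) = H +>\<^sub>M (a \<odot>\<^sub>M x)"
proof -
 show "a \<odot>\<^bsub>quotient_module M H\<^esub> (H +>\<^sub>M x) = H +>\<^sub>M (a \<odot>\<^sub>M x)"
  if ax: "a \<in> carrier R" "x \<in> carrier M"
 proof -
  have "H +>\<^sub>M (a \<odot>\<^sub>M y) = H +>\<^sub>M (a \<odot>\<^sub>M x)" if y: "y \<in> H +>\<^sub>M x" for y
  proof -
   note c = coset_memD[OF H ax(2) y]
   have "a \<odot>\<^sub>M y \<ominus>\<^sub>M a \<odot>\<^sub>M x \<in> H"
    using smult_r_diff[OF ax(1) c(1) ax(2)] submoduleD(7)[OF H ax(1) c(2)] by simp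
   then show ?thesis using coset_eq_iff[OF H] smult_closed ax c(1) by blast
  qed
  then have "(\<Union>y\<in>H +>\<^sub>M x. H +>\<^sub>M (a \<odot>\<^sub>M y)) = (\<Union>y\<in>H +>\<^sub>M x. H +>\<^sub>M (a \<odot>\<^sub>M x))"
   by (intro SUP_cong refl) blast
  also have "\<dots> = H +>\<^sub>M (a \<odot>\<^sub>M x)" using coset_self[OF H ax(2)] by (metis SUP_const empty_iff)
  finally show ?thesis by (simp add: quotient_module_def)
 qed
qed (auto simp: quotient_module_def a_rcosets_image coset_add[OF H])

lemma left_module_quotient:
 assumes H: "submodule H R M"
 shows "left_module R (quotient_module M H)"
 by (rule left_module_image[OF left_module_axioms R.ring_axioms ring_hom_ident _
    quotient_module_simps(1)[OF H, symmetric]])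
  (use quotient_module_simps[OF H] submoduleD(1)[OF H] in auto)

end

subsection \<open>Homomorphisms\<close>

lemma lmod_homI:
 assumes "\<And>x. x \<in> carrier M ==> f x \<in> carrier N"
  and "\<And>x y. x \<in> carrier M ==> y \<in> carrier M ==> f (x \<oplus>\<^sub>M y) = f x \<oplus>\<^sub>N f y"
  and "\<And>a x. a \<in> carrier R ==> x \<in> carrier M ==> f (a \<odot>\<^sub>M x) = a \<odot>\<^sub>N f x"
  and "left_module R M"
 shows "(\<lambda>x\<in>carrier M. f x) \<in> lmod_hom R M N"
proof -
 interpret lmod R M by (rule lmod.intro) fact
 show ?thesis using assms by (auto simp: lmod_hom_def smult_closed)
qed

lemma lmod_homD:
 assumes "f \<in> lmod_hom R M N"
 shows "x \<in> carrier M ==> f x \<in> carrier N"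
  and "x \<in> carrier M ==> y \<in> carrier M ==> f (x \<oplus>\<^sub>M y) = f x \<oplus>\<^sub>N f y"
  and "a \<in> carrier R ==> x \<in> carrier M ==> f (a \<odot>\<^sub>M x) = a \<odot>\<^sub>N f x"
 using assms by (auto simp: lmod_hom_def)

lemma lmod_hom_ext:
 assumes "f \<in> lmod_hom R M N" "g \<in> lmod_hom R M N'" "\<And>x. x \<in> carrier M ==> f x = g x"
 shows "f = g"
proof (rule extensionalityI)
 show "f \<in> extensional (carrier M)" "g \<in> extensional (carrier M)"
  using assms(1,2) by (simp_all add: lmod_hom_def PiE_def)
qed (rule assms(3))

lemma lmod_hom_zero:
 assumes "left_module R M" "left_module R N" "f \<in> lmod_hom R M N"
 shows "f \<zero>\<^sub>M = \<zero>\<^sub>N"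
proof -
 interpret M: lmod R M by (rule lmod.intro) fact
 interpret N: lmod R N by (rule lmod.intro) fact
 have "f \<zero>\<^sub>M = f (\<zero>\<^sub>R \<odot>\<^sub>M \<zero>\<^sub>M)" by simp
 also have "\<dots> = \<zero>\<^sub>R \<odot>\<^sub>N f \<zero>\<^sub>M" by (rule lmod_homD(3)[OF assms(3)]) simp_all
 also have "\<dots> = \<zero>\<^sub>N" using lmod_homD(1)[OF assms(3)] by simp
 finally show ?thesis .
qed

lemma lmod_hom_diff:
 assumes "left_module R M" "left_module R N" "f \<in> lmod_hom R M N" "x \<in> carrier M" "y \<in> carrier M"
 shows "f (x \<ominus>\<^sub>M y) = f x \<ominus>\<^sub>N f y"
proof -
 interpret M: lmod R M by (rule lmod.intro) fact
 interpret N: lmod R N by (rule lmod.intro) fact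
 have "f (\<ominus>\<^sub>M y) = \<ominus>\<^sub>N f y"
  using lmod_homD(3)[OF assms(3), of "\<ominus>\<^sub>R \<one>\<^sub>R" y] lmod_homD(1)[OF assms(3)] assms(5)
  by (simp add: M.smult_uminus_one N.smult_uminus_one)
 then show ?thesis using lmod_homD(2)[OF assms(3)] assms(4,5) by (simp add: a_minus_def)
qed

lemma lmod_hom_inj_iff:
 assumes "left_module R M" "left_module R N" "f \<in> lmod_hom R M N"
 shows "inj_on f (carrier M) \<longleftrightarrow> (\<forall>x\<in>carrier M. f x = \<zero>\<^sub>N --> x = \<zero>\<^sub>M)"
proof -
 interpret M: lmod R M by (rule lmod.intro) fact
 interpret N: lmod R N by (rule lmod.intro) fact
 show ?thesis
 proof
  assume "inj_on f (carrier M)"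
  then show "\<forall>x\<in>carrier M. f x = \<zero>\<^sub>N --> x = \<zero>\<^sub>M"
   using lmod_hom_zero[OF assms] M.M.zero_closed by (metis inj_onD)
 next
  assume a: "\<forall>x\<in>carrier M. f x = \<zero>\<^sub>N --> x = \<zero>\<^sub>M"
  show "inj_on f (carrier M)"
  proof (rule inj_onI)
   fix x y assume xy: "x \<in> carrier M" "y \<in> carrier M" "f x = f y"
   then have "f (x \<ominus>\<^sub>M y) = \<zero>\<^sub>N"
    using lmod_hom_diff[OF assms xy(1,2)] N.diff_zero_iff lmod_homD(1)[OF assms(3)] by simp
   then show "x = y" using a xy M.diff_zero_iff by blast
  qed
 qed
qed

lemma lmod_hom_compose:
 assumes "f \<in> lmod_hom R L M" "g \<in> lmod_hom R M N" "left_module R L"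
 shows "(\<lambda>x\<in>carrier L. g (f x)) \<in> lmod_hom R L N"
 by (rule lmod_homI) (use assms lmod_homD[OF assms(1)] lmod_homD[OF assms(2)] in auto)

lemma lmod_hom_ident: "left_module R M ==> (\<lambda>x\<in>carrier M. x) \<in> lmod_hom R M M"
 by (rule lmod_homI) auto

lemma lmod_hom_restrict:
 assumes "f \<in> lmod_hom R M N" "left_module R M" "submodule H R M"
 shows "(\<lambda>x\<in>H. f x) \<in> lmod_hom R (res M H) N"
 using lmod_homI[of "res M H" f N R] lmod.left_module_restrict[OF lmod.intro, OF assms(2,3)]
  lmod_homD[OF assms(1)] lmod.submoduleD(3)[OF lmod.intro, OF assms(2,3)] by simp

lemma lmod_hom_inv:
 assumes M: "left_module R M" and N: "left_module R N" and f: "f \<in> lmod_hom R M N"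
  and b: "bij_betw f (carrier M) (carrier N)"
 shows "(\<lambda>y\<in>carrier N. inv_into (carrier M) f y) \<in> lmod_hom R N M"
proof (rule lmod_homI)
 interpret M: lmod R M by (rule lmod.intro) fact
 interpret N: lmod R N by (rule lmod.intro) fact
 note D = lmod_homD[OF f]
 let ?g = "inv_into (carrier M) f"
 have i: "inj_on f (carrier M)" and im: "f ` carrier M = carrier N" using b by (auto simp: bij_betw_def)
 have g: "?g y \<in> carrier M" "f (?g y) = y" if "y \<in> carrier N" for y
  using that im by (auto intro: inv_into_into f_inv_into_f)
 show "?g y \<in> carrier M" if "y \<in> carrier N" for y using g that by blast
 show "?g (x \<oplus>\<^sub>N y) = ?g x \<oplus>\<^sub>M ?g y" if "x \<in> carrier N" "y \<in> carrier N" for x y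
  using that g D(2) by (intro inv_into_f_eq[OF i]) auto
 show "?g (a \<odot>\<^sub>N y) = a \<odot>\<^sub>M ?g y" if "a \<in> carrier R" "y \<in> carrier N" for a y
  using that g D(3) M.smult_closed by (intro inv_into_f_eq[OF i]) auto
qed (rule N)

text \<open>Extending a homomorphism from \<open>H\<close> to \<open>H + R v\<close> amounts to choosing an image \<open>w\<close> of \<open>v\<close>
 that satisfies the relations between \<open>v\<close> and \<open>H\<close>.\<close>

lemma hom_extend_cyclic:
 assumes M: "left_module R M" and N: "left_module R N"
  and H: "submodule H R M" and K: "submodule K R M" and HK: "H \<subseteq> K" and v: "v \<in> K"
  and gen: "\<And>x. x \<in> K ==> \<exists>d\<in>carrier R. \<exists>h\<in>H. x = h \<oplus>\<^sub>M d \<odot>\<^sub>M v"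
  and g: "g \<in> lmod_hom R (res M H) N" and w: "w \<in> carrier N"
  and rel: "\<And>d. d \<in> carrier R ==> d \<odot>\<^sub>M v \<in> H ==> g (d \<odot>\<^sub>M v) = d \<odot>\<^sub>N w"
 obtains G where "G \<in> lmod_hom R (res M K) N"
  and "\<And>h d. h \<in> H ==> d \<in> carrier R ==> G (h \<oplus>\<^sub>M d \<odot>\<^sub>M v) = g h \<oplus>\<^sub>N d \<odot>\<^sub>N w"
proof -
 interpret M: lmod R M by (rule lmod.intro) fact
 interpret N: lmod R N by (rule lmod.intro) fact
 note HD = M.submoduleD[OF H] and KD = M.submoduleD[OF K]
 have gD: "\<And>x. x \<in> H ==> g x \<in> carrier N" "\<And>x y. x \<in> H ==> y \<in> H ==> g (x \<oplus>\<^sub>M y) = g x \<oplus>\<^sub>N g y"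
  "\<And>a x. a \<in> carrier R ==> x \<in> H ==> g (a \<odot>\<^sub>M x) = a \<odot>\<^sub>N g x"
  using lmod_homD[OF g] by auto
 have vM: "v \<in> carrier M" using v KD by blast
 have wd: "g h \<oplus>\<^sub>N d \<odot>\<^sub>N w = g h' \<oplus>\<^sub>N d' \<odot>\<^sub>N w"
  if a: "h \<in> H" "h' \<in> H" "d \<in> carrier R" "d' \<in> carrier R"
   and e: "h \<oplus>\<^sub>M d \<odot>\<^sub>M v = h' \<oplus>\<^sub>M d' \<odot>\<^sub>M v" for h h' d d'
 proof -
  let ?d = "d \<ominus>\<^sub>R d'"
  have dR: "?d \<in> carrier R" using a by simp
  have "?d \<oplus>\<^sub>R d' = d" using a by (simp add: a_minus_def M.R.a_assoc M.R.l_neg)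
  then have dd: "d = d' \<oplus>\<^sub>R ?d" using a dR M.R.a_comm by metis
  have sp: "d \<odot>\<^sub>M v = d' \<odot>\<^sub>M v \<oplus>\<^sub>M ?d \<odot>\<^sub>M v" "d \<odot>\<^sub>N w = d' \<odot>\<^sub>N w \<oplus>\<^sub>N ?d \<odot>\<^sub>N w"
   using M.smult_l_distr[OF a(4) dR vM] N.smult_l_distr[OF a(4) dR w] dd by auto
  have c: "h \<in> carrier M" "h' \<in> carrier M" "d' \<odot>\<^sub>M v \<in> carrier M" "?d \<odot>\<^sub>M v \<in> carrier M"
   using a HD dR vM M.smult_closed by auto
  have "(h \<oplus>\<^sub>M ?d \<odot>\<^sub>M v) \<oplus>\<^sub>M d' \<odot>\<^sub>M v = h' \<oplus>\<^sub>M d' \<odot>\<^sub>M v"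
   using e c unfolding sp by (simp add: M.M.a_ac)
  then have hh: "h \<oplus>\<^sub>M ?d \<odot>\<^sub>M v = h'" using c by simp
  then have dv: "?d \<odot>\<^sub>M v = h' \<ominus>\<^sub>M h" using M.add_diff_cancel[OF c(1,4)] by simp
  have dH: "?d \<odot>\<^sub>M v \<in> H" unfolding dv by (rule HD(6)[OF a(2,1)])
  have "g h' = g h \<oplus>\<^sub>N ?d \<odot>\<^sub>N w" using gD(2)[OF a(1) dH] rel[OF dR dH] hh by simp
  then show ?thesis unfolding sp using gD(1) a dR w N.smult_closed by (simp add: N.M.a_ac)
 qed
 define D where "D x = (SOME p. fst p \<in> carrier R \<and> snd p \<in> H \<and> x = snd p \<oplus>\<^sub>M fst p \<odot>\<^sub>M v)" for x
 have D: "fst (D x) \<in> carrier R \<and> snd (D x) \<in> H \<and> x = snd (D x) \<oplus>\<^sub>M fst (D x) \<odot>\<^sub>M v" if "x \<in> K" for x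
  unfolding D_def
 proof (rule someI_ex)
  from gen[OF that] obtain h d where "d \<in> carrier R" "h \<in> H" "x = h \<oplus>\<^sub>M d \<odot>\<^sub>M v" by blast
  then show "\<exists>p. fst p \<in> carrier R \<and> snd p \<in> H \<and> x = snd p \<oplus>\<^sub>M fst p \<odot>\<^sub>M v"
   by (intro exI[of _ "(d, h)"]) simp
 qed
 define G0 where "G0 x = g (snd (D x)) \<oplus>\<^sub>N fst (D x) \<odot>\<^sub>N w" for x
 have inK: "h \<oplus>\<^sub>M d \<odot>\<^sub>M v \<in> K" if "h \<in> H" "d \<in> carrier R" for h d
  by (rule KD(4)[OF subsetD[OF HK that(1)] KD(7)[OF that(2) v]])
 have G0: "G0 (h \<oplus>\<^sub>M d \<odot>\<^sub>M v) = g h \<oplus>\<^sub>N d \<odot>\<^sub>N w" if "h \<in> H" "d \<in> carrier R" for h d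
 proof -
  note DD = D[OF inK[OF that]]
  show ?thesis unfolding G0_def
   by (rule wd) (use DD that in simp_all)
 qed
 have cl: "G0 x \<in> carrier N" if "x \<in> K" for x
 proof -
  from gen[OF that] obtain h d where x: "d \<in> carrier R" "h \<in> H" "x = h \<oplus>\<^sub>M d \<odot>\<^sub>M v" by blast
  show ?thesis unfolding x(3) G0[OF x(2,1)]
   by (rule N.M.a_closed[OF gD(1)[OF x(2)] N.smult_closed[OF x(1) w]])
 qed
 have sm: "G0 (a \<odot>\<^sub>M x) = a \<odot>\<^sub>N G0 x" if "x \<in> K" "a \<in> carrier R" for a x
 proof -
  note a = that(2)
  from gen[OF that(1)] obtain h d where x: "d \<in> carrier R" "h \<in> H" "x = h \<oplus>\<^sub>M d \<odot>\<^sub>M v" by blast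
  have "a \<odot>\<^sub>M x = a \<odot>\<^sub>M h \<oplus>\<^sub>M (a \<otimes>\<^sub>R d) \<odot>\<^sub>M v"
   unfolding x(3) M.smult_assoc[OF a x(1) vM]
   by (rule M.smult_r_distr[OF a HD(3)[OF x(2)] M.smult_closed[OF x(1) vM]])
  then have "G0 (a \<odot>\<^sub>M x) = g (a \<odot>\<^sub>M h) \<oplus>\<^sub>N (a \<otimes>\<^sub>R d) \<odot>\<^sub>N w"
   using G0[OF HD(7)[OF a x(2)] M.R.m_closed[OF a x(1)]] by simp
  also have "\<dots> = a \<odot>\<^sub>N (g h \<oplus>\<^sub>N d \<odot>\<^sub>N w)"
   unfolding N.smult_assoc[OF a x(1) w] gD(3)[OF a x(2)]
   by (rule N.smult_r_distr[OF a gD(1)[OF x(2)] N.smult_closed[OF x(1) w], symmetric])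
  also have "\<dots> = a \<odot>\<^sub>N G0 x" unfolding x(3) G0[OF x(2,1)] ..
  finally show ?thesis .
 qed
 have ad: "G0 (x \<oplus>\<^sub>M y) = G0 x \<oplus>\<^sub>N G0 y" if "x \<in> K" "y \<in> K" for x y
 proof -
  from gen[OF that(1)] obtain h d where x: "h \<in> H" "d \<in> carrier R" "x = h \<oplus>\<^sub>M d \<odot>\<^sub>M v" by blast
  from gen[OF that(2)] obtain h' d' where y: "h' \<in> H" "d' \<in> carrier R" "y = h' \<oplus>\<^sub>M d' \<odot>\<^sub>M v" by blast
  have e: "x \<oplus>\<^sub>M y = (h \<oplus>\<^sub>M h') \<oplus>\<^sub>M (d \<oplus>\<^sub>R d') \<odot>\<^sub>M v"
   unfolding x(3) y(3) M.smult_l_distr[OF x(2) y(2) vM]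
   by (rule M.add_add_swap[OF HD(3)[OF x(1)] M.smult_closed[OF x(2) vM] HD(3)[OF y(1)] M.smult_closed[OF y(2) vM]])
  have "G0 (x \<oplus>\<^sub>M y) = g (h \<oplus>\<^sub>M h') \<oplus>\<^sub>N (d \<oplus>\<^sub>R d') \<odot>\<^sub>N w"
   unfolding e by (rule G0[OF HD(4)[OF x(1) y(1)] M.R.a_closed[OF x(2) y(2)]])
  also have "\<dots> = (g h \<oplus>\<^sub>N d \<odot>\<^sub>N w) \<oplus>\<^sub>N (g h' \<oplus>\<^sub>N d' \<odot>\<^sub>N w)"
   unfolding N.smult_l_distr[OF x(2) y(2) w] gD(2)[OF x(1) y(1)]
   by (rule N.add_add_swap[OF gD(1)[OF x(1)] N.smult_closed[OF x(2) w] gD(1)[OF y(1)] N.smult_closed[OF y(2) w], symmetric])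
  also have "\<dots> = G0 x \<oplus>\<^sub>N G0 y" unfolding x(3) y(3) G0[OF x(1,2)] G0[OF y(1,2)] ..
  finally show ?thesis .
 qed
 show thesis
 proof (rule that)
  show "(\<lambda>x\<in>carrier (res M K). G0 x) \<in> lmod_hom R (res M K) N"
   by (rule lmod_homI[OF _ _ _ M.left_module_restrict[OF K]]) (simp_all add: cl ad sm)
  show "(\<lambda>x\<in>carrier (res M K). G0 x) (h \<oplus>\<^sub>M d \<odot>\<^sub>M v) = g h \<oplus>\<^sub>N d \<odot>\<^sub>N w"
   if "h \<in> H" "d \<in> carrier R" for h d
   using G0[OF that] inK[OF that] by simp
 qed
qed

section \<open>Complex algebras\<close>

locale calg = ring A for A :: "(complex, 'a) module" (structure) +
 assumes cs_closed: "x \<in> carrier A ==> c \<odot>\<^sub>A x \<in> carrier A"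
  and cs_ladd: "x \<in> carrier A ==> (c + d) \<odot>\<^sub>A x = c \<odot>\<^sub>A x \<oplus>\<^sub>A d \<odot>\<^sub>A x"
  and cs_radd: "x \<in> carrier A ==> y \<in> carrier A ==> c \<odot>\<^sub>A (x \<oplus>\<^sub>A y) = c \<odot>\<^sub>A x \<oplus>\<^sub>A c \<odot>\<^sub>A y"
  and cs_assoc: "x \<in> carrier A ==> (c * d) \<odot>\<^sub>A x = c \<odot>\<^sub>A (d \<odot>\<^sub>A x)"
  and cs_one: "x \<in> carrier A ==> 1 \<odot>\<^sub>A x = x"
  and cs_lmult: "x \<in> carrier A ==> y \<in> carrier A ==> (c \<odot>\<^sub>A x) \<otimes>\<^sub>A y = c \<odot>\<^sub>A (x \<otimes>\<^sub>A y)"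
  and cs_rmult: "x \<in> carrier A ==> y \<in> carrier A ==> x \<otimes>\<^sub>A (c \<odot>\<^sub>A y) = c \<odot>\<^sub>A (x \<otimes>\<^sub>A y)"
begin

lemma cs_one_mult: "x \<in> carrier A ==> (c \<odot>\<^sub>A \<one>\<^sub>A) \<otimes>\<^sub>A x = c \<odot>\<^sub>A x"
 by (simp add: cs_lmult)

lemma cs_mult_one: "x \<in> carrier A ==> x \<otimes>\<^sub>A (c \<odot>\<^sub>A \<one>\<^sub>A) = c \<odot>\<^sub>A x"
 by (simp add: cs_rmult)

lemma cs_zero: "c \<odot>\<^sub>A \<zero>\<^sub>A = \<zero>\<^sub>A"
 using cs_mult_one[of "\<zero>\<^sub>A" c] cs_closed[of "\<one>\<^sub>A" c] by simp

end

lemma quotient_algebra_simps: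
 "carrier (quotient_algebra A I) = a_rcosets\<^bsub>A\<^esub> I"
 "mult (quotient_algebra A I) = rcoset_mult A I"
 "one (quotient_algebra A I) = I +>\<^sub>A \<one>\<^sub>A"
 "zero (quotient_algebra A I) = I"
 "add (quotient_algebra A I) = set_add A"
 "smult (quotient_algebra A I) = (\<lambda>c X. \<Union>x\<in>X. I +>\<^sub>A (c \<odot>\<^sub>A x))"
 by (simp_all add: quotient_algebra_def ring.defs module.defs FactRing_def)

locale calg_quotient = calg A + I?: ideal I A for A :: "(complex, 'a) module" (structure) and I
begin

abbreviation "Q \<equiv> quotient_algebra A I"

lemma Q_carrier: "carrier Q = (\<lambda>x. I +>\<^sub>A x) ` carrier A"
 by (auto simp: quotient_algebra_simps A_RCOSETS_def')

lemma Q_closed: "x \<in> carrier A ==> I +>\<^sub>A x \<in> carrier Q"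
 unfolding Q_carrier by (rule imageI)

lemma Q_cases:
 assumes "X \<in> carrier Q"
 obtains x where "x \<in> carrier A" "X = I +>\<^sub>A x"
 using assms unfolding Q_carrier by (elim imageE) simp

lemma Q_add: "x \<in> carrier A ==> y \<in> carrier A ==> (I +>\<^sub>A x) \<oplus>\<^sub>Q (I +>\<^sub>A y) = I +>\<^sub>A (x \<oplus>\<^sub>A y)"
 unfolding quotient_algebra_simps by (rule I.a_rcos_sum)

lemma Q_mult: "x \<in> carrier A ==> y \<in> carrier A ==> (I +>\<^sub>A x) \<otimes>\<^sub>Q (I +>\<^sub>A y) = I +>\<^sub>A (x \<otimes>\<^sub>A y)"
 unfolding quotient_algebra_simps by (rule I.rcoset_mult_add)

lemma coset_eqI: "x \<in> carrier A ==> y \<in> carrier A ==> x \<ominus>\<^sub>A y \<in> I ==> I +>\<^sub>A x = I +>\<^sub>A y"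
 using quotient_eq_iff_same_a_r_cos[OF I.is_ideal] by simp

lemma coset_eqD: "x \<in> carrier A ==> y \<in> carrier A ==> I +>\<^sub>A x = I +>\<^sub>A y ==> x \<ominus>\<^sub>A y \<in> I"
 using quotient_eq_iff_same_a_r_cos[OF I.is_ideal] by simp

lemma Q_smult:
 assumes x: "x \<in> carrier A"
 shows "c \<odot>\<^sub>Q (I +>\<^sub>A x) = I +>\<^sub>A (c \<odot>\<^sub>A x)"
proof -
 let ?c = "c \<odot>\<^sub>A \<one>\<^sub>A"
 have c: "?c \<in> carrier A" by (simp add: cs_closed)
 have "I +>\<^sub>A (c \<odot>\<^sub>A y) = I +>\<^sub>A (c \<odot>\<^sub>A x)" if y: "y \<in> I +>\<^sub>A x" for y
 proof -
  have yA: "y \<in> carrier A" using I.a_elemrcos_carrier x y by blast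
  have e: "I +>\<^sub>A x = I +>\<^sub>A y" using I.a_repr_independence' y x by blast
  have "I +>\<^sub>A (?c \<otimes>\<^sub>A y) = I +>\<^sub>A (?c \<otimes>\<^sub>A x)"
   unfolding Q_mult[OF c yA, symmetric] Q_mult[OF c x, symmetric] e ..
  then show ?thesis using cs_one_mult x yA by simp
 qed
 then have "(\<Union>y\<in>I +>\<^sub>A x. I +>\<^sub>A (c \<odot>\<^sub>A y)) = (\<Union>y\<in>I +>\<^sub>A x. I +>\<^sub>A (c \<odot>\<^sub>A x))"
  by (intro SUP_cong refl) simp
 also have "\<dots> = I +>\<^sub>A (c \<odot>\<^sub>A x)" using I.a_rcos_self[OF x] by (metis SUP_const empty_iff)
 finally show ?thesis unfolding quotient_algebra_simps .
qed

lemma Q_zero: "\<zero>\<^sub>Q = I +>\<^sub>A \<zero>\<^sub>A"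
 using I.a_subset by (simp add: quotient_algebra_simps)

lemma Q_one: "\<one>\<^sub>Q = I +>\<^sub>A \<one>\<^sub>A"
 by (simp add: quotient_algebra_simps)

lemma Q_ring: "ring Q"
proof -
 have "ring (A Quot I)" by (rule I.quotient_is_ring)
 then interpret F: ring "A Quot I" .
 have c: "carrier Q = carrier (A Quot I)" "mult Q = mult (A Quot I)" "add Q = add (A Quot I)"
  "one Q = one (A Quot I)" "zero Q = zero (A Quot I)"
  by (simp_all add: quotient_algebra_simps FactRing_def)
 show ?thesis
 proof (rule ringI)
  show "abelian_group Q"
  proof (rule abelian_groupI)
   fix x assume "x \<in> carrier Q"
   then have "\<ominus>\<^bsub>A Quot I\<^esub> x \<in> carrier Q \<and> (\<ominus>\<^bsub>A Quot I\<^esub> x) \<oplus>\<^sub>Q x = \<zero>\<^sub>Q"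
    unfolding c by (simp add: F.l_neg)
   then show "\<exists>y\<in>carrier Q. y \<oplus>\<^sub>Q x = \<zero>\<^sub>Q" by blast
  qed (unfold c, simp_all add: F.a_assoc, simp add: F.a_comm)
  show "monoid Q" by (rule monoidI) (unfold c, simp_all add: F.m_assoc)
 qed (unfold c, simp_all add: F.l_distr F.r_distr)
qed

lemma Q_calg: "calg Q"
proof (intro calg.intro calg_axioms.intro Q_ring)
 fix c d :: complex and X Y
 show "X \<in> carrier Q ==> c \<odot>\<^sub>Q X \<in> carrier Q"
  by (elim Q_cases) (simp add: Q_smult cs_closed Q_closed)
 show "X \<in> carrier Q ==> (c + d) \<odot>\<^sub>Q X = c \<odot>\<^sub>Q X \<oplus>\<^sub>Q d \<odot>\<^sub>Q X"
  by (elim Q_cases) (simp add: Q_smult cs_closed cs_ladd Q_add)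
 show "X \<in> carrier Q ==> Y \<in> carrier Q ==> c \<odot>\<^sub>Q (X \<oplus>\<^sub>Q Y) = c \<odot>\<^sub>Q X \<oplus>\<^sub>Q c \<odot>\<^sub>Q Y"
  by (elim Q_cases) (simp add: Q_smult cs_closed cs_radd Q_add)
 show "X \<in> carrier Q ==> (c * d) \<odot>\<^sub>Q X = c \<odot>\<^sub>Q (d \<odot>\<^sub>Q X)"
  by (elim Q_cases) (simp add: Q_smult cs_closed cs_assoc)
 show "X \<in> carrier Q ==> 1 \<odot>\<^sub>Q X = X"
  by (elim Q_cases) (simp add: Q_smult cs_one)
 show "X \<in> carrier Q ==> Y \<in> carrier Q ==> (c \<odot>\<^sub>Q X) \<otimes>\<^sub>Q Y = c \<odot>\<^sub>Q (X \<otimes>\<^sub>Q Y)"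
  by (elim Q_cases) (simp add: Q_smult cs_closed cs_lmult Q_mult)
 show "X \<in> carrier Q ==> Y \<in> carrier Q ==> X \<otimes>\<^sub>Q (c \<odot>\<^sub>Q Y) = c \<odot>\<^sub>Q (X \<otimes>\<^sub>Q Y)"
  by (elim Q_cases) (simp add: Q_smult cs_closed cs_rmult Q_mult)
qed

lemma Q_proj_hom: "(\<lambda>x. I +>\<^sub>A x) \<in> ring_hom A Q"
 by (rule ring_hom_memI) (simp_all add: Q_closed Q_mult Q_add Q_one)

end

section \<open>Path algebras\<close>

definition psrc :: "('v, 'e) path => 'v" where "psrc p = fst p"

definition ptgt :: "('v, 'e) path => 'v" where "ptgt p = snd (snd p)"

definition pjoin :: "('v, 'e) path => ('v, 'e) path => ('v, 'e) path"
 where "pjoin q p = (fst p, fst (snd p) @ fst (snd q), snd (snd q))"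

lemma path_simps [simp]:
 "psrc (u, w, v) = u" "ptgt (u, w, v) = v" "pjoin (u', w', v') (u, w, v) = (u, w @ w', v')"
 "psrc (pjoin q p) = psrc p" "ptgt (pjoin q p) = ptgt q"
 by (simp_all add: psrc_def ptgt_def pjoin_def)

lemma path_mult_eq: "path_mult q p = (if ptgt p = psrc q then path_elem (pjoin q p) else (\<lambda>_. 0))"
 by (cases q, cases p) simp

lemma pjoin_assoc: "pjoin (pjoin r q) p = pjoin r (pjoin q p)"
 by (simp add: pjoin_def)

text \<open>The linear functional on the path algebra that takes the values \<open>F p\<close> on the paths \<open>p\<close>.\<close>

definition lsum :: "('p => complex) => ('p => complex) => complex"
 where "lsum f F = (\<Sum>p | f p \<noteq> 0. f p * F p)"

lemma lsum_superset:
 assumes "finite S" "{p. f p \<noteq> 0} \<subseteq> S"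
 shows "lsum f F = (\<Sum>p\<in>S. f p * F p)"
 unfolding lsum_def by (rule sum.mono_neutral_left) (use assms in auto)

lemma lsum_cong: "(\<And>p. f p \<noteq> 0 ==> F p = G p) ==> lsum f F = lsum f G"
 unfolding lsum_def by (rule sum.cong) auto

lemma lsum_zero: "lsum f (\<lambda>_. 0) = 0"
 by (simp add: lsum_def)

lemma lsum_path_elem: "lsum (path_elem q) F = F q"
proof -
 have "{p. path_elem q p \<noteq> 0} = {q}" by (auto simp: path_elem_def)
 then show ?thesis by (simp add: lsum_def path_elem_def)
qed

lemma lsum_single:
 assumes "finite {p. f p \<noteq> 0}" "\<And>p. f p \<noteq> 0 ==> F p \<noteq> 0 ==> p = q"
 shows "lsum f F = f q * F q"
proof -
 have "lsum f F = (\<Sum>p\<in>insert q {p. f p \<noteq> 0}. f p * F p)"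
  by (rule lsum_superset) (use assms in auto)
 also have "\<dots> = (\<Sum>p\<in>{q}. f p * F p)"
  by (rule sum.mono_neutral_right) (use assms in auto)
 finally show ?thesis by simp
qed

lemma lsum_add:
 assumes "finite {p. f p \<noteq> 0}" "finite {p. g p \<noteq> 0}"
 shows "lsum (\<lambda>p. f p + g p) F = lsum f F + lsum g F"
proof -
 let ?S = "{p. f p \<noteq> 0} \<union> {p. g p \<noteq> 0}"
 have "lsum f F = (\<Sum>p\<in>?S. f p * F p)" "lsum g F = (\<Sum>p\<in>?S. g p * F p)"
  "lsum (\<lambda>p. f p + g p) F = (\<Sum>p\<in>?S. (f p + g p) * F p)"
  by (rule lsum_superset; use assms in auto)+
 then show ?thesis by (simp add: distrib_right sum.distrib)
qed

lemma lsum_scale: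
 assumes "finite {p. f p \<noteq> 0}"
 shows "lsum (\<lambda>p. c * f p) F = c * lsum f F"
proof -
 have "lsum (\<lambda>p. c * f p) F = (\<Sum>p\<in>{p. f p \<noteq> 0}. (c * f p) * F p)"
  by (rule lsum_superset) (use assms in auto)
 then show ?thesis by (simp add: lsum_def sum_distrib_left mult.assoc)
qed

lemma lsum_swap: "lsum f (\<lambda>q. lsum g (\<lambda>p. F q p)) = lsum g (\<lambda>p. lsum f (\<lambda>q. F q p))"
proof -
 have "lsum f (\<lambda>q. lsum g (\<lambda>p. F q p)) = (\<Sum>q | f q \<noteq> 0. \<Sum>p | g p \<noteq> 0. f q * (g p * F q p))"
  by (simp add: lsum_def sum_distrib_left)
 also have "\<dots> = (\<Sum>p | g p \<noteq> 0. \<Sum>q | f q \<noteq> 0. f q * (g p * F q p))" by (rule sum.swap)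
 also have "\<dots> = lsum g (\<lambda>p. lsum f (\<lambda>q. F q p))"
  by (simp add: lsum_def sum_distrib_left mult.left_commute)
 finally show ?thesis .
qed

lemma path_algebra_simps:
 "f \<in> carrier (path_algebra G) \<longleftrightarrow> finite {p. f p \<noteq> 0} \<and> {p. f p \<noteq> 0} \<subseteq> paths G"
 "zero (path_algebra G) = (\<lambda>_. 0)"
 "add (path_algebra G) = (\<lambda>f g p. f p + g p)"
 "smult (path_algebra G) = (\<lambda>c f p. c * f p)"
 by (simp_all add: path_algebra_def)

lemma path_algebra_mult:
 "(f \<otimes>\<^bsub>path_algebra G\<^esub> g) r = lsum f (\<lambda>q. lsum g (\<lambda>p. path_mult q p r))"
 by (simp add: path_algebra_def lsum_def sum_distrib_left mult.assoc)

lemma path_mult_support: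
 assumes "(f \<otimes>\<^bsub>path_algebra G\<^esub> g) r \<noteq> 0"
 shows "\<exists>q p. f q \<noteq> 0 \<and> g p \<noteq> 0 \<and> ptgt p = psrc q \<and> r = pjoin q p"
proof (rule ccontr)
 assume a: "\<not> ?thesis"
 have "(f \<otimes>\<^bsub>path_algebra G\<^esub> g) r = lsum f (\<lambda>q. lsum g (\<lambda>p. 0))"
  unfolding path_algebra_mult
 proof (rule lsum_cong, rule lsum_cong)
  fix q p assume "f q \<noteq> 0" "g p \<noteq> 0"
  then have "\<not> (ptgt p = psrc q \<and> r = pjoin q p)" using a by blast
  then show "path_mult q p r = 0" by (auto simp: path_mult_eq path_elem_def)
 qed
 then show False using assms by (simp add: lsum_zero)
qed

lemma mult_support_subset:
 "{r. (f \<otimes>\<^bsub>path_algebra G\<^esub> g) r \<noteq> 0}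
  \<subseteq> (\<lambda>(q, p). pjoin q p) ` ({p. f p \<noteq> 0} \<times> {p. g p \<noteq> 0})"
proof
 fix r assume "r \<in> {r. (f \<otimes>\<^bsub>path_algebra G\<^esub> g) r \<noteq> 0}"
 then have "(f \<otimes>\<^bsub>path_algebra G\<^esub> g) r \<noteq> 0" by simp
 from path_mult_support[OF this] obtain q p where "f q \<noteq> 0" "g p \<noteq> 0" "r = pjoin q p" by blast
 then show "r \<in> (\<lambda>(q, p). pjoin q p) ` ({p. f p \<noteq> 0} \<times> {p. g p \<noteq> 0})"
  by (intro image_eqI[of _ _ "(q, p)"]) simp_all
qed

lemma finite_mult_support:
 assumes "finite {p. f p \<noteq> 0}" "finite {p. g p \<noteq> 0}"
 shows "finite {r. (f \<otimes>\<^bsub>path_algebra G\<^esub> g) r \<noteq> 0}"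
 by (rule finite_subset[OF mult_support_subset]) (use assms in simp)

lemma lsum_mult:
 assumes "finite {p. f p \<noteq> 0}" "finite {p. g p \<noteq> 0}"
 shows "lsum (f \<otimes>\<^bsub>path_algebra G\<^esub> g) F
  = lsum f (\<lambda>q. lsum g (\<lambda>p. if ptgt p = psrc q then F (pjoin q p) else 0))"
proof -
 let ?A = "{p. f p \<noteq> 0}" and ?B = "{p. g p \<noteq> 0}"
 let ?R = "(\<lambda>(q, p). pjoin q p) ` (?A \<times> ?B)"
 have fin: "finite ?R" using assms by simp
 have "lsum (f \<otimes>\<^bsub>path_algebra G\<^esub> g) F = (\<Sum>r\<in>?R. (f \<otimes>\<^bsub>path_algebra G\<^esub> g) r * F r)"
  by (rule lsum_superset[OF fin mult_support_subset])
 also have "\<dots> = (\<Sum>r\<in>?R. \<Sum>q\<in>?A. \<Sum>p\<in>?B. f q * (g p * (path_mult q p r * F r)))"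
  by (simp add: path_algebra_mult lsum_def sum_distrib_left sum_distrib_right mult.assoc)
 also have "\<dots> = (\<Sum>q\<in>?A. \<Sum>r\<in>?R. \<Sum>p\<in>?B. f q * (g p * (path_mult q p r * F r)))" by (rule sum.swap)
 also have "\<dots> = (\<Sum>q\<in>?A. \<Sum>p\<in>?B. \<Sum>r\<in>?R. f q * (g p * (path_mult q p r * F r)))"
  by (rule sum.cong[OF refl], rule sum.swap)
 also have "\<dots> = (\<Sum>q\<in>?A. \<Sum>p\<in>?B. f q * (g p * (if ptgt p = psrc q then F (pjoin q p) else 0)))"
 proof (rule sum.cong[OF refl], rule sum.cong[OF refl])
  fix q p assume qp: "q \<in> ?A" "p \<in> ?B"
  then have R: "pjoin q p \<in> ?R" by (intro image_eqI[of _ _ "(q, p)"]) auto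
  have "(\<Sum>r\<in>?R. path_mult q p r * F r) = (if ptgt p = psrc q then F (pjoin q p) else 0)"
  proof (cases "ptgt p = psrc q")
   case True
   have "(\<Sum>r\<in>?R. path_mult q p r * F r) = (\<Sum>r\<in>?R. if r = pjoin q p then F r else 0)"
    by (rule sum.cong[OF refl]) (simp add: path_mult_eq path_elem_def True)
   then show ?thesis using fin R True by simp
  qed (simp add: path_mult_eq)
  then show "(\<Sum>r\<in>?R. f q * (g p * (path_mult q p r * F r)))
    = f q * (g p * (if ptgt p = psrc q then F (pjoin q p) else 0))"
   unfolding sum_distrib_left[symmetric] by simp
 qed
 also have "\<dots> = lsum f (\<lambda>q. lsum g (\<lambda>p. if ptgt p = psrc q then F (pjoin q p) else 0))"
  by (simp add: lsum_def sum_distrib_left)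
 finally show ?thesis .
qed

lemma cas_append:
 "pre_digraph.cas G u p v ==> pre_digraph.cas G v q w ==> pre_digraph.cas G u (p @ q) w"
 by (induction p arbitrary: u) (simp_all add: pre_digraph.cas.simps)

lemma pjoin_in_paths:
 assumes q: "q \<in> paths G" and p: "p \<in> paths G" and pq: "ptgt p = psrc q"
 shows "pjoin q p \<in> paths G"
proof -
 obtain u w v u' w' v' where e: "p = (u, w, v)" "q = (u', w', v')" by (cases p, cases q)
 have a: "u \<in> verts G" "set w \<subseteq> arcs G" "pre_digraph.cas G u w v"
  "set w' \<subseteq> arcs G" "pre_digraph.cas G v w' v'"
  using q p pq unfolding e by (simp_all add: paths_def pre_digraph.awalk_def)
 have "set (w @ w') \<subseteq> arcs G" using a(2,4) by (simp only: set_append Un_subset_iff)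
 then show ?thesis
  using a(1) cas_append[OF a(3,5)] unfolding e by (simp add: paths_def pre_digraph.awalk_def)
qed

lemma path_elem_mult:
 "path_elem q \<otimes>\<^bsub>path_algebra G\<^esub> path_elem p = path_mult q p"
 by (rule ext) (simp add: path_algebra_mult lsum_path_elem)

lemma path_elem_closed: "p \<in> paths G ==> path_elem p \<in> carrier (path_algebra G)"
 by (auto simp: path_algebra_simps path_elem_def)

lemma path_algebra_calg:
 fixes G :: "('v, 'e) pre_digraph"
 assumes "wf_digraph G" "finite (verts G)"
 shows "calg (path_algebra G)"
proof -
 let ?P = "path_algebra G"
 interpret wf_digraph G by fact
 have fin: "finite {p. f p \<noteq> 0}" if "f \<in> carrier ?P" for f using that by (simp add: path_algebra_simps)
 have pth: "p \<in> paths G" if "f \<in> carrier ?P" "f p \<noteq> 0" for f p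
  using that by (auto simp: path_algebra_simps)
 have add_c: "f \<oplus>\<^sub>?P g \<in> carrier ?P" if "f \<in> carrier ?P" "g \<in> carrier ?P" for f g
 proof -
  have "{p. f p + g p \<noteq> 0} \<subseteq> {p. f p \<noteq> 0} \<union> {p. g p \<noteq> 0}" by auto
  then show ?thesis using that by (auto simp: path_algebra_simps intro: finite_subset)
 qed
 have sc: "c \<odot>\<^sub>?P f \<in> carrier ?P" if "f \<in> carrier ?P" for c f
 proof -
  have "{p. c * f p \<noteq> 0} \<subseteq> {p. f p \<noteq> 0}" by auto
  then show ?thesis using that by (auto simp: path_algebra_simps intro: finite_subset)
 qed
 have mult_c: "f \<otimes>\<^sub>?P g \<in> carrier ?P" if "f \<in> carrier ?P" "g \<in> carrier ?P" for f g
 proof -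
  have "r \<in> paths G" if "(f \<otimes>\<^sub>?P g) r \<noteq> 0" for r
   using path_mult_support[OF that] pth \<open>f \<in> carrier ?P\<close> \<open>g \<in> carrier ?P\<close> pjoin_in_paths by metis
  then show ?thesis using finite_mult_support[OF fin[OF that(1)] fin[OF that(2)]]
   by (auto simp: path_algebra_simps)
 qed
 have one_eq: "\<one>\<^sub>?P = (\<lambda>p. if p \<in> (\<lambda>v. (v, [], v)) ` verts G then 1 else 0)"
  by (rule ext) (auto simp: path_algebra_def)
 have one_supp: "{p. \<one>\<^sub>?P p \<noteq> 0} = (\<lambda>v. (v, [], v)) ` verts G" by (auto simp: one_eq)
 have one_c: "\<one>\<^sub>?P \<in> carrier ?P"
  using assms(2) unfolding path_algebra_simps one_supp by (auto simp: paths_def awalk_Nil_iff)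
 have lone: "lsum \<one>\<^sub>?P F = (\<Sum>v\<in>verts G. F (v, [], v))" for F
  unfolding lsum_def one_supp by (subst sum.reindex) (auto simp: inj_on_def one_eq)
 have ends: "psrc p \<in> verts G" "ptgt p \<in> verts G" if "p \<in> paths G" for p
 proof -
  obtain u w v where p: "p = (u, w, v)" by (cases p)
  then have w: "awalk u w v" using that by (simp add: paths_def)
  show "psrc p \<in> verts G" "ptgt p \<in> verts G"
   unfolding p path_simps by (rule awalk_hd_in_verts[OF w], rule awalk_last_in_verts[OF w])
 qed
 have delta: "lsum f (\<lambda>p. if p = r then 1 else 0) = f r" if "f \<in> carrier ?P" for f r
  by (subst lsum_single[OF fin[OF that], of _ r]) (auto split: if_splits)
 have l_one: "\<one>\<^sub>?P \<otimes>\<^sub>?P f = f" if f: "f \<in> carrier ?P" for f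
 proof
  fix r
  have "(\<one>\<^sub>?P \<otimes>\<^sub>?P f) r = lsum f (\<lambda>p. lsum \<one>\<^sub>?P (\<lambda>q. path_mult q p r))"
   unfolding path_algebra_mult by (rule lsum_swap)
  also have "\<dots> = lsum f (\<lambda>p. if p = r then 1 else 0)"
  proof (rule lsum_cong)
   fix p assume "f p \<noteq> 0"
   then have v: "ptgt p \<in> verts G" using ends pth f by blast
   obtain u w x where p: "p = (u, w, x)" by (cases p)
   have "lsum \<one>\<^sub>?P (\<lambda>q. path_mult q p r) = (\<Sum>v\<in>verts G. if v = x then path_elem p r else 0)"
    unfolding lone by (rule sum.cong) (auto simp: p)
   then show "lsum \<one>\<^sub>?P (\<lambda>q. path_mult q p r) = (if p = r then 1 else 0)"
    using v assms(2) by (auto simp: p path_elem_def)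
  qed
  finally show "(\<one>\<^sub>?P \<otimes>\<^sub>?P f) r = f r" using delta[OF f] by simp
 qed
 have r_one: "f \<otimes>\<^sub>?P \<one>\<^sub>?P = f" if f: "f \<in> carrier ?P" for f
 proof
  fix r
  have "(f \<otimes>\<^sub>?P \<one>\<^sub>?P) r = lsum f (\<lambda>p. if p = r then 1 else 0)"
   unfolding path_algebra_mult
  proof (rule lsum_cong)
   fix p assume "f p \<noteq> 0"
   then have v: "psrc p \<in> verts G" using ends pth f by blast
   obtain u w x where p: "p = (u, w, x)" by (cases p)
   have "lsum \<one>\<^sub>?P (\<lambda>q. path_mult p q r) = (\<Sum>v\<in>verts G. if v = u then path_elem p r else 0)"
    unfolding lone by (rule sum.cong) (auto simp: p)
   then show "lsum \<one>\<^sub>?P (\<lambda>q. path_mult p q r) = (if p = r then 1 else 0)"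
    using v assms(2) by (auto simp: p path_elem_def)
  qed
  then show "(f \<otimes>\<^sub>?P \<one>\<^sub>?P) r = f r" using delta[OF f] by simp
 qed
 have assoc: "(f \<otimes>\<^sub>?P g) \<otimes>\<^sub>?P h = f \<otimes>\<^sub>?P (g \<otimes>\<^sub>?P h)"
  if c: "f \<in> carrier ?P" "g \<in> carrier ?P" "h \<in> carrier ?P" for f g h
 proof
  fix r
  have "((f \<otimes>\<^sub>?P g) \<otimes>\<^sub>?P h) r
    = lsum f (\<lambda>a. lsum g (\<lambda>b. if ptgt b = psrc a then lsum h (\<lambda>d. path_mult (pjoin a b) d r) else 0))"
   unfolding path_algebra_mult[of G "f \<otimes>\<^sub>?P g" h] lsum_mult[OF fin[OF c(1)] fin[OF c(2)]] ..
  also have "\<dots> = lsum f (\<lambda>a. lsum g (\<lambda>b. lsum h (\<lambda>d. if ptgt d = psrc b then path_mult a (pjoin b d) r else 0)))"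
  proof (rule lsum_cong, rule lsum_cong)
   fix a b :: "('v, 'e) path"
   show "(if ptgt b = psrc a then lsum h (\<lambda>d. path_mult (pjoin a b) d r) else 0)
     = lsum h (\<lambda>d. if ptgt d = psrc b then path_mult a (pjoin b d) r else 0)"
   proof (cases "ptgt b = psrc a")
    case True
    then show ?thesis by (auto simp: path_mult_eq pjoin_assoc intro!: lsum_cong)
   next
    case False
    then have "lsum h (\<lambda>d. if ptgt d = psrc b then path_mult a (pjoin b d) r else 0) = lsum h (\<lambda>_. 0)"
     by (intro lsum_cong) (simp add: path_mult_eq)
    then show ?thesis using False by (simp add: lsum_zero)
   qed
  qed
  also have "\<dots> = lsum f (\<lambda>a. lsum (g \<otimes>\<^sub>?P h) (\<lambda>x. path_mult a x r))"
   unfolding lsum_mult[OF fin[OF c(2)] fin[OF c(3)]] ..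
  also have "\<dots> = (f \<otimes>\<^sub>?P (g \<otimes>\<^sub>?P h)) r" by (simp only: path_algebra_mult)
  finally show "((f \<otimes>\<^sub>?P g) \<otimes>\<^sub>?P h) r = (f \<otimes>\<^sub>?P (g \<otimes>\<^sub>?P h)) r" .
 qed
 have ld: "(f \<oplus>\<^sub>?P g) \<otimes>\<^sub>?P h = f \<otimes>\<^sub>?P h \<oplus>\<^sub>?P g \<otimes>\<^sub>?P h"
  if "f \<in> carrier ?P" "g \<in> carrier ?P" for f g h
  by (rule ext) (simp add: path_algebra_mult path_algebra_simps(3) lsum_add fin that)
 have rd: "h \<otimes>\<^sub>?P (f \<oplus>\<^sub>?P g) = h \<otimes>\<^sub>?P f \<oplus>\<^sub>?P h \<otimes>\<^sub>?P g"
  if "f \<in> carrier ?P" "g \<in> carrier ?P" for f g h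
 proof
  fix r
  show "(h \<otimes>\<^sub>?P (f \<oplus>\<^sub>?P g)) r = (h \<otimes>\<^sub>?P f \<oplus>\<^sub>?P h \<otimes>\<^sub>?P g) r"
   unfolding path_algebra_mult path_algebra_simps(3) lsum_add[OF fin[OF that(1)] fin[OF that(2)]]
   by (simp add: lsum_def distrib_left sum.distrib)
 qed
 have "ring ?P"
 proof (rule ringI)
  show "abelian_group ?P"
  proof (rule abelian_groupI)
   fix f assume f: "f \<in> carrier ?P"
   show "\<exists>y\<in>carrier ?P. y \<oplus>\<^sub>?P f = \<zero>\<^sub>?P"
   proof (rule bexI)
    show "((-1) \<odot>\<^sub>?P f) \<oplus>\<^sub>?P f = \<zero>\<^sub>?P"
     unfolding path_algebra_simps by (rule ext) simp
   qed (rule sc[OF f])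
   show "\<zero>\<^sub>?P \<oplus>\<^sub>?P f = f" unfolding path_algebra_simps by (rule ext) simp
  next
   show "\<zero>\<^sub>?P \<in> carrier ?P" unfolding path_algebra_simps by simp
  next
   fix f g h
   show "f \<oplus>\<^sub>?P g \<oplus>\<^sub>?P h = f \<oplus>\<^sub>?P (g \<oplus>\<^sub>?P h)" "f \<oplus>\<^sub>?P g = g \<oplus>\<^sub>?P f"
    unfolding path_algebra_simps by (rule ext, simp)+
  qed (rule add_c)
  show "monoid ?P" by (rule monoidI) (simp_all add: mult_c one_c l_one r_one assoc)
 qed (simp_all add: ld rd)
 then show ?thesis
 proof (rule calg.intro, intro calg_axioms.intro)
  fix c f g assume "f \<in> carrier ?P" and g: "g \<in> carrier ?P"
  show "(c \<odot>\<^sub>?P f) \<otimes>\<^sub>?P g = c \<odot>\<^sub>?P (f \<otimes>\<^sub>?P g)"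
   by (rule ext) (simp add: path_algebra_mult path_algebra_simps(4) lsum_scale fin \<open>f \<in> carrier ?P\<close>)
  show "f \<otimes>\<^sub>?P (c \<odot>\<^sub>?P g) = c \<odot>\<^sub>?P (f \<otimes>\<^sub>?P g)"
  proof
   fix r
   show "(f \<otimes>\<^sub>?P (c \<odot>\<^sub>?P g)) r = (c \<odot>\<^sub>?P (f \<otimes>\<^sub>?P g)) r"
    unfolding path_algebra_mult path_algebra_simps(4) lsum_scale[OF fin[OF g]]
    by (simp add: lsum_def sum_distrib_left mult.left_commute)
  qed
  fix d
  show "(c + d) \<odot>\<^sub>?P f = c \<odot>\<^sub>?P f \<oplus>\<^sub>?P d \<odot>\<^sub>?P f" "(c * d) \<odot>\<^sub>?P f = c \<odot>\<^sub>?P (d \<odot>\<^sub>?P f)"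
   "1 \<odot>\<^sub>?P f = f" "c \<odot>\<^sub>?P (f \<oplus>\<^sub>?P g) = c \<odot>\<^sub>?P f \<oplus>\<^sub>?P c \<odot>\<^sub>?P g"
   unfolding path_algebra_simps by (rule ext, simp add: distrib_left distrib_right mult.assoc)+
 qed (rule sc)
qed

section \<open>A basis of the algebra \<open>D\<close>\<close>

definition is_b :: "arrow => bool" where "is_b x = (case x of Arr_a _ => False | Arr_b _ => True)"

lemma is_b_simps [simp]: "is_b (Arr_b i)" "\<not> is_b (Arr_a i)"
 by (simp_all add: is_b_def)

text \<open>
 The relations preserve the source, the target, and the number of arrows \<open>b\<close>, and they kill
 exactly the paths for which the sum \<open>pdeg\<close> of the source and of the number of arrows \<open>b\<close>
 reaches \<open>n\<close>. This sum is the highest vertex visited by the equivalent path that first goes up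
 and then down.
\<close>

definition pdeg :: "(nat, arrow) path => nat"
 where "pdeg p = fst p + length (filter is_b (fst (snd p)))"

definition updown :: "nat => nat => nat => (nat, arrow) path"
 where "updown i k m = (i, map Arr_b [Suc i..<Suc m] @ map Arr_a (rev [Suc k..<Suc m]), k)"

lemma aus_quiver_simps [simp]:
 "verts (aus_quiver n) = {0..<n}"
 "arcs (aus_quiver n) = Arr_a ` {1..n-1} \<union> Arr_b ` {1..n-1}"
 "tail (aus_quiver n) (Arr_a i) = i" "tail (aus_quiver n) (Arr_b i) = i - 1"
 "head (aus_quiver n) (Arr_a i) = i - 1" "head (aus_quiver n) (Arr_b i) = i"
 by (simp_all add: aus_quiver_def)

abbreviation aus_cas where "aus_cas n \<equiv> pre_digraph.cas (aus_quiver n)"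

lemma aus_cas_simps [simp]:
 "aus_cas n u [] v \<longleftrightarrow> u = v"
 "aus_cas n u (x # w) v \<longleftrightarrow> tail (aus_quiver n) x = u \<and> aus_cas n (head (aus_quiver n) x) w v"
 by (simp_all add: pre_digraph.cas.simps)

lemma in_paths_iff:
 "(u, w, v) \<in> paths (aus_quiver n) \<longleftrightarrow> u < n \<and> set w \<subseteq> arcs (aus_quiver n) \<and> aus_cas n u w v"
 by (auto simp: paths_def pre_digraph.awalk_def)

lemma aus_quiver_wf: "wf_digraph (aus_quiver n)"
proof
 fix e assume "e \<in> arcs (aus_quiver n)"
 then obtain i where "i \<in> {1..n-1}" "e = Arr_a i \<or> e = Arr_b i" by auto
 then show "tail (aus_quiver n) e \<in> verts (aus_quiver n)" "head (aus_quiver n) e \<in> verts (aus_quiver n)"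
  by auto
qed

lemma cas_count:
 assumes "aus_cas n u w v" "set w \<subseteq> arcs (aus_quiver n)"
 shows "v + length (filter (\<lambda>x. \<not> is_b x) w) = u + length (filter is_b w)"
 using assms
proof (induction w arbitrary: u)
 case (Cons x w)
 have x: "x \<in> arcs (aus_quiver n)" and ws: "set w \<subseteq> arcs (aus_quiver n)" using Cons.prems(2) by simp_all
 have c: "tail (aus_quiver n) x = u" "aus_cas n (head (aus_quiver n) x) w v" using Cons.prems(1) by simp_all
 note IH = Cons.IH[OF c(2) ws]
 from x obtain i where i: "1 \<le> i" "x = Arr_a i \<or> x = Arr_b i" by auto
 from i(2) show ?case
 proof
  assume "x = Arr_a i" then show ?thesis using IH c(1) i(1) by simp
 next
  assume "x = Arr_b i" then show ?thesis using IH c(1) i(1) by simp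
 qed
qed simp

lemma path_bounds:
 assumes "p \<in> paths (aus_quiver n)"
 shows "psrc p \<le> pdeg p" "ptgt p \<le> pdeg p" "psrc p < n" "ptgt p < n"
proof -
 obtain u w v where p: "p = (u, w, v)" by (cases p)
 have w: "u < n" "set w \<subseteq> arcs (aus_quiver n)" "aus_cas n u w v" using assms unfolding p in_paths_iff by simp_all
 show "psrc p \<le> pdeg p" "ptgt p \<le> pdeg p" "psrc p < n"
  using cas_count[OF w(3,2)] w(1) by (simp_all add: p pdeg_def)
 have "pre_digraph.awalk (aus_quiver n) u w v" using assms by (simp add: p paths_def)
 then have "v \<in> verts (aus_quiver n)" by (rule wf_digraph.awalk_last_in_verts[OF aus_quiver_wf])
 then show "ptgt p < n" by (simp add: p)
qed

lemma pdeg_pjoin: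
 "ptgt p = psrc q ==> pdeg (pjoin q p) + psrc q = pdeg p + pdeg q"
 by (cases p, cases q) (simp add: pdeg_def)

lemma pdeg_updown: "i \<le> m ==> pdeg (updown i k m) = m"
 by (simp add: pdeg_def updown_def filter_map comp_def)

lemma updown_ends [simp]: "psrc (updown i k m) = i" "ptgt (updown i k m) = k"
 by (simp_all add: updown_def)

lemma cas_up: "i \<le> m ==> aus_cas n i (map Arr_b [Suc i..<Suc m]) m"
proof (induction "m - i" arbitrary: i)
 case (Suc d)
 then have "i < m" by simp
 then have "[Suc i..<Suc m] = Suc i # [Suc (Suc i)..<Suc m]" by (simp add: upt_conv_Cons)
 then show ?case using Suc.hyps(1)[of "Suc i"] Suc.hyps(2) \<open>i < m\<close> by simp
qed simp

lemma cas_down: "k \<le> m ==> aus_cas n m (map Arr_a (rev [Suc k..<Suc m])) k"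
proof (induction m)
 case (Suc m)
 show ?case
 proof (cases "k = Suc m")
  case False
  then have "k \<le> m" using Suc.prems by simp
  then show ?thesis using Suc.IH by simp
 qed simp
qed simp

lemma updown_in_paths: "i \<le> m ==> k \<le> m ==> m < n ==> updown i k m \<in> paths (aus_quiver n)"
 unfolding updown_def in_paths_iff
 using cas_append[OF cas_up[of i m n] cas_down[of k m n]] by auto

locale auslander =
 fixes n :: nat
 assumes n_gt_1: "n > 1"
begin

abbreviation "PA \<equiv> aus_path_algebra n"
abbreviation "II \<equiv> aus_ideal n"
abbreviation "DD \<equiv> D_alg n"
abbreviation "PP \<equiv> Pi_alg n"
abbreviation "Pth \<equiv> paths (aus_quiver n)"

sublocale PA: calg PA
 by (rule path_algebra_calg[OF aus_quiver_wf]) simp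

lemma PA_fin: "f \<in> carrier PA ==> finite {p. f p \<noteq> 0}"
 by (simp add: path_algebra_simps)

lemma PA_path: "f \<in> carrier PA ==> f p \<noteq> 0 ==> p \<in> Pth"
 by (auto simp: path_algebra_simps)

lemma PA_minus:
 assumes g: "g \<in> carrier PA"
 shows "f \<ominus>\<^sub>PA g = (\<lambda>p. f p - g p)"
proof -
 have "((-1) \<odot>\<^sub>PA g) \<oplus>\<^sub>PA g = \<zero>\<^sub>PA" unfolding path_algebra_simps by (rule ext) simp
 then have "\<ominus>\<^sub>PA g = (-1) \<odot>\<^sub>PA g"
  using PA.minus_equality g PA.cs_closed[OF g] by blast
 then show ?thesis unfolding a_minus_def by (simp add: path_algebra_simps)
qed

text \<open>The sum of the coefficients of the paths from \<open>i\<close> to \<open>k\<close> that have normal form \<open>updown i k m\<close>.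
 For \<open>m < n\<close> these functionals vanish on the relations and hence give coordinates on \<open>D\<close>.\<close>

definition lam :: "nat => nat => nat => ((nat, arrow) path => complex) => complex"
 where "lam i k m f = lsum f (\<lambda>p. if psrc p = i \<and> ptgt p = k \<and> pdeg p = m then 1 else 0)"

definition lam_kernel :: "((nat, arrow) path => complex) set"
 where "lam_kernel = {f \<in> carrier PA. \<forall>i k m. m < n --> lam i k m f = 0}"

lemma lam_add: "f \<in> carrier PA ==> g \<in> carrier PA ==> lam i k m (f \<oplus>\<^sub>PA g) = lam i k m f + lam i k m g"
 by (simp add: lam_def path_algebra_simps(3) lsum_add PA_fin)

lemma lam_scale: "f \<in> carrier PA ==> lam i k m (c \<odot>\<^sub>PA f) = c * lam i k m f"
 by (simp add: lam_def path_algebra_simps(4) lsum_scale PA_fin)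

lemma lam_path: "lam i k m (path_elem p) = (if psrc p = i \<and> ptgt p = k \<and> pdeg p = m then 1 else 0)"
 by (simp add: lam_def lsum_path_elem)

lemma lam_mult_left:
 assumes "x \<in> carrier PA" "f \<in> lam_kernel" "m < n"
 shows "lam i k m (x \<otimes>\<^sub>PA f) = 0"
proof -
 have f: "f \<in> carrier PA" using assms(2) by (simp add: lam_kernel_def)
 have "lam i k m (x \<otimes>\<^sub>PA f) = lsum x (\<lambda>q. lsum f (\<lambda>p. if ptgt p = psrc q
   then if psrc (pjoin q p) = i \<and> ptgt (pjoin q p) = k \<and> pdeg (pjoin q p) = m then 1 else 0 else 0))"
  unfolding lam_def by (rule lsum_mult[OF PA_fin[OF assms(1)] PA_fin[OF f]])
 also have "\<dots> = lsum x (\<lambda>_. 0)"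
 proof (rule lsum_cong)
  fix q assume "x q \<noteq> 0"
  then have q: "psrc q \<le> pdeg q" using path_bounds(1) PA_path[OF assms(1)] by blast
  show "lsum f (\<lambda>p. if ptgt p = psrc q
   then if psrc (pjoin q p) = i \<and> ptgt (pjoin q p) = k \<and> pdeg (pjoin q p) = m then 1 else 0 else 0) = 0"
  proof (cases "ptgt q = k \<and> pdeg q - psrc q \<le> m")
   case True
   let ?m = "m - (pdeg q - psrc q)"
   have "lsum f (\<lambda>p. if ptgt p = psrc q
     then if psrc (pjoin q p) = i \<and> ptgt (pjoin q p) = k \<and> pdeg (pjoin q p) = m then 1 else 0 else 0)
    = lam i (psrc q) ?m f"
    unfolding lam_def
   proof (rule lsum_cong)
    fix p
    show "(if ptgt p = psrc q
     then if psrc (pjoin q p) = i \<and> ptgt (pjoin q p) = k \<and> pdeg (pjoin q p) = m then 1 else 0 else 0)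
     = (if psrc p = i \<and> ptgt p = psrc q \<and> pdeg p = ?m then 1 else (0::complex))"
    proof (cases "ptgt p = psrc q")
     case pq: True
     have "pdeg (pjoin q p) = m \<longleftrightarrow> pdeg p = ?m"
      using pdeg_pjoin[OF pq] q True by auto
     then show ?thesis using pq True by simp
    qed simp
   qed
   also have "\<dots> = 0" using assms(2,3) by (simp add: lam_kernel_def)
   finally show ?thesis .
  next
   case False
   have "lsum f (\<lambda>p. if ptgt p = psrc q
     then if psrc (pjoin q p) = i \<and> ptgt (pjoin q p) = k \<and> pdeg (pjoin q p) = m then 1 else 0 else 0)
    = lsum f (\<lambda>_. 0)"
   proof (rule lsum_cong)
    fix p
    show "(if ptgt p = psrc q
     then if psrc (pjoin q p) = i \<and> ptgt (pjoin q p) = k \<and> pdeg (pjoin q p) = m then 1 else 0 else 0)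
     = (0::complex)"
     using False pdeg_pjoin[of p q] q by auto
   qed
   then show ?thesis by (simp add: lsum_zero)
  qed
 qed
 finally show ?thesis by (simp add: lsum_zero)
qed

lemma lam_mult_right:
 assumes "x \<in> carrier PA" "f \<in> lam_kernel" "m < n"
 shows "lam i k m (f \<otimes>\<^sub>PA x) = 0"
proof -
 have f: "f \<in> carrier PA" using assms(2) by (simp add: lam_kernel_def)
 have "lam i k m (f \<otimes>\<^sub>PA x) = lsum f (\<lambda>q. lsum x (\<lambda>p. if ptgt p = psrc q
   then if psrc (pjoin q p) = i \<and> ptgt (pjoin q p) = k \<and> pdeg (pjoin q p) = m then 1 else 0 else 0))"
  unfolding lam_def by (rule lsum_mult[OF PA_fin[OF f] PA_fin[OF assms(1)]])
 also have "\<dots> = lsum x (\<lambda>p. lsum f (\<lambda>q. if ptgt p = psrc q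
   then if psrc (pjoin q p) = i \<and> ptgt (pjoin q p) = k \<and> pdeg (pjoin q p) = m then 1 else 0 else 0))"
  by (rule lsum_swap)
 also have "\<dots> = lsum x (\<lambda>_. 0)"
 proof (rule lsum_cong)
  fix p assume "x p \<noteq> 0"
  then have p: "ptgt p \<le> pdeg p" using path_bounds(2) PA_path[OF assms(1)] by blast
  have q: "psrc q \<le> pdeg q" if "f q \<noteq> 0" for q using that path_bounds(1) PA_path[OF f] by blast
  show "lsum f (\<lambda>q. if ptgt p = psrc q
   then if psrc (pjoin q p) = i \<and> ptgt (pjoin q p) = k \<and> pdeg (pjoin q p) = m then 1 else 0 else 0) = 0"
  proof (cases "psrc p = i \<and> pdeg p \<le> m")
   case True
   let ?m = "m - pdeg p + ptgt p"
   have "lsum f (\<lambda>q. if ptgt p = psrc q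
     then if psrc (pjoin q p) = i \<and> ptgt (pjoin q p) = k \<and> pdeg (pjoin q p) = m then 1 else 0 else 0)
    = lam (ptgt p) k ?m f"
    unfolding lam_def
   proof (rule lsum_cong)
    fix q
    show "(if ptgt p = psrc q
     then if psrc (pjoin q p) = i \<and> ptgt (pjoin q p) = k \<and> pdeg (pjoin q p) = m then 1 else 0 else 0)
     = (if psrc q = ptgt p \<and> ptgt q = k \<and> pdeg q = ?m then 1 else (0::complex))"
    proof (cases "ptgt p = psrc q")
     case pq: True
     have "pdeg (pjoin q p) = m \<longleftrightarrow> pdeg q = ?m"
      using pdeg_pjoin[OF pq] p pq True by auto
     then show ?thesis using pq True by simp
    qed simp
   qed
   also have "\<dots> = 0" using assms(2,3) p True by (simp add: lam_kernel_def)
   finally show ?thesis .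
  next
   case False
   have "lsum f (\<lambda>q. if ptgt p = psrc q
     then if psrc (pjoin q p) = i \<and> ptgt (pjoin q p) = k \<and> pdeg (pjoin q p) = m then 1 else 0 else 0)
    = lsum f (\<lambda>_. 0)"
   proof (rule lsum_cong)
    fix qq assume "f qq \<noteq> 0"
    then show "(if ptgt p = psrc qq
     then if psrc (pjoin qq p) = i \<and> ptgt (pjoin qq p) = k \<and> pdeg (pjoin qq p) = m then 1 else 0 else 0)
     = (0::complex)"
     using False pdeg_pjoin[of p qq] q[of qq] by auto
   qed
   then show ?thesis by (simp add: lsum_zero)
  qed
 qed
 finally show ?thesis by (simp add: lsum_zero)
qed

lemma lam_kernel_ideal: "ideal lam_kernel PA"
proof (rule idealI[OF PA.ring_axioms])
 show "subgroup lam_kernel (add_monoid PA)"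
 proof (rule subgroup.intro)
  show "lam_kernel \<subseteq> carrier (add_monoid PA)" by (simp add: lam_kernel_def subset_eq)
  show "\<one>\<^bsub>add_monoid PA\<^esub> \<in> lam_kernel"
   by (simp add: lam_kernel_def lam_def path_algebra_simps lsum_def)
 next
  fix f g assume "f \<in> lam_kernel" "g \<in> lam_kernel"
  then show "f \<otimes>\<^bsub>add_monoid PA\<^esub> g \<in> lam_kernel" by (simp add: lam_kernel_def lam_add)
 next
  fix f assume f: "f \<in> lam_kernel"
  then have c: "f \<in> carrier PA" by (simp add: lam_kernel_def)
  have "\<ominus>\<^sub>PA f = \<zero>\<^sub>PA \<ominus>\<^sub>PA f" using c by (simp add: a_minus_def)
  also have "\<dots> = (-1) \<odot>\<^sub>PA f" unfolding PA_minus[OF c] by (simp add: path_algebra_simps)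
  finally have "\<ominus>\<^sub>PA f \<in> lam_kernel" using f c by (simp add: lam_kernel_def lam_scale PA.cs_closed)
  then show "inv\<^bsub>add_monoid PA\<^esub> f \<in> lam_kernel" by (simp add: a_inv_def)
 qed
next
 fix a x assume a: "a \<in> lam_kernel" and x: "x \<in> carrier PA"
 then have "a \<in> carrier PA" by (simp add: lam_kernel_def)
 then show "x \<otimes>\<^sub>PA a \<in> lam_kernel" "a \<otimes>\<^sub>PA x \<in> lam_kernel"
  unfolding lam_kernel_def using lam_mult_left[OF x a] lam_mult_right[OF x a] x by simp_all
qed

lemma rel_paths:
 "(n-1, [Arr_a (n-1), Arr_b (n-1)], n-1) \<in> Pth"
 "i \<in> {2..n-1} ==> (i-1, [Arr_b i, Arr_a i], i-1) \<in> Pth"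
 "i \<in> {2..n-1} ==> (i-1, [Arr_a (i-1), Arr_b (i-1)], i-1) \<in> Pth"
proof -
 have arc: "Arr_a k \<in> arcs (aus_quiver n)" "Arr_b k \<in> arcs (aus_quiver n)" if "1 \<le> k" "k < n" for k
  using that by auto
 show "(n-1, [Arr_a (n-1), Arr_b (n-1)], n-1) \<in> Pth"
  using n_gt_1 arc[of "n - 1"] unfolding in_paths_iff by (simp del: aus_quiver_simps(2))
 assume i: "i \<in> {2..n-1}"
 show "(i-1, [Arr_b i, Arr_a i], i-1) \<in> Pth" "(i-1, [Arr_a (i-1), Arr_b (i-1)], i-1) \<in> Pth"
 proof -
  have k: "1 \<le> i" "i < n" "1 \<le> i - 1" "i - 1 < n" using i n_gt_1 by auto
  show "(i-1, [Arr_b i, Arr_a i], i-1) \<in> Pth" "(i-1, [Arr_a (i-1), Arr_b (i-1)], i-1) \<in> Pth"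
   using k arc[OF k(1,2)] arc[OF k(3,4)] unfolding in_paths_iff by (simp_all del: aus_quiver_simps(2))
 qed
qed

lemma aus_relations_subset: "aus_relations n \<subseteq> carrier PA" "aus_relations n \<subseteq> lam_kernel"
proof -
 have "r \<in> lam_kernel" if "r \<in> aus_relations n" for r
 proof -
  from that consider "r = path_elem (n-1, [Arr_a (n-1), Arr_b (n-1)], n-1)"
   | i where "i \<in> {2..n-1}" "r = path_elem (i-1, [Arr_b i, Arr_a i], i-1)
     \<ominus>\<^sub>PA path_elem (i-1, [Arr_a (i-1), Arr_b (i-1)], i-1)"
   unfolding aus_relations_def by blast
  then show ?thesis
  proof cases
   case 1
   then show ?thesis using path_elem_closed[OF rel_paths(1)] n_gt_1
    by (auto simp: lam_kernel_def lam_path pdeg_def)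
  next
   case 2
   note c = path_elem_closed[OF rel_paths(2)[OF 2(1)]] path_elem_closed[OF rel_paths(3)[OF 2(1)]]
   let ?u = "path_elem (i-1, [Arr_b i, Arr_a i], i-1)" and ?v = "path_elem (i-1, [Arr_a (i-1), Arr_b (i-1)], i-1)"
   have "r = ?u \<oplus>\<^sub>PA ((-1) \<odot>\<^sub>PA ?v)"
    unfolding 2(2) PA_minus[OF c(2)] path_algebra_simps by (rule ext) simp
   then show ?thesis using c by (simp add: lam_kernel_def lam_add lam_scale PA.cs_closed lam_path pdeg_def)
  qed
 qed
 then show "aus_relations n \<subseteq> lam_kernel" by blast
 then show "aus_relations n \<subseteq> carrier PA" by (auto simp: lam_kernel_def)
qed

lemma aus_ideal_ideal: "ideal II PA"
 unfolding aus_ideal_def by (rule PA.genideal_ideal[OF aus_relations_subset(1)])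

lemma aus_ideal_lam: "II \<subseteq> lam_kernel"
 unfolding aus_ideal_def by (rule PA.genideal_minimal[OF lam_kernel_ideal aus_relations_subset(2)])

sublocale PQ: calg_quotient PA II
 by (intro calg_quotient.intro PA.calg_axioms aus_ideal_ideal)

lemma DD_eq: "DD = quotient_algebra PA II"
 by (simp add: D_alg_def)

sublocale DD: calg DD
 unfolding DD_eq by (rule PQ.Q_calg)

lemma D_path_closed: "p \<in> Pth ==> D_path n p \<in> carrier DD"
 unfolding D_path_def DD_eq by (intro PQ.Q_closed path_elem_closed)

lemma D_path_mult:
 assumes "q \<in> Pth" "p \<in> Pth"
 shows "D_path n q \<otimes>\<^sub>DD D_path n p = (if ptgt p = psrc q then D_path n (pjoin q p) else \<zero>\<^sub>DD)"
 unfolding D_path_def DD_eq PQ.Q_mult[OF path_elem_closed[OF assms(1)] path_elem_closed[OF assms(2)]]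
  path_elem_mult path_mult_eq PQ.Q_zero path_algebra_simps by simp

text \<open>The class in \<open>D\<close> of the path that goes up from \<open>i\<close> to \<open>m\<close> and then down to \<open>k\<close>. The value is \<open>0\<close>
 outside the range \<open>i, k \<le> m < n\<close>, since the relations kill the paths with \<open>m \<ge> n\<close>.\<close>

definition dU :: "nat => nat => nat => D_elem"
 where "dU i k m = (if i \<le> m \<and> k \<le> m \<and> m < n then D_path n (updown i k m) else \<zero>\<^sub>DD)"

lemma dU_closed: "dU i k m \<in> carrier DD"
 by (simp add: dU_def D_path_closed updown_in_paths)

lemma dU_zero: "n \<le> m ==> dU i k m = \<zero>\<^sub>DD"
 by (simp add: dU_def)

lemma arr_path: "1 \<le> k ==> k < n ==> (k, [Arr_a k], k - 1) \<in> Pth" "1 \<le> k ==> k < n ==> (k - 1, [Arr_b k], k) \<in> Pth"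
 by (auto simp: in_paths_iff)

lemma D_a_dU:
 assumes "1 \<le> k" "k < n" "i \<le> m" "k \<le> m"
 shows "D_a n k \<otimes>\<^sub>DD dU i k m = dU i (k - 1) m"
proof (cases "m < n")
 case True
 have "[Suc (k - 1)..<Suc m] = k # [Suc k..<Suc m]" using assms by (simp add: upt_conv_Cons)
 then have e: "pjoin (k, [Arr_a k], k - 1) (updown i k m) = updown i (k - 1) m" by (simp add: updown_def)
 show ?thesis
  unfolding D_a_def using D_path_mult[OF arr_path(1)[OF assms(1,2)] updown_in_paths[OF assms(3,4) True]]
   assms True e le_trans[OF diff_le_self assms(4), of 1] by (simp add: dU_def)
next
 case False
 have "D_a n k \<in> carrier DD" unfolding D_a_def by (rule D_path_closed[OF arr_path(1)[OF assms(1,2)]])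
 then show ?thesis using False by (simp add: dU_zero)
qed

lemma D_relation_top: "D_b n (n - 1) \<otimes>\<^sub>DD D_a n (n - 1) = \<zero>\<^sub>DD"
proof -
 have k: "1 \<le> n - 1" "n - 1 < n" using n_gt_1 by auto
 let ?r = "path_elem (n-1, [Arr_a (n-1), Arr_b (n-1)], n-1)"
 have "?r \<in> aus_relations n" by (simp add: aus_relations_def)
 then have "?r \<in> II" unfolding aus_ideal_def using PA.genideal_self[OF aus_relations_subset(1)] by (rule rev_subsetD)
 then have "II +>\<^sub>PA ?r = II" by (rule PQ.I.a_rcos_const)
 then show ?thesis
  unfolding D_a_def D_b_def D_path_mult[OF arr_path(2)[OF k] arr_path(1)[OF k]]
  by (simp add: D_path_def DD_eq quotient_algebra_simps)
qed

lemma D_relation: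
 assumes "2 \<le> i" "i < n"
 shows "D_b n (i - 1) \<otimes>\<^sub>DD D_a n (i - 1) = D_a n i \<otimes>\<^sub>DD D_b n i"
proof -
 have k: "1 \<le> i" "i < n" "1 \<le> i - 1" "i - 1 < n" and i: "i \<in> {2..n-1}" using assms by auto
 let ?u = "path_elem (i-1, [Arr_b i, Arr_a i], i-1)" and ?v = "path_elem (i-1, [Arr_a (i-1), Arr_b (i-1)], i-1)"
 note c = path_elem_closed[OF rel_paths(2)[OF i]] path_elem_closed[OF rel_paths(3)[OF i]]
 have "?u \<ominus>\<^sub>PA ?v \<in> aus_relations n" using i unfolding aus_relations_def by blast
 then have "?u \<ominus>\<^sub>PA ?v \<in> II" unfolding aus_ideal_def using PA.genideal_self[OF aus_relations_subset(1)] by (rule rev_subsetD)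
 then have "II +>\<^sub>PA ?u = II +>\<^sub>PA ?v" by (rule PQ.coset_eqI[OF c])
 then show ?thesis
  unfolding D_a_def D_b_def D_path_mult[OF arr_path(2)[OF k(3,4)] arr_path(1)[OF k(3,4)]]
   D_path_mult[OF arr_path(1)[OF k(1,2)] arr_path(2)[OF k(1,2)]]
  by (simp add: D_path_def)
qed

lemma D_ab_closed: "1 \<le> k ==> k < n ==> D_a n k \<in> carrier DD" "1 \<le> k ==> k < n ==> D_b n k \<in> carrier DD"
 unfolding D_a_def D_b_def by (intro D_path_closed arr_path; assumption)+

text \<open>Moving the last arrow \<open>b\<close> past the downward arrows \<open>a\<close> of the normal form.\<close>

lemma D_b_dU:
 assumes "Suc k < n" "i \<le> m" "k \<le> m"
 shows "D_b n (Suc k) \<otimes>\<^sub>DD dU i k m = dU i (Suc k) (Suc m)"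
 using assms
proof (induction "m - k" arbitrary: k)
 case 0
 then have km: "k = m" by simp
 have "[Suc i..<Suc (Suc m)] = [Suc i..<Suc m] @ [Suc m]" using 0 by simp
 then have e: "pjoin (m, [Arr_b (Suc m)], Suc m) (updown i m m) = updown i (Suc m) (Suc m)"
  by (simp add: updown_def)
 show ?case
  unfolding D_b_def using D_path_mult[OF arr_path(2)[of "Suc m"] updown_in_paths[of i m m n]] 0 km e
  by (simp add: dU_def)
next
 case (Suc d)
 then have k: "Suc k \<le> m" by simp
 let ?U = "dU i (Suc k) m"
 have a: "dU i k m = D_a n (Suc k) \<otimes>\<^sub>DD ?U" using D_a_dU[of "Suc k" i m] Suc k by simp
 have cl: "D_a n (Suc k) \<in> carrier DD" "D_b n (Suc k) \<in> carrier DD" using D_ab_closed[of "Suc k"] Suc.prems by auto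
 have e: "D_b n (Suc k) \<otimes>\<^sub>DD dU i k m = (D_b n (Suc k) \<otimes>\<^sub>DD D_a n (Suc k)) \<otimes>\<^sub>DD ?U"
  unfolding a using cl dU_closed by (simp add: DD.m_assoc)
 show ?case
 proof (cases "Suc (Suc k) < n")
  case True
  have cl': "D_a n (Suc (Suc k)) \<in> carrier DD" "D_b n (Suc (Suc k)) \<in> carrier DD"
   using D_ab_closed[of "Suc (Suc k)"] True by auto
  have "(D_b n (Suc k) \<otimes>\<^sub>DD D_a n (Suc k)) \<otimes>\<^sub>DD ?U
    = D_a n (Suc (Suc k)) \<otimes>\<^sub>DD (D_b n (Suc (Suc k)) \<otimes>\<^sub>DD ?U)"
   using D_relation[of "Suc (Suc k)"] True cl' dU_closed by (simp add: DD.m_assoc)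
  also have "D_b n (Suc (Suc k)) \<otimes>\<^sub>DD ?U = dU i (Suc (Suc k)) (Suc m)"
   using Suc.hyps(1)[of "Suc k"] Suc.hyps(2) Suc.prems True k by simp
  also have "D_a n (Suc (Suc k)) \<otimes>\<^sub>DD \<dots> = dU i (Suc k) (Suc m)"
   using D_a_dU[of "Suc (Suc k)" i "Suc m"] True Suc.prems k by simp
  finally show ?thesis unfolding e .
 next
  case False
  then have kn: "Suc k = n - 1" using Suc.prems by simp
  have "(D_b n (Suc k) \<otimes>\<^sub>DD D_a n (Suc k)) \<otimes>\<^sub>DD ?U = \<zero>\<^sub>DD"
   unfolding kn D_relation_top using dU_closed by simp
  moreover have "dU i (Suc k) (Suc m) = \<zero>\<^sub>DD" using kn k by (intro dU_zero) simp
  ultimately show ?thesis unfolding e by simp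
 qed
qed

text \<open>Every path equals its normal form in \<open>D\<close>, by induction on its length.\<close>

lemma D_path_dU:
 assumes "p \<in> Pth"
 shows "D_path n p = dU (psrc p) (ptgt p) (pdeg p)"
proof -
 have "(u, w, v) \<in> Pth ==> D_path n (u, w, v) = dU u v (pdeg (u, w, v))" for u w v
 proof (induction w arbitrary: v rule: rev_induct)
  case Nil
  then show ?case by (simp add: in_paths_iff dU_def pdeg_def updown_def)
 next
  case (snoc x w)
  let ?t = "tail (aus_quiver n) x"
  interpret wf_digraph "aus_quiver n" by (rule aus_quiver_wf)
  have aw: "awalk u (w @ [x]) v" using snoc.prems by (simp add: paths_def)
  then have x: "x \<in> arcs (aus_quiver n)" and w0: "awalk u w ?t" and hv: "head (aus_quiver n) x = v"
   by (auto simp: awalk_Cons_iff awalk_Nil_iff)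
  have w: "(u, w, ?t) \<in> Pth" using w0 by (simp add: paths_def)
  note b = path_bounds[OF w]
  let ?m = "pdeg (u, w, ?t)"
  have pj: "(u, w @ [x], v) = pjoin (?t, [x], v) (u, w, ?t)" by simp
  have xp: "(?t, [x], v) \<in> Pth" using x hv b(4) by (simp add: in_paths_iff)
  have "D_path n (u, w @ [x], v) = D_path n (?t, [x], v) \<otimes>\<^sub>DD D_path n (u, w, ?t)"
   using D_path_mult[OF xp w] unfolding pj by simp
  then have e: "D_path n (u, w @ [x], v) = D_path n (?t, [x], v) \<otimes>\<^sub>DD dU u ?t ?m"
   using snoc.IH[OF w] by simp
  from x obtain i where i: "1 \<le> i" "i < n" "x = Arr_a i \<or> x = Arr_b i" using n_gt_1 by fastforce
  from i(3) show ?case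
  proof
   assume x: "x = Arr_a i"
   then have "D_path n (?t, [x], v) = D_a n i" "?t = i" "v = i - 1" using hv by (simp_all add: D_a_def)
   then show ?thesis using e D_a_dU[OF i(1,2), of u ?m] b by (simp add: x pdeg_def)
  next
   assume x: "x = Arr_b i"
   then have "D_path n (?t, [x], v) = D_b n i" "?t = i - 1" "v = i" using hv by (simp_all add: D_b_def)
   then show ?thesis using e D_b_dU[of "i - 1" u ?m] b i by (simp add: x pdeg_def)
  qed
 qed
 then show ?thesis using assms by (cases p) simp
qed

lemma dU_mult:
 assumes "i \<le> m" "k \<le> m" "k' \<le> m'" "l \<le> m'"
 shows "dU k' l m' \<otimes>\<^sub>DD dU i k m = (if k = k' then dU i l (m + m' - k) else \<zero>\<^sub>DD)"
proof (cases "m < n \<and> m' < n")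
 case True
 note p = updown_in_paths[of i m k n] updown_in_paths[of k' m' l n]
 have e: "dU k' l m' = D_path n (updown k' l m')" "dU i k m = D_path n (updown i k m)"
  using True assms by (simp_all add: dU_def)
 show ?thesis
 proof (cases "k = k'")
  case kk: True
  have "D_path n (pjoin (updown k' l m') (updown i k m)) = dU i l (pdeg (pjoin (updown k' l m') (updown i k m)))"
   using D_path_dU[OF pjoin_in_paths[OF p(2) p(1)]] True assms kk by simp
  moreover have "pdeg (pjoin (updown k' l m') (updown i k m)) = m + m' - k"
   using pdeg_pjoin[of "updown i k m" "updown k' l m'"] assms kk by (simp add: pdeg_updown)
  ultimately show ?thesis unfolding e using D_path_mult[OF p(2) p(1)] True assms kk by simp
 next
  case False
  then show ?thesis unfolding e using D_path_mult[OF p(2) p(1)] True assms by simp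
 qed
next
 case False
 then have "n \<le> m + m' - k" if "k = k'" using assms that by auto
 then show ?thesis using False dU_closed by (auto simp: dU_zero)
qed

lemma D_e_dU: "i < n ==> D_e n i = dU i i i"
 by (simp add: D_e_def dU_def updown_def)

lemma D_a_eq_dU: "1 \<le> k ==> k < n ==> D_a n k = dU k (k - 1) k"
 unfolding D_a_def by (subst D_path_dU[OF arr_path(1)]) (simp_all add: pdeg_def)

lemma D_b_eq_dU: "1 \<le> k ==> k < n ==> D_b n k = dU (k - 1) k k"
 unfolding D_b_def by (subst D_path_dU[OF arr_path(2)]) (simp_all add: pdeg_def)

lemma D_up_dU: "k < n ==> D_path n (0, map Arr_b [1..<Suc k], k) = dU 0 k k"
 by (simp add: dU_def updown_def)

subsection \<open>Coordinates\<close>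

text \<open>The element with prescribed coordinates, and the coordinates of an element, with respect to
 the basis \<open>dU i k m\<close> (\<open>i, k \<le> m < n\<close>).\<close>

definition idx :: "nat => nat => nat => bool" where "idx i k m \<longleftrightarrow> i \<le> m \<and> k \<le> m \<and> m < n"

definition emb :: "(nat => nat => nat => complex) => (nat, arrow) path => complex"
 where "emb c p = (if idx (psrc p) (ptgt p) (pdeg p) \<and> p = updown (psrc p) (ptgt p) (pdeg p)
  then c (psrc p) (ptgt p) (pdeg p) else 0)"

definition dfun :: "(nat => nat => nat => complex) => D_elem"
 where "dfun c = II +>\<^sub>PA emb c"

definition dco :: "D_elem => nat => nat => nat => complex"
 where "dco X i k m = (if idx i k m then lam i k m (SOME f. f \<in> X) else 0)"

lemma emb_closed: "emb c \<in> carrier PA"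
proof -
 let ?S = "(\<lambda>(i, k, m). updown i k m) ` ({..n} \<times> {..n} \<times> {..n})"
 have "{p. emb c p \<noteq> 0} \<subseteq> ?S"
 proof
  fix p assume "p \<in> {p. emb c p \<noteq> 0}"
  then have p: "p = updown (psrc p) (ptgt p) (pdeg p)" "idx (psrc p) (ptgt p) (pdeg p)"
   by (auto simp: emb_def split: if_splits)
  then show "p \<in> ?S" by (intro image_eqI[of _ _ "(psrc p, ptgt p, pdeg p)"]) (auto simp: idx_def)
 qed
 then have f: "finite {p. emb c p \<noteq> 0}" by (rule finite_subset) simp
 have "p \<in> Pth" if "emb c p \<noteq> 0" for p
 proof -
  from that have p: "p = updown (psrc p) (ptgt p) (pdeg p)" "idx (psrc p) (ptgt p) (pdeg p)"
   by (auto simp: emb_def split: if_splits)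
  show ?thesis by (subst p(1), rule updown_in_paths) (use p(2) in \<open>simp_all add: idx_def\<close>)
 qed
 then show ?thesis using f unfolding path_algebra_simps by blast
qed

lemma lam_emb: "idx i k m ==> lam i k m (emb c) = c i k m"
 unfolding lam_def
 by (subst lsum_single[OF PA_fin[OF emb_closed], where q = "updown i k m"])
  (auto simp: emb_def idx_def pdeg_updown split: if_splits)

lemma dco_coset:
 assumes f: "f \<in> carrier PA" and i: "idx i k m"
 shows "dco (II +>\<^sub>PA f) i k m = lam i k m f"
proof -
 define g where "g = (SOME g. g \<in> II +>\<^sub>PA f)"
 have g: "g \<in> II +>\<^sub>PA f" unfolding g_def by (rule someI[of _ f]) (rule PQ.I.a_rcos_self[OF f])
 have gP: "g \<in> carrier PA" by (rule PQ.I.a_elemrcos_carrier[OF f g])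
 have "II +>\<^sub>PA f = II +>\<^sub>PA g" by (rule PQ.I.a_repr_independence'[OF g f])
 then have "f \<ominus>\<^sub>PA g \<in> lam_kernel" using PQ.coset_eqD[OF f gP] aus_ideal_lam by blast
 then have z: "lam i k m (f \<ominus>\<^sub>PA g) = 0" using i by (simp add: lam_kernel_def idx_def)
 have "f = (f \<ominus>\<^sub>PA g) \<oplus>\<^sub>PA g" unfolding PA_minus[OF gP] path_algebra_simps by simp
 then have "lam i k m f = lam i k m ((f \<ominus>\<^sub>PA g) \<oplus>\<^sub>PA g)" by simp
 also have "\<dots> = lam i k m g" using z f gP by (simp add: lam_add)
 finally show ?thesis using i by (simp add: dco_def g_def)
qed

lemma dfun_closed: "dfun c \<in> carrier DD"
 unfolding dfun_def DD_eq by (rule PQ.Q_closed[OF emb_closed])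

lemma dco_dfun: "dco (dfun c) i k m = (if idx i k m then c i k m else 0)"
 using dco_coset[OF emb_closed] lam_emb by (simp add: dfun_def) (simp add: dco_def)

lemma dco_add:
 assumes "X \<in> carrier DD" "Y \<in> carrier DD"
 shows "dco (X \<oplus>\<^sub>DD Y) i k m = dco X i k m + dco Y i k m"
proof (cases "idx i k m")
 case True
 obtain f where f: "f \<in> carrier PA" "X = II +>\<^sub>PA f" using assms(1) unfolding DD_eq by (rule PQ.Q_cases)
 obtain g where g: "g \<in> carrier PA" "Y = II +>\<^sub>PA g" using assms(2) unfolding DD_eq by (rule PQ.Q_cases)
 show ?thesis unfolding f(2) g(2) DD_eq PQ.Q_add[OF f(1) g(1)]
  by (simp add: dco_coset[OF _ True] f g lam_add)
qed (simp add: dco_def)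

lemma dco_scale:
 assumes "X \<in> carrier DD"
 shows "dco (c \<odot>\<^sub>DD X) i k m = c * dco X i k m"
proof (cases "idx i k m")
 case True
 obtain f where f: "f \<in> carrier PA" "X = II +>\<^sub>PA f" using assms(1) unfolding DD_eq by (rule PQ.Q_cases)
 show ?thesis unfolding f(2) DD_eq PQ.Q_smult[OF f(1)]
  by (simp add: dco_coset[OF _ True] f lam_scale PA.cs_closed)
qed (simp add: dco_def)

lemma dco_dU: "dco (dU i k m) i' k' m' = (if idx i k m \<and> i' = i \<and> k' = k \<and> m' = m then 1 else 0)"
proof (cases "idx i' k' m'")
 case True
 show ?thesis
 proof (cases "idx i k m")
  case T: True
  have "dco (dU i k m) i' k' m' = lam i' k' m' (path_elem (updown i k m))"
   using T dco_coset[OF path_elem_closed[OF updown_in_paths] True, of i m k] by (simp add: dU_def idx_def D_path_def)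
  then show ?thesis using T by (auto simp: lam_path pdeg_updown idx_def)
 next
  case False
  have "dco (dU i k m) i' k' m' = lam i' k' m' \<zero>\<^sub>PA"
   using False dco_coset[OF PA.zero_closed True] by (auto simp: dU_def idx_def DD_eq PQ.Q_zero)
  then show ?thesis using False by (simp add: lam_def lsum_def path_algebra_simps)
 qed
qed (auto simp: dco_def)

lemma D_induct [consumes 1, case_names zero add scale_dU]:
 assumes X: "X \<in> carrier DD"
  and z: "P \<zero>\<^sub>DD"
  and a: "\<And>X Y. X \<in> carrier DD ==> Y \<in> carrier DD ==> P X ==> P Y ==> P (X \<oplus>\<^sub>DD Y)"
  and u: "\<And>c i k m. idx i k m ==> P (c \<odot>\<^sub>DD dU i k m)"
 shows "P X"
proof -
 obtain f where f: "f \<in> carrier PA" "X = II +>\<^sub>PA f" using X unfolding DD_eq by (rule PQ.Q_cases)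
 have "f \<in> carrier PA ==> {p. f p \<noteq> 0} \<subseteq> S ==> P (II +>\<^sub>PA f)" if "finite S" for S f
  using that
 proof (induction S arbitrary: f rule: finite_induct)
  case empty
  then have "f = \<zero>\<^sub>PA" by (auto simp: path_algebra_simps)
  then show ?case using z by (simp add: DD_eq PQ.Q_zero)
 next
  case (insert p S)
  show ?case
  proof (cases "f p = 0")
   case True
   then have "{p. f p \<noteq> 0} \<subseteq> S" using insert.prems(2) by auto
   then show ?thesis using insert.IH insert.prems(1) by blast
  next
   case False
   then have p: "p \<in> Pth" using PA_path insert.prems(1) by blast
   define g where "g = f(p := 0)"
   have gs: "{p. g p \<noteq> 0} \<subseteq> {p. f p \<noteq> 0}" by (auto simp: g_def)
   then have g: "g \<in> carrier PA" using insert.prems(1) unfolding path_algebra_simps by (auto intro: finite_subset)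
   have "{p. g p \<noteq> 0} \<subseteq> S" using insert.prems(2) by (auto simp: g_def)
   then have Pg: "P (II +>\<^sub>PA g)" using insert.IH g by blast
   have h: "path_elem p \<in> carrier PA" by (rule path_elem_closed[OF p])
   have fe: "f = g \<oplus>\<^sub>PA (f p \<odot>\<^sub>PA path_elem p)"
    unfolding path_algebra_simps by (rule ext) (simp add: g_def path_elem_def)
   have "II +>\<^sub>PA f = (II +>\<^sub>PA g) \<oplus>\<^sub>DD (f p \<odot>\<^sub>DD D_path n p)"
    unfolding D_path_def DD_eq PQ.Q_smult[OF h] PQ.Q_add[OF g PA.cs_closed[OF h]] using fe by simp
   moreover have "P (f p \<odot>\<^sub>DD D_path n p)"
   proof (cases "pdeg p < n")
    case True
    then show ?thesis unfolding D_path_dU[OF p] using path_bounds[OF p] by (intro u) (simp add: idx_def)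
   next
    case False
    then show ?thesis unfolding D_path_dU[OF p] using z by (simp add: dU_zero DD.cs_zero)
   qed
   moreover have "II +>\<^sub>PA g \<in> carrier DD" unfolding DD_eq by (rule PQ.Q_closed[OF g])
   moreover have "f p \<odot>\<^sub>DD D_path n p \<in> carrier DD" by (rule DD.cs_closed[OF D_path_closed[OF p]])
   ultimately show ?thesis using a Pg by simp
  qed
 qed
 then show ?thesis using f PA_fin by blast
qed

lemma dfun_dco: "X \<in> carrier DD ==> dfun (dco X) = X"
proof (induction rule: D_induct)
 case zero
 have "dco \<zero>\<^sub>DD i k m = 0" for i k m
  using dco_dU[of 0 0 n i k m] dU_zero[of n 0 0] by (simp add: idx_def)
 then have "emb (dco \<zero>\<^sub>DD) = \<zero>\<^sub>PA" by (auto simp: emb_def path_algebra_simps)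
 then show ?case by (simp add: dfun_def DD_eq PQ.Q_zero)
next
 case (add X Y)
 have "emb (dco (X \<oplus>\<^sub>DD Y)) = emb (dco X) \<oplus>\<^sub>PA emb (dco Y)"
  unfolding path_algebra_simps by (rule ext) (simp add: emb_def dco_add add)
 then have "dfun (dco (X \<oplus>\<^sub>DD Y)) = dfun (dco X) \<oplus>\<^sub>DD dfun (dco Y)"
  unfolding dfun_def DD_eq PQ.Q_add[OF emb_closed emb_closed] by simp
 then show ?case using add by simp
next
 case (scale_dU c i k m)
 then have p: "updown i k m \<in> Pth" by (simp add: idx_def updown_in_paths)
 have "emb (dco (c \<odot>\<^sub>DD dU i k m)) = c \<odot>\<^sub>PA path_elem (updown i k m)"
  unfolding path_algebra_simps
 proof
  fix q
  show "emb (dco (c \<odot>\<^sub>DD dU i k m)) q = c * path_elem (updown i k m) q"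
   using scale_dU by (auto simp: emb_def dco_scale dU_closed dco_dU path_elem_def pdeg_updown idx_def)
 qed
 then have "dfun (dco (c \<odot>\<^sub>DD dU i k m)) = c \<odot>\<^sub>DD D_path n (updown i k m)"
  unfolding dfun_def D_path_def DD_eq PQ.Q_smult[OF path_elem_closed[OF p]] by simp
 then show ?case using scale_dU by (simp add: dU_def idx_def)
qed

lemma D_eqI:
 assumes "X \<in> carrier DD" "Y \<in> carrier DD" "\<And>i k m. idx i k m ==> dco X i k m = dco Y i k m"
 shows "X = Y"
proof -
 have "dco X i k m = dco Y i k m" for i k m using assms(3) by (cases "idx i k m") (simp_all add: dco_def)
 then have "dco X = dco Y" by (intro ext)
 then show ?thesis using dfun_dco[OF assms(1)] dfun_dco[OF assms(2)] by metis
qed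

lemma dco_zero: "dco \<zero>\<^sub>DD i k m = 0"
 using dco_dU[of 0 0 n i k m] dU_zero[of n 0 0] by (simp add: idx_def)

lemma dco_mult_dU:
 assumes X: "X \<in> carrier DD" and j: "idx j l r" and i: "idx i k m"
 shows "dco (X \<otimes>\<^sub>DD dU j l r) i k m = (if i = j \<and> r \<le> m then dco X l k (m + l - r) else 0)"
 using X
proof (induction rule: D_induct)
 case zero
 then show ?case using dU_closed by (simp add: dco_zero)
next
 case (add X Y)
 then show ?case using dU_closed by (simp add: DD.l_distr dco_add)
next
 case (scale_dU c i' k' m')
 have b: "j \<le> r" "l \<le> r" "i' \<le> m'" "k' \<le> m'" using scale_dU j by (simp_all add: idx_def)
 have L: "(c \<odot>\<^sub>DD dU i' k' m') \<otimes>\<^sub>DD dU j l r = c \<odot>\<^sub>DD (if l = i' then dU j k' (r + m' - l) else \<zero>\<^sub>DD)"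
  using dU_mult[OF b] by (simp add: DD.cs_lmult dU_closed)
 have a1: "m = r + m' - l \<longleftrightarrow> m + l = r + m'" using b by arith
 have a2: "r \<le> m \<and> m + l - r = m' \<longleftrightarrow> m + l = r + m'" if "l = i'" using b that by arith
 show ?case
 proof (cases "l = i' \<and> i = j \<and> k = k' \<and> m + l = r + m'")
  case True
  then have m: "m = r + m' - l" and r: "r \<le> m" "m + l - r = m'" using a1 a2 by blast+
  have v: "idx j k' (r + m' - l)" using i True m by simp
  have "dco (c \<odot>\<^sub>DD dU j k' (r + m' - l)) i k m = c"
   using v True m by (simp add: dco_scale dU_closed dco_dU)
  moreover have "dco (c \<odot>\<^sub>DD dU i' k' m') l k (m + l - r) = c"
   unfolding r(2) using scale_dU True by (simp add: dco_scale dU_closed dco_dU)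
  ultimately show ?thesis unfolding L using True r(1) by simp
 next
  case False
  have "dco (c \<odot>\<^sub>DD (if l = i' then dU j k' (r + m' - l) else \<zero>\<^sub>DD)) i k m = 0"
  proof (cases "l = i'")
   case True
   then have "\<not> (i = j \<and> k = k' \<and> m = r + m' - l)" using False a1 by blast
   then show ?thesis using True dco_dU[of j k' "r + m' - l" i k m] by (auto simp: dco_scale dU_closed)
  qed (simp add: DD.cs_zero dco_zero)
  moreover have "(if i = j \<and> r \<le> m then dco (c \<odot>\<^sub>DD dU i' k' m') l k (m + l - r) else 0) = 0"
  proof (cases "i = j \<and> r \<le> m")
   case True
   then have "\<not> (l = i' \<and> k = k' \<and> m + l - r = m')" using False a2 by blast
   then show ?thesis using True dco_dU[of i' k' m' l k "m + l - r"] by (auto simp: dco_scale dU_closed)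
  next
   case F: False
   show ?thesis by (rule if_not_P[OF F])
  qed
  ultimately show ?thesis unfolding L by simp
 qed
qed

lemma dco_dU_mult:
 assumes X: "X \<in> carrier DD" and j: "idx j l r" and i: "idx i k m"
 shows "dco (dU j l r \<otimes>\<^sub>DD X) i k m = (if k = l \<and> r \<le> m + j then dco X i j (m + j - r) else 0)"
 using X
proof (induction rule: D_induct)
 case zero
 then show ?case using dU_closed by (simp add: dco_zero)
next
 case (add X Y)
 then show ?case using dU_closed by (simp add: DD.r_distr dco_add)
next
 case (scale_dU c i' k' m')
 have b: "i' \<le> m'" "k' \<le> m'" "j \<le> r" "l \<le> r" using scale_dU j by (simp_all add: idx_def)
 have L: "dU j l r \<otimes>\<^sub>DD (c \<odot>\<^sub>DD dU i' k' m') = c \<odot>\<^sub>DD (if k' = j then dU i' l (m' + r - k') else \<zero>\<^sub>DD)"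
  using dU_mult[OF b] by (simp add: DD.cs_rmult dU_closed)
 have a1: "m = m' + r - k' \<longleftrightarrow> m + j = m' + r" if "k' = j" using b that by arith
 have a2: "r \<le> m + j \<and> m + j - r = m' \<longleftrightarrow> m + j = m' + r" by arith
 show ?case
 proof (cases "k' = j \<and> i = i' \<and> k = l \<and> m + j = m' + r")
  case True
  then have m: "m = m' + r - k'" and r: "r \<le> m + j" "m + j - r = m'" using a1 a2 by blast+
  have v: "idx i' l (m' + r - k')" using i True m by simp
  have "dco (c \<odot>\<^sub>DD dU i' l (m' + r - k')) i k m = c"
   using v True m by (simp add: dco_scale dU_closed dco_dU)
  moreover have "dco (c \<odot>\<^sub>DD dU i' k' m') i j (m + j - r) = c"
   unfolding r(2) using scale_dU True by (simp add: dco_scale dU_closed dco_dU)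
  ultimately show ?thesis unfolding L using True r(1) by simp
 next
  case False
  have "dco (c \<odot>\<^sub>DD (if k' = j then dU i' l (m' + r - k') else \<zero>\<^sub>DD)) i k m = 0"
  proof (cases "k' = j")
   case True
   then have "\<not> (i = i' \<and> k = l \<and> m = m' + r - k')" using False a1 by blast
   then show ?thesis using True dco_dU[of i' l "m' + r - k'" i k m] by (auto simp: dco_scale dU_closed)
  qed (simp add: DD.cs_zero dco_zero)
  moreover have "(if k = l \<and> r \<le> m + j then dco (c \<odot>\<^sub>DD dU i' k' m') i j (m + j - r) else 0) = 0"
  proof (cases "k = l \<and> r \<le> m + j")
   case True
   then have "\<not> (i = i' \<and> j = k' \<and> m + j - r = m')" using False a2 by blast
   then show ?thesis using True dco_dU[of i' k' m' i j "m + j - r"] by (auto simp: dco_scale dU_closed)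
  next
   case F: False
   show ?thesis by (rule if_not_P[OF F])
  qed
  ultimately show ?thesis unfolding L by simp
 qed
qed

end

section \<open>Constructions on modules\<close>

lemma quotient_hom:
 assumes M: "left_module R M" and N: "left_module R N" and H: "submodule H R M"
  and g: "g \<in> lmod_hom R M N" and zero: "\<And>x. x \<in> H ==> g x = \<zero>\<^sub>N"
 obtains h where "h \<in> lmod_hom R (quotient_module M H) N"
  and "\<And>x. x \<in> carrier M ==> h (H +>\<^sub>M x) = g x"
proof -
 interpret M: lmod R M by (rule lmod.intro) fact
 interpret N: lmod R N by (rule lmod.intro) fact
 note Q = M.quotient_module_simps[OF H] and gD = lmod_homD[OF g]
 define h where "h X = g (SOME x. x \<in> carrier M \<and> X = H +>\<^sub>M x)" for X
 have h: "h (H +>\<^sub>M x) = g x" if x: "x \<in> carrier M" for x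
 proof -
  define y where "y = (SOME y. y \<in> carrier M \<and> H +>\<^sub>M x = H +>\<^sub>M y)"
  have "\<exists>y. y \<in> carrier M \<and> H +>\<^sub>M x = H +>\<^sub>M y" using x by (intro exI[of _ x]) simp
  then have y: "y \<in> carrier M \<and> H +>\<^sub>M x = H +>\<^sub>M y" unfolding y_def by (rule someI_ex)
  then have yc: "y \<in> carrier M" and xy: "H +>\<^sub>M x = H +>\<^sub>M y" by (rule conjunct1, rule conjunct2)
  have "x \<ominus>\<^sub>M y \<in> H" by (rule iffD1[OF M.coset_eq_iff[OF H x yc] xy])
  then have "g (x \<ominus>\<^sub>M y) = \<zero>\<^sub>N" by (rule zero)
  then have "g x \<ominus>\<^sub>N g y = \<zero>\<^sub>N" unfolding lmod_hom_diff[OF M N g x yc] .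
  then have "g x = g y" by (rule iffD1[OF N.diff_zero_iff[OF gD(1)[OF x] gD(1)[OF yc]]])
  then show ?thesis unfolding h_def y_def[symmetric] by (rule sym)
 qed
 show thesis
 proof (rule that)
  show "(\<lambda>X\<in>carrier (quotient_module M H). h X) \<in> lmod_hom R (quotient_module M H) N"
  proof (rule lmod_homI[OF _ _ _ M.left_module_quotient[OF H]])
   fix X assume "X \<in> carrier (quotient_module M H)"
   then obtain x where x: "x \<in> carrier M" "X = H +>\<^sub>M x" unfolding Q(1) by (elim imageE) simp
   show "h X \<in> carrier N" unfolding x(2) h[OF x(1)] by (rule gD(1)[OF x(1)])
   show "h (a \<odot>\<^bsub>quotient_module M H\<^esub> X) = a \<odot>\<^sub>N h X" if "a \<in> carrier R" for a
    unfolding x(2) Q(4)[OF that x(1)] h[OF x(1)] h[OF M.smult_closed[OF that x(1)]] by (rule gD(3)[OF that x(1)])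
  next
   fix X Y assume "X \<in> carrier (quotient_module M H)" "Y \<in> carrier (quotient_module M H)"
   then obtain x y where x: "x \<in> carrier M" "X = H +>\<^sub>M x" and y: "y \<in> carrier M" "Y = H +>\<^sub>M y"
    unfolding Q(1) by (elim imageE) simp
   show "h (X \<oplus>\<^bsub>quotient_module M H\<^esub> Y) = h X \<oplus>\<^sub>N h Y"
    unfolding x(2) y(2) Q(3)[OF x(1) y(1)] h[OF x(1)] h[OF y(1)] h[OF M.M.a_closed[OF x(1) y(1)]]
    by (rule gD(2)[OF x(1) y(1)])
  qed
  show "(\<lambda>X\<in>carrier (quotient_module M H). h X) (H +>\<^sub>M x) = g x" if "x \<in> carrier M" for x
   using h[OF that] that by (simp add: Q(1))
 qed
qed

subsection \<open>Finite direct sums and \<open>add\<close>\<close>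

lemma direct_sum_simps:
 "carrier (direct_sum I X) = (\<Pi>\<^sub>E i\<in>I. carrier (X i))"
 "zero (direct_sum I X) = (\<lambda>i\<in>I. \<zero>\<^bsub>X i\<^esub>)"
 "add (direct_sum I X) = (\<lambda>x y. \<lambda>i\<in>I. x i \<oplus>\<^bsub>X i\<^esub> y i)"
 "smult (direct_sum I X) = (\<lambda>a x. \<lambda>i\<in>I. a \<odot>\<^bsub>X i\<^esub> x i)"
 by (simp_all add: direct_sum_def)

lemma direct_sum_memD: "x \<in> carrier (direct_sum I X) ==> i \<in> I ==> x i \<in> carrier (X i)"
 by (auto simp: direct_sum_simps)

lemma direct_sum_memI: "(\<And>i. i \<in> I ==> x i \<in> carrier (X i)) ==> (\<lambda>i\<in>I. x i) \<in> carrier (direct_sum I X)"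
 by (simp add: direct_sum_simps)

lemma direct_sum_ext:
 assumes "x \<in> carrier (direct_sum I X)" "y \<in> carrier (direct_sum I X)" "\<And>i. i \<in> I ==> x i = y i"
 shows "x = y"
 by (rule PiE_ext[of _ I "\<lambda>i. carrier (X i)"]) (use assms in \<open>simp_all add: direct_sum_simps\<close>)

lemma left_module_direct_sum:
 assumes R: "ring R" and X: "\<And>i. i \<in> I ==> left_module R (X i)"
 shows "left_module R (direct_sum I X)"
proof -
 let ?D = "direct_sum I X"
 have g: "abelian_group (X i)" if "i \<in> I" for i using X[OF that] by (rule left_module_abelian_group)
 have clo: "x \<oplus>\<^sub>?D y \<in> carrier ?D" if "x \<in> carrier ?D" "y \<in> carrier ?D" for x y
  unfolding direct_sum_simps(3)
 proof (rule direct_sum_memI)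
  fix i assume i: "i \<in> I"
  show "x i \<oplus>\<^bsub>X i\<^esub> y i \<in> carrier (X i)"
   by (rule abelian_groupE(1)[OF g[OF i] direct_sum_memD[OF that(1) i] direct_sum_memD[OF that(2) i]])
 qed
 have sm: "a \<odot>\<^sub>?D x \<in> carrier ?D" if "a \<in> carrier R" "x \<in> carrier ?D" for a x
  unfolding direct_sum_simps(4)
 proof (rule direct_sum_memI)
  fix i assume i: "i \<in> I"
  show "a \<odot>\<^bsub>X i\<^esub> x i \<in> carrier (X i)"
   by (rule left_module.smult_closed[OF X[OF i] that(1) direct_sum_memD[OF that(2) i]])
 qed
 have ze: "\<zero>\<^sub>?D \<in> carrier ?D"
  unfolding direct_sum_simps(2) by (rule direct_sum_memI) (rule abelian_groupE(2)[OF g])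
 have "abelian_group ?D"
 proof (rule abelian_groupI)
  fix x y z assume x: "x \<in> carrier ?D" and y: "y \<in> carrier ?D" and z: "z \<in> carrier ?D"
  show "x \<oplus>\<^sub>?D y \<oplus>\<^sub>?D z = x \<oplus>\<^sub>?D (y \<oplus>\<^sub>?D z)"
  proof (rule direct_sum_ext[OF clo[OF clo[OF x y] z] clo[OF x clo[OF y z]]])
   fix i assume i: "i \<in> I"
   show "(x \<oplus>\<^sub>?D y \<oplus>\<^sub>?D z) i = (x \<oplus>\<^sub>?D (y \<oplus>\<^sub>?D z)) i"
    using abelian_groupE(3)[OF g[OF i] direct_sum_memD[OF x i] direct_sum_memD[OF y i] direct_sum_memD[OF z i]] i
    by (simp add: direct_sum_simps(3))
  qed
 next
  fix x y assume x: "x \<in> carrier ?D" and y: "y \<in> carrier ?D"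
  show "x \<oplus>\<^sub>?D y \<in> carrier ?D" by (rule clo[OF x y])
  show "x \<oplus>\<^sub>?D y = y \<oplus>\<^sub>?D x"
  proof (rule direct_sum_ext[OF clo[OF x y] clo[OF y x]])
   fix i assume i: "i \<in> I"
   show "(x \<oplus>\<^sub>?D y) i = (y \<oplus>\<^sub>?D x) i"
    using abelian_groupE(4)[OF g[OF i] direct_sum_memD[OF x i] direct_sum_memD[OF y i]] i
    by (simp add: direct_sum_simps(3))
  qed
 next
  fix x assume x: "x \<in> carrier ?D"
  show "\<zero>\<^sub>?D \<oplus>\<^sub>?D x = x"
  proof (rule direct_sum_ext[OF clo[OF ze x] x])
   fix i assume i: "i \<in> I"
   show "(\<zero>\<^sub>?D \<oplus>\<^sub>?D x) i = x i"
    using abelian_groupE(5)[OF g[OF i] direct_sum_memD[OF x i]] i by (simp add: direct_sum_simps(2,3))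
  qed
  let ?m = "\<lambda>i\<in>I. \<ominus>\<^bsub>X i\<^esub> x i"
  have m: "?m \<in> carrier ?D"
  proof (rule direct_sum_memI)
   fix i assume i: "i \<in> I"
   show "\<ominus>\<^bsub>X i\<^esub> x i \<in> carrier (X i)" by (rule abelian_group.a_inv_closed[OF g[OF i] direct_sum_memD[OF x i]])
  qed
  have "?m \<oplus>\<^sub>?D x = \<zero>\<^sub>?D"
  proof (rule direct_sum_ext[OF clo[OF m x] ze])
   fix i assume i: "i \<in> I"
   show "(?m \<oplus>\<^sub>?D x) i = \<zero>\<^sub>?D i"
    using abelian_group.l_neg[OF g[OF i] direct_sum_memD[OF x i]] i by (simp add: direct_sum_simps(2,3))
  qed
  then show "\<exists>y\<in>carrier ?D. y \<oplus>\<^sub>?D x = \<zero>\<^sub>?D" using m by (rule bexI)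
 qed (rule ze)
 moreover have "left_module_axioms R ?D"
 proof (rule left_module_axioms.intro)
  fix a b x assume a: "a \<in> carrier R" and b: "b \<in> carrier R" and x: "x \<in> carrier ?D"
  have ab: "a \<oplus>\<^sub>R b \<in> carrier R" "a \<otimes>\<^sub>R b \<in> carrier R"
   using a b R by (simp_all add: ring.ring_simprules)
  show "(a \<oplus>\<^sub>R b) \<odot>\<^sub>?D x = a \<odot>\<^sub>?D x \<oplus>\<^sub>?D b \<odot>\<^sub>?D x"
  proof (rule direct_sum_ext[OF sm[OF ab(1) x] clo[OF sm[OF a x] sm[OF b x]]])
   fix i assume i: "i \<in> I"
   show "((a \<oplus>\<^sub>R b) \<odot>\<^sub>?D x) i = (a \<odot>\<^sub>?D x \<oplus>\<^sub>?D b \<odot>\<^sub>?D x) i"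
    using left_module.smult_l_distr[OF X[OF i] a b direct_sum_memD[OF x i]] i by (simp add: direct_sum_simps(3,4))
  qed
  show "(a \<otimes>\<^sub>R b) \<odot>\<^sub>?D x = a \<odot>\<^sub>?D (b \<odot>\<^sub>?D x)"
  proof (rule direct_sum_ext[OF sm[OF ab(2) x] sm[OF a sm[OF b x]]])
   fix i assume i: "i \<in> I"
   show "((a \<otimes>\<^sub>R b) \<odot>\<^sub>?D x) i = (a \<odot>\<^sub>?D (b \<odot>\<^sub>?D x)) i"
    using left_module.smult_assoc[OF X[OF i] a b direct_sum_memD[OF x i]] i by (simp add: direct_sum_simps(4))
  qed
 next
  fix a x y assume a: "a \<in> carrier R" and x: "x \<in> carrier ?D" and y: "y \<in> carrier ?D"
  show "a \<odot>\<^sub>?D (x \<oplus>\<^sub>?D y) = a \<odot>\<^sub>?D x \<oplus>\<^sub>?D a \<odot>\<^sub>?D y"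
  proof (rule direct_sum_ext[OF sm[OF a clo[OF x y]] clo[OF sm[OF a x] sm[OF a y]]])
   fix i assume i: "i \<in> I"
   show "(a \<odot>\<^sub>?D (x \<oplus>\<^sub>?D y)) i = (a \<odot>\<^sub>?D x \<oplus>\<^sub>?D a \<odot>\<^sub>?D y) i"
    using left_module.smult_r_distr[OF X[OF i] a direct_sum_memD[OF x i] direct_sum_memD[OF y i]] i
    by (simp add: direct_sum_simps(3,4))
  qed
 next
  fix x assume x: "x \<in> carrier ?D"
  have o: "\<one>\<^sub>R \<in> carrier R" using R by (simp add: ring.ring_simprules)
  show "\<one>\<^sub>R \<odot>\<^sub>?D x = x"
  proof (rule direct_sum_ext[OF sm[OF o x] x])
   fix i assume i: "i \<in> I"
   show "(\<one>\<^sub>R \<odot>\<^sub>?D x) i = x i"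
    using left_module.smult_one[OF X[OF i] direct_sum_memD[OF x i]] i by (simp add: direct_sum_simps(4))
  qed
 qed (rule sm)
 ultimately show ?thesis using R by (simp add: left_module_def)
qed

lemma direct_sum_proj_hom:
 assumes "left_module R (direct_sum I X)" "i \<in> I"
 shows "(\<lambda>x\<in>carrier (direct_sum I X). x i) \<in> lmod_hom R (direct_sum I X) (X i)"
 by (rule lmod_homI[OF direct_sum_memD[OF _ assms(2)] _ _ assms(1)])
  (simp_all add: direct_sum_simps(3,4) assms(2))

lemma direct_sum_tuple_hom:
 assumes M: "left_module R M" and f: "\<And>i. i \<in> I ==> f i \<in> lmod_hom R M (X i)"
 shows "(\<lambda>x\<in>carrier M. \<lambda>i\<in>I. f i x) \<in> lmod_hom R M (direct_sum I X)"
proof (rule lmod_homI[OF _ _ _ M])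
 fix x assume "x \<in> carrier M"
 then show "(\<lambda>i\<in>I. f i x) \<in> carrier (direct_sum I X)"
  by (intro direct_sum_memI) (rule lmod_homD(1)[OF f])
next
 fix x y assume "x \<in> carrier M" "y \<in> carrier M"
 then show "(\<lambda>i\<in>I. f i (x \<oplus>\<^sub>M y)) = (\<lambda>i\<in>I. f i x) \<oplus>\<^bsub>direct_sum I X\<^esub> (\<lambda>i\<in>I. f i y)"
  using lmod_homD(2)[OF f] by (simp add: direct_sum_simps(3) cong: restrict_cong)
next
 fix a x assume "a \<in> carrier R" "x \<in> carrier M"
 then show "(\<lambda>i\<in>I. f i (a \<odot>\<^sub>M x)) = a \<odot>\<^bsub>direct_sum I X\<^esub> (\<lambda>i\<in>I. f i x)"
  using lmod_homD(3)[OF f] by (simp add: direct_sum_simps(4) cong: restrict_cong)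
qed

lemma direct_sum_map_hom:
 assumes X: "left_module R (direct_sum I X)" and f: "\<And>i. i \<in> I ==> f i \<in> lmod_hom R (X i) (Y i)"
 shows "(\<lambda>x\<in>carrier (direct_sum I X). \<lambda>i\<in>I. f i (x i)) \<in> lmod_hom R (direct_sum I X) (direct_sum I Y)"
proof -
 let ?p = "\<lambda>i. \<lambda>x\<in>carrier (direct_sum I X). f i ((\<lambda>x\<in>carrier (direct_sum I X). x i) x)"
 have "?p i \<in> lmod_hom R (direct_sum I X) (Y i)" if "i \<in> I" for i
  by (rule lmod_hom_compose[OF direct_sum_proj_hom[OF X that] f[OF that] X])
 from direct_sum_tuple_hom[OF X this]
 have "(\<lambda>x\<in>carrier (direct_sum I X). \<lambda>i\<in>I. ?p i x) \<in> lmod_hom R (direct_sum I X) (direct_sum I Y)" .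
 moreover have "(\<lambda>x\<in>carrier (direct_sum I X). \<lambda>i\<in>I. ?p i x) = (\<lambda>x\<in>carrier (direct_sum I X). \<lambda>i\<in>I. f i (x i))"
  by (intro restrict_ext) simp
 ultimately show ?thesis by simp
qed

lemma direct_sum_map_bij:
 assumes f: "\<And>i. i \<in> I ==> inj_on (f i) (carrier (X i))"
 shows "inj_on (\<lambda>x\<in>carrier (direct_sum I X). \<lambda>i\<in>I. f i (x i)) (carrier (direct_sum I X))"
proof (rule inj_onI)
 fix x y assume x: "x \<in> carrier (direct_sum I X)" and y: "y \<in> carrier (direct_sum I X)"
  and e: "(\<lambda>x\<in>carrier (direct_sum I X). \<lambda>i\<in>I. f i (x i)) x = (\<lambda>x\<in>carrier (direct_sum I X). \<lambda>i\<in>I. f i (x i)) y"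
 show "x = y"
 proof (rule direct_sum_ext[OF x y])
  fix i assume i: "i \<in> I"
  have "f i (x i) = f i (y i)" using fun_cong[OF e, of i] x y i by simp
  then show "x i = y i" using inj_onD[OF f[OF i]] direct_sum_memD[OF x i] direct_sum_memD[OF y i] by blast
 qed
qed

lemma in_add_retract:
 assumes M: "left_module R M" and i: "i \<in> lmod_hom R M M'" and p: "p \<in> lmod_hom R M' M"
  and pi: "\<And>m. m \<in> carrier M ==> p (i m) = m"
  and add: "in_add R X M'" and X: "left_module R X"
 shows "in_add R X M"
proof -
 from add obtain k :: nat and j q where j: "j \<in> lmod_hom R M' (direct_sum {..<k} (\<lambda>_. X))"
  and q: "q \<in> lmod_hom R (direct_sum {..<k} (\<lambda>_. X)) M'" and qj: "\<forall>m\<in>carrier M'. q (j m) = m"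
  unfolding in_add_def by blast
 have S: "left_module R (direct_sum {..<k} (\<lambda>_. X))"
  by (rule left_module_direct_sum[OF left_module_ring[OF M] X])
 have "(\<lambda>x\<in>carrier (direct_sum {..<k} (\<lambda>_. X)). p (q x)) ((\<lambda>x\<in>carrier M. j (i x)) m) = m"
  if m: "m \<in> carrier M" for m
  using m pi[OF m] qj lmod_homD(1)[OF i m] lmod_homD(1)[OF j] by simp
 then show ?thesis
  unfolding in_add_def using lmod_hom_compose[OF i j M] lmod_hom_compose[OF q p S] by blast
qed

lemma in_add_power: "left_module R X ==> in_add R X (direct_sum {..<k::nat} (\<lambda>_. X))"
 unfolding in_add_def
proof (intro exI[of _ k] bexI)
 assume X: "left_module R X"
 have S: "left_module R (direct_sum {..<k} (\<lambda>_. X))"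
  by (rule left_module_direct_sum[OF left_module_ring[OF X] X])
 show "(\<lambda>x\<in>carrier (direct_sum {..<k} (\<lambda>_. X)). x) \<in> lmod_hom R (direct_sum {..<k} (\<lambda>_. X)) (direct_sum {..<k} (\<lambda>_. X))"
  "(\<lambda>x\<in>carrier (direct_sum {..<k} (\<lambda>_. X)). x) \<in> lmod_hom R (direct_sum {..<k} (\<lambda>_. X)) (direct_sum {..<k} (\<lambda>_. X))"
  by (rule lmod_hom_ident[OF S])+
qed simp

abbreviation pair_sum :: "('a, 'b) module => ('a, 'b) module => ('a, nat => 'b) module"
 where "pair_sum M N \<equiv> direct_sum {..<2} (\<lambda>i. if i = 0 then M else N)"

text \<open>If \<open>M\<close> is a retract of \<open>k\<close> copies of \<open>X\<close> and \<open>N\<close> of \<open>l\<close> copies, then their sum is one of \<open>k + l\<close> copies.\<close>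

lemma in_add_pair_sum:
 assumes M: "left_module R M" and N: "left_module R N" and X: "left_module R X"
  and aM: "in_add R X M" and aN: "in_add R X N"
 shows "in_add R X (pair_sum M N)"
proof -
 from aM obtain k :: nat and i p where i: "i \<in> lmod_hom R M (direct_sum {..<k} (\<lambda>_. X))"
  and p: "p \<in> lmod_hom R (direct_sum {..<k} (\<lambda>_. X)) M" and pi: "\<forall>m\<in>carrier M. p (i m) = m"
  unfolding in_add_def by blast
 from aN obtain l :: nat and j q where j: "j \<in> lmod_hom R N (direct_sum {..<l} (\<lambda>_. X))"
  and q: "q \<in> lmod_hom R (direct_sum {..<l} (\<lambda>_. X)) N" and qj: "\<forall>m\<in>carrier N. q (j m) = m"
  unfolding in_add_def by blast
 let ?P = "pair_sum M N" and ?S = "direct_sum {..<k + l} (\<lambda>_. X)"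
 let ?K = "direct_sum {..<k} (\<lambda>_. X)" and ?L = "direct_sum {..<l} (\<lambda>_. X)"
 have R: "ring R" by (rule left_module_ring[OF M])
 have P: "left_module R ?P" by (rule left_module_direct_sum[OF R]) (simp add: M N)
 have S: "left_module R ?S" and K: "left_module R ?K" and L: "left_module R ?L"
  by (rule left_module_direct_sum[OF R X])+
 have pr: "(\<lambda>x\<in>carrier ?P. x 0) \<in> lmod_hom R ?P M" "(\<lambda>x\<in>carrier ?P. x 1) \<in> lmod_hom R ?P N"
  using direct_sum_proj_hom[OF P, of 0] direct_sum_proj_hom[OF P, of 1] by simp_all
 have pm: "x 0 \<in> carrier M" "x 1 \<in> carrier N" if "x \<in> carrier ?P" for x
  using direct_sum_memD[OF that, of 0] direct_sum_memD[OF that, of 1] by simp_all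
 let ?c = "\<lambda>a. if a < k then (\<lambda>x\<in>carrier ?P. i (x 0) a) else (\<lambda>x\<in>carrier ?P. j (x 1) (a - k))"
 have ph: "(\<lambda>x\<in>carrier ?P. i (x 0) a) \<in> lmod_hom R ?P X" if "a < k" for a
 proof -
  have "(\<lambda>x\<in>carrier ?P. (\<lambda>y\<in>carrier ?K. y a) ((\<lambda>x\<in>carrier ?P. i ((\<lambda>x\<in>carrier ?P. x 0) x)) x)) \<in> lmod_hom R ?P X"
   by (rule lmod_hom_compose[OF lmod_hom_compose[OF pr(1) i P] direct_sum_proj_hom[OF K] P]) (simp add: that)
  moreover have "(\<lambda>x\<in>carrier ?P. (\<lambda>y\<in>carrier ?K. y a) ((\<lambda>x\<in>carrier ?P. i ((\<lambda>x\<in>carrier ?P. x 0) x)) x))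
    = (\<lambda>x\<in>carrier ?P. i (x 0) a)"
   by (rule restrict_ext) (simp add: lmod_homD(1)[OF i] pm)
  ultimately show ?thesis by simp
 qed
 have qh: "(\<lambda>x\<in>carrier ?P. j (x 1) a) \<in> lmod_hom R ?P X" if "a < l" for a
 proof -
  have "(\<lambda>x\<in>carrier ?P. (\<lambda>y\<in>carrier ?L. y a) ((\<lambda>x\<in>carrier ?P. j ((\<lambda>x\<in>carrier ?P. x 1) x)) x)) \<in> lmod_hom R ?P X"
   by (rule lmod_hom_compose[OF lmod_hom_compose[OF pr(2) j P] direct_sum_proj_hom[OF L] P]) (simp add: that)
  moreover have "(\<lambda>x\<in>carrier ?P. (\<lambda>y\<in>carrier ?L. y a) ((\<lambda>x\<in>carrier ?P. j ((\<lambda>x\<in>carrier ?P. x 1) x)) x))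
    = (\<lambda>x\<in>carrier ?P. j (x 1) a)"
   by (rule restrict_ext) (simp add: lmod_homD(1)[OF j] pm[unfolded One_nat_def])
  ultimately show ?thesis by simp
 qed
 have I: "(\<lambda>x\<in>carrier ?P. \<lambda>a\<in>{..<k + l}. ?c a x) \<in> lmod_hom R ?P ?S"
 proof (rule direct_sum_tuple_hom[OF P])
  fix a assume a: "a \<in> {..<k + l}"
  show "?c a \<in> lmod_hom R ?P X"
  proof (cases "a < k")
   case True
   show ?thesis unfolding if_P[OF True] by (rule ph[OF True])
  next
   case False
   then have "a - k < l" using a by simp
   then show ?thesis unfolding if_not_P[OF False] by (rule qh)
  qed
 qed
 have sK: "(\<lambda>y\<in>carrier ?S. \<lambda>a\<in>{..<k}. (\<lambda>y\<in>carrier ?S. y a) y) \<in> lmod_hom R ?S ?K"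
  by (rule direct_sum_tuple_hom[OF S], rule direct_sum_proj_hom[OF S]) simp
 have sL: "(\<lambda>y\<in>carrier ?S. \<lambda>a\<in>{..<l}. (\<lambda>y\<in>carrier ?S. y (a + k)) y) \<in> lmod_hom R ?S ?L"
  by (rule direct_sum_tuple_hom[OF S], rule direct_sum_proj_hom[OF S]) simp
 define F1 where "F1 = (\<lambda>y\<in>carrier ?S. p ((\<lambda>y\<in>carrier ?S. \<lambda>a\<in>{..<k}. (\<lambda>y\<in>carrier ?S. y a) y) y))"
 define F2 where "F2 = (\<lambda>y\<in>carrier ?S. q ((\<lambda>y\<in>carrier ?S. \<lambda>a\<in>{..<l}. (\<lambda>y\<in>carrier ?S. y (a + k)) y) y))"
 have F: "F1 \<in> lmod_hom R ?S M" "F2 \<in> lmod_hom R ?S N"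
  unfolding F1_def F2_def by (rule lmod_hom_compose[OF sK p S], rule lmod_hom_compose[OF sL q S])
 have Q: "(\<lambda>y\<in>carrier ?S. \<lambda>b\<in>{..<2}. (if b = 0 then F1 y else F2 y)) \<in> lmod_hom R ?S ?P"
 proof -
  have "(\<lambda>y\<in>carrier ?S. \<lambda>b\<in>{..<2::nat}. (if b = 0 then F1 else F2) y) \<in> lmod_hom R ?S ?P"
  proof (rule direct_sum_tuple_hom[OF S])
   fix b :: nat
   show "(if b = 0 then F1 else F2) \<in> lmod_hom R ?S (if b = 0 then M else N)"
    using F by (cases "b = 0") simp_all
  qed
  moreover have "(if b = 0 then F1 else F2) y = (if b = 0 then F1 y else F2 y)" for b :: nat and y by simp
  ultimately show ?thesis by simp
 qed
 have "(\<lambda>y\<in>carrier ?S. \<lambda>b\<in>{..<2}. (if b = 0 then F1 y else F2 y)) ((\<lambda>x\<in>carrier ?P. \<lambda>a\<in>{..<k + l}. ?c a x) x) = x"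
  if x: "x \<in> carrier ?P" for x
 proof -
  define y where "y = (\<lambda>x\<in>carrier ?P. \<lambda>a\<in>{..<k + l}. ?c a x) x"
  have y: "y \<in> carrier ?S" unfolding y_def by (rule lmod_homD(1)[OF I x])
  have ya: "y a = ?c a x" if "a < k + l" for a using x that by (simp add: y_def)
  have y1: "(\<lambda>a\<in>{..<k}. y a) = i (x 0)"
  proof (rule direct_sum_ext[of _ "{..<k}" "\<lambda>_. X"])
   show "i (x 0) \<in> carrier ?K" by (rule lmod_homD(1)[OF i pm(1)[OF x]])
   show "(\<lambda>a\<in>{..<k}. y a) \<in> carrier ?K" by (rule direct_sum_memI) (rule direct_sum_memD[OF y], simp)
  qed (use x in \<open>simp add: ya\<close>)
  have y2: "(\<lambda>a\<in>{..<l}. y (a + k)) = j (x 1)"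
  proof (rule direct_sum_ext[of _ "{..<l}" "\<lambda>_. X"])
   show "j (x 1) \<in> carrier ?L" by (rule lmod_homD(1)[OF j pm(2)[OF x]])
   show "(\<lambda>a\<in>{..<l}. y (a + k)) \<in> carrier ?L" by (rule direct_sum_memI) (rule direct_sum_memD[OF y], simp)
  qed (use x in \<open>simp add: ya\<close>)
  have "F1 y = p (\<lambda>a\<in>{..<k}. y a)" "F2 y = q (\<lambda>a\<in>{..<l}. y (a + k))"
   unfolding F1_def F2_def by (simp_all only: restrict_apply'[OF y])
  then have F12: "F1 y = x 0" "F2 y = x 1" unfolding y1 y2 using pi qj pm[OF x] by simp_all
  have "(\<lambda>y\<in>carrier ?S. \<lambda>b\<in>{..<2}. (if b = 0 then F1 y else F2 y)) y = (\<lambda>b\<in>{..<2}. if b = 0 then x 0 else x 1)"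
   unfolding restrict_apply'[OF y] F12 ..
  also have "\<dots> = x"
  proof (rule direct_sum_ext[OF direct_sum_memI x])
   fix b :: nat assume b: "b \<in> {..<2}"
   then have "b = 0 \<or> b = 1" by auto
   then show "(if b = 0 then x 0 else x 1) \<in> carrier (if b = 0 then M else N)"
    "(\<lambda>b\<in>{..<2}. if b = 0 then x 0 else x 1) b = x b"
    using b pm[OF x] by auto
  qed
  finally show ?thesis unfolding y_def .
 qed
 then show ?thesis unfolding in_add_def using I Q by blast
qed

subsection \<open>Copies of modules\<close>

text \<open>Transport of structure along an injection of the carrier. It moves modules built from \<open>D\<close> into the
 universe of the categories.\<close>

definition copy_mod :: "('b => 'c) => ('a, 'b) module => ('a, 'c) module"
 where "copy_mod e M = \<lparr>carrier = e ` carrier M, mult = undefined, one = undefined, zero = e \<zero>\<^sub>M,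
  add = (\<lambda>x y. e (inv_into (carrier M) e x \<oplus>\<^sub>M inv_into (carrier M) e y)),
  smult = (\<lambda>a x. e (a \<odot>\<^sub>M inv_into (carrier M) e x))\<rparr>"

lemma copy_mod:
 assumes M: "left_module R M" and e: "inj_on e (carrier M)"
 shows "left_module R (copy_mod e M)"
  and "(\<lambda>x\<in>carrier M. e x) \<in> lmod_hom R M (copy_mod e M)"
  and "bij_betw (\<lambda>x\<in>carrier M. e x) (carrier M) (carrier (copy_mod e M))"
proof -
 interpret M: lmod R M by (rule lmod.intro[OF M])
 have s: "e x \<oplus>\<^bsub>copy_mod e M\<^esub> e y = e (x \<oplus>\<^sub>M y)" if "x \<in> carrier M" "y \<in> carrier M" for x y
  using that by (simp add: copy_mod_def inv_into_f_f[OF e])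
 have t: "a \<odot>\<^bsub>copy_mod e M\<^esub> e x = e (a \<odot>\<^sub>M x)" if "x \<in> carrier M" for a x
  using that by (simp add: copy_mod_def inv_into_f_f[OF e])
 have c: "e ` carrier M = carrier (copy_mod e M)" by (simp add: copy_mod_def)
 show "left_module R (copy_mod e M)"
  by (rule left_module_image[OF M left_module_ring[OF M] ring_hom_ident _ c])
   (simp_all add: s t, simp add: copy_mod_def)
 show "(\<lambda>x\<in>carrier M. e x) \<in> lmod_hom R M (copy_mod e M)"
  by (rule lmod_homI[OF _ _ _ M]) (simp_all add: s t c[symmetric])
 show "bij_betw (\<lambda>x\<in>carrier M. e x) (carrier M) (carrier (copy_mod e M))"
  unfolding bij_betw_def using e c by (simp add: inj_on_def)
qed

subsection \<open>Finite-dimensional modules\<close>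

locale amod = A?: calg A + lmod A M for A :: "(complex, 'a) module" and M :: "('a, 'b) module"
begin

abbreviation "sc \<equiv> scal A M"

lemma c1_closed: "c \<odot>\<^sub>A \<one>\<^sub>A \<in> carrier A"
 by (rule cs_closed) simp

lemma sc_closed: "x \<in> carrier M ==> sc c x \<in> carrier M"
 unfolding scal_def by (rule smult_closed[OF c1_closed])

lemma sc_radd: "x \<in> carrier M ==> y \<in> carrier M ==> sc c (x \<oplus>\<^sub>M y) = sc c x \<oplus>\<^sub>M sc c y"
 unfolding scal_def by (rule smult_r_distr[OF c1_closed])

lemma sc_ladd: "x \<in> carrier M ==> sc (c + d) x = sc c x \<oplus>\<^sub>M sc d x"
 unfolding scal_def by (simp add: cs_ladd smult_l_distr c1_closed)

lemma smult_scale: "a \<in> carrier A ==> x \<in> carrier M ==> (c \<odot>\<^sub>A a) \<odot>\<^sub>M x = sc c (a \<odot>\<^sub>M x)"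
 unfolding scal_def using smult_assoc[OF c1_closed, of a x c] by (simp add: cs_one_mult)

lemma smult_sc: "a \<in> carrier A ==> x \<in> carrier M ==> a \<odot>\<^sub>M sc c x = sc c (a \<odot>\<^sub>M x)"
 unfolding scal_def using smult_assoc[OF _ c1_closed, of a x c] smult_assoc[OF c1_closed, of a x c]
 by (simp add: cs_one_mult cs_mult_one)

lemma sc_assoc: "x \<in> carrier M ==> sc (c * d) x = sc c (sc d x)"
 unfolding scal_def using smult_assoc[OF c1_closed c1_closed, of x c d]
 by (simp add: cs_one_mult c1_closed cs_assoc)

lemma sc_one: "x \<in> carrier M ==> sc 1 x = x"
 unfolding scal_def by (simp add: cs_one smult_one)

lemma sc_zero_left: "x \<in> carrier M ==> sc 0 x = \<zero>\<^sub>M"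
 using sc_ladd[of x 0 0] sc_closed[of x 0] by simp

lemma sc_zero_right: "sc c \<zero>\<^sub>M = \<zero>\<^sub>M"
 unfolding scal_def by (rule smult_r_null[OF c1_closed])

lemma sc_eq_zeroD: "x \<in> carrier M ==> sc c x = \<zero>\<^sub>M ==> c \<noteq> 0 ==> x = \<zero>\<^sub>M"
 using sc_assoc[of x "inverse c" c] by (simp add: sc_one sc_zero_right)

definition csub :: "'b set => bool"
 where "csub H \<longleftrightarrow> H \<subseteq> carrier M \<and> \<zero>\<^sub>M \<in> H \<and> (\<forall>x\<in>H. \<forall>y\<in>H. x \<oplus>\<^sub>M y \<in> H) \<and> (\<forall>c. \<forall>x\<in>H. sc c x \<in> H)"

lemma submodule_sc: "submodule H A M ==> x \<in> H ==> sc c x \<in> H"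
 unfolding scal_def by (rule submoduleD(7)[OF _ c1_closed])

lemma csub_finsum:
 assumes "csub H" "finite S" "\<And>s. s \<in> S ==> f s \<in> H"
 shows "(\<Oplus>\<^bsub>M\<^esub>s\<in>S. f s) \<in> H"
 using assms(2,3)
proof (induction S rule: finite_induct)
 case (insert s S)
 have "f \<in> S \<rightarrow> carrier M" "f s \<in> carrier M" using insert.prems assms(1) by (auto simp: csub_def)
 then show ?case using insert assms(1) by (simp add: csub_def)
qed (use assms(1) in \<open>simp add: csub_def\<close>)

lemma sc_finsum:
 assumes "finite S" "\<And>s. s \<in> S ==> f s \<in> carrier M"
 shows "sc c (\<Oplus>\<^bsub>M\<^esub>s\<in>S. f s) = (\<Oplus>\<^bsub>M\<^esub>s\<in>S. sc c (f s))"
 using assms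
proof (induction S rule: finite_induct)
 case (insert s S)
 have "f \<in> S \<rightarrow> carrier M" "f s \<in> carrier M" using insert.prems by auto
 moreover have "(\<lambda>s. sc c (f s)) \<in> S \<rightarrow> carrier M" using insert.prems sc_closed by auto
 ultimately show ?case using insert by (simp add: sc_radd sc_closed)
qed (simp add: sc_zero_right)

text \<open>Generation by linear subspaces avoids linear combinations in the later arguments.\<close>

lemma finite_dimensional_iff:
 "finite_dimensional A M \<longleftrightarrow>
  (\<exists>S. finite S \<and> S \<subseteq> carrier M \<and> (\<forall>H. csub H --> S \<subseteq> H --> carrier M \<subseteq> H))"
proof
 assume "finite_dimensional A M"
 then obtain S where S: "finite S" "S \<subseteq> carrier M"
  and sp: "\<And>x. x \<in> carrier M ==> \<exists>c. x = (\<Oplus>\<^bsub>M\<^esub>s\<in>S. sc (c s) s)"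
  unfolding finite_dimensional_def by blast
 have "carrier M \<subseteq> H" if H: "csub H" "S \<subseteq> H" for H
 proof
  fix x assume "x \<in> carrier M"
  then obtain c where x: "x = (\<Oplus>\<^bsub>M\<^esub>s\<in>S. sc (c s) s)" using sp by blast
  show "x \<in> H" unfolding x by (rule csub_finsum[OF H(1) S(1)]) (use H in \<open>auto simp: csub_def\<close>)
 qed
 then show "\<exists>S. finite S \<and> S \<subseteq> carrier M \<and> (\<forall>H. csub H --> S \<subseteq> H --> carrier M \<subseteq> H)" using S by blast
next
 assume "\<exists>S. finite S \<and> S \<subseteq> carrier M \<and> (\<forall>H. csub H --> S \<subseteq> H --> carrier M \<subseteq> H)"
 then obtain S where S: "finite S" "S \<subseteq> carrier M" and sp: "\<And>H. csub H ==> S \<subseteq> H ==> carrier M \<subseteq> H" by blast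
 define L where "L c = (\<Oplus>\<^bsub>M\<^esub>s\<in>S. sc (c s) s)" for c
 have f: "(\<lambda>s. sc (c s) s) \<in> S \<rightarrow> carrier M" for c using S(2) sc_closed by auto
 have Lc: "L c \<in> carrier M" for c unfolding L_def by (rule M.finsum_closed[OF f])
 have Ladd: "L c \<oplus>\<^sub>M L d = L (\<lambda>s. c s + d s)" for c d
 proof -
  have "L c \<oplus>\<^sub>M L d = (\<Oplus>\<^bsub>M\<^esub>s\<in>S. sc (c s) s \<oplus>\<^sub>M sc (d s) s)" unfolding L_def by (rule M.finsum_addf[OF f f, symmetric])
  also have "\<dots> = L (\<lambda>s. c s + d s)" unfolding L_def
   by (rule M.finsum_cong'[OF refl f]) (use S(2) sc_ladd in auto)
  finally show ?thesis .
 qed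
 have Lsc: "sc d (L c) = L (\<lambda>s. d * c s)" for c d
 proof -
  have "sc d (L c) = (\<Oplus>\<^bsub>M\<^esub>s\<in>S. sc d (sc (c s) s))" unfolding L_def
   by (rule sc_finsum[OF S(1)]) (use S(2) sc_closed in auto)
  also have "\<dots> = L (\<lambda>s. d * c s)" unfolding L_def
   by (rule M.finsum_cong'[OF refl f]) (use S(2) sc_assoc in auto)
  finally show ?thesis .
 qed
 have L0: "L (\<lambda>_. 0) = \<zero>\<^sub>M"
 proof -
  have "L (\<lambda>_. 0) = (\<Oplus>\<^bsub>M\<^esub>s\<in>S. \<zero>\<^sub>M)" unfolding L_def
   by (rule M.finsum_cong'[OF refl]) (use S(2) sc_zero_left in auto)
  then show ?thesis by simp
 qed
 have L1: "L (\<lambda>s. if t = s then 1 else 0) = t" if "t \<in> S" for t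
 proof -
  have "L (\<lambda>s. if t = s then 1 else 0) = (\<Oplus>\<^bsub>M\<^esub>s\<in>S. if t = s then s else \<zero>\<^sub>M)" unfolding L_def
   by (rule M.finsum_cong'[OF refl]) (use S(2) sc_zero_left sc_one in auto)
  also have "\<dots> = t" by (rule M.finsum_singleton[OF that S(1)]) (use S(2) in auto)
  finally show ?thesis .
 qed
 have "csub (range L)"
  unfolding csub_def
 proof (intro conjI ballI allI)
  show "range L \<subseteq> carrier M" using Lc by blast
  show "\<zero>\<^sub>M \<in> range L" unfolding L0[symmetric] by (rule rangeI)
  show "x \<oplus>\<^sub>M y \<in> range L" if "x \<in> range L" "y \<in> range L" for x y
   using that by (elim rangeE) (simp add: Ladd)
  show "sc c x \<in> range L" if "x \<in> range L" for c x using that by (elim rangeE) (simp add: Lsc)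
 qed
 moreover have "S \<subseteq> range L" using L1 by (metis rangeI subsetI)
 ultimately have "carrier M \<subseteq> range L" by (rule sp)
 then have "\<exists>c. x = (\<Oplus>\<^bsub>M\<^esub>s\<in>S. sc (c s) s)" if "x \<in> carrier M" for x
  using that unfolding L_def by blast
 then show "finite_dimensional A M" unfolding finite_dimensional_def using S by blast
qed

end

lemma amod_intro: "calg A ==> left_module A M ==> amod A M"
 by (intro amod.intro lmod.intro)

lemma hom_scal:
 assumes "calg A" "f \<in> lmod_hom A M N" "x \<in> carrier M"
 shows "f (scal A M c x) = scal A N c (f x)"
proof -
 interpret calg A by fact
 show ?thesis unfolding scal_def by (rule lmod_homD(3)[OF assms(2) cs_closed[OF one_closed] assms(3)])
qed

lemma finite_dimensional_image:
 assumes M: "amod A M" and N: "amod B N"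
  and \<phi>: "\<phi> ` carrier M = carrier N"
  and add: "\<And>x y. x \<in> carrier M ==> y \<in> carrier M ==> \<phi> (x \<oplus>\<^sub>M y) = \<phi> x \<oplus>\<^sub>N \<phi> y"
  and sc: "\<And>c x. x \<in> carrier M ==> \<phi> (scal A M c x) = scal B N c (\<phi> x)"
  and fd: "finite_dimensional A M"
 shows "finite_dimensional B N"
proof -
 interpret M: amod A M by fact
 interpret N: amod B N by fact
 from fd obtain S where S: "finite S" "S \<subseteq> carrier M"
  and sp: "\<And>H. M.csub H ==> S \<subseteq> H ==> carrier M \<subseteq> H" unfolding M.finite_dimensional_iff by blast
 have cl: "\<phi> x \<in> carrier N" if "x \<in> carrier M" for x unfolding \<phi>[symmetric] by (rule imageI[OF that])
 have zero: "\<phi> \<zero>\<^sub>M = \<zero>\<^sub>N"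
  using sc[of "\<zero>\<^sub>M" 0] N.sc_zero_left[OF cl[OF M.M.zero_closed]] M.sc_zero_left[OF M.M.zero_closed] by simp
 show ?thesis unfolding N.finite_dimensional_iff
 proof (intro exI[of _ "\<phi> ` S"] conjI allI impI)
  show "finite (\<phi> ` S)" using S(1) by simp
  show "\<phi> ` S \<subseteq> carrier N" using S(2) cl by auto
  fix H assume H: "N.csub H" "\<phi> ` S \<subseteq> H"
  let ?K = "{x \<in> carrier M. \<phi> x \<in> H}"
  have "M.csub ?K"
   using H(1) unfolding M.csub_def N.csub_def by (auto simp: add sc zero M.sc_closed)
  moreover have "S \<subseteq> ?K" using S(2) H(2) by auto
  ultimately have "carrier M \<subseteq> ?K" by (rule sp)
  then show "carrier N \<subseteq> H" unfolding \<phi>[symmetric] by auto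
 qed
qed

lemma finite_dimensional_hom_image:
 assumes A: "calg A" and M: "left_module A M" and N: "left_module A N" and f: "f \<in> lmod_hom A M N"
  and im: "f ` carrier M = carrier N" and fd: "finite_dimensional A M"
 shows "finite_dimensional A N"
 by (rule finite_dimensional_image[OF amod_intro[OF A M] amod_intro[OF A N] im lmod_homD(2)[OF f]
    hom_scal[OF A f] fd])

text \<open>The map \<open>\<phi>\<close> may land in a module over another algebra, as the projection \<open>M \<rightarrow> M / \<eta> M\<close> does.\<close>

lemma finite_dimensional_extension:
 assumes M: "amod A M" and N: "amod B N" and X: "submodule X A M"
  and fdX: "finite_dimensional A (res M X)"
  and \<phi>: "\<phi> ` carrier M = carrier N"
  and add: "\<And>x y. x \<in> carrier M ==> y \<in> carrier M ==> \<phi> (x \<oplus>\<^sub>M y) = \<phi> x \<oplus>\<^sub>N \<phi> y"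
  and sc: "\<And>c x. x \<in> carrier M ==> \<phi> (scal A M c x) = scal B N c (\<phi> x)"
  and ker: "\<And>x y. x \<in> carrier M ==> y \<in> carrier M ==> \<phi> x = \<phi> y ==> x \<ominus>\<^sub>M y \<in> X"
  and fd: "finite_dimensional B N"
 shows "finite_dimensional A M"
proof -
 interpret M: amod A M by fact
 interpret N: amod B N by fact
 interpret X: amod A "res M X" by (rule amod_intro[OF M.A.calg_axioms M.left_module_restrict[OF X]])
 have cl: "\<phi> x \<in> carrier N" if "x \<in> carrier M" for x unfolding \<phi>[symmetric] by (rule imageI[OF that])
 from fd obtain S where S: "finite S" "S \<subseteq> carrier N"
  and sp: "\<And>H. N.csub H ==> S \<subseteq> H ==> carrier N \<subseteq> H" unfolding N.finite_dimensional_iff by blast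
 from fdX obtain T where T: "finite T" "T \<subseteq> X"
  and tp: "\<And>H. X.csub H ==> T \<subseteq> H ==> X \<subseteq> H" unfolding X.finite_dimensional_iff by auto
 define lift where "lift = inv_into (carrier M) \<phi>"
 have lift: "lift s \<in> carrier M" "\<phi> (lift s) = s" if "s \<in> carrier N" for s
  using that unfolding lift_def \<phi>[symmetric] by (auto intro: inv_into_into f_inv_into_f)
 have scX: "scal A (res M X) c x = scal A M c x" for c x by (simp add: scal_def)
 show ?thesis unfolding M.finite_dimensional_iff
 proof (intro exI[of _ "T \<union> lift ` S"] conjI allI impI)
  show "finite (T \<union> lift ` S)" using S(1) T(1) by simp
  show "T \<union> lift ` S \<subseteq> carrier M" using S(2) T(2) M.submoduleD(1)[OF X] lift(1) by auto
  fix H assume H: "M.csub H" "T \<union> lift ` S \<subseteq> H"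
  have "X.csub (X \<inter> H)"
   using H(1) M.submoduleD[OF X] M.submodule_sc[OF X] unfolding M.csub_def X.csub_def scX by auto
  then have XH: "X \<subseteq> H" using tp[of "X \<inter> H"] T(2) H(2) by auto
  have "N.csub (\<phi> ` H)"
   unfolding N.csub_def
  proof (intro conjI ballI allI)
   have HM: "H \<subseteq> carrier M" using H(1) by (simp add: M.csub_def)
   then show "\<phi> ` H \<subseteq> carrier N" using cl by auto
   have "\<phi> \<zero>\<^sub>M = \<zero>\<^sub>N"
    using sc[of "\<zero>\<^sub>M" 0] N.sc_zero_left[OF cl[OF M.M.zero_closed]] M.sc_zero_left[OF M.M.zero_closed] by simp
   then show "\<zero>\<^sub>N \<in> \<phi> ` H" using H(1) unfolding M.csub_def by (metis imageI)
   show "a \<oplus>\<^sub>N b \<in> \<phi> ` H" if "a \<in> \<phi> ` H" "b \<in> \<phi> ` H" for a b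
   proof -
    from that obtain x y where x: "x \<in> H" "y \<in> H" "a = \<phi> x" "b = \<phi> y" by (elim imageE) simp
    then have "a \<oplus>\<^sub>N b = \<phi> (x \<oplus>\<^sub>M y)"
     using add[OF subsetD[OF HM x(1)] subsetD[OF HM x(2)]] by simp
    moreover have "x \<oplus>\<^sub>M y \<in> H" using x H(1) by (simp add: M.csub_def)
    ultimately show ?thesis by simp
   qed
   show "scal B N c a \<in> \<phi> ` H" if "a \<in> \<phi> ` H" for a c
   proof -
    from that obtain x where x: "x \<in> H" "a = \<phi> x" by (elim imageE) simp
    then have "scal B N c a = \<phi> (scal A M c x)" using sc[OF subsetD[OF HM x(1)]] by simp
    moreover have "scal A M c x \<in> H" using x H(1) by (simp add: M.csub_def)
    ultimately show ?thesis by simp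
   qed
  qed
  moreover have "S \<subseteq> \<phi> ` H"
  proof
   fix s assume "s \<in> S"
   then have "s = \<phi> (lift s)" "lift s \<in> H" using lift(2) S(2) H(2) by auto
   then show "s \<in> \<phi> ` H" by (rule image_eqI)
  qed
  ultimately have NH: "carrier N \<subseteq> \<phi> ` H" by (rule sp)
  show "carrier M \<subseteq> H"
  proof
   fix x assume x: "x \<in> carrier M"
   then have "\<phi> x \<in> \<phi> ` H" using cl NH by auto
   then obtain h where h: "h \<in> H" "\<phi> x = \<phi> h" by (elim imageE) simp
   then have hM: "h \<in> carrier M" using H(1) by (auto simp: M.csub_def)
   have "x \<ominus>\<^sub>M h \<in> H" using ker[OF x hM h(2)] XH by auto
   then have "(x \<ominus>\<^sub>M h) \<oplus>\<^sub>M h \<in> H" using h(1) H(1) by (simp add: M.csub_def)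
   then show "x \<in> H" using M.diff_add_cancel[OF x hM] by simp
  qed
 qed
qed

lemma finite_dimensional_direct_sum:
 assumes A: "calg A" and I: "finite I" and X: "\<And>i. i \<in> I ==> left_module A (X i)"
  and fd: "\<And>i. i \<in> I ==> finite_dimensional A (X i)"
 shows "finite_dimensional A (direct_sum I X)"
proof -
 let ?D = "direct_sum I X"
 have R: "ring A" using A by (simp add: calg_def)
 have D: "left_module A ?D" by (rule left_module_direct_sum[OF R X])
 interpret D: amod A ?D by (rule amod_intro[OF A D])
 define inj where "inj i x = (\<lambda>j\<in>I. if j = i then x else \<zero>\<^bsub>X j\<^esub>)" for i x
 have am: "amod A (X i)" if "i \<in> I" for i by (rule amod_intro[OF A X[OF that]])
 have xz: "\<zero>\<^bsub>X i\<^esub> \<in> carrier (X i)" if "i \<in> I" for i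
  by (rule abelian_groupE(2)[OF left_module_abelian_group[OF X[OF that]]])
 have injc: "inj i x \<in> carrier ?D" if "i \<in> I" "x \<in> carrier (X i)" for i x
  unfolding inj_def by (rule direct_sum_memI) (use that xz in auto)
 have inj_add: "inj i (x \<oplus>\<^bsub>X i\<^esub> y) = inj i x \<oplus>\<^sub>?D inj i y" if "i \<in> I" for i x y
  unfolding inj_def direct_sum_simps
  by (rule restrict_ext) (simp add: abelian_groupE(5)[OF left_module_abelian_group[OF X] xz])
 have sc: "scal A ?D c x = (\<lambda>i\<in>I. scal A (X i) c (x i))" for c x
  by (simp add: scal_def direct_sum_simps)
 have inj_sc: "inj i (scal A (X i) c x) = scal A ?D c (inj i x)" if "i \<in> I" for i c x
  unfolding sc unfolding inj_def
  by (rule restrict_ext) (simp add: amod.sc_zero_right[OF am])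
 have inj_zero: "inj i \<zero>\<^bsub>X i\<^esub> = \<zero>\<^sub>?D" for i
  unfolding inj_def direct_sum_simps by (rule restrict_ext) simp
 have "\<exists>S. finite S \<and> S \<subseteq> carrier (X i) \<and> (\<forall>H. amod.csub A (X i) H --> S \<subseteq> H --> carrier (X i) \<subseteq> H)"
  if "i \<in> I" for i using fd[OF that] amod.finite_dimensional_iff[OF am[OF that]] by simp
 then obtain S where S: "\<And>i. i \<in> I ==> finite (S i) \<and> S i \<subseteq> carrier (X i) \<and>
   (\<forall>H. amod.csub A (X i) H --> S i \<subseteq> H --> carrier (X i) \<subseteq> H)" by metis
 show ?thesis unfolding D.finite_dimensional_iff
 proof (intro exI[of _ "\<Union>i\<in>I. inj i ` S i"] conjI allI impI)
  show "finite (\<Union>i\<in>I. inj i ` S i)" using I S by blast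
  show "(\<Union>i\<in>I. inj i ` S i) \<subseteq> carrier ?D" using S injc by blast
  fix H assume H: "D.csub H" "(\<Union>i\<in>I. inj i ` S i) \<subseteq> H"
  have inH: "inj i x \<in> H" if i: "i \<in> I" and x: "x \<in> carrier (X i)" for i x
  proof -
   interpret Xi: amod A "X i" by (rule am[OF i])
   let ?K = "{x \<in> carrier (X i). inj i x \<in> H}"
   have "Xi.csub ?K"
    using H(1) unfolding Xi.csub_def D.csub_def
    by (auto simp: inj_zero inj_add[OF i] inj_sc[OF i] Xi.sc_closed)
   moreover have "S i \<subseteq> ?K" using H(2) i S[OF i] by blast
   ultimately have "carrier (X i) \<subseteq> ?K" using S[OF i] by blast
   then show ?thesis using x by blast
  qed
  have "(\<lambda>i\<in>I. if i \<in> K then x i else \<zero>\<^bsub>X i\<^esub>) \<in> H" if x: "x \<in> carrier ?D" and K: "finite K" "K \<subseteq> I" for x K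
   using K
  proof (induction K rule: finite_induct)
   case empty
   have z: "(\<lambda>i\<in>I. if i \<in> {} then x i else \<zero>\<^bsub>X i\<^esub>) = \<zero>\<^sub>?D"
    unfolding direct_sum_simps by (rule restrict_ext) simp
   show ?case unfolding z by (rule conjunct1[OF conjunct2[OF H(1)[unfolded D.csub_def]]])
  next
   case (insert k K)
   then have k: "k \<in> I" by simp
   have e: "(\<lambda>i\<in>I. if i \<in> insert k K then x i else \<zero>\<^bsub>X i\<^esub>)
     = inj k (x k) \<oplus>\<^sub>?D (\<lambda>i\<in>I. if i \<in> K then x i else \<zero>\<^bsub>X i\<^esub>)"
    unfolding inj_def direct_sum_simps
   proof (rule restrict_ext)
    fix i assume i: "i \<in> I"
    interpret G: abelian_group "X i" by (rule left_module_abelian_group[OF X[OF i]])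
    have xi: "x i \<in> carrier (X i)" by (rule direct_sum_memD[OF x i])
    have "x i \<oplus>\<^bsub>X i\<^esub> \<zero>\<^bsub>X i\<^esub> = x i" "\<zero>\<^bsub>X i\<^esub> \<oplus>\<^bsub>X i\<^esub> x i = x i" "\<zero>\<^bsub>X i\<^esub> \<oplus>\<^bsub>X i\<^esub> \<zero>\<^bsub>X i\<^esub> = \<zero>\<^bsub>X i\<^esub>"
     using xi by simp_all
    then show "(if i \<in> insert k K then x i else \<zero>\<^bsub>X i\<^esub>) = (\<lambda>j\<in>I. if j = k then x k else \<zero>\<^bsub>X j\<^esub>) i
      \<oplus>\<^bsub>X i\<^esub> (\<lambda>i\<in>I. if i \<in> K then x i else \<zero>\<^bsub>X i\<^esub>) i"
     using i insert.hyps(2) by auto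
   qed
   have "(\<lambda>i\<in>I. if i \<in> K then x i else \<zero>\<^bsub>X i\<^esub>) \<in> H" by (rule insert.IH) (use insert.prems in simp)
   then show ?case unfolding e
    using inH[OF k direct_sum_memD[OF x k]] H(1)[unfolded D.csub_def] by blast
  qed
  from this[OF _ I subset_refl] show "carrier ?D \<subseteq> H"
  proof (intro subsetI)
   fix x assume x: "x \<in> carrier ?D"
   have "(\<lambda>i\<in>I. if i \<in> I then x i else \<zero>\<^bsub>X i\<^esub>) = x"
   proof (rule direct_sum_ext[OF _ x])
    show "(\<lambda>i\<in>I. if i \<in> I then x i else \<zero>\<^bsub>X i\<^esub>) \<in> carrier ?D"
     by (rule direct_sum_memI) (simp add: direct_sum_memD[OF x])
   qed simp
   then show "x \<in> H" using \<open>\<And>x. x \<in> carrier ?D ==> (\<lambda>i\<in>I. if i \<in> I then x i else \<zero>\<^bsub>X i\<^esub>) \<in> H\<close>[OF x] by simp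
  qed
 qed
qed

text \<open>By counting, every finite-dimensional module has a copy in any type that contains
 the complex numbers.\<close>

lemma finite_dimensional_embeds:
 fixes \<iota> :: "complex => 'm" and M :: "('a, 'b) module"
 assumes \<iota>: "inj \<iota>" and M: "amod A M" and fd: "finite_dimensional A M"
 obtains e :: "'b => 'm" where "inj_on e (carrier M)"
proof -
 interpret M: amod A M by fact
 have "\<exists>pr. inj_on pr (UNIV \<times> UNIV :: (complex \<times> complex) set) \<and> pr ` (UNIV \<times> UNIV) \<subseteq> (UNIV :: complex set)"
  by (rule iffD2[OF card_of_ordLeq ordIso_imp_ordLeq[OF card_of_Times_same_infinite]])
   (rule infinite_UNIV_char_0)
 then obtain pr :: "complex \<times> complex => complex" where pr: "inj_on pr (UNIV \<times> UNIV)" by blast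
 define enc where "enc = rec_list (0::complex) (\<lambda>x _ r. pr (x, r))"
 have enc: "enc [] = 0" "\<And>x xs. enc (x # xs) = pr (x, enc xs)" by (simp_all add: enc_def)
 have enc_inj: "length xs = length ys ==> enc xs = enc ys ==> xs = ys" for xs ys
 proof (induction xs ys rule: list_induct2')
  case (4 x xs y ys)
  then have "(x, enc xs) = (y, enc ys)" using inj_onD[OF pr, of "(x, enc xs)" "(y, enc ys)"] by (simp add: enc)
  then show ?case using 4 by simp
 qed simp_all
 from fd obtain S where S: "finite S" "S \<subseteq> carrier M"
  and sp: "\<And>x. x \<in> carrier M ==> \<exists>c. x = (\<Oplus>\<^bsub>M\<^esub>s\<in>S. scal A M (c s) s)"
  unfolding finite_dimensional_def by blast
 have f: "(\<lambda>s. scal A M (d s) s) \<in> S \<rightarrow> carrier M" for d using S(2) M.sc_closed by auto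
 obtain ss where ss: "set ss = S" using finite_list[OF S(1)] by blast
 from sp obtain c where c: "\<And>x. x \<in> carrier M ==> x = (\<Oplus>\<^bsub>M\<^esub>s\<in>S. scal A M (c x s) s)" by metis
 have "inj_on (\<lambda>x. \<iota> (enc (map (c x) ss))) (carrier M)"
 proof (rule inj_onI)
  fix x y assume x: "x \<in> carrier M" and y: "y \<in> carrier M"
   and "\<iota> (enc (map (c x) ss)) = \<iota> (enc (map (c y) ss))"
  then have "enc (map (c x) ss) = enc (map (c y) ss)" by (intro injD[OF \<iota>])
  then have "map (c x) ss = map (c y) ss" by (rule enc_inj[rotated]) simp
  then have "c x s = c y s" if "s \<in> S" for s using that unfolding ss[symmetric] by simp
  then have "(\<Oplus>\<^bsub>M\<^esub>s\<in>S. scal A M (c x s) s) = (\<Oplus>\<^bsub>M\<^esub>s\<in>S. scal A M (c y s) s)"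
   by (intro M.M.finsum_cong'[OF refl f]) simp
  then show "x = y" using c[OF x] c[OF y] by simp
 qed
 then show thesis by (rule that)
qed

section \<open>Modules over \<open>D\<close>\<close>

context lmod
begin

lemma smult_l_diff:
 assumes "a \<in> carrier R" "b \<in> carrier R" "x \<in> carrier M"
 shows "a \<odot>\<^sub>M x \<ominus>\<^sub>M b \<odot>\<^sub>M x = (a \<ominus>\<^sub>R b) \<odot>\<^sub>M x"
proof -
 have ab: "a \<ominus>\<^sub>R b \<in> carrier R" using assms by simp
 have "b \<oplus>\<^sub>R (a \<ominus>\<^sub>R b) = a" using assms by (simp add: a_minus_def R.a_lcomm[of b] R.r_neg)
 then have "a \<odot>\<^sub>M x = b \<odot>\<^sub>M x \<oplus>\<^sub>M (a \<ominus>\<^sub>R b) \<odot>\<^sub>M x"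
  using smult_l_distr[OF assms(2) ab assms(3)] by simp
 then show ?thesis
  using add_diff_cancel[OF smult_closed[OF assms(2,3)] smult_closed[OF ab assms(3)]] by simp
qed

end

lemma hom_image_submodule:
 assumes M: "left_module R M" and N: "left_module R N" and f: "f \<in> lmod_hom R M N"
 shows "submodule (f ` carrier M) R N"
proof -
 interpret M: lmod R M by (rule lmod.intro[OF M])
 interpret N: lmod R N by (rule lmod.intro[OF N])
 note fD = lmod_homD[OF f]
 show ?thesis
 proof (rule N.submodule_intro)
  show "f ` carrier M \<subseteq> carrier N" using fD(1) by (rule image_subsetI)
  show "\<zero>\<^sub>N \<in> f ` carrier M" unfolding lmod_hom_zero[OF M N f, symmetric] by (rule imageI) simp
  show "a \<oplus>\<^sub>N b \<in> f ` carrier M" if "a \<in> f ` carrier M" "b \<in> f ` carrier M" for a b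
  proof -
   from that obtain x y where x: "x \<in> carrier M" "y \<in> carrier M" "a = f x" "b = f y" by (elim imageE) simp
   show ?thesis unfolding x(3,4) fD(2)[OF x(1,2), symmetric] by (rule imageI) (simp add: x)
  qed
  show "a \<odot>\<^sub>N b \<in> f ` carrier M" if "a \<in> carrier R" "b \<in> f ` carrier M" for a b
  proof -
   from that(2) obtain x where x: "x \<in> carrier M" "b = f x" by (elim imageE) simp
   show ?thesis unfolding x(2) fD(3)[OF that(1) x(1), symmetric] by (rule imageI) (rule M.smult_closed[OF that(1) x(1)])
  qed
 qed
qed

locale dmod = auslander n + amod "D_alg n" M for n :: nat and M :: "(D_elem, 'b) module"
begin

abbreviation u :: "nat => nat => nat => 'b => 'b" where "u i k m x \<equiv> dU i k m \<odot>\<^sub>M x"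

lemma u_closed: "x \<in> carrier M ==> u i k m x \<in> carrier M"
 by (rule smult_closed[OF dU_closed])

lemma u_add: "x \<in> carrier M ==> y \<in> carrier M ==> u i k m (x \<oplus>\<^sub>M y) = u i k m x \<oplus>\<^sub>M u i k m y"
 by (rule smult_r_distr[OF dU_closed])

lemma u_diff: "x \<in> carrier M ==> y \<in> carrier M ==> u i k m (x \<ominus>\<^sub>M y) = u i k m x \<ominus>\<^sub>M u i k m y"
 by (rule smult_r_diff[OF dU_closed])

lemma u_sc: "x \<in> carrier M ==> u i k m (sc c x) = sc c (u i k m x)"
 by (rule smult_sc[OF dU_closed])

lemma u_null: "u i k m \<zero>\<^sub>M = \<zero>\<^sub>M"
 by (rule smult_r_null[OF dU_closed])

lemma u_top: "n \<le> m ==> x \<in> carrier M ==> u i k m x = \<zero>\<^sub>M"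
 by (simp add: dU_zero)

lemma u_u:
 assumes "i \<le> m" "k \<le> m" "k' \<le> m'" "l \<le> m'" "x \<in> carrier M"
 shows "u k' l m' (u i k m x) = (if k = k' then u i l (m + m' - k) x else \<zero>\<^sub>M)"
proof -
 have "u k' l m' (u i k m x) = (dU k' l m' \<otimes>\<^sub>DD dU i k m) \<odot>\<^sub>M x"
  by (rule smult_assoc[OF dU_closed dU_closed assms(5), symmetric])
 then show ?thesis unfolding dU_mult[OF assms(1-4)] using assms(5) by simp
qed

lemma u_src: "i \<le> m ==> k \<le> m ==> x \<in> carrier M ==> u i k m (u i i i x) = u i k m x"
 using u_u[of i i i i m k x] by simp

lemma u_tgt: "i \<le> m ==> k \<le> m ==> x \<in> carrier M ==> u k k k (u i k m x) = u i k m x"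
 using u_u[of i m k k k k x] by simp

lemma u_tgt_neq: "i \<le> m ==> k \<le> m ==> x \<in> carrier M ==> l \<noteq> k ==> u l l l (u i k m x) = \<zero>\<^sub>M"
 using u_u[of i m k l l l x] by simp

lemma vertex_zero:
 assumes x: "x \<in> carrier M" and z: "\<And>k. k < n ==> u k k k x = \<zero>\<^sub>M"
 shows "x = \<zero>\<^sub>M"
proof -
 have "X \<odot>\<^sub>M x = \<zero>\<^sub>M" if "X \<in> carrier DD" for X
  using that
 proof (induction rule: D_induct)
  case (scale_dU c i k m)
  then have "u i k m x = u i k m (u i i i x)" using u_src x by (simp add: idx_def)
  also have "\<dots> = \<zero>\<^sub>M" using z[of i] scale_dU u_null by (simp add: idx_def)
  finally show ?case using smult_scale[OF dU_closed x] sc_zero_right by simp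
 qed (simp_all add: x smult_l_distr)
 from this[OF DD.one_closed] show ?thesis using smult_one[OF x] by simp
qed

lemma vertex_eq:
 assumes x: "x \<in> carrier M" and y: "y \<in> carrier M" and e: "\<And>k. k < n ==> u k k k x = u k k k y"
 shows "x = y"
proof -
 have "x \<ominus>\<^sub>M y = \<zero>\<^sub>M"
 proof (rule vertex_zero)
  fix k assume "k < n"
  show "u k k k (x \<ominus>\<^sub>M y) = \<zero>\<^sub>M" unfolding u_diff[OF x y]
   by (rule iffD2[OF diff_zero_iff[OF u_closed[OF x] u_closed[OF y]] e[OF \<open>k < n\<close>]])
 qed (use x y in simp)
 then show ?thesis using diff_zero_iff[OF x y] by blast
qed

lemma vertex_sub:
 assumes H: "submodule H DD M" and x: "x \<in> carrier M" and e: "\<And>k. k < n ==> u k k k x \<in> H"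
 shows "x \<in> H"
proof -
 have "X \<odot>\<^sub>M x \<in> H" if "X \<in> carrier DD" for X
  using that
 proof (induction rule: D_induct)
  case zero
  show ?case using x submoduleD(2)[OF H] by simp
 next
  case (add X Y)
  then show ?case using submoduleD(4)[OF H] by (simp add: x smult_l_distr)
 next
  case (scale_dU c i k m)
  have "u i i i x \<in> H" by (rule e) (use scale_dU in \<open>simp add: idx_def\<close>)
  then have "u i k m (u i i i x) \<in> H" by (rule submoduleD(7)[OF H dU_closed])
  then have "u i k m x \<in> H" using u_src x scale_dU by (simp add: idx_def)
  then show ?case unfolding smult_scale[OF dU_closed x] by (rule submodule_sc[OF H])
 qed
 from this[OF DD.one_closed] show ?thesis using smult_one[OF x] by simp
qed

text \<open>The elements \<open>z k\<close> are the components of their sum.\<close>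

lemma vertex_glue:
 assumes z: "\<And>k. k < n ==> z k \<in> carrier M" "\<And>k. k < n ==> u k k k (z k) = z k"
 shows "\<exists>x\<in>carrier M. \<forall>k<n. u k k k x = z k"
proof -
 have "j \<le> n ==> \<exists>x\<in>carrier M. \<forall>k<n. u k k k x = (if k < j then z k else \<zero>\<^sub>M)" for j
 proof (induction j)
  case 0
  show ?case by (rule bexI[of _ "\<zero>\<^sub>M"]) (simp_all add: u_null)
 next
  case (Suc j)
  then obtain x where x: "x \<in> carrier M" "\<forall>k<n. u k k k x = (if k < j then z k else \<zero>\<^sub>M)" by auto
  have j: "j < n" using Suc.prems by simp
  show ?case
  proof (intro bexI allI impI)
   show xz: "x \<oplus>\<^sub>M z j \<in> carrier M" using x(1) z(1)[OF j] by simp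
   fix k assume k: "k < n"
   have "u k k k (z j) = u k k k (u j j j (z j))" using z(2)[OF j] by simp
   also have "\<dots> = (if k = j then z j else \<zero>\<^sub>M)"
    using u_u[of j j j k k k "z j"] z[OF j] by auto
   finally have e: "u k k k (z j) = (if k = j then z j else \<zero>\<^sub>M)" .
   show "u k k k (x \<oplus>\<^sub>M z j) = (if k < Suc j then z k else \<zero>\<^sub>M)"
    unfolding u_add[OF x(1) z(1)[OF j]] e using x(2) k z(1)[OF k] z(1)[OF j] by (auto simp: less_Suc_eq)
  qed
 qed
 from this[OF le_refl] obtain x where "x \<in> carrier M" "\<forall>k<n. u k k k x = (if k < n then z k else \<zero>\<^sub>M)" by blast
 then show ?thesis by auto
qed

lemma dmod_submoduleI:
 assumes "H \<subseteq> carrier M" "\<zero>\<^sub>M \<in> H"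
  and add: "\<And>x y. x \<in> H ==> y \<in> H ==> x \<oplus>\<^sub>M y \<in> H"
  and sc: "\<And>c x. x \<in> H ==> sc c x \<in> H"
  and u: "\<And>i k m x. idx i k m ==> x \<in> H ==> u i k m x \<in> H"
 shows "submodule H DD M"
proof (rule submodule_intro[OF assms(1,2) add])
 fix X x assume "X \<in> carrier DD" and xH: "x \<in> H"
 then have x: "x \<in> carrier M" using assms(1) by blast
 show "X \<odot>\<^sub>M x \<in> H"
  using \<open>X \<in> carrier DD\<close>
 proof (induction rule: D_induct)
  case zero
  show ?case using x assms(2) by simp
 next
  case (add X Y)
  then show ?case using assms(3) by (simp add: x smult_l_distr)
 next
  case (scale_dU c i k m)
  show ?case unfolding smult_scale[OF dU_closed x] by (rule sc[OF u[OF scale_dU xH]])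
 qed
qed

end

lemma dmod_intro: "n > 1 ==> left_module (D_alg n) M ==> dmod n M"
proof -
 assume "n > 1" and M: "left_module (D_alg n) M"
 then interpret auslander n by (intro auslander.intro)
 show "dmod n M" by (intro dmod.intro auslander_axioms amod_intro DD.calg_axioms M)
qed

context auslander
begin

lemma dmod: "left_module DD M ==> dmod n M"
 by (rule dmod_intro[OF n_gt_1])

lemma dmod_homI:
 assumes M: "left_module DD M" and N: "left_module DD N"
  and c: "\<And>x. x \<in> carrier M ==> f x \<in> carrier N"
  and add: "\<And>x y. x \<in> carrier M ==> y \<in> carrier M ==> f (x \<oplus>\<^sub>M y) = f x \<oplus>\<^sub>N f y"
  and sc: "\<And>c x. x \<in> carrier M ==> f (scal DD M c x) = scal DD N c (f x)"
  and u: "\<And>i k m x. idx i k m ==> x \<in> carrier M ==> f (dU i k m \<odot>\<^sub>M x) = dU i k m \<odot>\<^sub>N f x"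
 shows "(\<lambda>x\<in>carrier M. f x) \<in> lmod_hom DD M N"
proof (rule lmod_homI[OF c add _ M])
 interpret M: dmod n M by (rule dmod[OF M])
 interpret N: dmod n N by (rule dmod[OF N])
 fix X x assume "X \<in> carrier DD" and x: "x \<in> carrier M"
 show "f (X \<odot>\<^sub>M x) = X \<odot>\<^sub>N f x"
  using \<open>X \<in> carrier DD\<close>
 proof (induction rule: D_induct)
  case zero
  show ?case using x c[OF x] sc[OF M.M.zero_closed, of 0] M.sc_zero_left N.sc_zero_left[OF c[OF M.M.zero_closed]]
   by simp
 next
  case (add X Y)
  then show ?case using assms(4)[of "X \<odot>\<^sub>M x" "Y \<odot>\<^sub>M x"] x c[OF x]
   by (simp add: M.smult_l_distr N.smult_l_distr M.smult_closed)
 next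
  case (scale_dU c' i k m)
  show ?case
   unfolding M.smult_scale[OF dU_closed x] N.smult_scale[OF dU_closed c[OF x]] sc[OF M.u_closed[OF x]] u[OF scale_dU x] ..
 qed
qed

subsection \<open>The submodule generated by the vertex \<open>0\<close>\<close>

text \<open>
 At the vertex \<open>k\<close> the submodule \<open>D e\<^sub>0 M\<close> is the image of \<open>M\<close> under \<open>b\<^sub>k \<cdots> b\<^sub>1\<close>, because
 every path from \<open>0\<close> to \<open>k\<close> equals a power of \<open>a\<^sub>1 b\<^sub>1\<close> followed by \<open>b\<^sub>k \<cdots> b\<^sub>1\<close>.
\<close>

definition etaS :: "(D_elem, 'c) module => 'c set"
 where "etaS M = {x \<in> carrier M. \<forall>k<n. \<exists>y\<in>carrier M. dU k k k \<odot>\<^sub>M x = dU 0 k k \<odot>\<^sub>M y}"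

end

context dmod
begin

lemma u0_factor: "k \<le> m ==> x \<in> carrier M ==> u 0 k m x = u 0 k k (u 0 0 (m - k) x)"
 using u_u[of 0 "m - k" 0 0 k k x] by simp

lemma u0_etaS:
 assumes y: "y \<in> carrier M" and k: "k \<le> m"
 shows "u 0 k m y \<in> etaS M"
 unfolding etaS_def
proof (intro CollectI conjI allI impI)
 show "u 0 k m y \<in> carrier M" by (rule u_closed[OF y])
 fix l assume "l < n"
 show "\<exists>z\<in>carrier M. u l l l (u 0 k m y) = u 0 l l z"
 proof (cases "l = k")
  case True
  then have "u l l l (u 0 k m y) = u 0 l l (u 0 0 (m - k) y)"
   using u_tgt[of 0 m k y] u0_factor[OF k y] k y by simp
  then show ?thesis using u_closed[OF y] by (rule bexI)
 next
  case False
  then have "u l l l (u 0 k m y) = u 0 l l \<zero>\<^sub>M"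
   using u_tgt_neq[of 0 m k y l] k y u_null by simp
  then show ?thesis by (rule bexI) simp
 qed
qed

lemma etaS_submodule: "submodule (etaS M) DD M"
proof (rule dmod_submoduleI)
 show "etaS M \<subseteq> carrier M" by (simp add: etaS_def subset_eq)
 have "\<zero>\<^sub>M = u 0 0 0 \<zero>\<^sub>M" by (simp add: u_null)
 then show "\<zero>\<^sub>M \<in> etaS M" using u0_etaS[of "\<zero>\<^sub>M" 0 0] by simp
next
 fix x y assume x: "x \<in> etaS M" and y: "y \<in> etaS M"
 have c: "x \<in> carrier M" "y \<in> carrier M" using x y by (simp_all add: etaS_def)
 show "x \<oplus>\<^sub>M y \<in> etaS M"
  unfolding etaS_def
 proof (intro CollectI conjI allI impI)
  show "x \<oplus>\<^sub>M y \<in> carrier M" using c by simp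
  fix k assume k: "k < n"
  from x k obtain a where a: "a \<in> carrier M" "u k k k x = u 0 k k a" by (auto simp: etaS_def)
  from y k obtain b where b: "b \<in> carrier M" "u k k k y = u 0 k k b" by (auto simp: etaS_def)
  have "u k k k (x \<oplus>\<^sub>M y) = u 0 k k (a \<oplus>\<^sub>M b)"
   unfolding u_add[OF c] u_add[OF a(1) b(1)] a(2) b(2) ..
  then show "\<exists>z\<in>carrier M. u k k k (x \<oplus>\<^sub>M y) = u 0 k k z" by (rule bexI) (simp add: a b)
 qed
next
 fix c x assume x: "x \<in> etaS M"
 have cx: "x \<in> carrier M" using x by (simp add: etaS_def)
 show "sc c x \<in> etaS M"
  unfolding etaS_def
 proof (intro CollectI conjI allI impI)
  show "sc c x \<in> carrier M" by (rule sc_closed[OF cx])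
  fix k assume k: "k < n"
  from x k obtain a where a: "a \<in> carrier M" "u k k k x = u 0 k k a" by (auto simp: etaS_def)
  have "u k k k (sc c x) = u 0 k k (sc c a)" unfolding u_sc[OF cx] u_sc[OF a(1)] a(2) ..
  then show "\<exists>z\<in>carrier M. u k k k (sc c x) = u 0 k k z" by (rule bexI) (rule sc_closed[OF a(1)])
 qed
next
 fix i k m x assume i: "idx i k m" and x: "x \<in> etaS M"
 have cx: "x \<in> carrier M" using x by (simp add: etaS_def)
 have im: "i \<le> m" "k \<le> m" "i < n" using i by (simp_all add: idx_def)
 from x im(3) obtain a where a: "a \<in> carrier M" "u i i i x = u 0 i i a" by (auto simp: etaS_def)
 have "u i k m x = u i k m (u 0 i i a)" unfolding a(2)[symmetric] by (rule u_src[OF im(1,2) cx, symmetric])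
 also have "\<dots> = u 0 k m a" using u_u[of 0 i i i m k a] im a(1) by simp
 finally show "u i k m x \<in> etaS M" using u0_etaS[OF a(1) im(2)] by simp
qed

lemma etaS_subset: "x \<in> etaS M ==> x \<in> carrier M"
 by (simp add: etaS_def)

lemma etaSE:
 assumes "x \<in> etaS M" "k < n"
 obtains y where "y \<in> carrier M" "u k k k x = u 0 k k y"
 using assms by (auto simp: etaS_def)

end

context auslander
begin

lemma etaS_hom:
 assumes f: "f \<in> lmod_hom DD M N" and M: "left_module DD M" and x: "x \<in> etaS M"
 shows "f x \<in> etaS N"
proof -
 interpret M: dmod n M by (rule dmod[OF M])
 have cx: "x \<in> carrier M" using x by (simp add: etaS_def)
 note fD = lmod_homD[OF f]
 show ?thesis unfolding etaS_def
 proof (intro CollectI conjI allI impI)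
  show "f x \<in> carrier N" by (rule fD(1)[OF cx])
  fix k assume k: "k < n"
  obtain a where a: "a \<in> carrier M" "dU k k k \<odot>\<^sub>M x = dU 0 k k \<odot>\<^sub>M a" by (rule M.etaSE[OF x k])
  have "dU k k k \<odot>\<^sub>N f x = dU 0 k k \<odot>\<^sub>N f a"
   unfolding fD(3)[OF dU_closed cx, symmetric] fD(3)[OF dU_closed a(1), symmetric] a(2) ..
  then show "\<exists>y\<in>carrier N. dU k k k \<odot>\<^sub>N f x = dU 0 k k \<odot>\<^sub>N y" by (rule bexI) (rule fD(1)[OF a(1)])
 qed
qed

lemma etaS_surj:
 assumes f: "f \<in> lmod_hom DD M N" and M: "left_module DD M" and im: "f ` carrier M = carrier N"
  and e: "etaS M = carrier M"
 shows "etaS N = carrier N"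
proof
 show "etaS N \<subseteq> carrier N" by (simp add: etaS_def subset_eq)
 show "carrier N \<subseteq> etaS N"
 proof
  fix y assume "y \<in> carrier N"
  then obtain x where x: "x \<in> carrier M" "y = f x" unfolding im[symmetric] by (elim imageE) simp
  show "y \<in> etaS N" unfolding x(2) by (rule etaS_hom[OF f M]) (simp add: e x(1))
 qed
qed

lemma D_proj_simps:
 "add (D_proj n i) = add DD" "zero (D_proj n i) = zero DD" "smult (D_proj n i) = mult DD"
 by (simp_all add: D_proj_def left_ideal_module_def)

lemma dU_idem: "dU i i i \<otimes>\<^sub>DD dU i i i = dU i i i"
 using dU_mult[of i i i i i i] by simp

lemma D_proj_mem_iff:
 assumes i: "i < n"
 shows "x \<in> carrier (D_proj n i) \<longleftrightarrow> x \<in> carrier DD \<and> x \<otimes>\<^sub>DD dU i i i = x"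
proof
 assume "x \<in> carrier (D_proj n i)"
 then obtain y where y: "y \<in> carrier DD" "x = y \<otimes>\<^sub>DD dU i i i"
  by (auto simp: D_proj_def left_ideal_module_def D_e_dU[OF i])
 show "x \<in> carrier DD \<and> x \<otimes>\<^sub>DD dU i i i = x"
  unfolding y(2) using y(1) dU_closed by (simp add: DD.m_assoc dU_idem)
next
 assume "x \<in> carrier DD \<and> x \<otimes>\<^sub>DD dU i i i = x"
 then show "x \<in> carrier (D_proj n i)"
  unfolding D_proj_def left_ideal_module_def D_e_dU[OF i] by (auto intro!: exI[of _ x])
qed

lemma D_proj_module:
 assumes i: "i < n"
 shows "left_module DD (D_proj n i)"
proof -
 note I = D_proj_mem_iff[OF i]
 have "abelian_group (D_proj n i)"
 proof (rule abelian_groupI)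
  fix x assume x: "x \<in> carrier (D_proj n i)"
  have "\<ominus>\<^sub>DD x \<in> carrier (D_proj n i) \<and> \<ominus>\<^sub>DD x \<oplus>\<^bsub>D_proj n i\<^esub> x = \<zero>\<^bsub>D_proj n i\<^esub>"
   using x unfolding I D_proj_simps by (simp add: DD.l_minus DD.l_neg dU_closed)
  then show "\<exists>y\<in>carrier (D_proj n i). y \<oplus>\<^bsub>D_proj n i\<^esub> x = \<zero>\<^bsub>D_proj n i\<^esub>" by blast
  show "\<zero>\<^bsub>D_proj n i\<^esub> \<oplus>\<^bsub>D_proj n i\<^esub> x = x" using x unfolding I D_proj_simps by simp
 next
  fix x y assume x: "x \<in> carrier (D_proj n i)" and y: "y \<in> carrier (D_proj n i)"
  show "x \<oplus>\<^bsub>D_proj n i\<^esub> y \<in> carrier (D_proj n i)"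
   using x y unfolding I D_proj_simps by (simp add: DD.l_distr dU_closed)
  show "x \<oplus>\<^bsub>D_proj n i\<^esub> y = y \<oplus>\<^bsub>D_proj n i\<^esub> x"
   using x y DD.a_comm unfolding I D_proj_simps by simp
 next
  fix x y z assume "x \<in> carrier (D_proj n i)" "y \<in> carrier (D_proj n i)" "z \<in> carrier (D_proj n i)"
  then show "x \<oplus>\<^bsub>D_proj n i\<^esub> y \<oplus>\<^bsub>D_proj n i\<^esub> z = x \<oplus>\<^bsub>D_proj n i\<^esub> (y \<oplus>\<^bsub>D_proj n i\<^esub> z)"
   unfolding I D_proj_simps by (simp add: DD.a_assoc)
 next
  show "\<zero>\<^bsub>D_proj n i\<^esub> \<in> carrier (D_proj n i)" unfolding I D_proj_simps by (simp add: dU_closed)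
 qed
 then show ?thesis
 proof (intro left_module.intro left_module_axioms.intro DD.ring_axioms)
  fix a x assume "a \<in> carrier DD" "x \<in> carrier (D_proj n i)"
  then show "a \<odot>\<^bsub>D_proj n i\<^esub> x \<in> carrier (D_proj n i)"
   unfolding I D_proj_simps by (simp add: DD.m_assoc dU_closed)
 qed (simp_all add: I D_proj_simps DD.l_distr DD.r_distr DD.m_assoc)
qed

lemma right_mult_hom:
 assumes ij: "i < n" "j < n" "i \<le> m" "j \<le> m"
 shows "(\<lambda>x\<in>carrier (D_proj n i). x \<otimes>\<^sub>DD dU j i m) \<in> lmod_hom DD (D_proj n i) (D_proj n j)"
proof (rule lmod_homI[OF _ _ _ D_proj_module[OF ij(1)]])
 fix x assume "x \<in> carrier (D_proj n i)"
 then have x: "x \<in> carrier DD" by (simp add: D_proj_mem_iff[OF ij(1)])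
 have "dU j i m \<otimes>\<^sub>DD dU j j j = dU j i m" using dU_mult[of j j j j m i] ij by simp
 then show "x \<otimes>\<^sub>DD dU j i m \<in> carrier (D_proj n j)"
  using x by (simp add: D_proj_mem_iff[OF ij(2)] DD.m_assoc dU_closed)
next
 fix x y assume "x \<in> carrier (D_proj n i)" "y \<in> carrier (D_proj n i)"
 then show "(x \<oplus>\<^bsub>D_proj n i\<^esub> y) \<otimes>\<^sub>DD dU j i m = x \<otimes>\<^sub>DD dU j i m \<oplus>\<^bsub>D_proj n j\<^esub> y \<otimes>\<^sub>DD dU j i m"
  by (simp add: D_proj_mem_iff[OF ij(1)] D_proj_simps DD.l_distr dU_closed)
next
 fix a x assume "a \<in> carrier DD" "x \<in> carrier (D_proj n i)"
 then show "(a \<odot>\<^bsub>D_proj n i\<^esub> x) \<otimes>\<^sub>DD dU j i m = a \<odot>\<^bsub>D_proj n j\<^esub> (x \<otimes>\<^sub>DD dU j i m)"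
  by (simp add: D_proj_mem_iff[OF ij(1)] D_proj_simps DD.m_assoc dU_closed)
qed

lemma zero_less_n: "0 < n" using n_gt_1 by simp

lemma D_proj_in_D0_eq:
 "j < n ==> D_proj_in_D0 n j = (\<lambda>x\<in>carrier (D_proj n j). x \<otimes>\<^sub>DD dU 0 j j) ` carrier (D_proj n j)"
 unfolding D_proj_in_D0_def by (simp only: if_True D_up_dU) (rule image_cong, simp_all)

lemma D_proj_in_D0_submodule: "submodule (D_proj_in_D0 n j) DD (D_proj n 0)"
proof (cases "j < n")
 case True
 show ?thesis unfolding D_proj_in_D0_eq[OF True]
  by (rule hom_image_submodule[OF D_proj_module[OF True] D_proj_module[OF zero_less_n]
     right_mult_hom[OF True zero_less_n]]) simp_all
next
 case False
 interpret P: dmod n "D_proj n 0" by (rule dmod[OF D_proj_module[OF zero_less_n]])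
 show ?thesis using P.submodule_zero False by (simp add: D_proj_in_D0_def D_proj_simps)
qed

lemma T_mod_module: "left_module DD (T_mod n j)"
proof -
 interpret P: dmod n "D_proj n 0" by (rule dmod[OF D_proj_module[OF zero_less_n]])
 show ?thesis unfolding T_mod_def by (rule P.left_module_quotient[OF D_proj_in_D0_submodule])
qed

lemma T_sum_module: "left_module DD (T_sum n J)"
 unfolding T_sum_def by (rule left_module_direct_sum[OF DD.ring_axioms T_mod_module])

lemma quotient_proj_hom:
 assumes M: "left_module DD M" and H: "submodule H DD M"
 shows "(\<lambda>x\<in>carrier M. H +>\<^sub>M x) \<in> lmod_hom DD M (quotient_module M H)"
  and "(\<lambda>x\<in>carrier M. H +>\<^sub>M x) ` carrier M = carrier (quotient_module M H)"
proof -
 interpret M: dmod n M by (rule dmod[OF M])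
 note Q = M.quotient_module_simps[OF H]
 show "(\<lambda>x\<in>carrier M. H +>\<^sub>M x) ` carrier M = carrier (quotient_module M H)" by (simp add: Q(1))
 show "(\<lambda>x\<in>carrier M. H +>\<^sub>M x) \<in> lmod_hom DD M (quotient_module M H)"
  by (rule lmod_homI[OF _ _ _ M]) (simp_all add: Q)
qed

lemma etaS_D_proj_0: "etaS (D_proj n 0) = carrier (D_proj n 0)"
proof
 interpret P: dmod n "D_proj n 0" by (rule dmod[OF D_proj_module[OF zero_less_n]])
 show "etaS (D_proj n 0) \<subseteq> carrier (D_proj n 0)" by (simp add: etaS_def subset_eq)
 show "carrier (D_proj n 0) \<subseteq> etaS (D_proj n 0)"
 proof
  fix x assume x: "x \<in> carrier (D_proj n 0)"
  have e: "dU 0 0 0 \<in> carrier (D_proj n 0)"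
   by (simp add: D_proj_mem_iff[OF zero_less_n] dU_closed dU_idem)
  have "dU 0 0 0 \<odot>\<^bsub>D_proj n 0\<^esub> dU 0 0 0 \<in> etaS (D_proj n 0)" by (rule P.u0_etaS[OF e]) simp
  then have "dU 0 0 0 \<in> etaS (D_proj n 0)" by (simp add: D_proj_simps dU_idem)
  then have "x \<odot>\<^bsub>D_proj n 0\<^esub> dU 0 0 0 \<in> etaS (D_proj n 0)"
   using P.submoduleD(7)[OF P.etaS_submodule] x by (simp add: D_proj_mem_iff[OF zero_less_n])
  then show "x \<in> etaS (D_proj n 0)" using x by (simp add: D_proj_simps D_proj_mem_iff[OF zero_less_n])
 qed
qed

lemma etaS_T_mod: "etaS (T_mod n j) = carrier (T_mod n j)"
 unfolding T_mod_def
 by (rule etaS_surj[OF quotient_proj_hom(1)[OF D_proj_module[OF zero_less_n] D_proj_in_D0_submodule]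
    D_proj_module[OF zero_less_n]
    quotient_proj_hom(2)[OF D_proj_module[OF zero_less_n] D_proj_in_D0_submodule] etaS_D_proj_0])

lemma etaS_direct_sum:
 assumes X: "\<And>i. i \<in> I ==> left_module DD (X i)"
 shows "x \<in> etaS (direct_sum I X) \<longleftrightarrow> x \<in> carrier (direct_sum I X) \<and> (\<forall>i\<in>I. x i \<in> etaS (X i))"
proof
 have D: "left_module DD (direct_sum I X)" by (rule left_module_direct_sum[OF DD.ring_axioms X])
 assume x: "x \<in> etaS (direct_sum I X)"
 then have c: "x \<in> carrier (direct_sum I X)" by (simp add: etaS_def)
 have "x i \<in> etaS (X i)" if "i \<in> I" for i
  using etaS_hom[OF direct_sum_proj_hom[OF D that] D x] c by simp
 then show "x \<in> carrier (direct_sum I X) \<and> (\<forall>i\<in>I. x i \<in> etaS (X i))" using c by blast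
next
 assume "x \<in> carrier (direct_sum I X) \<and> (\<forall>i\<in>I. x i \<in> etaS (X i))"
 then have c: "x \<in> carrier (direct_sum I X)" and x: "\<And>i. i \<in> I ==> x i \<in> etaS (X i)" by blast+
 show "x \<in> etaS (direct_sum I X)"
  unfolding etaS_def
 proof (intro CollectI conjI allI impI c)
  fix k assume k: "k < n"
  define y where "y i = (SOME y. y \<in> carrier (X i) \<and> dU k k k \<odot>\<^bsub>X i\<^esub> x i = dU 0 k k \<odot>\<^bsub>X i\<^esub> y)" for i
  have y: "y i \<in> carrier (X i) \<and> dU k k k \<odot>\<^bsub>X i\<^esub> x i = dU 0 k k \<odot>\<^bsub>X i\<^esub> y i" if i: "i \<in> I" for i
   unfolding y_def
  proof (rule someI_ex)
   interpret Xi: dmod n "X i" by (rule dmod[OF X[OF i]])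
   obtain z where "z \<in> carrier (X i)" "dU k k k \<odot>\<^bsub>X i\<^esub> x i = dU 0 k k \<odot>\<^bsub>X i\<^esub> z"
    by (rule Xi.etaSE[OF x[OF i] k])
   then show "\<exists>y. y \<in> carrier (X i) \<and> dU k k k \<odot>\<^bsub>X i\<^esub> x i = dU 0 k k \<odot>\<^bsub>X i\<^esub> y" by (intro exI conjI)
  qed
  have "dU k k k \<odot>\<^bsub>direct_sum I X\<^esub> x = dU 0 k k \<odot>\<^bsub>direct_sum I X\<^esub> (\<lambda>i\<in>I. y i)"
   unfolding direct_sum_simps
  proof (rule restrict_ext)
   fix i assume i: "i \<in> I"
   show "dU k k k \<odot>\<^bsub>X i\<^esub> x i = dU 0 k k \<odot>\<^bsub>X i\<^esub> (\<lambda>i\<in>I. y i) i"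
    unfolding restrict_apply'[OF i] by (rule conjunct2[OF y[OF i]])
  qed
  then show "\<exists>y\<in>carrier (direct_sum I X). dU k k k \<odot>\<^bsub>direct_sum I X\<^esub> x = dU 0 k k \<odot>\<^bsub>direct_sum I X\<^esub> y"
   by (rule bexI[where x = "\<lambda>i\<in>I. y i"]) (rule direct_sum_memI[OF conjunct1[OF y]])
 qed
qed

lemma etaS_direct_sum_full:
 assumes X: "\<And>i. i \<in> I ==> left_module DD (X i)"
  and e: "\<And>i. i \<in> I ==> etaS (X i) = carrier (X i)"
 shows "etaS (direct_sum I X) = carrier (direct_sum I X)"
proof
 show "etaS (direct_sum I X) \<subseteq> carrier (direct_sum I X)" by (simp add: etaS_def subset_eq)
 show "carrier (direct_sum I X) \<subseteq> etaS (direct_sum I X)"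
 proof (rule subsetI, rule iffD2[OF etaS_direct_sum[OF X]], assumption, intro conjI ballI)
  fix x i assume x: "x \<in> carrier (direct_sum I X)" and i: "i \<in> I"
  show "x i \<in> etaS (X i)" unfolding e[OF i] by (rule direct_sum_memD[OF x i])
 qed
qed

lemma etaS_T_sum: "etaS (T_sum n J) = carrier (T_sum n J)"
 unfolding T_sum_def by (rule etaS_direct_sum_full[OF T_mod_module etaS_T_mod])

text \<open>The equality \<open>\<eta> T = T\<close> passes to sums and to images.\<close>

lemma etaS_in_add:
 assumes M: "left_module DD M" and a: "in_add DD (T_sum n J) M"
 shows "etaS M = carrier M"
proof -
 from a obtain k :: nat and i p where i: "i \<in> lmod_hom DD M (direct_sum {..<k} (\<lambda>_. T_sum n J))"
  and p: "p \<in> lmod_hom DD (direct_sum {..<k} (\<lambda>_. T_sum n J)) M" and pi: "\<forall>m\<in>carrier M. p (i m) = m"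
  unfolding in_add_def by blast
 let ?S = "direct_sum {..<k} (\<lambda>_. T_sum n J)"
 have S: "left_module DD ?S" by (rule left_module_direct_sum[OF DD.ring_axioms T_sum_module])
 have "etaS ?S = carrier ?S" by (rule etaS_direct_sum_full[OF T_sum_module etaS_T_sum])
 moreover have "p ` carrier ?S = carrier M"
 proof
  show "p ` carrier ?S \<subseteq> carrier M" by (rule image_subsetI) (rule lmod_homD(1)[OF p])
  show "carrier M \<subseteq> p ` carrier ?S"
  proof
   fix m assume m: "m \<in> carrier M"
   then have "m = p (i m)" using pi by simp
   then show "m \<in> p ` carrier ?S" using lmod_homD(1)[OF i m] by (rule image_eqI)
  qed
 qed
 ultimately show ?thesis using etaS_surj[OF p S] by blast
qed

lemma generator_hom:
 assumes M: "left_module DD M" and y: "y \<in> carrier M"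
 shows "(\<lambda>d\<in>carrier (D_proj n 0). d \<odot>\<^sub>M y) \<in> lmod_hom DD (D_proj n 0) M"
proof -
 interpret M: dmod n M by (rule dmod[OF M])
 show ?thesis
  by (rule lmod_homI[OF _ _ _ D_proj_module[OF zero_less_n]])
   (simp_all add: D_proj_mem_iff[OF zero_less_n] D_proj_simps M.smult_closed M.smult_l_distr M.smult_assoc y)
qed

text \<open>
 The trace of \<open>T\<close> is the trace of its summand \<open>T\<^sub>n = D\<^sub>0\<close>, since the other summands are
 quotients of \<open>D\<^sub>0\<close>.
\<close>

lemma eta_eq:
 assumes M: "left_module DD M"
 shows "eta n M = etaS M"
proof -
 interpret M: dmod n M by (rule dmod[OF M])
 let ?T = "T_sum n {1..n}" and ?P = "D_proj n 0"
 interpret P: dmod n ?P by (rule dmod[OF D_proj_module[OF zero_less_n]])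
 let ?G = "\<Union>f\<in>lmod_hom DD ?T M. f ` carrier ?T"
 have GE: "?G \<subseteq> etaS M"
 proof (rule UN_least, rule image_subsetI)
  fix f x assume "f \<in> lmod_hom DD ?T M" "x \<in> carrier ?T"
  then show "f x \<in> etaS M" using etaS_hom[OF _ T_sum_module] by (simp add: etaS_T_sum)
 qed
 have sg: "subgroup (etaS M) (add_monoid M)" using M.etaS_submodule by (simp add: submodule_def)
 have 1: "eta n M \<subseteq> etaS M"
  unfolding eta_def mod_trace_def by (rule group.generate_subgroup_incl[OF M.M.a_group GE sg])
 have GM: "?G \<subseteq> carrier (add_monoid M)" using GE M.etaS_subset by auto
 have sg': "subgroup (eta n M) (add_monoid M)"
  unfolding eta_def mod_trace_def by (rule group.generate_is_subgroup[OF M.M.a_group GM])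
 have sm: "a \<odot>\<^sub>M x \<in> eta n M" if a: "a \<in> carrier DD" and "x \<in> eta n M" for a x
  using that(2) unfolding eta_def mod_trace_def
 proof (induction rule: generate.induct)
  case one
  have "a \<odot>\<^sub>M \<one>\<^bsub>add_monoid M\<^esub> = \<one>\<^bsub>add_monoid M\<^esub>" using a by simp
  then show ?case using generate.one[of "add_monoid M" ?G] by simp
 next
  case (incl h)
  then obtain f t where f: "f \<in> lmod_hom DD ?T M" "t \<in> carrier ?T" "h = f t" by auto
  have "a \<odot>\<^sub>M h = f (a \<odot>\<^sub>?T t)" unfolding f(3) by (rule lmod_homD(3)[OF f(1) a f(2), symmetric])
  moreover have "a \<odot>\<^sub>?T t \<in> carrier ?T" by (rule left_module.smult_closed[OF T_sum_module a f(2)])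
  ultimately have "a \<odot>\<^sub>M h \<in> ?G" using f(1) by blast
  then show ?case by (rule generate.incl)
 next
  case (inv h)
  then obtain f t where f: "f \<in> lmod_hom DD ?T M" "t \<in> carrier ?T" "h = f t" by auto
  have hM: "h \<in> carrier M" unfolding f(3) by (rule lmod_homD(1)[OF f(1,2)])
  have "a \<odot>\<^sub>M h = f (a \<odot>\<^sub>?T t)" unfolding f(3) by (rule lmod_homD(3)[OF f(1) a f(2), symmetric])
  moreover have "a \<odot>\<^sub>?T t \<in> carrier ?T" by (rule left_module.smult_closed[OF T_sum_module a f(2)])
  ultimately have "a \<odot>\<^sub>M h \<in> ?G" using f(1) by blast
  then have "inv\<^bsub>add_monoid M\<^esub> (a \<odot>\<^sub>M h) \<in> generate (add_monoid M) ?G" by (rule generate.inv)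
  moreover have "a \<odot>\<^sub>M (inv\<^bsub>add_monoid M\<^esub> h) = inv\<^bsub>add_monoid M\<^esub> (a \<odot>\<^sub>M h)"
   using M.smult_r_minus[OF a hM] by (simp add: a_inv_def)
  ultimately show ?case by simp
 next
  case (eng h1 h2)
  have c: "h1 \<in> carrier M" "h2 \<in> carrier M"
   using subgroup.mem_carrier[OF group.generate_is_subgroup[OF M.M.a_group GM] eng.hyps(1)]
    subgroup.mem_carrier[OF group.generate_is_subgroup[OF M.M.a_group GM] eng.hyps(2)] by simp_all
  have "a \<odot>\<^sub>M (h1 \<otimes>\<^bsub>add_monoid M\<^esub> h2) = (a \<odot>\<^sub>M h1) \<otimes>\<^bsub>add_monoid M\<^esub> (a \<odot>\<^sub>M h2)"
   using M.smult_r_distr[OF a c] by simp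
  then show ?case using generate.eng[OF eng.IH] by simp
 qed
 have sub: "submodule (eta n M) DD M"
  using sg' sm by (intro submodule.intro submodule_axioms.intro)
 have "etaS M \<subseteq> eta n M"
 proof
  fix x assume x: "x \<in> etaS M"
  show "x \<in> eta n M"
  proof (rule M.vertex_sub[OF sub M.etaS_subset[OF x]])
   fix k assume k: "k < n"
   obtain y where y: "y \<in> carrier M" "dU k k k \<odot>\<^sub>M x = dU 0 k k \<odot>\<^sub>M y" by (rule M.etaSE[OF x k])
   obtain h where h: "h \<in> lmod_hom DD (quotient_module ?P {\<zero>\<^sub>?P}) M"
    "\<And>d. d \<in> carrier ?P ==> h ({\<zero>\<^sub>?P} +>\<^sub>?P d) = (\<lambda>d\<in>carrier ?P. d \<odot>\<^sub>M y) d"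
   proof (rule quotient_hom[OF P.left_module_axioms M P.submodule_zero generator_hom[OF M y(1)]])
    fix x assume "x \<in> {\<zero>\<^sub>?P}"
    then show "(\<lambda>d\<in>carrier ?P. d \<odot>\<^sub>M y) x = \<zero>\<^sub>M"
     using P.M.zero_closed M.smult_l_null[OF y(1)] by (simp add: D_proj_simps)
   next
    fix h assume 1: "h \<in> lmod_hom DD (quotient_module ?P {\<zero>\<^sub>?P}) M"
     and 2: "\<And>d. d \<in> carrier ?P ==> h ({\<zero>\<^sub>?P} +>\<^sub>?P d) = (\<lambda>d\<in>carrier ?P. d \<odot>\<^sub>M y) d"
    show thesis by (rule that[OF 1]) (erule 2)
   qed
   have Tn: "T_mod n n = quotient_module ?P {\<zero>\<^sub>?P}"
    by (simp add: T_mod_def D_proj_in_D0_def D_proj_simps)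
   have nn: "n \<in> {1..n}" using n_gt_1 by simp
   have pj: "(\<lambda>t\<in>carrier ?T. t n) \<in> lmod_hom DD ?T (T_mod n n)"
    unfolding T_sum_def by (rule direct_sum_proj_hom[OF T_sum_module[unfolded T_sum_def] nn])
   define f where "f = (\<lambda>t\<in>carrier ?T. h ((\<lambda>t\<in>carrier ?T. t n) t))"
   have f: "f \<in> lmod_hom DD ?T M"
    unfolding f_def by (rule lmod_hom_compose[OF pj _ T_sum_module]) (simp add: Tn h(1))
   have d: "dU 0 k k \<in> carrier ?P"
    using dU_mult[of 0 0 0 0 k k] by (simp add: D_proj_mem_iff[OF zero_less_n] dU_closed)
   define t where "t = (\<lambda>j\<in>{1..n}. if j = n then {\<zero>\<^sub>?P} +>\<^sub>?P dU 0 k k else \<zero>\<^bsub>T_mod n j\<^esub>)"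
   have t: "t \<in> carrier ?T"
    unfolding T_sum_def t_def
   proof (rule direct_sum_memI)
    fix j
    have "{\<zero>\<^sub>?P} +>\<^sub>?P dU 0 k k \<in> carrier (T_mod n n)"
     unfolding Tn P.quotient_module_simps(1)[OF P.submodule_zero] by (rule imageI[OF d])
    moreover have "\<zero>\<^bsub>T_mod n j\<^esub> \<in> carrier (T_mod n j)"
     by (rule abelian_groupE(2)[OF left_module_abelian_group[OF T_mod_module]])
    ultimately show "(if j = n then {\<zero>\<^sub>?P} +>\<^sub>?P dU 0 k k else \<zero>\<^bsub>T_mod n j\<^esub>) \<in> carrier (T_mod n j)" by simp
   qed
   have "f t = dU 0 k k \<odot>\<^sub>M y"
    using t nn h(2)[OF d] d by (simp add: f_def) (simp add: t_def)
   then have "dU k k k \<odot>\<^sub>M x = f t" using y(2) by simp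
   moreover have "f t \<in> ?G" using f t by blast
   ultimately show "dU k k k \<odot>\<^sub>M x \<in> eta n M"
    unfolding eta_def mod_trace_def using generate.incl by metis
  qed
 qed
 then show ?thesis using 1 by blast
qed

end

section \<open>The functor \<open>\<pi>\<close>\<close>

context amod
begin

lemma sc_inject:
 assumes x: "x \<in> carrier M" "x \<noteq> \<zero>\<^sub>M" and e: "sc c x = sc d x"
 shows "c = d"
proof (rule ccontr)
 assume cd: "c \<noteq> d"
 have "sc c x = sc (c - d) x \<oplus>\<^sub>M sc d x" using sc_ladd[OF x(1), of "c - d" d] by simp
 then have "sc (c - d) x \<oplus>\<^sub>M sc d x = sc d x" using e by simp
 then have "sc (c - d) x = \<zero>\<^sub>M"
  using add_diff_cancel[OF sc_closed[OF x(1), of d] sc_closed[OF x(1), of "c - d"]]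
   diff_zero_iff[OF sc_closed[OF x(1), of d] sc_closed[OF x(1), of d]]
   M.a_comm[OF sc_closed[OF x(1), of d] sc_closed[OF x(1), of "c - d"]] by simp
 then have "x = \<zero>\<^sub>M" by (rule sc_eq_zeroD[OF x(1)]) (use cd in simp)
 then show False using x(2) by simp
qed

lemma smult_l_uminus: "a \<in> carrier A ==> x \<in> carrier M ==> (\<ominus>\<^sub>A a) \<odot>\<^sub>M x = \<ominus>\<^sub>M (a \<odot>\<^sub>M x)"
 using smult_l_diff[of "\<zero>\<^sub>A" a x] smult_closed[of a x] by (simp add: a_minus_def)

end

context auslander
begin

lemma Pi_ideal_ideal: "ideal (Pi_ideal n) DD"
 unfolding Pi_ideal_def by (rule DD.genideal_ideal) (simp add: D_e_dU[OF zero_less_n] dU_closed)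

sublocale PiQ: calg_quotient DD "Pi_ideal n"
 by (intro calg_quotient.intro DD.calg_axioms Pi_ideal_ideal)

lemma Pi_alg_eq: "PP = quotient_algebra DD (Pi_ideal n)"
 by (simp add: Pi_alg_def)

sublocale PiA: calg "PP"
 unfolding Pi_alg_eq by (rule PiQ.Q_calg)

text \<open>The projection \<open>D \<rightarrow> \<Pi>\<close>.\<close>

definition sig :: "D_elem => Pi_elem" where "sig d = Pi_ideal n +>\<^sub>DD d"

lemma sig_hom: "sig \<in> ring_hom DD PP"
 using PiQ.Q_proj_hom unfolding Pi_alg_eq sig_def[abs_def] .

lemma sig_surj: "sig ` carrier DD = carrier PP"
 unfolding Pi_alg_eq PiQ.Q_carrier sig_def ..

lemma sig_closed: "d \<in> carrier DD ==> sig d \<in> carrier PP"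
 unfolding sig_surj[symmetric] by (rule imageI)

lemma sig_cases:
 assumes "A \<in> carrier PP" obtains d where "d \<in> carrier DD" "A = sig d"
 using assms unfolding sig_surj[symmetric] by (elim imageE) simp

lemma sig_scal: "d \<in> carrier DD ==> sig (c \<odot>\<^sub>DD d) = c \<odot>\<^sub>PP sig d"
 unfolding sig_def Pi_alg_eq by (rule PiQ.Q_smult[symmetric])

lemma sig_c1: "sig (c \<odot>\<^sub>DD \<one>\<^sub>DD) = c \<odot>\<^sub>PP \<one>\<^sub>PP"
 using sig_scal[OF DD.one_closed] ring_hom_one[OF sig_hom] by simp

lemma sig_eq_zero_iff: "d \<in> carrier DD ==> sig d = \<zero>\<^sub>PP \<longleftrightarrow> d \<in> Pi_ideal n"
 using PiQ.I.a_rcos_const[of d] PiQ.I.a_rcos_self[of d]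
 by (auto simp: sig_def Pi_alg_eq quotient_algebra_simps)

lemma dU0_Pi_ideal: "dU 0 k m \<in> Pi_ideal n"
proof (cases "k \<le> m")
 case True
 have "dU 0 0 0 \<in> Pi_ideal n"
  unfolding Pi_ideal_def D_e_dU[OF zero_less_n] by (rule DD.genideal_self'[OF dU_closed])
 then have "dU 0 k m \<otimes>\<^sub>DD dU 0 0 0 \<in> Pi_ideal n" by (rule PiQ.I.I_l_closed[OF _ dU_closed])
 then show ?thesis using dU_mult[of 0 0 0 0 m k] True by simp
next
 case False
 then have "dU 0 k m = \<zero>\<^sub>DD" by (simp add: dU_def)
 then show ?thesis by simp
qed

text \<open>The elements of \<open>D\<close> that map \<open>M\<close> into \<open>D e\<^sub>0 M\<close> form a two-sided ideal that contains \<open>e\<^sub>0\<close>.\<close>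

lemma Pi_ideal_act:
 assumes M: "left_module DD M" and a: "a \<in> Pi_ideal n" and x: "x \<in> carrier M"
 shows "a \<odot>\<^sub>M x \<in> etaS M"
proof -
 interpret M: dmod n M by (rule dmod[OF M])
 let ?K = "{a \<in> carrier DD. \<forall>x\<in>carrier M. a \<odot>\<^sub>M x \<in> etaS M}"
 note E = M.submoduleD[OF M.etaS_submodule]
 have "ideal ?K DD"
 proof (rule idealI[OF DD.ring_axioms])
  show "subgroup ?K (add_monoid DD)"
  proof (rule subgroup.intro)
   fix a b assume "a \<in> ?K" "b \<in> ?K"
   then show "a \<otimes>\<^bsub>add_monoid DD\<^esub> b \<in> ?K" using E(4) by (simp add: M.smult_l_distr)
  next
   fix a assume "a \<in> ?K"
   then have "\<ominus>\<^sub>DD a \<in> ?K" using E(5) by (simp add: M.smult_l_uminus)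
   then show "inv\<^bsub>add_monoid DD\<^esub> a \<in> ?K" by (simp add: a_inv_def)
  qed (use E(2) in auto)
 next
  fix a x assume a: "a \<in> ?K" and x: "x \<in> carrier DD"
  then show "x \<otimes>\<^sub>DD a \<in> ?K" using E(7)[OF x] by (simp add: M.smult_assoc)
  show "a \<otimes>\<^sub>DD x \<in> ?K" using a x M.smult_closed[OF x] by (simp add: M.smult_assoc)
 qed
 moreover have "{D_e n 0} \<subseteq> ?K"
  using M.u0_etaS[of _ 0 0] by (simp add: D_e_dU[OF zero_less_n] dU_closed)
 ultimately have "Pi_ideal n \<subseteq> ?K" unfolding Pi_ideal_def by (rule DD.genideal_minimal)
 then show ?thesis using a x by blast
qed

text \<open>The projection \<open>M \<rightarrow> \<pi> M\<close>.\<close>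

definition qpi :: "(D_elem, 'c) module => 'c => 'c set" where "qpi M x = etaS M +>\<^sub>M x"

lemma qpi_eq_iff:
 "left_module DD M ==> x \<in> carrier M ==> y \<in> carrier M ==> qpi M x = qpi M y \<longleftrightarrow> x \<ominus>\<^sub>M y \<in> etaS M"
 unfolding qpi_def by (rule lmod.coset_eq_iff[OF lmod.intro dmod.etaS_submodule[OF dmod]])

lemma pi_obj_simps:
 assumes M: "left_module DD M"
 shows "carrier (pi_obj n M) = qpi M ` carrier M"
  and "\<zero>\<^bsub>pi_obj n M\<^esub> = qpi M \<zero>\<^sub>M"
  and "x \<in> carrier M ==> y \<in> carrier M ==> qpi M x \<oplus>\<^bsub>pi_obj n M\<^esub> qpi M y = qpi M (x \<oplus>\<^sub>M y)"
  and "d \<in> carrier DD ==> x \<in> carrier M ==> sig d \<odot>\<^bsub>pi_obj n M\<^esub> qpi M x = qpi M (d \<odot>\<^sub>M x)"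
proof -
 interpret M: dmod n M by (rule dmod[OF M])
 note E = M.etaS_submodule and e = eta_eq[OF M]
 show "carrier (pi_obj n M) = qpi M ` carrier M"
  by (simp add: pi_obj_def e M.a_rcosets_image qpi_def[abs_def])
 show "\<zero>\<^bsub>pi_obj n M\<^esub> = qpi M \<zero>\<^sub>M"
  using M.submoduleD(1)[OF E] by (simp add: pi_obj_def e qpi_def)
 show "qpi M x \<oplus>\<^bsub>pi_obj n M\<^esub> qpi M y = qpi M (x \<oplus>\<^sub>M y)" if "x \<in> carrier M" "y \<in> carrier M"
  using M.coset_add[OF E that] by (simp add: pi_obj_def qpi_def)
 assume d: "d \<in> carrier DD" and x: "x \<in> carrier M"
 have "qpi M (a \<odot>\<^sub>M y) = qpi M (d \<odot>\<^sub>M x)" if a: "a \<in> sig d" and y: "y \<in> qpi M x" for a y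
 proof -
  have aD: "a \<in> carrier DD" using PiQ.I.a_elemrcos_carrier[OF d] a unfolding sig_def .
  have ad: "a \<ominus>\<^sub>DD d \<in> Pi_ideal n"
   using PiQ.I.a_rcos_module_imp[OF d] a unfolding sig_def a_minus_def .
  note c = M.coset_memD[OF E x y[unfolded qpi_def]]
  have "a \<odot>\<^sub>M y \<ominus>\<^sub>M d \<odot>\<^sub>M y \<in> etaS M"
   unfolding M.smult_l_diff[OF aD d c(1)] by (rule Pi_ideal_act[OF M ad c(1)])
  then have 1: "qpi M (a \<odot>\<^sub>M y) = qpi M (d \<odot>\<^sub>M y)"
   by (rule iffD2[OF qpi_eq_iff[OF M M.smult_closed[OF aD c(1)] M.smult_closed[OF d c(1)]]])
  have "d \<odot>\<^sub>M y \<ominus>\<^sub>M d \<odot>\<^sub>M x \<in> etaS M"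
   unfolding M.smult_r_diff[OF d c(1) x, symmetric] by (rule M.submoduleD(7)[OF E d c(2)])
  then have "qpi M (d \<odot>\<^sub>M y) = qpi M (d \<odot>\<^sub>M x)"
   by (rule iffD2[OF qpi_eq_iff[OF M M.smult_closed[OF d c(1)] M.smult_closed[OF d x]]])
  then show ?thesis using 1 by simp
 qed
 then have "(\<Union>a\<in>sig d. \<Union>y\<in>qpi M x. qpi M (a \<odot>\<^sub>M y)) = (\<Union>a\<in>sig d. \<Union>y\<in>qpi M x. qpi M (d \<odot>\<^sub>M x))"
  by (intro SUP_cong refl)
 also have "\<dots> = qpi M (d \<odot>\<^sub>M x)"
  using PiQ.I.a_rcos_self[OF d] M.coset_self[OF E x] unfolding sig_def qpi_def[of M x]
  by (metis SUP_const empty_iff)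
 finally show "sig d \<odot>\<^bsub>pi_obj n M\<^esub> qpi M x = qpi M (d \<odot>\<^sub>M x)" by (simp add: pi_obj_def e qpi_def)
qed

lemma pi_module:
 assumes M: "left_module DD M"
 shows "left_module PP (pi_obj n M)"
 by (rule left_module_image[OF M PiA.ring_axioms sig_hom sig_surj pi_obj_simps(1)[OF M, symmetric]])
  (simp_all add: pi_obj_simps[OF M])

lemma qpi_closed: "left_module DD M ==> x \<in> carrier M ==> qpi M x \<in> carrier (pi_obj n M)"
 by (simp add: pi_obj_simps(1))

lemma pi_cases:
 assumes "left_module DD M" "X \<in> carrier (pi_obj n M)"
 obtains x where "x \<in> carrier M" "X = qpi M x"
 using assms(2) unfolding pi_obj_simps(1)[OF assms(1)] by (elim imageE) simp

text \<open>Additive maps from \<open>D\<close>-modules to \<open>\<Pi>\<close>-modules that are semilinear along \<open>D \<rightarrow> \<Pi>\<close>.\<close>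

definition semi :: "(D_elem, 'c) module => (Pi_elem, 'd) module => ('c => 'd) => bool"
 where "semi M N \<kappa> \<longleftrightarrow> (\<forall>x\<in>carrier M. \<kappa> x \<in> carrier N) \<and>
  (\<forall>x\<in>carrier M. \<forall>y\<in>carrier M. \<kappa> (x \<oplus>\<^sub>M y) = \<kappa> x \<oplus>\<^sub>N \<kappa> y) \<and>
  (\<forall>d\<in>carrier DD. \<forall>x\<in>carrier M. \<kappa> (d \<odot>\<^sub>M x) = sig d \<odot>\<^sub>N \<kappa> x)"

lemma semiD:
 assumes "semi M N \<kappa>"
 shows "x \<in> carrier M ==> \<kappa> x \<in> carrier N"
  and "x \<in> carrier M ==> y \<in> carrier M ==> \<kappa> (x \<oplus>\<^sub>M y) = \<kappa> x \<oplus>\<^sub>N \<kappa> y"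
  and "d \<in> carrier DD ==> x \<in> carrier M ==> \<kappa> (d \<odot>\<^sub>M x) = sig d \<odot>\<^sub>N \<kappa> x"
 using assms unfolding semi_def by simp_all

lemma semi_qpi: "left_module DD M ==> semi M (pi_obj n M) (qpi M)"
 unfolding semi_def by (simp add: pi_obj_simps)

lemma semi_hom:
 "semi M N \<kappa> ==> f \<in> lmod_hom PP N N' ==> semi M N' (\<lambda>x. f (\<kappa> x))"
 using lmod_homD[of f "PP" N N'] sig_closed unfolding semi_def by simp

lemma semi_compose:
 "f \<in> lmod_hom DD L M ==> semi M N \<kappa> ==> semi L N (\<lambda>x. \<kappa> (f x))"
 using lmod_homD[of f DD L M] unfolding semi_def by simp

lemma semi_scal:
 "left_module DD M ==> semi M N \<kappa> ==> x \<in> carrier M ==> \<kappa> (scal DD M c x) = scal PP N c (\<kappa> x)"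
 unfolding scal_def sig_c1[symmetric] by (rule semiD(3)) (simp_all add: DD.cs_closed)

lemma semi_zero:
 assumes M: "left_module DD M" and N: "left_module PP N" and k: "semi M N \<kappa>"
 shows "\<kappa> \<zero>\<^sub>M = \<zero>\<^sub>N"
proof -
 interpret M: dmod n M by (rule dmod[OF M])
 interpret N: amod "PP" N by (rule amod_intro[OF PiA.calg_axioms N])
 have "\<kappa> \<zero>\<^sub>M = \<kappa> (scal DD M 0 \<zero>\<^sub>M)" by (simp add: M.sc_zero_left)
 also have "\<dots> = scal PP N 0 (\<kappa> \<zero>\<^sub>M)" by (rule semi_scal[OF M k M.M.zero_closed])
 also have "\<dots> = \<zero>\<^sub>N" by (rule N.sc_zero_left[OF semiD(1)[OF k M.M.zero_closed]])
 finally show ?thesis .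
qed

lemma semi_kernel_submodule:
 assumes M: "left_module DD M" and N: "left_module PP N" and k: "semi M N \<kappa>"
  and K: "submodule K PP N"
 shows "submodule {x \<in> carrier M. \<kappa> x \<in> K} DD M"
proof -
 interpret M: dmod n M by (rule dmod[OF M])
 interpret N: amod "PP" N by (rule amod_intro[OF PiA.calg_axioms N])
 note KD = N.submoduleD[OF K] and kD = semiD[OF k]
 show ?thesis
  by (rule M.submodule_intro)
   (use KD(2) in \<open>simp_all add: subset_eq kD semi_zero[OF M N k] KD(4) KD(7) sig_closed M.smult_closed\<close>)
qed

lemma semi_eta:
 assumes M: "left_module DD M" and N: "left_module PP N" and k: "semi M N \<kappa>" and x: "x \<in> etaS M"
 shows "\<kappa> x = \<zero>\<^sub>N"
proof -
 interpret M: dmod n M by (rule dmod[OF M])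
 interpret N: amod "PP" N by (rule amod_intro[OF PiA.calg_axioms N])
 have "x \<in> {x \<in> carrier M. \<kappa> x \<in> {\<zero>\<^sub>N}}"
 proof (rule M.vertex_sub[OF semi_kernel_submodule[OF M N k N.submodule_zero] M.etaS_subset[OF x]])
  fix l assume l: "l < n"
  obtain y where y: "y \<in> carrier M" "M.u l l l x = M.u 0 l l y" by (rule M.etaSE[OF x l])
  have "sig (dU 0 l l) = \<zero>\<^sub>PP" using sig_eq_zero_iff[OF dU_closed] dU0_Pi_ideal by simp
  then have "\<kappa> (M.u 0 l l y) = \<zero>\<^sub>N"
   unfolding semiD(3)[OF k dU_closed y(1)] by (simp add: semiD(1)[OF k y(1)])
  then show "M.u l l l x \<in> {x \<in> carrier M. \<kappa> x \<in> {\<zero>\<^sub>N}}" unfolding y(2) by (simp add: M.u_closed[OF y(1)])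
 qed
 then show ?thesis by simp
qed

lemma semi_diff:
 assumes M: "left_module DD M" and N: "left_module PP N" and k: "semi M N \<kappa>"
  and x: "x \<in> carrier M" and y: "y \<in> carrier M"
 shows "\<kappa> (x \<ominus>\<^sub>M y) = \<kappa> x \<ominus>\<^sub>N \<kappa> y"
proof -
 interpret M: dmod n M by (rule dmod[OF M])
 interpret N: amod "PP" N by (rule amod_intro[OF PiA.calg_axioms N])
 have xy: "x \<ominus>\<^sub>M y \<in> carrier M" using x y by simp
 note kD = semiD[OF k]
 have "\<kappa> y \<oplus>\<^sub>N \<kappa> (x \<ominus>\<^sub>M y) = \<kappa> (y \<oplus>\<^sub>M (x \<ominus>\<^sub>M y))" by (rule kD(2)[OF y xy, symmetric])
 also have "y \<oplus>\<^sub>M (x \<ominus>\<^sub>M y) = x" using M.diff_add_cancel[OF x y] M.M.a_comm[OF y xy] by simp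
 finally show ?thesis using N.add_diff_cancel[OF kD(1)[OF y] kD(1)[OF xy]] by simp
qed

lemma semi_factor:
 assumes M: "left_module DD M" and N: "left_module PP N" and k: "semi M N \<kappa>"
 obtains h where "h \<in> lmod_hom PP (pi_obj n M) N" "\<And>x. x \<in> carrier M ==> h (qpi M x) = \<kappa> x"
proof -
 interpret M: dmod n M by (rule dmod[OF M])
 interpret N: amod "PP" N by (rule amod_intro[OF PiA.calg_axioms N])
 note kD = semiD[OF k] and P = pi_obj_simps[OF M]
 define h where "h X = \<kappa> (SOME x. x \<in> carrier M \<and> X = qpi M x)" for X
 have h: "h (qpi M x) = \<kappa> x" if x: "x \<in> carrier M" for x
 proof -
  define y where "y = (SOME y. y \<in> carrier M \<and> qpi M x = qpi M y)"
  have "\<exists>y. y \<in> carrier M \<and> qpi M x = qpi M y" using x by (intro exI[of _ x]) simp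
  then have "y \<in> carrier M \<and> qpi M x = qpi M y" unfolding y_def by (rule someI_ex)
  then have yc: "y \<in> carrier M" and xy: "qpi M x = qpi M y" by (rule conjunct1, rule conjunct2)
  have "x \<ominus>\<^sub>M y \<in> etaS M" by (rule iffD1[OF qpi_eq_iff[OF M x yc] xy])
  then have "\<kappa> x \<ominus>\<^sub>N \<kappa> y = \<zero>\<^sub>N" unfolding semi_diff[OF M N k x yc, symmetric] by (rule semi_eta[OF M N k])
  then have "\<kappa> x = \<kappa> y" by (rule iffD1[OF N.diff_zero_iff[OF kD(1)[OF x] kD(1)[OF yc]]])
  then show ?thesis unfolding h_def y_def[symmetric] by (rule sym)
 qed
 show thesis
 proof (rule that)
  show "(\<lambda>X\<in>carrier (pi_obj n M). h X) \<in> lmod_hom PP (pi_obj n M) N"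
  proof (rule lmod_homI[OF _ _ _ pi_module[OF M]])
   fix X assume X: "X \<in> carrier (pi_obj n M)"
   obtain x where x: "x \<in> carrier M" "X = qpi M x" by (rule pi_cases[OF M X])
   show "h X \<in> carrier N" unfolding x(2) h[OF x(1)] by (rule kD(1)[OF x(1)])
   fix A assume A: "A \<in> carrier PP"
   obtain d where d: "d \<in> carrier DD" "A = sig d" by (rule sig_cases[OF A])
   show "h (A \<odot>\<^bsub>pi_obj n M\<^esub> X) = A \<odot>\<^sub>N h X"
    unfolding x(2) d(2) P(4)[OF d(1) x(1)] h[OF x(1)] h[OF M.smult_closed[OF d(1) x(1)]] by (rule kD(3)[OF d(1) x(1)])
  next
   fix X Y assume X: "X \<in> carrier (pi_obj n M)" and Y: "Y \<in> carrier (pi_obj n M)"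
   obtain x where x: "x \<in> carrier M" "X = qpi M x" by (rule pi_cases[OF M X])
   obtain y where y: "y \<in> carrier M" "Y = qpi M y" by (rule pi_cases[OF M Y])
   show "h (X \<oplus>\<^bsub>pi_obj n M\<^esub> Y) = h X \<oplus>\<^sub>N h Y"
    unfolding x(2) y(2) P(3)[OF x(1) y(1)] h[OF x(1)] h[OF y(1)] h[OF M.M.a_closed[OF x(1) y(1)]]
    by (rule kD(2)[OF x(1) y(1)])
  qed
  show "(\<lambda>X\<in>carrier (pi_obj n M). h X) (qpi M x) = \<kappa> x" if "x \<in> carrier M" for x
   using h[OF that] qpi_closed[OF M that] by simp
 qed
qed

lemma semi_factor_inj:
 assumes M: "left_module DD M" and N: "left_module PP N" and k: "semi M N \<kappa>"
  and ker: "\<And>x. x \<in> carrier M ==> \<kappa> x = \<zero>\<^sub>N ==> x \<in> etaS M"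
  and h: "\<And>x. x \<in> carrier M ==> h (qpi M x) = \<kappa> x"
 shows "inj_on h (carrier (pi_obj n M))"
proof (rule inj_onI)
 interpret M: dmod n M by (rule dmod[OF M])
 interpret N: amod "PP" N by (rule amod_intro[OF PiA.calg_axioms N])
 fix X Y assume X: "X \<in> carrier (pi_obj n M)" and Y: "Y \<in> carrier (pi_obj n M)" and e: "h X = h Y"
 obtain x where x: "x \<in> carrier M" "X = qpi M x" by (rule pi_cases[OF M X])
 obtain y where y: "y \<in> carrier M" "Y = qpi M y" by (rule pi_cases[OF M Y])
 have "\<kappa> x = \<kappa> y" using e unfolding x(2) y(2) h[OF x(1)] h[OF y(1)] .
 then have "\<kappa> (x \<ominus>\<^sub>M y) = \<zero>\<^sub>N" unfolding semi_diff[OF M N k x(1) y(1)]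
  by (rule iffD2[OF N.diff_zero_iff[OF semiD(1)[OF k x(1)] semiD(1)[OF k y(1)]]])
 then have "x \<ominus>\<^sub>M y \<in> etaS M" by (rule ker[rotated]) (simp add: x y)
 then show "X = Y" unfolding x(2) y(2) by (rule iffD2[OF qpi_eq_iff[OF M x(1) y(1)]])
qed

lemma pi_mor_qpi:
 assumes M: "left_module DD M" and N: "left_module DD N" and f: "f \<in> lmod_hom DD M N" and x: "x \<in> carrier M"
 shows "pi_mor n M N f (qpi M x) = qpi N (f x)"
proof -
 interpret M: dmod n M by (rule dmod[OF M])
 note fD = lmod_homD[OF f]
 have "qpi N (f y) = qpi N (f x)" if y: "y \<in> qpi M x" for y
 proof -
  note c = M.coset_memD[OF M.etaS_submodule x y[unfolded qpi_def]]
  have "f (y \<ominus>\<^sub>M x) \<in> etaS N" by (rule etaS_hom[OF f M c(2)])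
  then have "f y \<ominus>\<^sub>N f x \<in> etaS N" unfolding lmod_hom_diff[OF M N f c(1) x] .
  then show ?thesis by (rule iffD2[OF qpi_eq_iff[OF N fD(1)[OF c(1)] fD(1)[OF x]]])
 qed
 then have "(\<Union>y\<in>qpi M x. qpi N (f y)) = (\<Union>y\<in>qpi M x. qpi N (f x))" by (intro SUP_cong refl)
 also have "\<dots> = qpi N (f x)"
  using M.coset_self[OF M.etaS_submodule x] unfolding qpi_def[of M x] by (metis SUP_const empty_iff)
 finally show ?thesis using qpi_closed[OF M x] by (simp add: pi_mor_def eta_eq[OF N] qpi_def)
qed

lemma pi_mor_hom:
 assumes M: "left_module DD M" and N: "left_module DD N" and f: "f \<in> lmod_hom DD M N"
 shows "pi_mor n M N f \<in> lmod_hom PP (pi_obj n M) (pi_obj n N)"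
proof -
 obtain h where h: "h \<in> lmod_hom PP (pi_obj n M) (pi_obj n N)"
  "\<And>x. x \<in> carrier M ==> h (qpi M x) = qpi N (f x)"
 proof (rule semi_factor[OF M pi_module[OF N] semi_compose[OF f semi_qpi[OF N]]])
  fix h assume 1: "h \<in> lmod_hom PP (pi_obj n M) (pi_obj n N)"
   and 2: "\<And>x. x \<in> carrier M ==> h (qpi M x) = qpi N (f x)"
  show thesis by (rule that[OF 1]) (erule 2)
 qed
 have "pi_mor n M N f = h"
 proof (rule extensionalityI)
  show "pi_mor n M N f \<in> extensional (carrier (pi_obj n M))" by (simp add: pi_mor_def)
  show "h \<in> extensional (carrier (pi_obj n M))" using h(1) by (simp add: lmod_hom_def PiE_def)
  fix X assume X: "X \<in> carrier (pi_obj n M)"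
  obtain x where x: "x \<in> carrier M" "X = qpi M x" by (rule pi_cases[OF M X])
  show "pi_mor n M N f X = h X" unfolding x(2) h(2)[OF x(1)] by (rule pi_mor_qpi[OF M N f x(1)])
 qed
 then show ?thesis using h(1) by simp
qed

lemma pi_finite_dimensional:
 assumes M: "left_module DD M" and fd: "finite_dimensional DD M"
 shows "finite_dimensional PP (pi_obj n M)"
 by (rule finite_dimensional_image[OF amod_intro[OF DD.calg_axioms M] amod_intro[OF PiA.calg_axioms pi_module[OF M]]
    pi_obj_simps(1)[OF M, symmetric] pi_obj_simps(3)[OF M, symmetric] semi_scal[OF M semi_qpi[OF M]] fd])

section \<open>Standard filtrations\<close>

text \<open>The arrows \<open>a\<^sub>k\<close> act injectively on \<open>M / H\<close>. For \<open>H = 0\<close> this characterizes the modules with a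
 standard filtration among the finite-dimensional ones.\<close>

definition satur :: "(D_elem, 'c) module => 'c set => bool"
 where "satur M H \<longleftrightarrow> (\<forall>k x. 1 \<le> k --> k < n --> x \<in> carrier M --> dU k k k \<odot>\<^sub>M x = x -->
  dU k (k - 1) k \<odot>\<^sub>M x \<in> H --> x \<in> H)"

lemma saturD:
 "satur M H ==> 1 \<le> k ==> k < n ==> x \<in> carrier M ==> dU k k k \<odot>\<^sub>M x = x ==>
  dU k (k - 1) k \<odot>\<^sub>M x \<in> H ==> x \<in> H"
 unfolding satur_def by blast

end

context dmod
begin

lemma at_vertex_iff: "k < n ==> x \<in> at_vertex n M k \<longleftrightarrow> (\<exists>y\<in>carrier M. x = u k k k y)"
 by (auto simp: at_vertex_def D_e_dU)

lemma u_at_vertex: "k < n ==> y \<in> carrier M ==> u k k k y \<in> at_vertex n M k"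
 unfolding at_vertex_iff by (rule bexI) simp_all

lemma standard_inj:
 assumes s: "is_standard n i M" and i: "1 \<le> i" "i \<le> n"
  and k: "1 \<le> k" "k < n" and x: "x \<in> carrier M" "u k k k x = x" and z: "u k (k - 1) k x = \<zero>\<^sub>M"
 shows "x = \<zero>\<^sub>M"
proof -
 have xv: "x \<in> at_vertex n M k" using u_at_vertex[OF k(2) x(1)] x(2) by simp
 have zv: "\<zero>\<^sub>M \<in> at_vertex n M k" using u_at_vertex[OF k(2) M.zero_closed] u_null by simp
 show ?thesis
 proof (cases "k \<le> i - 1")
  case True
  then have "bij_betw (\<lambda>x. D_a n k \<odot>\<^sub>M x) (at_vertex n M k) (at_vertex n M (k - 1))"
   using s k(1) unfolding is_standard_def by simp
  then have inj: "inj_on (\<lambda>x. u k (k - 1) k x) (at_vertex n M k)"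
   unfolding D_a_eq_dU[OF k] by (rule bij_betw_imp_inj_on)
  show ?thesis by (rule inj_onD[OF inj _ xv zv]) (simp only: z u_null)
 next
  case False
  then have "at_vertex n M k = {\<zero>\<^sub>M}" using s k(2) unfolding is_standard_def by simp
  then show ?thesis using xv by simp
 qed
qed

lemma standard_generator:
 assumes s: "is_standard n i M" and i: "1 \<le> i" "i \<le> n"
 obtains V where "V \<in> carrier M" "u (i - 1) (i - 1) (i - 1) V = V"
  "\<forall>k. k < i --> u (i - 1) k (i - 1) V \<noteq> \<zero>\<^sub>M"
  "\<forall>k x. k < i --> x \<in> carrier M --> (\<exists>c. u k k k x = sc c (u (i - 1) k (i - 1) V))"
proof -
 have vx: "\<exists>v. v \<noteq> \<zero>\<^sub>M \<and> v \<in> at_vertex n M j \<and> at_vertex n M j = range (\<lambda>c. sc c v)" if "j < i" for j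
  using s that unfolding is_standard_def by simp
 have i1: "i - 1 < i" "i - 1 < n" using i by auto
 obtain V where V: "V \<noteq> \<zero>\<^sub>M" "V \<in> at_vertex n M (i - 1)" using vx[OF i1(1)] by blast
 obtain y where y: "y \<in> carrier M" "V = u (i - 1) (i - 1) (i - 1) y"
  using V(2) unfolding at_vertex_iff[OF i1(2)] by blast
 have VM: "V \<in> carrier M" unfolding y(2) by (rule u_closed[OF y(1)])
 have eV: "u (i - 1) (i - 1) (i - 1) V = V" unfolding y(2) using u_tgt[of "i - 1" "i - 1" "i - 1" y] y(1) by simp
 have nz: "d \<le> i - 1 ==> u (i - 1) (i - 1 - d) (i - 1) V \<noteq> \<zero>\<^sub>M" for d
 proof (induction d)
  case 0
  then show ?case using eV V(1) by simp
 next
  case (Suc d)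
  let ?k = "i - 1 - d"
  have k: "1 \<le> ?k" "?k < n" "?k \<le> i - 1" "i - 1 - Suc d = ?k - 1" using Suc.prems i by auto
  let ?w = "u (i - 1) ?k (i - 1) V"
  show ?case
  proof
   assume z: "u (i - 1) (i - 1 - Suc d) (i - 1) V = \<zero>\<^sub>M"
   have "u ?k (?k - 1) ?k ?w = u (i - 1) (?k - 1) (i - 1) V"
    using u_u[of "i - 1" "i - 1" ?k ?k ?k "?k - 1" V] k(3) VM by simp
   then have "u ?k (?k - 1) ?k ?w = \<zero>\<^sub>M" using z k(4) by simp
   moreover have "u ?k ?k ?k ?w = ?w" by (rule u_tgt[OF le_refl k(3) VM])
   ultimately have "?w = \<zero>\<^sub>M" by (intro standard_inj[OF s i k(1,2) u_closed[OF VM]])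
   then show False using Suc by simp
  qed
 qed
 have W: "u (i - 1) k (i - 1) V \<noteq> \<zero>\<^sub>M" if k: "k < i" for k
 proof -
  have "i - 1 - (i - 1 - k) = k" using k by simp
  then show ?thesis using nz[of "i - 1 - k"] by simp
 qed
 show thesis
 proof (rule that[OF VM eV]; intro allI impI)
  fix k assume k: "k < i"
  show "u (i - 1) k (i - 1) V \<noteq> \<zero>\<^sub>M" by (rule W[OF k])
  fix x assume x: "x \<in> carrier M"
  have kn: "k < n" "k \<le> i - 1" using k i by auto
  let ?W = "u (i - 1) k (i - 1) V"
  obtain v where v: "v \<in> at_vertex n M k" "at_vertex n M k = range (\<lambda>c. sc c v)" using vx[OF k] by blast
  have vM: "v \<in> carrier M" using v(1) unfolding at_vertex_iff[OF kn(1)] using u_closed by auto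
  have "u k k k ?W = ?W" by (rule u_tgt[OF le_refl kn(2) VM])
  then have "?W \<in> at_vertex n M k" using u_at_vertex[OF kn(1) u_closed[OF VM]] by metis
  then obtain d where d: "?W = sc d v" unfolding v(2) by (rule rangeE)
  have d0: "d \<noteq> 0" using W[OF k] d sc_zero_left[OF vM] by metis
  have "u k k k x \<in> at_vertex n M k" by (rule u_at_vertex[OF kn(1) x])
  then obtain c where c: "u k k k x = sc c v" unfolding v(2) by (rule rangeE)
  have "sc (c / d) ?W = sc c v" unfolding d sc_assoc[OF vM, symmetric] using d0 by simp
  then show "\<exists>c. u k k k x = sc c ?W" using c by (intro exI[of _ "c / d"]) simp
 qed
qed

lemma quotient_dmod:
 assumes H: "submodule H DD M" and K: "submodule K DD M" and HK: "H \<subseteq> K"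
 shows "left_module DD (res M K)" "submodule H DD (res M K)"
  "left_module DD (quotient_module (res M K) H)"
proof -
 show N: "left_module DD (res M K)" by (rule left_module_restrict[OF K])
 show HN: "submodule H DD (res M K)" by (rule iffD2[OF submodule_restrict_iff[OF K HK] H])
 show "left_module DD (quotient_module (res M K) H)"
  by (rule lmod.left_module_quotient[OF lmod.intro[OF N] HN])
qed

lemma quotient_facts:
 assumes H: "submodule H DD M" and K: "submodule K DD M" and HK: "H \<subseteq> K"
 defines "Q \<equiv> quotient_module (res M K) H" and "c \<equiv> \<lambda>x. H +>\<^bsub>res M K\<^esub> x"
 shows "carrier Q = c ` K" and "\<zero>\<^sub>Q = H"
  and "x \<in> K ==> c x \<in> carrier Q"
  and "d \<in> carrier DD ==> x \<in> K ==> d \<odot>\<^sub>Q c x = c (d \<odot>\<^sub>M x)"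
  and "x \<in> K ==> scal DD Q a (c x) = c (sc a x)"
  and "x \<in> K ==> c x = H \<longleftrightarrow> x \<in> H"
  and "x \<in> K ==> y \<in> K ==> c x = c y ==> \<exists>h\<in>H. x = y \<oplus>\<^sub>M h"
  and "h \<in> H ==> y \<in> K ==> c (y \<oplus>\<^sub>M h) = c y"
proof -
 note q = quotient_dmod[OF H K HK]
 interpret N: dmod n "res M K" by (rule dmod[OF q(1)])
 note S = N.quotient_module_simps[OF q(2)]
 note KD = submoduleD[OF K]
 show "carrier Q = c ` K" "\<zero>\<^sub>Q = H" using S(1,2) unfolding Q_def c_def by simp_all
 then show "c x \<in> carrier Q" if "x \<in> K" using that by simp
 show sm: "d \<odot>\<^sub>Q c x = c (d \<odot>\<^sub>M x)" if "d \<in> carrier DD" "x \<in> K" for d x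
  using S(4)[of d x] that unfolding Q_def c_def by simp
 show "scal DD Q a (c x) = c (sc a x)" if "x \<in> K" unfolding scal_def by (rule sm[OF c1_closed that])
 show "c x = H \<longleftrightarrow> x \<in> H" if "x \<in> K" using N.coset_zero_iff[OF q(2), of x] that unfolding c_def by simp
 show "\<exists>h\<in>H. x = y \<oplus>\<^sub>M h" if xy: "x \<in> K" "y \<in> K" "c x = c y"
 proof -
  have "x \<ominus>\<^bsub>res M K\<^esub> y \<in> H"
   using N.coset_eq_iff[OF q(2), of x y] xy unfolding c_def by simp
  moreover have "y \<oplus>\<^bsub>res M K\<^esub> (x \<ominus>\<^bsub>res M K\<^esub> y) = x"
   using N.diff_add_cancel[of x y] N.M.a_comm[of y "x \<ominus>\<^bsub>res M K\<^esub> y"] N.M.minus_closed[of x y] xy by simp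
  ultimately show ?thesis by (intro bexI[of _ "x \<ominus>\<^bsub>res M K\<^esub> y"]) simp_all
 qed
 show "c (y \<oplus>\<^sub>M h) = c y" if hy: "h \<in> H" "y \<in> K"
 proof -
  have hK: "h \<in> K" using hy(1) HK by blast
  have "(y \<oplus>\<^bsub>res M K\<^esub> h) \<ominus>\<^bsub>res M K\<^esub> y = h"
   using N.add_diff_cancel[of y h] hy hK by simp
  moreover have "y \<oplus>\<^sub>M h \<in> K" by (rule KD(4)[OF hy(2) hK])
  ultimately show ?thesis
   using N.coset_eq_iff[OF q(2), of "y \<oplus>\<^sub>M h" y] hy unfolding c_def by simp
 qed
qed

lemma standard_quotient_inj:
 assumes H: "submodule H DD M" and K: "submodule K DD M" and HK: "H \<subseteq> K"
  and s: "is_standard n i (quotient_module (res M K) H)" and i: "1 \<le> i" "i \<le> n"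
  and k: "1 \<le> k" "k < n" and x: "x \<in> K" "u k k k x = x" and z: "u k (k - 1) k x \<in> H"
 shows "x \<in> H"
proof -
 note F = quotient_facts[OF H K HK]
 let ?Q = "quotient_module (res M K) H" and ?c = "\<lambda>x. H +>\<^bsub>res M K\<^esub> x"
 interpret Q: dmod n ?Q by (rule dmod[OF quotient_dmod(3)[OF H K HK]])
 have "?c x = \<zero>\<^sub>?Q"
 proof (rule Q.standard_inj[OF s i k F(3)[OF x(1)]])
  show "dU k k k \<odot>\<^sub>?Q ?c x = ?c x" unfolding F(4)[OF dU_closed x(1)] x(2) ..
  have "u k (k - 1) k x \<in> K" using z HK by blast
  then show "dU k (k - 1) k \<odot>\<^sub>?Q ?c x = \<zero>\<^sub>?Q"
   unfolding F(4)[OF dU_closed x(1)] F(2) using F(6) z by simp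
 qed
 then show ?thesis using F(6)[OF x(1)] unfolding F(2) by simp
qed

lemma standard_quotient_generator:
 assumes H: "submodule H DD M" and K: "submodule K DD M" and HK: "H \<subseteq> K"
  and s: "is_standard n i (quotient_module (res M K) H)" and i: "1 \<le> i" "i \<le> n"
 obtains v where "v \<in> K" "u (i - 1) (i - 1) (i - 1) v = v"
  "i < n --> u (i - 1) i i v \<in> H"
  "\<forall>k. k < i --> u (i - 1) k (i - 1) v \<notin> H"
  "\<forall>k x. k < i --> x \<in> K --> (\<exists>c. \<exists>h\<in>H. u k k k x = sc c (u (i - 1) k (i - 1) v) \<oplus>\<^sub>M h)"
  "\<forall>k x. i \<le> k --> k < n --> x \<in> K --> u k k k x \<in> H"
proof -
 note F = quotient_facts[OF H K HK]
 let ?Q = "quotient_module (res M K) H" and ?c = "\<lambda>x. H +>\<^bsub>res M K\<^esub> x"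
 interpret Q: dmod n ?Q by (rule dmod[OF quotient_dmod(3)[OF H K HK]])
 note KD = submoduleD[OF K]
 have uK: "u j k m x \<in> K" if "x \<in> K" for j k m x by (rule KD(7)[OF dU_closed that])
 obtain V where V: "V \<in> carrier ?Q" "Q.u (i - 1) (i - 1) (i - 1) V = V"
  and V3[rule_format]: "\<forall>k. k < i --> Q.u (i - 1) k (i - 1) V \<noteq> \<zero>\<^sub>?Q"
  and V4[rule_format]: "\<forall>k x. k < i --> x \<in> carrier ?Q --> (\<exists>c. Q.u k k k x = Q.sc c (Q.u (i - 1) k (i - 1) V))"
  by (rule Q.standard_generator[OF s i])
 obtain v0 where v0: "v0 \<in> K" "V = ?c v0" using V(1) unfolding F(1) by (elim imageE) simp
 define v where "v = u (i - 1) (i - 1) (i - 1) v0"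
 have vK: "v \<in> K" unfolding v_def by (rule uK[OF v0(1)])
 have Vv: "V = ?c v" using V(2) unfolding v0(2) F(4)[OF dU_closed v0(1)] v_def by simp
 have v0M: "v0 \<in> carrier M" by (rule KD(3)[OF v0(1)])
 have QV: "Q.u j k m V = ?c (u j k m v)" for j k m unfolding Vv by (rule F(4)[OF dU_closed vK])
 have g1: "u (i - 1) (i - 1) (i - 1) v = v" unfolding v_def by (rule u_tgt[OF le_refl le_refl v0M])
 have g3: "u (i - 1) k (i - 1) v \<notin> H" if "k < i" for k
  using V3[OF that] F(6)[OF uK[OF vK]] unfolding QV F(2) by blast
 have g5: "u k k k x \<in> H" if k: "i \<le> k" "k < n" "x \<in> K" for k x
 proof -
  have "at_vertex n ?Q k = {\<zero>\<^sub>?Q}" using s k(1,2) unfolding is_standard_def by simp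
  then have "Q.u k k k (?c x) = \<zero>\<^sub>?Q" using Q.u_at_vertex[OF k(2) F(3)[OF k(3)]] by simp
  then show ?thesis unfolding F(4)[OF dU_closed k(3)] F(2) using F(6)[OF uK[OF k(3)]] by blast
 qed
 have g2: "u (i - 1) i i v \<in> H" if "i < n"
 proof -
  have "D_b n i \<odot>\<^sub>?Q V = \<zero>\<^sub>?Q" using s V(1) i(1) that unfolding is_standard_def by simp
  then have "?c (u (i - 1) i i v) = H" unfolding D_b_eq_dU[OF i(1) that] QV F(2) .
  then show ?thesis using F(6)[OF uK[OF vK]] by blast
 qed
 have g4: "\<exists>c. \<exists>h\<in>H. u k k k x = sc c (u (i - 1) k (i - 1) v) \<oplus>\<^sub>M h" if k: "k < i" "x \<in> K" for k x
 proof -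
  obtain c where c: "Q.u k k k (?c x) = Q.sc c (Q.u (i - 1) k (i - 1) V)" using V4[OF k(1) F(3)[OF k(2)]] by blast
  have "?c (u k k k x) = ?c (sc c (u (i - 1) k (i - 1) v))"
   using c unfolding QV F(4)[OF dU_closed k(2)] F(5)[OF uK[OF vK]] .
  then show ?thesis using F(7)[OF uK[OF k(2)] submodule_sc[OF K uK[OF vK]]] by blast
 qed
 show thesis
 proof (rule that[OF vK g1]; intro allI impI)
 qed (erule g2, erule g3, erule (1) g4, erule (2) g5)
qed

text \<open>The arrows \<open>a\<^sub>k\<close> act injectively on the factors \<open>\<Delta>\<^sub>i\<close>, hence on every extension of them.\<close>

lemma filtration_satur:
 assumes "has_standard_filtration n M"
 shows "satur M {\<zero>\<^sub>M}"
proof -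
 obtain r :: nat and H where H: "\<And>k. k \<le> r ==> submodule (H k) DD M" "H 0 = {\<zero>\<^sub>M}" "H r = carrier M"
  and st: "\<And>k. k < r ==> H k \<subseteq> H (Suc k) \<and>
    (\<exists>i\<in>{1..n}. is_standard n i (quotient_module (res M (H (Suc k))) (H k)))"
  using assms unfolding has_standard_filtration_def by metis
 have "j \<le> r ==> \<forall>x\<in>H j. u k k k x = x --> u k (k - 1) k x = \<zero>\<^sub>M --> x = \<zero>\<^sub>M"
  if k: "1 \<le> k" "k < n" for j k
 proof (induction j)
  case 0
  then show ?case using H(2) by simp
 next
  case (Suc j)
  then have j: "j < r" "j \<le> r" "Suc j \<le> r" by auto
  obtain i where i: "1 \<le> i" "i \<le> n" "is_standard n i (quotient_module (res M (H (Suc j))) (H j))"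
   using st[OF j(1)] by auto
  have sub: "H j \<subseteq> H (Suc j)" using st[OF j(1)] by simp
  show ?case
  proof (intro ballI impI)
   fix x assume x: "x \<in> H (Suc j)" "u k k k x = x" "u k (k - 1) k x = \<zero>\<^sub>M"
   have "u k (k - 1) k x \<in> H j" unfolding x(3) by (rule submoduleD(2)[OF H(1)[OF j(2)]])
   then have "x \<in> H j" by (rule standard_quotient_inj[OF H(1)[OF j(2)] H(1)[OF j(3)] sub i(3,1,2) k x(1,2)])
   then show "x = \<zero>\<^sub>M" using Suc.IH[OF j(2)] x by blast
  qed
 qed
 from this[OF _ _ le_refl] show ?thesis unfolding satur_def H(3) by simp
qed

end

section \<open>Lifting homomorphisms along \<open>N \<rightarrow> N / \<eta> N\<close>\<close>

context auslander
begin

text \<open>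
 The group \<open>Ext\<^sup>1(\<Delta>\<^sub>i, X)\<close> vanishes as soon as \<open>b\<^sub>i\<close> maps \<open>e\<^sub>i\<^sub>-\<^sub>1 X\<close> onto \<open>e\<^sub>i X\<close>, and
 \<open>X = \<eta> N\<close> has this property for all \<open>i\<close>. In the step from \<open>H\<close> to \<open>K\<close> with \<open>K / H \<cong> \<Delta>\<^sub>i\<close>, the
 generator \<open>v\<close> of \<open>K\<close> over \<open>H\<close> is subject to one relation, the value of \<open>b\<^sub>i v\<close> in \<open>H\<close>; the image of
 \<open>v\<close> is corrected by an element of \<open>\<eta> N\<close> so as to satisfy it.
\<close>

lemma lift_step:
 assumes M: "left_module DD M" and N: "left_module DD N" and \<psi>: "semi M (pi_obj n N) \<psi>"
  and H: "submodule H DD M" and K: "submodule K DD M" and HK: "H \<subseteq> K"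
  and s: "is_standard n i (quotient_module (res M K) H)" and i: "1 \<le> i" "i \<le> n"
  and g: "g \<in> lmod_hom DD (res M H) N" and gq: "\<And>x. x \<in> H ==> qpi N (g x) = \<psi> x"
 shows "\<exists>G\<in>lmod_hom DD (res M K) N. \<forall>x\<in>K. qpi N (G x) = \<psi> x"
proof -
 interpret M: dmod n M by (rule dmod[OF M])
 interpret N: dmod n N by (rule dmod[OF N])
 note HD = M.submoduleD[OF H] and KD = M.submoduleD[OF K] and P = pi_obj_simps[OF N] and pD = semiD[OF \<psi>]
 have gD: "\<And>x. x \<in> H ==> g x \<in> carrier N" "\<And>x y. x \<in> H ==> y \<in> H ==> g (x \<oplus>\<^sub>M y) = g x \<oplus>\<^sub>N g y"
  "\<And>a x. a \<in> carrier DD ==> x \<in> H ==> g (a \<odot>\<^sub>M x) = a \<odot>\<^sub>N g x"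
  using lmod_homD[OF g] by simp_all
 have gsc: "g (M.sc c x) = N.sc c (g x)" if "x \<in> H" for c x
  unfolding scal_def by (rule gD(3)[OF M.c1_closed that])
 have g0: "g \<zero>\<^sub>M = \<zero>\<^sub>N"
  using gsc[OF HD(2), of 0] M.sc_zero_left[OF M.M.zero_closed] N.sc_zero_left[OF gD(1)[OF HD(2)]] by simp
 obtain v where v: "v \<in> K" "M.u (i - 1) (i - 1) (i - 1) v = v"
  and bv[rule_format]: "i < n --> M.u (i - 1) i i v \<in> H"
  and nz[rule_format]: "\<forall>k. k < i --> M.u (i - 1) k (i - 1) v \<notin> H"
  and low[rule_format]: "\<forall>k x. k < i --> x \<in> K -->
   (\<exists>c. \<exists>h\<in>H. M.u k k k x = M.sc c (M.u (i - 1) k (i - 1) v) \<oplus>\<^sub>M h)"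
  and high[rule_format]: "\<forall>k x. i \<le> k --> k < n --> x \<in> K --> M.u k k k x \<in> H"
  by (rule M.standard_quotient_generator[OF H K HK s i])
 have vM: "v \<in> carrier M" by (rule KD(3)[OF v(1)])
 let ?e = "i - 1"
 obtain y where y: "y \<in> carrier N" "\<psi> v = qpi N y" by (rule pi_cases[OF N pD(1)[OF vM]])
 define y1 where "y1 = N.u ?e ?e ?e y"
 have y1: "y1 \<in> carrier N" "N.u ?e ?e ?e y1 = y1"
  unfolding y1_def using y(1) by (simp_all add: N.u_closed N.u_tgt)
 have qy1: "qpi N y1 = \<psi> v"
  unfolding y1_def P(4)[OF dU_closed y(1), symmetric] y(2)[symmetric] pD(3)[OF dU_closed vM, symmetric] v(2) ..
 \<comment> \<open>A lift of \<open>\<psi> v\<close> may be changed by elements of \<open>\<eta> N\<close>, on which \<open>b\<^sub>i\<close> is surjective.\<close>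
 have "\<exists>w\<in>carrier N. N.u ?e ?e ?e w = w \<and> qpi N w = \<psi> v \<and> (i < n --> N.u ?e i i w = g (M.u ?e i i v))"
 proof (cases "i < n")
  case False
  then show ?thesis using y1 qy1 by (intro bexI[of _ y1]) simp_all
 next
  case True
  note bH = bv[OF True]
  let ?g = "g (M.u ?e i i v)" and ?b = "N.u ?e i i y1"
  have gc: "?g \<in> carrier N" and bc: "?b \<in> carrier N" by (rule gD(1)[OF bH], rule N.u_closed[OF y1(1)])
  have "qpi N ?g = \<psi> (M.u ?e i i v)" by (rule gq[OF bH])
  also have "\<dots> = qpi N ?b" unfolding pD(3)[OF dU_closed vM] qy1[symmetric] by (rule P(4)[OF dU_closed y1(1)])
  finally have "?g \<ominus>\<^sub>N ?b \<in> etaS N" by (rule iffD1[OF qpi_eq_iff[OF N gc bc]])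
  then obtain t where t: "t \<in> carrier N" "N.u i i i (?g \<ominus>\<^sub>N ?b) = N.u 0 i i t" by (rule N.etaSE[OF _ True])
  have "N.u i i i ?g = g (M.u i i i (M.u ?e i i v))" by (rule gD(3)[OF dU_closed bH, symmetric])
  also have "\<dots> = ?g" using M.u_tgt[of ?e i i v] vM by simp
  finally have "N.u i i i (?g \<ominus>\<^sub>N ?b) = ?g \<ominus>\<^sub>N ?b"
   unfolding N.u_diff[OF gc bc] using N.u_tgt[of ?e i i y1] y1(1) by simp
  then have gb: "?g \<ominus>\<^sub>N ?b = N.u 0 i i t" using t(2) by simp
  let ?t = "N.u 0 ?e ?e t"
  have tc: "?t \<in> carrier N" by (rule N.u_closed[OF t(1)])
  let ?w = "y1 \<oplus>\<^sub>N ?t"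
  have w: "?w \<in> carrier N" using y1(1) tc by simp
  have "N.u ?e ?e ?e ?w = ?w" unfolding N.u_add[OF y1(1) tc] y1(2) using N.u_tgt[of 0 ?e ?e t] t(1) by simp
  moreover have "qpi N ?w = qpi N y1"
  proof (rule iffD2[OF qpi_eq_iff[OF N w y1(1)]])
   show "?w \<ominus>\<^sub>N y1 \<in> etaS N" unfolding N.add_diff_cancel[OF y1(1) tc] by (rule N.u0_etaS[OF t(1) le_refl])
  qed
  moreover have "N.u ?e i i ?w = ?g"
  proof -
   have "N.u ?e i i ?t = N.u 0 i i t" using N.u_u[of 0 ?e ?e ?e i i t] t(1) i by simp
   then have "N.u ?e i i ?w = ?b \<oplus>\<^sub>N (?g \<ominus>\<^sub>N ?b)" unfolding N.u_add[OF y1(1) tc] gb by simp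
   also have "\<dots> = ?g" using N.diff_add_cancel[OF gc bc] N.M.a_comm[OF bc N.M.minus_closed[OF gc bc]] by simp
   finally show ?thesis .
  qed
  ultimately show ?thesis using w qy1 by (intro bexI[of _ ?w]) simp_all
 qed
 then obtain w where w: "w \<in> carrier N" "N.u ?e ?e ?e w = w" "qpi N w = \<psi> v"
  and bw: "i < n ==> N.u ?e i i w = g (M.u ?e i i v)" by blast
 \<comment> \<open>At every vertex \<open>d v\<close> is, modulo \<open>H\<close>, a multiple of \<open>a \<cdots> a v\<close>, and \<open>d w\<close> is the same combination.\<close>
 have claim: "\<exists>c. \<exists>h\<in>H. M.u k k k (d \<odot>\<^sub>M v) = M.sc c (M.u ?e k ?e v) \<oplus>\<^sub>M h
   \<and> N.u k k k (d \<odot>\<^sub>N w) = N.sc c (N.u ?e k ?e w) \<oplus>\<^sub>N g h \<and> (i \<le> k --> c = 0)"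
  if d: "d \<in> carrier DD" for k d
  using d
 proof (induction rule: D_induct)
  case zero
  show ?case
   by (rule exI[of _ 0], rule bexI[OF _ HD(2)])
    (simp add: vM w(1) M.u_null N.u_null M.sc_zero_left N.sc_zero_left M.u_closed N.u_closed g0)
 next
  case (add X Y)
  from add.IH(1) obtain c h where 1: "h \<in> H" "M.u k k k (X \<odot>\<^sub>M v) = M.sc c (M.u ?e k ?e v) \<oplus>\<^sub>M h"
   "N.u k k k (X \<odot>\<^sub>N w) = N.sc c (N.u ?e k ?e w) \<oplus>\<^sub>N g h" "i \<le> k --> c = 0" by blast
  from add.IH(2) obtain c' h' where 2: "h' \<in> H" "M.u k k k (Y \<odot>\<^sub>M v) = M.sc c' (M.u ?e k ?e v) \<oplus>\<^sub>M h'"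
   "N.u k k k (Y \<odot>\<^sub>N w) = N.sc c' (N.u ?e k ?e w) \<oplus>\<^sub>N g h'" "i \<le> k --> c' = 0" by blast
  show ?case
  proof (rule exI[of _ "c + c'"], rule bexI[OF _ HD(4)[OF 1(1) 2(1)]], intro conjI)
   note XM = M.smult_closed[OF add.hyps(1) vM] and YM = M.smult_closed[OF add.hyps(2) vM]
   note XN = N.smult_closed[OF add.hyps(1) w(1)] and YN = N.smult_closed[OF add.hyps(2) w(1)]
   note AM = M.u_closed[OF vM, of ?e k ?e] and AN = N.u_closed[OF w(1), of ?e k ?e]
   show "M.u k k k ((X \<oplus>\<^sub>DD Y) \<odot>\<^sub>M v) = M.sc (c + c') (M.u ?e k ?e v) \<oplus>\<^sub>M (h \<oplus>\<^sub>M h')"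
    unfolding M.smult_l_distr[OF add.hyps vM] M.u_add[OF XM YM] 1(2) 2(2) M.sc_ladd[OF AM]
    by (rule M.add_add_swap[OF M.sc_closed[OF AM] HD(3)[OF 1(1)] M.sc_closed[OF AM] HD(3)[OF 2(1)]])
   show "N.u k k k ((X \<oplus>\<^sub>DD Y) \<odot>\<^sub>N w) = N.sc (c + c') (N.u ?e k ?e w) \<oplus>\<^sub>N g (h \<oplus>\<^sub>M h')"
    unfolding N.smult_l_distr[OF add.hyps w(1)] N.u_add[OF XN YN] 1(3) 2(3) N.sc_ladd[OF AN] gD(2)[OF 1(1) 2(1)]
    by (rule N.add_add_swap[OF N.sc_closed[OF AN] gD(1)[OF 1(1)] N.sc_closed[OF AN] gD(1)[OF 2(1)]])
   show "i \<le> k --> c + c' = 0" using 1(4) 2(4) by simp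
  qed
 next
  case (scale_dU c j l m)
  then have jl: "j \<le> m" "l \<le> m" "m < n" by (simp_all add: idx_def)
  have eM: "M.u k k k ((c \<odot>\<^sub>DD dU j l m) \<odot>\<^sub>M v) = M.sc c (M.u k k k (M.u j l m v))"
   unfolding M.smult_scale[OF dU_closed vM] by (rule M.u_sc[OF M.u_closed[OF vM]])
  have eN: "N.u k k k ((c \<odot>\<^sub>DD dU j l m) \<odot>\<^sub>N w) = N.sc c (N.u k k k (N.u j l m w))"
   unfolding N.smult_scale[OF dU_closed w(1)] by (rule N.u_sc[OF N.u_closed[OF w(1)]])
  show ?case
  proof (cases "k = l \<and> j = ?e")
   case False
   have "M.u k k k (M.u j l m v) = \<zero>\<^sub>M \<and> N.u k k k (N.u j l m w) = \<zero>\<^sub>N"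
   proof (cases "k = l")
    case kl: False
    then show ?thesis using M.u_tgt_neq[OF jl(1,2) vM] N.u_tgt_neq[OF jl(1,2) w(1)] by simp
   next
    case True
    then have j: "j \<noteq> ?e" using False by simp
    have "M.u j l m (M.u ?e ?e ?e v) = \<zero>\<^sub>M" "N.u j l m (N.u ?e ?e ?e w) = \<zero>\<^sub>N"
     using M.u_u[of ?e ?e ?e j m l v] N.u_u[of ?e ?e ?e j m l w] jl j vM w(1) by simp_all
    then show ?thesis unfolding v(2) w(2) by (simp add: M.u_null N.u_null)
   qed
   then show ?thesis unfolding eM eN
    by (intro exI[of _ 0] bexI[OF _ HD(2)])
     (simp add: vM w(1) M.sc_zero_right N.sc_zero_right M.sc_zero_left N.sc_zero_left M.u_closed N.u_closed g0)
  next
   case kl: True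
   then have tg: "M.u k k k (M.u j l m v) = M.u ?e k m v" "N.u k k k (N.u j l m w) = N.u ?e k m w"
    using M.u_tgt[OF jl(1,2) vM] N.u_tgt[OF jl(1,2) w(1)] by simp_all
   show ?thesis
   proof (cases "m = ?e")
    case True
    then have "\<not> i \<le> k" using kl jl(2) i by simp
    then show ?thesis unfolding eM eN tg unfolding True
     by (intro exI[of _ c] bexI[OF _ HD(2)] conjI)
      (simp_all add: vM w(1) M.sc_closed N.sc_closed M.u_closed N.u_closed g0
       M.M.r_zero[OF M.sc_closed[OF M.u_closed[OF vM]]] N.M.r_zero[OF N.sc_closed[OF N.u_closed[OF w(1)]]])
   next
    case False
    then have im: "i \<le> m" "i < n" using kl jl i by auto
    have km: "k \<le> m" using kl jl(2) by simp
    have M1: "M.u ?e k m v = M.u i k m (M.u ?e i i v)" using M.u_u[of ?e i i i m k v] im(1) km vM by simp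
    have N1: "N.u ?e k m w = N.u i k m (N.u ?e i i w)" using N.u_u[of ?e i i i m k w] im(1) km w(1) by simp
    let ?h = "M.u i k m (M.u ?e i i v)"
    have h: "?h \<in> H" by (rule HD(7)[OF dU_closed bv[OF im(2)]])
    have gh: "g (M.sc c ?h) = N.sc c (N.u ?e k m w)"
     unfolding gsc[OF h] gD(3)[OF dU_closed bv[OF im(2)]] N1 bw[OF im(2)] ..
    show ?thesis unfolding eM eN tg
    proof (intro exI[of _ 0] bexI[OF _ M.submodule_sc[OF H h]] conjI)
     show "M.sc c (M.u ?e k m v) = M.sc 0 (M.u ?e k ?e v) \<oplus>\<^sub>M M.sc c ?h"
      unfolding M.sc_zero_left[OF M.u_closed[OF vM]] M1
      by (rule M.M.l_zero[OF M.sc_closed[OF HD(3)[OF h]], symmetric])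
     show "N.sc c (N.u ?e k m w) = N.sc 0 (N.u ?e k ?e w) \<oplus>\<^sub>N g (M.sc c ?h)"
      unfolding N.sc_zero_left[OF N.u_closed[OF w(1)]] gh
      by (rule N.M.l_zero[OF N.sc_closed[OF N.u_closed[OF w(1)]], symmetric])
    qed simp
   qed
  qed
 qed
 \<comment> \<open>The coefficient of \<open>a \<cdots> a v\<close> in \<open>d v\<close> vanishes, since \<open>a \<cdots> a v\<close> is not in \<open>H\<close>.\<close>
 have rel: "g (d \<odot>\<^sub>M v) = d \<odot>\<^sub>N w" if d: "d \<in> carrier DD" and dv: "d \<odot>\<^sub>M v \<in> H" for d
 proof (rule N.vertex_eq[OF gD(1)[OF dv] N.smult_closed[OF d w(1)]])
  fix k
  obtain c h where h: "h \<in> H" and e: "M.u k k k (d \<odot>\<^sub>M v) = M.sc c (M.u ?e k ?e v) \<oplus>\<^sub>M h"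
   and e': "N.u k k k (d \<odot>\<^sub>N w) = N.sc c (N.u ?e k ?e w) \<oplus>\<^sub>N g h" and ck: "i \<le> k --> c = 0"
   using claim[OF d, of k] by blast
  have AM: "M.u ?e k ?e v \<in> carrier M" by (rule M.u_closed[OF vM])
  have c0: "c = 0"
  proof (rule ccontr)
   assume c: "c \<noteq> 0"
   then have k: "k < i" using ck by simp
   have "M.sc c (M.u ?e k ?e v) = M.u k k k (d \<odot>\<^sub>M v) \<ominus>\<^sub>M h"
    unfolding e using M.add_diff_cancel[OF HD(3)[OF h] M.sc_closed[OF AM]]
     M.M.a_comm[OF HD(3)[OF h] M.sc_closed[OF AM]] by simp
   also have "\<dots> \<in> H" by (rule HD(6)[OF HD(7)[OF dU_closed dv] h])
   finally have "M.sc (inverse c) (M.sc c (M.u ?e k ?e v)) \<in> H" by (rule M.submodule_sc[OF H])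
   moreover have "M.sc (inverse c) (M.sc c (M.u ?e k ?e v)) = M.u ?e k ?e v"
    unfolding M.sc_assoc[OF AM, symmetric] using c M.sc_one[OF AM] by simp
   ultimately have "M.u ?e k ?e v \<in> H" by simp
   then show False using nz[OF k] by simp
  qed
  have "M.u k k k (d \<odot>\<^sub>M v) = h" 
   unfolding e c0 M.sc_zero_left[OF AM] by (rule M.M.l_zero[OF HD(3)[OF h]])
  moreover have "N.u k k k (d \<odot>\<^sub>N w) = g h"

   unfolding e' c0 N.sc_zero_left[OF N.u_closed[OF w(1)]] by (rule N.M.l_zero[OF gD(1)[OF h]])
  ultimately show "N.u k k k (g (d \<odot>\<^sub>M v)) = N.u k k k (d \<odot>\<^sub>N w)"
   using gD(3)[OF dU_closed dv, of k k k] by simp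
 qed
 let ?L = "{x. \<exists>d\<in>carrier DD. \<exists>h\<in>H. x = h \<oplus>\<^sub>M d \<odot>\<^sub>M v}"
 have L: "submodule ?L DD M"
 proof (rule M.submodule_intro)
  show "?L \<subseteq> carrier M"
  proof
   fix x assume "x \<in> ?L"
   then obtain d h where "d \<in> carrier DD" "h \<in> H" "x = h \<oplus>\<^sub>M d \<odot>\<^sub>M v" by blast
   then show "x \<in> carrier M" using HD(3) M.smult_closed[OF _ vM] by simp
  qed
  have "\<zero>\<^sub>M = \<zero>\<^sub>M \<oplus>\<^sub>M \<zero>\<^sub>DD \<odot>\<^sub>M v" using vM by simp
  then show "\<zero>\<^sub>M \<in> ?L" using HD(2) DD.zero_closed by blast
 next
  fix x y assume "x \<in> ?L" "y \<in> ?L"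
  then obtain d h d' h' where x: "d \<in> carrier DD" "h \<in> H" "x = h \<oplus>\<^sub>M d \<odot>\<^sub>M v"
   and y: "d' \<in> carrier DD" "h' \<in> H" "y = h' \<oplus>\<^sub>M d' \<odot>\<^sub>M v" by blast
  have "x \<oplus>\<^sub>M y = (h \<oplus>\<^sub>M h') \<oplus>\<^sub>M (d \<oplus>\<^sub>DD d') \<odot>\<^sub>M v"
   unfolding x(3) y(3) M.smult_l_distr[OF x(1) y(1) vM]
   by (rule M.add_add_swap[OF HD(3)[OF x(2)] M.smult_closed[OF x(1) vM] HD(3)[OF y(2)] M.smult_closed[OF y(1) vM]])
  then show "x \<oplus>\<^sub>M y \<in> ?L" using DD.a_closed[OF x(1) y(1)] HD(4)[OF x(2) y(2)] by blast
 next
  fix a x assume a: "a \<in> carrier DD" and "x \<in> ?L"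
  then obtain d h where x: "d \<in> carrier DD" "h \<in> H" "x = h \<oplus>\<^sub>M d \<odot>\<^sub>M v" by blast
  have "a \<odot>\<^sub>M x = a \<odot>\<^sub>M h \<oplus>\<^sub>M (a \<otimes>\<^sub>DD d) \<odot>\<^sub>M v"
   unfolding x(3) M.smult_assoc[OF a x(1) vM] by (rule M.smult_r_distr[OF a HD(3)[OF x(2)] M.smult_closed[OF x(1) vM]])
  then show "a \<odot>\<^sub>M x \<in> ?L" using DD.m_closed[OF a x(1)] HD(7)[OF a x(2)] by blast
 qed
 have gen: "\<exists>d\<in>carrier DD. \<exists>h\<in>H. x = h \<oplus>\<^sub>M d \<odot>\<^sub>M v" if x: "x \<in> K" for x
 proof -
  have "x \<in> ?L"
  proof (rule M.vertex_sub[OF L KD(3)[OF x]])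
   fix k assume k: "k < n"
   show "M.u k k k x \<in> ?L"
   proof (cases "k < i")
    case True
    obtain c h where h: "h \<in> H" "M.u k k k x = M.sc c (M.u ?e k ?e v) \<oplus>\<^sub>M h" using low[OF True x] by blast
    have "M.u k k k x = h \<oplus>\<^sub>M (c \<odot>\<^sub>DD dU ?e k ?e) \<odot>\<^sub>M v"
     unfolding h(2) M.smult_scale[OF dU_closed vM]
     by (rule M.M.a_comm[OF M.sc_closed[OF M.u_closed[OF vM]] HD(3)[OF h(1)]])
    then show ?thesis using h(1) DD.cs_closed[OF dU_closed] by blast
   next
    case False
    then have h: "M.u k k k x \<in> H" using high k x by simp
    have "M.u k k k x = M.u k k k x \<oplus>\<^sub>M \<zero>\<^sub>DD \<odot>\<^sub>M v" using vM HD(3)[OF h] by simp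
    then show ?thesis using h DD.zero_closed by blast
   qed
  qed
  then show ?thesis by simp
 qed
 obtain G where G: "G \<in> lmod_hom DD (res M K) N"
  "\<And>h d. h \<in> H ==> d \<in> carrier DD ==> G (h \<oplus>\<^sub>M d \<odot>\<^sub>M v) = g h \<oplus>\<^sub>N d \<odot>\<^sub>N w"
 proof (rule hom_extend_cyclic[OF M N H K HK v(1) gen g w(1) rel])
  fix G assume 1: "G \<in> lmod_hom DD (res M K) N"
   and 2: "\<And>h d. h \<in> H ==> d \<in> carrier DD ==> G (h \<oplus>\<^sub>M d \<odot>\<^sub>M v) = g h \<oplus>\<^sub>N d \<odot>\<^sub>N w"
  show thesis by (rule that[OF 1]) (erule (1) 2)
 qed
 have "qpi N (G x) = \<psi> x" if x: "x \<in> K" for x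
 proof -
  obtain d h where dh: "d \<in> carrier DD" "h \<in> H" "x = h \<oplus>\<^sub>M d \<odot>\<^sub>M v" using gen[OF x] by blast
  have "qpi N (G x) = qpi N (g h \<oplus>\<^sub>N d \<odot>\<^sub>N w)" unfolding dh(3) G(2)[OF dh(2,1)] ..
  also have "\<dots> = qpi N (g h) \<oplus>\<^bsub>pi_obj n N\<^esub> sig d \<odot>\<^bsub>pi_obj n N\<^esub> qpi N w"
   unfolding P(4)[OF dh(1) w(1)] by (rule P(3)[OF gD(1)[OF dh(2)] N.smult_closed[OF dh(1) w(1)], symmetric])
  also have "\<dots> = \<psi> h \<oplus>\<^bsub>pi_obj n N\<^esub> \<psi> (d \<odot>\<^sub>M v)" unfolding gq[OF dh(2)] w(3) pD(3)[OF dh(1) vM] ..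
  also have "\<dots> = \<psi> x" unfolding dh(3) by (rule pD(2)[OF HD(3)[OF dh(2)] M.smult_closed[OF dh(1) vM], symmetric])
  finally show ?thesis .
 qed
 then show ?thesis using G(1) by blast
qed

text \<open>Induction along a standard filtration of \<open>M\<close>.\<close>

lemma lift_hom:
 assumes M: "left_module DD M" and N: "left_module DD N" and fil: "has_standard_filtration n M"
  and \<phi>: "\<phi> \<in> lmod_hom PP (pi_obj n M) (pi_obj n N)"
 obtains G where "G \<in> lmod_hom DD M N" "pi_mor n M N G = \<phi>"
proof -
 interpret M: dmod n M by (rule dmod[OF M])
 interpret N: dmod n N by (rule dmod[OF N])
 have \<psi>: "semi M (pi_obj n N) (\<lambda>x. \<phi> (qpi M x))" by (rule semi_hom[OF semi_qpi[OF M] \<phi>])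
 obtain r :: nat and H where H: "\<And>k. k \<le> r ==> submodule (H k) DD M" "H 0 = {\<zero>\<^sub>M}" "H r = carrier M"
  and st: "\<And>k. k < r ==> H k \<subseteq> H (Suc k) \<and>
    (\<exists>i\<in>{1..n}. is_standard n i (quotient_module (res M (H (Suc k))) (H k)))"
  using fil unfolding has_standard_filtration_def by metis
 have "j \<le> r ==> \<exists>g\<in>lmod_hom DD (res M (H j)) N. \<forall>x\<in>H j. qpi N (g x) = \<phi> (qpi M x)" for j
 proof (induction j)
  case 0
  have "(\<lambda>x\<in>carrier (res M {\<zero>\<^sub>M}). \<zero>\<^sub>N) \<in> lmod_hom DD (res M {\<zero>\<^sub>M}) N"
   by (rule lmod_homI[OF _ _ _ M.left_module_restrict[OF M.submodule_zero]]) simp_all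
  moreover have "\<phi> (qpi M \<zero>\<^sub>M) = qpi N \<zero>\<^sub>N"
   using semi_zero[OF M pi_module[OF N] \<psi>] unfolding pi_obj_simps(2)[OF N] .
  ultimately show ?case unfolding H(2)
   by (intro bexI[of _ "\<lambda>x\<in>carrier (res M {\<zero>\<^sub>M}). \<zero>\<^sub>N"]) simp_all
 next
  case (Suc j)
  then have j: "j < r" "j \<le> r" "Suc j \<le> r" by auto
  obtain i where i: "1 \<le> i" "i \<le> n" "is_standard n i (quotient_module (res M (H (Suc j))) (H j))"
   using st[OF j(1)] by auto
  obtain g where g: "g \<in> lmod_hom DD (res M (H j)) N" "\<forall>x\<in>H j. qpi N (g x) = \<phi> (qpi M x)"
   using Suc.IH[OF j(2)] by blast
  show ?case
   by (rule lift_step[OF M N \<psi> H(1)[OF j(2)] H(1)[OF j(3)] conjunct1[OF st[OF j(1)]] i(3,1,2) g(1)])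
    (rule bspec[OF g(2)])
 qed
 from this[OF le_refl] obtain G where G: "G \<in> lmod_hom DD (res M (carrier M)) N"
  and Gq: "\<forall>x\<in>carrier M. qpi N (G x) = \<phi> (qpi M x)" unfolding H(3) by blast
 have GM: "G \<in> lmod_hom DD M N" using G by simp
 have "pi_mor n M N G = \<phi>"
 proof (rule lmod_hom_ext[OF pi_mor_hom[OF M N GM] \<phi>])
  fix X assume X: "X \<in> carrier (pi_obj n M)"
  obtain x where x: "x \<in> carrier M" "X = qpi M x" by (rule pi_cases[OF M X])
  show "pi_mor n M N G X = \<phi> X" unfolding x(2) pi_mor_qpi[OF M N GM x(1)] by (rule bspec[OF Gq x(1)])
 qed
 then show thesis by (rule that[OF GM])
qed

end

section \<open>Modules on which the arrows \<open>a\<close> act injectively\<close>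

context dmod
begin

text \<open>
 Adjoining to \<open>H\<close> an element \<open>v\<close> of the highest vertex \<open>i - 1\<close> at which \<open>H\<close> and \<open>M\<close> still differ
 produces a subquotient \<open>\<Delta>\<^sub>i\<close>; the condition \<open>satur\<close> makes \<open>v, a v, a\<^sup>2 v, \<dots>\<close> linearly
 independent modulo \<open>H\<close> and is inherited by \<open>H + D v\<close>.
\<close>

lemma filtration_step:
 assumes H: "submodule H DD M" and sat: "satur M H"
  and high: "\<And>j x. i \<le> j ==> j < n ==> x \<in> carrier M ==> u j j j x \<in> H"
  and i: "1 \<le> i" "i \<le> n" and v: "v \<in> carrier M" "u (i - 1) (i - 1) (i - 1) v = v" "v \<notin> H"
 obtains K where "submodule K DD M" "H \<subseteq> K" "v \<in> K" "satur M K"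
  "is_standard n i (quotient_module (res M K) H)"
proof -
 note HD = submoduleD[OF H]
 define A where "A k = u (i - 1) k (i - 1) v" for k
 have AM: "A k \<in> carrier M" for k unfolding A_def by (rule u_closed[OF v(1)])
 have eA: "u k k k (A k) = A k" if "k < i" for k
  unfolding A_def by (rule u_tgt[OF le_refl _ v(1)]) (use that in simp)
 have aA: "u k (k - 1) k (A k) = A (k - 1)" if "1 \<le> k" "k < i" for k
  unfolding A_def using u_u[of "i - 1" "i - 1" k k k "k - 1" v] that v(1) by simp
 have Atop: "A (i - 1) = v" unfolding A_def by (rule v(2))
 have bv: "u (i - 1) i i v \<in> H" if "i < n"
  using high[OF le_refl that u_closed[OF v(1)], of "i - 1" i i] u_tgt[of "i - 1" i i v] v(1) by simp
 have up: "u j l m (A j) \<in> H" if j: "j < i" "j < m" "l \<le> m" for j l m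
 proof -
  let ?m = "i - 1 + m - j"
  have e: "u j l m (A j) = u (i - 1) l ?m v"
   unfolding A_def using u_u[of "i - 1" "i - 1" j j m l v] j v(1) by simp
  have im: "i \<le> ?m" using j by simp
  show ?thesis
  proof (cases "?m < n")
   case True
   have "u (i - 1) l ?m v = u i l ?m (u (i - 1) i i v)"
    using u_u[of "i - 1" i i i ?m l v] im j v(1) by simp
   then show ?thesis unfolding e using HD(7)[OF dU_closed bv] True im by simp
  next
   case False
   then show ?thesis unfolding e using u_top[OF _ v(1)] HD(2) by simp
  qed
 qed
 have AH: "A k \<notin> H" if "k < i" for k
 proof -
  have "d \<le> i - 1 ==> A (i - 1 - d) \<notin> H" for d
  proof (induction d)
   case 0
   then show ?case using Atop v(3) by simp
  next
   case (Suc d)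
   let ?k = "i - 1 - d"
   have k: "1 \<le> ?k" "?k < n" "?k < i" "i - 1 - Suc d = ?k - 1" using Suc.prems i by auto
   show ?case unfolding k(4)
   proof
    assume "A (?k - 1) \<in> H"
    then have "u ?k (?k - 1) ?k (A ?k) \<in> H" using aA[OF k(1,3)] by simp
    then have "A ?k \<in> H" by (rule saturD[OF sat k(1,2) AM eA[OF k(3)]])
    then show False using Suc by simp
   qed
  qed
  from this[of "i - 1 - k"] show ?thesis using that by simp
 qed
 \<comment> \<open>This is \<open>H + D v\<close>, described at each vertex.\<close>
 define K where "K = {x \<in> carrier M. \<forall>k<i. \<exists>c. \<exists>h\<in>H. u k k k x = sc c (A k) \<oplus>\<^sub>M h}"
 have KM: "x \<in> carrier M" if "x \<in> K" for x using that by (simp add: K_def)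
 have KE: "\<exists>c. \<exists>h\<in>H. u k k k x = sc c (A k) \<oplus>\<^sub>M h" if "x \<in> K" "k < i" for x k
  using that by (simp add: K_def)
 have KI: "x \<in> K" if "x \<in> carrier M" "\<And>k. k < i ==> \<exists>c. \<exists>h\<in>H. u k k k x = sc c (A k) \<oplus>\<^sub>M h" for x
  using that by (simp add: K_def)
 have Hex: "\<exists>c. \<exists>h\<in>H. y = sc c (A k) \<oplus>\<^sub>M h" if "y \<in> H" for y k
 proof (intro exI[of _ 0] bexI[OF _ that])
  show "y = sc 0 (A k) \<oplus>\<^sub>M y" using HD(3)[OF that] by (simp add: sc_zero_left[OF AM])
 qed
 have HK: "H \<subseteq> K"
 proof
  fix x assume x: "x \<in> H"
  show "x \<in> K" by (rule KI[OF HD(3)[OF x] Hex[OF HD(7)[OF dU_closed x]]])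
 qed
 have uA: "u j j m (A j) \<in> H \<or> (m = j)" if "j < i" "j \<le> m" for j m
  using up[of j m j] that by auto
 have K: "submodule K DD M"
 proof (rule dmod_submoduleI)
  show "K \<subseteq> carrier M" using KM by blast
  show "\<zero>\<^sub>M \<in> K" using HK HD(2) by blast
 next
  fix x y assume x: "x \<in> K" and y: "y \<in> K"
  show "x \<oplus>\<^sub>M y \<in> K"
  proof (rule KI)
   show "x \<oplus>\<^sub>M y \<in> carrier M" using KM[OF x] KM[OF y] by simp
   fix k assume k: "k < i"
   obtain c h where 1: "h \<in> H" "u k k k x = sc c (A k) \<oplus>\<^sub>M h" using KE[OF x k] by blast
   obtain c' h' where 2: "h' \<in> H" "u k k k y = sc c' (A k) \<oplus>\<^sub>M h'" using KE[OF y k] by blast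
   show "\<exists>c. \<exists>h\<in>H. u k k k (x \<oplus>\<^sub>M y) = sc c (A k) \<oplus>\<^sub>M h"
   proof (intro exI[of _ "c + c'"] bexI[OF _ HD(4)[OF 1(1) 2(1)]])
    show "u k k k (x \<oplus>\<^sub>M y) = sc (c + c') (A k) \<oplus>\<^sub>M (h \<oplus>\<^sub>M h')"
     unfolding u_add[OF KM[OF x] KM[OF y]] 1(2) 2(2) sc_ladd[OF AM]
     by (rule add_add_swap[OF sc_closed[OF AM] HD(3)[OF 1(1)] sc_closed[OF AM] HD(3)[OF 2(1)]])
   qed
  qed
 next
  fix a x assume x: "x \<in> K"
  show "sc a x \<in> K"
  proof (rule KI[OF sc_closed[OF KM[OF x]]])
   fix k assume k: "k < i"
   obtain c h where 1: "h \<in> H" "u k k k x = sc c (A k) \<oplus>\<^sub>M h" using KE[OF x k] by blast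
   show "\<exists>c. \<exists>h\<in>H. u k k k (sc a x) = sc c (A k) \<oplus>\<^sub>M h"
   proof (intro exI[of _ "a * c"] bexI[OF _ submodule_sc[OF H 1(1)]])
    show "u k k k (sc a x) = sc (a * c) (A k) \<oplus>\<^sub>M sc a h"
     unfolding u_sc[OF KM[OF x]] 1(2) sc_assoc[OF AM] by (rule sc_radd[OF sc_closed[OF AM] HD(3)[OF 1(1)]])
   qed
  qed
 next
  fix j l m x assume jlm: "idx j l m" and x: "x \<in> K"
  have m: "j \<le> m" "l \<le> m" "j < n" using jlm by (simp_all add: idx_def)
  have xM: "x \<in> carrier M" by (rule KM[OF x])
  show "u j l m x \<in> K"
  proof (rule KI[OF u_closed[OF xM]])
   fix k assume k: "k < i"
   show "\<exists>c. \<exists>h\<in>H. u k k k (u j l m x) = sc c (A k) \<oplus>\<^sub>M h"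
   proof (cases "k = l")
    case False
    then have "u k k k (u j l m x) = \<zero>\<^sub>M" by (rule u_tgt_neq[OF m(1,2) xM])
    then show ?thesis using Hex[OF HD(2)] by simp
   next
    case True
    have e: "u k k k (u j l m x) = u j l m (u j j j x)"
     unfolding True u_tgt[OF m(1,2) xM] u_src[OF m(1,2) xM] ..
    show ?thesis
    proof (cases "j < i")
     case False
     then have "u j j j x \<in> H" using high m(3) xM by simp
     then show ?thesis unfolding e by (intro Hex[OF HD(7)[OF dU_closed]])
    next
     case j: True
     obtain c h where 1: "h \<in> H" "u j j j x = sc c (A j) \<oplus>\<^sub>M h" using KE[OF x j] by blast
     have e2: "u k k k (u j l m x) = sc c (u j l m (A j)) \<oplus>\<^sub>M u j l m h"
      unfolding e 1(2) u_add[OF sc_closed[OF AM] HD(3)[OF 1(1)]] u_sc[OF AM] ..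
     have h': "u j l m h \<in> H" by (rule HD(7)[OF dU_closed 1(1)])
     show ?thesis
     proof (cases "j < m")
      case True
      have "sc c (u j l m (A j)) \<in> H" by (rule submodule_sc[OF H up[OF j True m(2)]])
      then show ?thesis unfolding e2 by (intro Hex HD(4)[OF _ h'])
     next
      case False
      then have "m = j" using m(1) by simp
      then have "u j l m (A j) = A k"
       unfolding A_def True using u_u[of "i - 1" "i - 1" j j j l v] j m v(1) by simp
      then show ?thesis unfolding e2 by (intro exI[of _ c] bexI[OF _ h']) simp
     qed
    qed
   qed
  qed
 qed
 have AK: "A k \<in> K" if k: "k < i" for k
 proof (rule KI[OF AM])
  fix l assume l: "l < i"
  show "\<exists>c. \<exists>h\<in>H. u l l l (A k) = sc c (A l) \<oplus>\<^sub>M h"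
  proof (cases "l = k")
   case True
   show ?thesis unfolding True eA[OF k]
    by (intro exI[of _ 1] bexI[OF _ HD(2)]) (simp add: sc_one[OF AM] AM)
  next
   case False
   have "u l l l (A k) = \<zero>\<^sub>M" unfolding A_def by (rule u_tgt_neq[OF le_refl _ v(1) False]) (use k in simp)
   then show ?thesis using Hex[OF HD(2)] by simp
  qed
 qed
 have vK: "v \<in> K" using AK[of "i - 1"] Atop i(1) by simp
 have satK: "satur M K"
  unfolding satur_def
 proof (intro allI impI)
  fix k x assume k: "1 \<le> k" "k < n" and x: "x \<in> carrier M" "u k k k x = x" and ax: "u k (k - 1) k x \<in> K"
  show "x \<in> K"
  proof (cases "k < i")
   case False
   then have "u k k k x \<in> H" using high k x(1) by simp
   then show ?thesis using x(2) HK by auto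
  next
   case ki: True
   then have k1: "k - 1 < i" by simp
   obtain c h where 1: "h \<in> H" "u (k - 1) (k - 1) (k - 1) (u k (k - 1) k x) = sc c (A (k - 1)) \<oplus>\<^sub>M h"
    using KE[OF ax k1] by blast
   have ax': "u k (k - 1) k x = sc c (A (k - 1)) \<oplus>\<^sub>M h"
    using 1(2) u_tgt[of k k "k - 1" x] x(1) by simp
   let ?y = "x \<ominus>\<^sub>M sc c (A k)"
   have sA: "sc c (A k) \<in> carrier M" by (rule sc_closed[OF AM])
   have y: "?y \<in> carrier M" using x(1) sA by simp
   have "u k k k ?y = ?y" unfolding u_diff[OF x(1) sA] x(2) u_sc[OF AM] eA[OF ki] ..
   moreover have "u k (k - 1) k ?y \<in> H"
    unfolding u_diff[OF x(1) sA] ax' u_sc[OF AM] aA[OF k(1) ki]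
    using add_diff_cancel[OF sc_closed[OF AM] HD(3)[OF 1(1)]] 1(1) by simp
   ultimately have yH: "?y \<in> H" by (rule saturD[OF sat k y])
   have xe: "x = ?y \<oplus>\<^sub>M sc c (A k)" by (rule diff_add_cancel[OF x(1) sA, symmetric])
   have "?y \<oplus>\<^sub>M sc c (A k) \<in> K"
    using submoduleD(4)[OF K] HK yH submodule_sc[OF K AK[OF ki]] by blast
   then show ?thesis using xe by simp
  qed
 qed
 note F = quotient_facts[OF H K HK]
 let ?Q = "quotient_module (res M K) H" and ?c = "\<lambda>x. H +>\<^bsub>res M K\<^esub> x"
 have QL: "left_module DD ?Q" by (rule quotient_dmod(3)[OF H K HK])
 interpret Q: dmod n ?Q by (rule dmod[OF QL])
 have uK: "u j l m x \<in> K" if "x \<in> K" for j l m x by (rule submoduleD(7)[OF K dU_closed that])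
 have atv: "x \<in> at_vertex n ?Q k \<longleftrightarrow> (\<exists>y\<in>K. x = ?c (u k k k y))" if k: "k < n" for x k
  unfolding Q.at_vertex_iff[OF k] F(1) using F(4)[OF dU_closed] by auto
 have range: "at_vertex n ?Q k = range (\<lambda>c. Q.sc c (?c (A k)))" if k: "k < i" for k
 proof -
  have kn: "k < n" using k i by simp
  show ?thesis
  proof (intro equalityI subsetI)
   fix X assume "X \<in> at_vertex n ?Q k"
   then obtain y where y: "y \<in> K" "X = ?c (u k k k y)" unfolding atv[OF kn] by blast
   obtain c h where 1: "h \<in> H" "u k k k y = sc c (A k) \<oplus>\<^sub>M h" using KE[OF y(1) k] by blast
   have "X = Q.sc c (?c (A k))"
    unfolding y(2) 1(2) F(5)[OF AK[OF k]] by (rule F(8)[OF 1(1) submodule_sc[OF K AK[OF k]]])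
   then show "X \<in> range (\<lambda>c. Q.sc c (?c (A k)))" by (rule range_eqI)
  next
   fix X assume "X \<in> range (\<lambda>c. Q.sc c (?c (A k)))"
   then obtain c where c: "X = Q.sc c (?c (A k))" by (rule rangeE)
   have "X = ?c (u k k k (sc c (A k)))" unfolding c F(5)[OF AK[OF k]] u_sc[OF AM] eA[OF k] ..
   then show "X \<in> at_vertex n ?Q k" unfolding atv[OF kn] using submodule_sc[OF K AK[OF k]] by (rule bexI)
  qed
 qed
 have cA0: "?c (A k) \<noteq> \<zero>\<^sub>?Q" if k: "k < i" for k
  unfolding F(2) using F(6)[OF AK[OF k]] AH[OF k] by simp
 have "is_standard n i ?Q"
  unfolding is_standard_def
 proof (intro conjI allI impI ballI QL)
  fix j assume j: "j < i"
  show "\<exists>w. w \<noteq> \<zero>\<^sub>?Q \<and> w \<in> at_vertex n ?Q j \<and> at_vertex n ?Q j = range (\<lambda>c. Q.sc c w)"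
  proof (intro exI[of _ "?c (A j)"] conjI cA0[OF j] range[OF j])
   show "?c (A j) \<in> at_vertex n ?Q j" unfolding range[OF j]
    by (rule range_eqI[of _ _ 1]) (rule Q.sc_one[OF F(3)[OF AK[OF j]], symmetric])
  qed
 next
  fix j assume "j \<in> {i..<n}"
  then have j: "i \<le> j" "j < n" by simp_all
  show "at_vertex n ?Q j = {\<zero>\<^sub>?Q}"
  proof (intro equalityI subsetI)
   fix X assume "X \<in> at_vertex n ?Q j"
   then obtain y where y: "y \<in> K" "X = ?c (u j j j y)" unfolding atv[OF j(2)] by blast
   have "u j j j y \<in> H" by (rule high[OF j KM[OF y(1)]])
   then show "X \<in> {\<zero>\<^sub>?Q}" unfolding y(2) F(2) using F(6)[OF uK[OF y(1)]] by simp
  next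
   fix X assume "X \<in> {\<zero>\<^sub>?Q}"
   then have "X = Q.u j j j \<zero>\<^sub>?Q" by (simp add: Q.u_null)
   then show "X \<in> at_vertex n ?Q j" using Q.u_at_vertex[OF j(2) Q.M.zero_closed] by simp
  qed
 next
  fix k assume "k \<in> {1..i-1}"
  then have k: "1 \<le> k" "k < n" "k < i" "k - 1 < i" using i by auto
  have a: "D_a n k \<odot>\<^sub>?Q Q.sc c (?c (A k)) = Q.sc c (?c (A (k - 1)))" for c
   unfolding D_a_eq_dU[OF k(1,2)] Q.u_sc[OF F(3)[OF AK[OF k(3)]]] F(4)[OF dU_closed AK[OF k(3)]] aA[OF k(1,3)] ..
  show "bij_betw (\<lambda>x. D_a n k \<odot>\<^sub>?Q x) (at_vertex n ?Q k) (at_vertex n ?Q (k - 1))"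
   unfolding bij_betw_def range[OF k(3)] range[OF k(4)]
  proof
   show "inj_on (\<lambda>x. D_a n k \<odot>\<^sub>?Q x) (range (\<lambda>c. Q.sc c (?c (A k))))"
   proof (rule inj_onI)
    fix X Y assume "X \<in> range (\<lambda>c. Q.sc c (?c (A k)))" "Y \<in> range (\<lambda>c. Q.sc c (?c (A k)))"
     and e: "D_a n k \<odot>\<^sub>?Q X = D_a n k \<odot>\<^sub>?Q Y"
    then obtain c d where c: "X = Q.sc c (?c (A k))" "Y = Q.sc d (?c (A k))" by (elim rangeE) simp
    have "c = d" by (rule Q.sc_inject[OF F(3)[OF AK[OF k(4)]] cA0[OF k(4)] e[unfolded c a]])
    then show "X = Y" unfolding c by simp
   qed
   show "(\<lambda>x. D_a n k \<odot>\<^sub>?Q x) ` range (\<lambda>c. Q.sc c (?c (A k))) = range (\<lambda>c. Q.sc c (?c (A (k - 1))))"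
    unfolding image_image a ..
  qed
 next
  fix k X assume "k \<in> {1..n-1}" and X: "X \<in> carrier ?Q"
  then have k: "1 \<le> k" "k < n" using n_gt_1 by auto
  obtain x where x: "x \<in> K" "X = ?c x" using X unfolding F(1) by (elim imageE) simp
  have "u (k - 1) k k x \<in> H"
  proof (cases "k - 1 < i")
   case True
   obtain c h where 1: "h \<in> H" "u (k - 1) (k - 1) (k - 1) x = sc c (A (k - 1)) \<oplus>\<^sub>M h"
    using KE[OF x(1) True] by blast
   have "u (k - 1) k k x = u (k - 1) k k (u (k - 1) (k - 1) (k - 1) x)"
    using u_src[of "k - 1" k k x] KM[OF x(1)] by simp
   also have "\<dots> = sc c (u (k - 1) k k (A (k - 1))) \<oplus>\<^sub>M u (k - 1) k k h"
    unfolding 1(2) u_add[OF sc_closed[OF AM] HD(3)[OF 1(1)]] u_sc[OF AM] ..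
   also have "\<dots> \<in> H"
    by (rule HD(4)[OF submodule_sc[OF H up[OF True]] HD(7)[OF dU_closed 1(1)]]) (use k in simp_all)
   finally show ?thesis .
  next
   case False
   have "u (k - 1) (k - 1) (k - 1) x \<in> H" by (rule high[OF _ _ KM[OF x(1)]]) (use False k in simp_all)
   then have "u (k - 1) k k (u (k - 1) (k - 1) (k - 1) x) \<in> H" by (rule HD(7)[OF dU_closed])
   then show ?thesis using u_src[of "k - 1" k k x] KM[OF x(1)] by simp
  qed
  then show "D_b n k \<odot>\<^sub>?Q X = \<zero>\<^sub>?Q"
   unfolding D_b_eq_dU[OF k] x(2) F(4)[OF dU_closed x(1)] F(2) using F(6)[OF uK[OF x(1)]] by simp
 qed
 then show thesis by (rule that[OF K HK vK satK])
qed

definition filtered :: "'b set => bool"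
 where "filtered L \<longleftrightarrow> (\<exists>(r::nat) H. (\<forall>k\<le>r. submodule (H k) DD M) \<and> H 0 = {\<zero>\<^sub>M} \<and> H r = L \<and>
   (\<forall>k<r. H k \<subseteq> H (Suc k) \<and>
    (\<exists>i\<in>{1..n}. is_standard n i (quotient_module (res M (H (Suc k))) (H k)))))"

lemma filtered_zero: "filtered {\<zero>\<^sub>M}"
 unfolding filtered_def by (intro exI[of _ 0] exI[of _ "\<lambda>_. {\<zero>\<^sub>M}"]) (simp add: submodule_zero)

lemma filtered_extend:
 assumes L: "filtered L" and K: "submodule K DD M" and LK: "L \<subseteq> K" and i: "1 \<le> i" "i \<le> n"
  and s: "is_standard n i (quotient_module (res M K) L)"
 shows "filtered K"
proof -
 obtain r :: nat and H where H: "\<And>k. k \<le> r ==> submodule (H k) DD M" "H 0 = {\<zero>\<^sub>M}" "H r = L"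
  and st: "\<And>k. k < r ==> H k \<subseteq> H (Suc k) \<and>
    (\<exists>i\<in>{1..n}. is_standard n i (quotient_module (res M (H (Suc k))) (H k)))"
  using L unfolding filtered_def by metis
 define H' where "H' k = (if k \<le> r then H k else K)" for k
 show ?thesis unfolding filtered_def
 proof (intro exI[of _ "Suc r"] exI[of _ H'] conjI allI impI)
  fix k assume k: "k < Suc r"
  have "H' k \<subseteq> H' (Suc k) \<and>
   (\<exists>i\<in>{1..n}. is_standard n i (quotient_module (res M (H' (Suc k))) (H' k)))"
  proof (cases "k < r")
   case True
   then have "H' k = H k" "H' (Suc k) = H (Suc k)" by (simp_all add: H'_def)
   then show ?thesis using st[OF True] by simp
  next
   case False
   then have "k = r" using k by simp
   then have e: "H' k = L" "H' (Suc k) = K" by (simp_all add: H'_def H(3))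
   have "\<exists>i\<in>{1..n}. is_standard n i (quotient_module (res M K) L)"
    by (rule bexI[where x = i]) (use s i in simp_all)
   then show ?thesis unfolding e using LK by simp
  qed
  then show "H' k \<subseteq> H' (Suc k)"
   "\<exists>i\<in>{1..n}. is_standard n i (quotient_module (res M (H' (Suc k))) (H' k))" by simp_all
 qed (auto simp: H'_def H K)
qed

lemma filtration_absorb:
 assumes "finite T" and T: "\<And>v. v \<in> T ==> v \<in> carrier M \<and> u (i - 1) (i - 1) (i - 1) v = v"
  and i: "1 \<le> i" "i \<le> n" and H: "submodule H DD M" "filtered H" "satur M H"
  and high: "\<And>j x. i \<le> j ==> j < n ==> x \<in> carrier M ==> u j j j x \<in> H"
 shows "\<exists>K. submodule K DD M \<and> filtered K \<and> satur M K \<and> H \<subseteq> K \<and> T \<subseteq> K"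
 using assms(1) T
proof (induction T rule: finite_induct)
 case empty
 show ?case using H by (intro exI[of _ H]) simp
next
 case (insert v T)
 then obtain K where K: "submodule K DD M" "filtered K" "satur M K" "H \<subseteq> K" "T \<subseteq> K" by blast
 have v: "v \<in> carrier M" "u (i - 1) (i - 1) (i - 1) v = v" using insert.prems[of v] by simp_all
 show ?case
 proof (cases "v \<in> K")
  case True
  then show ?thesis using K by (intro exI[of _ K]) simp
 next
  case False
  have hK: "u j j j x \<in> K" if "i \<le> j" "j < n" "x \<in> carrier M" for j x using high[OF that] K(4) by blast
  obtain L where L: "submodule L DD M" "K \<subseteq> L" "v \<in> L" "satur M L"
   "is_standard n i (quotient_module (res M L) K)"
   by (rule filtration_step[OF K(1,3) hK i v False])
  have "filtered L" by (rule filtered_extend[OF K(2) L(1,2) i L(5)])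
  then show ?thesis using L K by (intro exI[of _ L]) auto
 qed
qed

text \<open>The vertices are absorbed from the highest one downwards: once the filtration contains the spaces
 at the vertices \<open>i, \<dots>, n - 1\<close>, finitely many factors \<open>\<Delta>\<^sub>i\<close> exhaust the space at the vertex \<open>i - 1\<close>.\<close>

theorem standard_filtration_exists:
 assumes sat: "satur M {\<zero>\<^sub>M}" and fd: "finite_dimensional DD M"
 shows "has_standard_filtration n M"
proof -
 from fd obtain S where S: "finite S" "S \<subseteq> carrier M"
  and sp: "\<And>H. csub H ==> S \<subseteq> H ==> carrier M \<subseteq> H" unfolding finite_dimensional_iff by blast
 have "d \<le> n ==> \<exists>H. submodule H DD M \<and> filtered H \<and> satur M H \<and>
   (\<forall>j x. n - d \<le> j --> j < n --> x \<in> carrier M --> u j j j x \<in> H)" for d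
 proof (induction d)
  case 0
  show ?case using submodule_zero filtered_zero sat by (intro exI[of _ "{\<zero>\<^sub>M}"]) simp
 next
  case (Suc d)
  then obtain H where H: "submodule H DD M" "filtered H" "satur M H"
   and high: "\<And>j x. n - d \<le> j ==> j < n ==> x \<in> carrier M ==> u j j j x \<in> H" by (metis Suc_leD)
  let ?i = "n - d"
  have i: "1 \<le> ?i" "?i \<le> n" "?i - 1 = n - Suc d" using Suc.prems by auto
  let ?e = "u (?i - 1) (?i - 1) (?i - 1)"
  have T: "v \<in> carrier M \<and> ?e v = v" if "v \<in> ?e ` S" for v
  proof -
   obtain x where x: "x \<in> S" "v = ?e x" using \<open>v \<in> ?e ` S\<close> by (rule imageE)
   have xM: "x \<in> carrier M" using x(1) S(2) by blast
   show ?thesis unfolding x(2) using u_closed[OF xM] u_tgt[OF le_refl le_refl xM] by blast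
  qed
  obtain K where K: "submodule K DD M" "filtered K" "satur M K" "H \<subseteq> K" "?e ` S \<subseteq> K"
   using filtration_absorb[OF finite_imageI[OF S(1)] T i(1,2) H high] by blast
  let ?C = "{x \<in> carrier M. ?e x \<in> K}"
  have "csub ?C"
   unfolding csub_def
   using submoduleD(2,4)[OF K(1)] submodule_sc[OF K(1)] by (simp add: subset_eq u_null u_add u_sc sc_closed)
  moreover have "S \<subseteq> ?C" using S(2) K(5) by blast
  ultimately have C: "carrier M \<subseteq> ?C" by (rule sp)
  have "u j j j x \<in> K" if "n - Suc d \<le> j" "j < n" "x \<in> carrier M" for j x
  proof (cases "j = n - Suc d")
   case True
   then show ?thesis using C that(3) i(3) by auto
  next
   case False
   then have "n - d \<le> j" using that(1) by simp
   then show ?thesis using high that(2,3) K(4) by blast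
  qed
  then show ?case using K by blast
 qed
 from this[OF le_refl] obtain H where H: "submodule H DD M" "filtered H"
  and high: "\<And>j x. j < n ==> x \<in> carrier M ==> u j j j x \<in> H" by auto
 have "carrier M \<subseteq> H"
 proof
  fix x assume x: "x \<in> carrier M"
  show "x \<in> H" by (rule vertex_sub[OF H(1) x high[OF _ x]])
 qed
 then have "H = carrier M" using submoduleD(1)[OF H(1)] by blast
 then show ?thesis using H(2) unfolding filtered_def has_standard_filtration_def by simp
qed

end

section \<open>Modules coinduced from the vertex \<open>0\<close>\<close>

lemma hom_lift_inj:
 assumes A: "left_module R A" and B: "left_module R B"
  and a: "a \<in> lmod_hom R A P" and b: "b \<in> lmod_hom R B P" and inj: "inj_on b (carrier B)"
  and sub: "\<And>x. x \<in> carrier A ==> a x \<in> b ` carrier B"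
 shows "(\<lambda>x\<in>carrier A. inv_into (carrier B) b (a x)) \<in> lmod_hom R A B"
  and "x \<in> carrier A ==> b (inv_into (carrier B) b (a x)) = a x"
proof -
 let ?g = "\<lambda>x. inv_into (carrier B) b (a x)"
 note aD = lmod_homD[OF a] and bD = lmod_homD[OF b]
 have g: "?g x \<in> carrier B" and bg: "b (?g x) = a x" if "x \<in> carrier A" for x
  using inv_into_into[OF sub[OF that]] f_inv_into_f[OF sub[OF that]] .
 show "x \<in> carrier A ==> b (?g x) = a x" by (rule bg)
 show "(\<lambda>x\<in>carrier A. ?g x) \<in> lmod_hom R A B"
 proof (rule lmod_homI[OF g _ _ A])
  fix x y assume x: "x \<in> carrier A" and y: "y \<in> carrier A"
  have xy: "x \<oplus>\<^sub>A y \<in> carrier A" by (rule left_module_add_closed[OF A x y])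
  have gg: "?g x \<oplus>\<^sub>B ?g y \<in> carrier B" by (rule left_module_add_closed[OF B g[OF x] g[OF y]])
  show "?g (x \<oplus>\<^sub>A y) = ?g x \<oplus>\<^sub>B ?g y"
   by (rule inj_onD[OF inj _ g[OF xy] gg]) (rule trans[OF bg[OF xy]], simp only: bD(2)[OF g[OF x] g[OF y]] bg[OF x] bg[OF y] aD(2)[OF x y])
 next
  fix d x assume d: "d \<in> carrier R" and x: "x \<in> carrier A"
  have dx: "d \<odot>\<^sub>A x \<in> carrier A" by (rule left_module.smult_closed[OF A d x])
  have dg: "d \<odot>\<^sub>B ?g x \<in> carrier B" by (rule left_module.smult_closed[OF B d g[OF x]])
  show "?g (d \<odot>\<^sub>A x) = d \<odot>\<^sub>B ?g x"
   by (rule inj_onD[OF inj _ g[OF dx] dg]) (rule trans[OF bg[OF dx]], simp only: bD(3)[OF d g[OF x]] bg[OF x] aD(3)[OF d x])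
 qed
qed

context auslander
begin

text \<open>
 A module \<open>P\<close> with this property is recovered from the vertex \<open>0\<close>: the maps \<open>a\<^sub>1 \<cdots> a\<^sub>k\<close> identify
 its space at the vertex \<open>k\<close> with the kernel of the \<open>(n - k)\<close>-th power of \<open>a\<^sub>1 b\<^sub>1\<close> on the
 space at the vertex \<open>0\<close>, which is the largest subspace that the relations permit.
\<close>

definition coinduced :: "(D_elem, 'c) module => bool"
 where "coinduced P \<longleftrightarrow>
  (\<forall>k<n. \<forall>y\<in>carrier P. dU k k k \<odot>\<^sub>P y = y --> dU k 0 k \<odot>\<^sub>P y = \<zero>\<^sub>P --> y = \<zero>\<^sub>P) \<and>
  (\<forall>k<n. \<forall>x\<in>carrier P. dU 0 0 0 \<odot>\<^sub>P x = x --> dU 0 0 (n - k) \<odot>\<^sub>P x = \<zero>\<^sub>P -->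
   (\<exists>y\<in>carrier P. dU k k k \<odot>\<^sub>P y = y \<and> dU k 0 k \<odot>\<^sub>P y = x))"

lemma coinducedD:
 assumes "coinduced P" "k < n"
 shows "y \<in> carrier P ==> dU k k k \<odot>\<^sub>P y = y ==> dU k 0 k \<odot>\<^sub>P y = \<zero>\<^sub>P ==> y = \<zero>\<^sub>P"
  and "x \<in> carrier P ==> dU 0 0 0 \<odot>\<^sub>P x = x ==> dU 0 0 (n - k) \<odot>\<^sub>P x = \<zero>\<^sub>P ==>
   \<exists>y\<in>carrier P. dU k k k \<odot>\<^sub>P y = y \<and> dU k 0 k \<odot>\<^sub>P y = x"
 using assms unfolding coinduced_def by simp_all

lemma coinduced_satur:
 assumes P: "left_module DD P" and c: "coinduced P"
 shows "satur P {\<zero>\<^sub>P}"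
 unfolding satur_def
proof (intro allI impI)
 interpret P: dmod n P by (rule dmod[OF P])
 fix k x assume k: "1 \<le> k" "k < n" and x: "x \<in> carrier P" "P.u k k k x = x" "P.u k (k - 1) k x \<in> {\<zero>\<^sub>P}"
 have "P.u k 0 k x = P.u (k - 1) 0 (k - 1) (P.u k (k - 1) k x)"
  using P.u_u[of k k "k - 1" "k - 1" "k - 1" 0 x] x(1) by simp
 also have "\<dots> = \<zero>\<^sub>P" using x(3) P.u_null by simp
 finally have "x = \<zero>\<^sub>P" by (rule coinducedD(1)[OF c k(2) x(1,2)])
 then show "x \<in> {\<zero>\<^sub>P}" by simp
qed

text \<open>Conversely, injectivity of the single arrows \<open>a\<^sub>k\<close> gives injectivity of their composites.\<close>

lemma satur_down_inj:
 assumes M: "left_module DD M" and s: "satur M {\<zero>\<^sub>M}"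
 shows "k < n ==> x \<in> carrier M ==> dU k k k \<odot>\<^sub>M x = x ==> dU k 0 k \<odot>\<^sub>M x = \<zero>\<^sub>M ==> x = \<zero>\<^sub>M"
proof (induction k arbitrary: x)
 case 0
 then show ?case by simp
next
 case (Suc k)
 interpret M: dmod n M by (rule dmod[OF M])
 let ?y = "M.u (Suc k) k (Suc k) x"
 have y: "?y \<in> carrier M" by (rule M.u_closed[OF Suc.prems(2)])
 have "M.u k k k ?y = ?y" by (rule M.u_tgt) (use Suc.prems in simp_all)
 moreover have "M.u k 0 k ?y = M.u (Suc k) 0 (Suc k) x"
  using M.u_u[of "Suc k" "Suc k" k k k 0 x] Suc.prems(2) by simp
 ultimately have "?y = \<zero>\<^sub>M" using Suc.IH[OF _ y] Suc.prems(1,4) by simp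
 then have "x \<in> {\<zero>\<^sub>M}" using saturD[OF s _ Suc.prems(1,2,3)] by simp
 then show ?case by simp
qed

text \<open>
 A homomorphism from \<open>D e\<^sub>0 M\<close> to a coinduced module is determined by its component at the vertex \<open>0\<close>,
 which sends the image of \<open>a\<^sub>1 \<cdots> a\<^sub>k\<close> into the kernel of the \<open>(n - k)\<close>-th power of
 \<open>a\<^sub>1 b\<^sub>1\<close>; hence it lifts uniquely through \<open>a\<^sub>1 \<cdots> a\<^sub>k\<close> at every vertex \<open>k\<close>.
\<close>

lemma coinduced_extend:
 assumes M: "left_module DD M" and P: "left_module DD P" and c: "coinduced P"
  and g: "g \<in> lmod_hom DD (res M (etaS M)) P"
 shows "\<exists>G\<in>lmod_hom DD M P. \<forall>x\<in>etaS M. G x = g x"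
proof -
 interpret M: dmod n M by (rule dmod[OF M])
 interpret P: dmod n P by (rule dmod[OF P])
 note E = M.submoduleD[OF M.etaS_submodule]
 have gD: "\<And>x. x \<in> etaS M ==> g x \<in> carrier P" "\<And>x y. x \<in> etaS M ==> y \<in> etaS M ==> g (x \<oplus>\<^sub>M y) = g x \<oplus>\<^sub>P g y"
  "\<And>a x. a \<in> carrier DD ==> x \<in> etaS M ==> g (a \<odot>\<^sub>M x) = a \<odot>\<^sub>P g x"
  using lmod_homD[OF g] by simp_all
 have gsc: "g (M.sc c x) = P.sc c (g x)" if "x \<in> etaS M" for c x
  unfolding scal_def by (rule gD(3)[OF M.c1_closed that])
 have g0: "g \<zero>\<^sub>M = \<zero>\<^sub>P"
  using gsc[OF E(2), of 0] M.sc_zero_left[OF M.M.zero_closed] P.sc_zero_left[OF gD(1)[OF E(2)]] by simp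
 have t0: "M.u 0 0 0 (M.u k 0 k x) = M.u k 0 k x" if "x \<in> carrier M" for k x
  by (rule M.u_tgt) (use that in simp_all)
 have d: "M.u k 0 k x \<in> etaS M" if x: "x \<in> carrier M" for k x
  using M.u0_etaS[OF M.u_closed[OF x, of k 0 k] le_refl, of 0] unfolding t0[OF x] .
 \<comment> \<open>The relation \<open>R x p\<close> forces the value \<open>p\<close> of the extension at \<open>x\<close>.\<close>
 define R where "R x p \<longleftrightarrow> p \<in> carrier P \<and> (\<forall>k<n. P.u k 0 k p = g (M.u k 0 k x))" for x p
 have ex: "\<exists>p. R x p" if x: "x \<in> carrier M" for x
 proof -
  have yex: "\<exists>y\<in>carrier P. P.u k k k y = y \<and> P.u k 0 k y = g (M.u k 0 k x)" if k: "k < n" for k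
  proof (rule coinducedD(2)[OF c k gD(1)[OF d[OF x]]])
   show "P.u 0 0 0 (g (M.u k 0 k x)) = g (M.u k 0 k x)"
    unfolding gD(3)[OF dU_closed d[OF x], symmetric] t0[OF x] ..
   have "M.u 0 0 (n - k) (M.u k 0 k x) = \<zero>\<^sub>M"
    using M.u_u[of k k 0 0 "n - k" 0 x] M.u_top[OF le_refl x] x k by simp
   then show "P.u 0 0 (n - k) (g (M.u k 0 k x)) = \<zero>\<^sub>P"
    unfolding gD(3)[OF dU_closed d[OF x], symmetric] by (simp only: g0)
  qed
  define z where "z k = (SOME y. y \<in> carrier P \<and> P.u k k k y = y \<and> P.u k 0 k y = g (M.u k 0 k x))" for k
  have z: "z k \<in> carrier P \<and> P.u k k k (z k) = z k \<and> P.u k 0 k (z k) = g (M.u k 0 k x)" if "k < n" for k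
   unfolding z_def by (rule someI_ex) (use yex[OF that] in blast)
  have "\<exists>p\<in>carrier P. \<forall>k<n. P.u k k k p = z k" by (rule P.vertex_glue) (simp_all add: z)
  then obtain p where p: "p \<in> carrier P" and pk: "\<forall>k<n. P.u k k k p = z k" by (rule bexE)
  have "R x p" unfolding R_def
  proof (intro conjI allI impI p)
   fix k assume k: "k < n"
   have "P.u k 0 k p = P.u k 0 k (P.u k k k p)" by (rule P.u_src[symmetric]) (use p in simp_all)
   also have "\<dots> = P.u k 0 k (z k)" using pk k by simp
   also have "\<dots> = g (M.u k 0 k x)" using z[OF k] by simp
   finally show "P.u k 0 k p = g (M.u k 0 k x)" .
  qed
  then show ?thesis by (rule exI)
 qed
 have uniq: "p = q" if "R x p" "R x q" for x p q
 proof -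
  have p: "p \<in> carrier P" and q: "q \<in> carrier P" and e: "\<And>k. k < n ==> P.u k 0 k p = P.u k 0 k q"
   using that unfolding R_def by simp_all
  have pq: "p \<ominus>\<^sub>P q \<in> carrier P" using p q by simp
  have "p \<ominus>\<^sub>P q = \<zero>\<^sub>P"
  proof (rule P.vertex_zero[OF pq], rule coinducedD(1)[OF c])
   fix k assume k: "k < n"
   show "k < n" by (rule k)
   show "P.u k k k (p \<ominus>\<^sub>P q) \<in> carrier P" by (rule P.u_closed[OF pq])
   show "P.u k k k (P.u k k k (p \<ominus>\<^sub>P q)) = P.u k k k (p \<ominus>\<^sub>P q)" by (rule P.u_tgt[OF le_refl le_refl pq])
   have "P.u k 0 k (P.u k k k (p \<ominus>\<^sub>P q)) = P.u k 0 k (p \<ominus>\<^sub>P q)" by (rule P.u_src) (use pq in simp_all)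
   also have "\<dots> = \<zero>\<^sub>P" unfolding P.u_diff[OF p q]
    by (rule iffD2[OF P.diff_zero_iff[OF P.u_closed[OF p] P.u_closed[OF q]] e[OF k]])
   finally show "P.u k 0 k (P.u k k k (p \<ominus>\<^sub>P q)) = \<zero>\<^sub>P" .
  qed
  then show ?thesis using P.diff_zero_iff[OF p q] by simp
 qed
 define G where "G x = (SOME p. R x p)" for x
 have RG: "R x (G x)" if "x \<in> carrier M" for x unfolding G_def by (rule someI_ex[OF ex[OF that]])
 have GP: "G x \<in> carrier P" if "x \<in> carrier M" for x using RG[OF that] unfolding R_def by simp
 have GD: "P.u k 0 k (G x) = g (M.u k 0 k x)" if "x \<in> carrier M" "k < n" for x k
  using RG[OF that(1)] that(2) unfolding R_def by simp
 have "(\<lambda>x\<in>carrier M. G x) \<in> lmod_hom DD M P"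
 proof (rule dmod_homI[OF M P GP])
  fix x y assume x: "x \<in> carrier M" and y: "y \<in> carrier M"
  have xy: "x \<oplus>\<^sub>M y \<in> carrier M" using x y by simp
  show "G (x \<oplus>\<^sub>M y) = G x \<oplus>\<^sub>P G y"
  proof (rule uniq[OF RG[OF xy]], unfold R_def, intro conjI allI impI)
   show "G x \<oplus>\<^sub>P G y \<in> carrier P" using GP[OF x] GP[OF y] by simp
   fix k assume k: "k < n"
   show "P.u k 0 k (G x \<oplus>\<^sub>P G y) = g (M.u k 0 k (x \<oplus>\<^sub>M y))"
    unfolding P.u_add[OF GP[OF x] GP[OF y]] M.u_add[OF x y] gD(2)[OF d[OF x] d[OF y]] GD[OF x k] GD[OF y k] ..
  qed
 next
  fix a x assume x: "x \<in> carrier M"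
  show "G (M.sc a x) = P.sc a (G x)"
  proof (rule uniq[OF RG[OF M.sc_closed[OF x]]], unfold R_def, intro conjI allI impI)
   show "P.sc a (G x) \<in> carrier P" by (rule P.sc_closed[OF GP[OF x]])
   fix k assume k: "k < n"
   show "P.u k 0 k (P.sc a (G x)) = g (M.u k 0 k (M.sc a x))"
    unfolding P.u_sc[OF GP[OF x]] M.u_sc[OF x] gsc[OF d[OF x]] GD[OF x k] ..
  qed
 next
  fix i j m x assume "idx i j m" and x: "x \<in> carrier M"
  then have m: "i \<le> m" "j \<le> m" "i < n" by (simp_all add: idx_def)
  have ux: "M.u i j m x \<in> carrier M" by (rule M.u_closed[OF x])
  show "G (M.u i j m x) = P.u i j m (G x)"
  proof (rule uniq[OF RG[OF ux]], unfold R_def, intro conjI allI impI)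
   show "P.u i j m (G x) \<in> carrier P" by (rule P.u_closed[OF GP[OF x]])
   fix k assume k: "k < n"
   show "P.u k 0 k (P.u i j m (G x)) = g (M.u k 0 k (M.u i j m x))"
   proof (cases "j = k")
    case True
    have 1: "M.u k 0 k (M.u i j m x) = M.u 0 0 (m - i) (M.u i 0 i x)"
     using M.u_u[of i m j k k 0 x] M.u_u[of i i 0 0 "m - i" 0 x] m x True by simp
    have 2: "P.u k 0 k (P.u i j m (G x)) = P.u 0 0 (m - i) (P.u i 0 i (G x))"
     using P.u_u[of i m j k k 0 "G x"] P.u_u[of i i 0 0 "m - i" 0 "G x"] m GP[OF x] True by simp
    show ?thesis unfolding 1 2 gD(3)[OF dU_closed d[OF x]] GD[OF x m(3)] ..
   next
    case False
    then have "M.u k 0 k (M.u i j m x) = \<zero>\<^sub>M" "P.u k 0 k (P.u i j m (G x)) = \<zero>\<^sub>P"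
     using M.u_u[of i m j k k 0 x] P.u_u[of i m j k k 0 "G x"] m GP[OF x] x by simp_all
    then show ?thesis by (simp only: g0)
   qed
  qed
 qed
 moreover have "\<forall>x\<in>etaS M. (\<lambda>x\<in>carrier M. G x) x = g x"
 proof
  fix x assume x: "x \<in> etaS M"
  have "G x = g x"
  proof (rule uniq[OF RG[OF E(3)[OF x]]], unfold R_def, intro conjI allI impI)
   show "g x \<in> carrier P" by (rule gD(1)[OF x])
   show "P.u k 0 k (g x) = g (M.u k 0 k x)" for k by (rule gD(3)[OF dU_closed x, symmetric])
  qed
  then show "(\<lambda>x\<in>carrier M. G x) x = g x" using E(3)[OF x] by simp
 qed
 ultimately show ?thesis by (intro bexI)
qed

lemma coinduced_direct_sum:
 assumes X: "\<And>i. i \<in> I ==> coinduced (X i)"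
 shows "coinduced (direct_sum I X)"
 unfolding coinduced_def
proof (intro conjI allI impI ballI)
 let ?S = "direct_sum I X"
 fix k y assume k: "k < n" and y: "y \<in> carrier ?S" and e: "dU k k k \<odot>\<^sub>?S y = y"
  and z: "dU k 0 k \<odot>\<^sub>?S y = \<zero>\<^sub>?S"
 have yi: "y i = \<zero>\<^bsub>X i\<^esub>" if i: "i \<in> I" for i
 proof (rule coinducedD(1)[OF X[OF i] k direct_sum_memD[OF y i]])
  show "dU k k k \<odot>\<^bsub>X i\<^esub> y i = y i" using fun_cong[OF e, of i] i by (simp add: direct_sum_simps)
  show "dU k 0 k \<odot>\<^bsub>X i\<^esub> y i = \<zero>\<^bsub>X i\<^esub>" using fun_cong[OF z, of i] i by (simp add: direct_sum_simps)
 qed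
 show "y = \<zero>\<^sub>?S"
 proof
  fix i show "y i = \<zero>\<^sub>?S i"
   using yi[of i] y by (cases "i \<in> I") (simp_all add: direct_sum_simps PiE_arb[of y])
 qed
next
 let ?S = "direct_sum I X"
 fix k x assume k: "k < n" and x: "x \<in> carrier ?S" and e: "dU 0 0 0 \<odot>\<^sub>?S x = x"
  and z: "dU 0 0 (n - k) \<odot>\<^sub>?S x = \<zero>\<^sub>?S"
 define y where "y i = (SOME y. y \<in> carrier (X i) \<and> dU k k k \<odot>\<^bsub>X i\<^esub> y = y \<and> dU k 0 k \<odot>\<^bsub>X i\<^esub> y = x i)" for i
 have y: "y i \<in> carrier (X i) \<and> dU k k k \<odot>\<^bsub>X i\<^esub> y i = y i \<and> dU k 0 k \<odot>\<^bsub>X i\<^esub> y i = x i" if i: "i \<in> I" for i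
  unfolding y_def
 proof (rule someI_ex)
  have "\<exists>y\<in>carrier (X i). dU k k k \<odot>\<^bsub>X i\<^esub> y = y \<and> dU k 0 k \<odot>\<^bsub>X i\<^esub> y = x i"
  proof (rule coinducedD(2)[OF X[OF i] k direct_sum_memD[OF x i]])
   show "dU 0 0 0 \<odot>\<^bsub>X i\<^esub> x i = x i" using fun_cong[OF e, of i] i by (simp add: direct_sum_simps)
   show "dU 0 0 (n - k) \<odot>\<^bsub>X i\<^esub> x i = \<zero>\<^bsub>X i\<^esub>" using fun_cong[OF z, of i] i by (simp add: direct_sum_simps)
  qed
  then show "\<exists>y. y \<in> carrier (X i) \<and> dU k k k \<odot>\<^bsub>X i\<^esub> y = y \<and> dU k 0 k \<odot>\<^bsub>X i\<^esub> y = x i" by blast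
 qed
 show "\<exists>y\<in>carrier ?S. dU k k k \<odot>\<^sub>?S y = y \<and> dU k 0 k \<odot>\<^sub>?S y = x"
 proof (rule bexI[where x = "\<lambda>i\<in>I. y i"], intro conjI)
  show "(\<lambda>i\<in>I. y i) \<in> carrier ?S" by (rule direct_sum_memI) (simp add: y)
  show "dU k k k \<odot>\<^sub>?S (\<lambda>i\<in>I. y i) = (\<lambda>i\<in>I. y i)"
   unfolding direct_sum_simps by (rule restrict_ext) (simp add: y)
  show "dU k 0 k \<odot>\<^sub>?S (\<lambda>i\<in>I. y i) = x"
  proof
   fix i show "(dU k 0 k \<odot>\<^sub>?S (\<lambda>i\<in>I. y i)) i = x i"
    using y[of i] x by (cases "i \<in> I") (simp_all add: direct_sum_simps PiE_arb[of x])
  qed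
 qed
qed

subsection \<open>The projective modules\<close>

lemma D_proj_coordinates:
 assumes i: "i < n"
 shows "x \<in> carrier (D_proj n i) \<longleftrightarrow> x \<in> carrier DD \<and> (\<forall>a k m. idx a k m --> a \<noteq> i --> dco x a k m = 0)"
proof
 have ii: "idx i i i" using i by (simp add: idx_def)
 {
  assume "x \<in> carrier (D_proj n i)"
  then have x: "x \<in> carrier DD" "x \<otimes>\<^sub>DD dU i i i = x" by (simp_all add: D_proj_mem_iff[OF i])
  have "dco x a k m = 0" if "idx a k m" "a \<noteq> i" for a k m
   using dco_mult_dU[OF x(1) ii that(1)] that(2) unfolding x(2) by simp
  then show "x \<in> carrier DD \<and> (\<forall>a k m. idx a k m --> a \<noteq> i --> dco x a k m = 0)" using x(1) by simp
 }
 assume "x \<in> carrier DD \<and> (\<forall>a k m. idx a k m --> a \<noteq> i --> dco x a k m = 0)"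
 then have x: "x \<in> carrier DD" and z: "\<And>a k m. idx a k m ==> a \<noteq> i ==> dco x a k m = 0" by simp_all
 have "x \<otimes>\<^sub>DD dU i i i = x"
 proof (rule D_eqI[OF DD.m_closed[OF x dU_closed] x])
  fix a k m assume a: "idx a k m"
  show "dco (x \<otimes>\<^sub>DD dU i i i) a k m = dco x a k m"
   unfolding dco_mult_dU[OF x ii a] using z[OF a] a by (auto simp: idx_def)
 qed
 then show "x \<in> carrier (D_proj n i)" using x by (simp add: D_proj_mem_iff[OF i])
qed

lemma left_mult_vertex_coordinates:
 assumes x: "x \<in> carrier DD" and k: "k < n" and e: "dU k k k \<otimes>\<^sub>DD x = x" and a: "idx a l m" "l \<noteq> k"
 shows "dco x a l m = 0"
proof -
 have kk: "idx k k k" using k by (simp add: idx_def)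
 show ?thesis using dco_dU_mult[OF x kk a(1)] a(2) unfolding e by simp
qed

text \<open>The space \<open>e\<^sub>k D\<^sub>i\<close> has the basis \<open>dU i k m\<close> with \<open>max i k \<le> m < n\<close>, and \<open>a\<^sub>1 \<cdots> a\<^sub>k\<close> maps it onto the span of
 the \<open>dU i 0 m\<close> with \<open>m \<ge> k\<close>, which are the ones that \<open>dU 0 0 (n - k)\<close> kills.\<close>

lemma D_proj_coinduced:
 assumes i: "i < n"
 shows "coinduced (D_proj n i)"
 unfolding coinduced_def D_proj_simps
proof (intro conjI allI impI ballI)
 fix k y assume k: "k < n" and yi: "y \<in> carrier (D_proj n i)" and e: "dU k k k \<otimes>\<^sub>DD y = y"
  and z: "dU k 0 k \<otimes>\<^sub>DD y = \<zero>\<^sub>DD"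
 have y: "y \<in> carrier DD" using yi by (simp add: D_proj_mem_iff[OF i])
 show "y = \<zero>\<^sub>DD"
 proof (rule D_eqI[OF y DD.zero_closed])
  fix a l m assume a: "idx a l m"
  show "dco y a l m = dco \<zero>\<^sub>DD a l m"
  proof (cases "l = k")
   case True
   have k0: "idx k 0 k" and a0: "idx a 0 m" using a k by (simp_all add: idx_def)
   have "dco y a k m = dco (dU k 0 k \<otimes>\<^sub>DD y) a 0 m" unfolding dco_dU_mult[OF y k0 a0] by simp
   then show ?thesis unfolding z dco_zero True .
  next
   case False
   then show ?thesis unfolding dco_zero by (rule left_mult_vertex_coordinates[OF y k e a])
  qed
 qed
next
 fix k x assume k: "k < n" and xi: "x \<in> carrier (D_proj n i)" and e: "dU 0 0 0 \<otimes>\<^sub>DD x = x"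
  and z: "dU 0 0 (n - k) \<otimes>\<^sub>DD x = \<zero>\<^sub>DD"
 have x: "x \<in> carrier DD" using xi by (simp add: D_proj_mem_iff[OF i])
 have xa: "dco x a l m = 0" if "idx a l m" "a \<noteq> i" for a l m
  using xi that unfolding D_proj_coordinates[OF i] by blast
 have xl: "dco x a l m = 0" if "idx a l m" "l \<noteq> 0" for a l m
  by (rule left_mult_vertex_coordinates[OF x zero_less_n e that])
 have low: "dco x i 0 m = 0" if m: "m < k" "idx i 0 m" for m
 proof -
  have im: "i \<le> m" using m by (simp add: idx_def)
  have 1: "idx 0 0 (n - k)" "idx i 0 (m + (n - k))" using im m(1) k unfolding idx_def by arith+
  show ?thesis using dco_dU_mult[OF x 1] unfolding z dco_zero by simp
 qed
 define y where "y = dfun (\<lambda>a l m. if a = i \<and> l = k then dco x i 0 m else 0)"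
 have y: "y \<in> carrier DD" unfolding y_def by (rule dfun_closed)
 have yc: "dco y a l m = (if idx a l m \<and> a = i \<and> l = k then dco x i 0 m else 0)" for a l m
  unfolding y_def dco_dfun by auto
 show "\<exists>y\<in>carrier (D_proj n i). dU k k k \<otimes>\<^sub>DD y = y \<and> dU k 0 k \<otimes>\<^sub>DD y = x"
 proof (rule bexI[where x = y], intro conjI)
  show "y \<in> carrier (D_proj n i)" unfolding D_proj_coordinates[OF i] using y by (auto simp: yc)
  have kk: "idx k k k" "idx k 0 k" using k by (simp_all add: idx_def)
  show "dU k k k \<otimes>\<^sub>DD y = y"
  proof (rule D_eqI[OF DD.m_closed[OF dU_closed y] y])
   fix a l m assume a: "idx a l m"
   show "dco (dU k k k \<otimes>\<^sub>DD y) a l m = dco y a l m"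
    unfolding dco_dU_mult[OF y kk(1) a] by (auto simp: yc)
  qed
  show "dU k 0 k \<otimes>\<^sub>DD y = x"
  proof (rule D_eqI[OF DD.m_closed[OF dU_closed y] x])
   fix a l m assume a: "idx a l m"
   have *: "dco (dU k 0 k \<otimes>\<^sub>DD y) a l m = (if l = 0 then dco y a k m else 0)"
    unfolding dco_dU_mult[OF y kk(2) a] by simp
   show "dco (dU k 0 k \<otimes>\<^sub>DD y) a l m = dco x a l m"
   proof (cases "l = 0 \<and> a = i")
    case False
    then show ?thesis unfolding * yc using xa[OF a] xl[OF a] by auto
   next
    case True
    have "k \<le> m ==> idx i k m" "m < k ==> dco x i 0 m = 0"
     using a True low by (simp_all add: idx_def)
    then show ?thesis unfolding * yc using True by (cases "k \<le> m") (simp_all add: idx_def)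
   qed
  qed
 qed
qed

lemma D_proj_finite_dimensional:
 assumes i: "i < n"
 shows "finite_dimensional DD (D_proj n i)"
proof -
 interpret P: dmod n "D_proj n i" by (rule dmod[OF D_proj_module[OF i]])
 let ?S = "(\<lambda>(k, m). dU i k m) ` ({..<n} \<times> {i..<n})"
 have SP: "dU i k m \<in> carrier (D_proj n i)" if "i \<le> m" "k \<le> m" for k m
  unfolding D_proj_mem_iff[OF i] using dU_mult[of i i i i m k] that by (simp add: dU_closed)
 have scP: "P.sc c x = c \<odot>\<^sub>DD x" if "x \<in> carrier DD" for c x
  unfolding scal_def D_proj_simps using that by (rule DD.cs_one_mult)
 show ?thesis
  unfolding P.finite_dimensional_iff
 proof (rule exI[where x = "{x \<in> ?S. x \<in> carrier (D_proj n i)}"], intro conjI allI impI)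
  show "finite {x \<in> ?S. x \<in> carrier (D_proj n i)}" by simp
  show "{x \<in> ?S. x \<in> carrier (D_proj n i)} \<subseteq> carrier (D_proj n i)" by blast
  fix H assume H: "P.csub H" and SH: "{x \<in> ?S. x \<in> carrier (D_proj n i)} \<subseteq> H"
  have H0: "\<zero>\<^sub>DD \<in> H" and Ha: "\<And>x y. x \<in> H ==> y \<in> H ==> x \<oplus>\<^sub>DD y \<in> H"
   and Hs: "\<And>c x. x \<in> H ==> P.sc c x \<in> H"
   using H unfolding P.csub_def D_proj_simps by simp_all
  have "x \<otimes>\<^sub>DD dU i i i \<in> H" if "x \<in> carrier DD" for x
   using that
  proof (induction rule: D_induct)
   case zero
   show ?case using H0 dU_closed by simp
  next
   case (add X Y)
   then show ?case using Ha by (simp add: DD.l_distr dU_closed)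
  next
   case (scale_dU c a k m)
   then have a: "a \<le> m" "k \<le> m" "m < n" by (simp_all add: idx_def)
   have e: "(c \<odot>\<^sub>DD dU a k m) \<otimes>\<^sub>DD dU i i i = c \<odot>\<^sub>DD (dU a k m \<otimes>\<^sub>DD dU i i i)"
    by (rule DD.cs_lmult[OF dU_closed dU_closed])
   show ?case
   proof (cases "a = i")
    case True
    have im: "i \<le> m" using a True by simp
    have "dU i k m \<in> ?S" by (rule image_eqI[where x = "(k, m)"]) (use a im in simp_all)
    then have "dU i k m \<in> {x \<in> ?S. x \<in> carrier (D_proj n i)}" using SP[OF im a(2)] by simp
    then have "dU i k m \<in> H" by (rule subsetD[OF SH])
    then have "c \<odot>\<^sub>DD dU i k m \<in> H" using Hs scP[OF dU_closed] by metis
    moreover have "dU a k m \<otimes>\<^sub>DD dU i i i = dU i k m" using dU_mult[of i i i i m k] a True by simp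
    ultimately show ?thesis unfolding e by simp
   next
    case False
    then have "dU a k m \<otimes>\<^sub>DD dU i i i = \<zero>\<^sub>DD" using dU_mult[of i i i a m k] a by simp
    moreover have "c \<odot>\<^sub>DD \<zero>\<^sub>DD = \<zero>\<^sub>DD" using scP[OF DD.zero_closed, of c] P.sc_zero_right[of c]
     by (simp add: D_proj_simps)
    ultimately show ?thesis unfolding e using H0 by simp
   qed
  qed
  then show "carrier (D_proj n i) \<subseteq> H" unfolding subset_eq Ball_def D_proj_mem_iff[OF i] by metis
 qed
qed

end

section \<open>The projective \<open>\<Pi>\<close>-modules and the modules \<open>T\<^sub>j\<close>\<close>

context auslander
begin

text \<open>
 The sequence \<open>0 \<rightarrow> X \<rightarrow> P \<rightarrow> Q \<rightarrow> 0\<close> is exact with \<open>X\<close> mapped onto \<open>\<eta> P\<close>, so that \<open>Q\<close> is \<open>\<pi> P\<close>,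
 and \<open>P\<close> is coinduced. The case that matters is \<open>X = T\<^sub>j\<close>, \<open>P = D\<^sub>n\<^sub>-\<^sub>j\<close>, \<open>Q = \<Pi>\<^sub>n\<^sub>-\<^sub>j\<close>.
\<close>

definition resolves :: "(D_elem, 'x) module => (D_elem, 'p) module => (Pi_elem, 'q) module
  => ('x => 'p) => ('p => 'q) => bool"
 where "resolves X P Q f \<kappa> \<longleftrightarrow>
  left_module DD X \<and> left_module DD P \<and> left_module PP Q \<and>
  finite_dimensional DD X \<and> finite_dimensional DD P \<and> coinduced P \<and>
  f \<in> lmod_hom DD X P \<and> inj_on f (carrier X) \<and> f ` carrier X = etaS P \<and>
  semi P Q \<kappa> \<and> \<kappa> ` carrier P = carrier Q \<and> (\<forall>x\<in>carrier P. \<kappa> x = \<zero>\<^sub>Q --> x \<in> etaS P)"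

lemma resolvesD:
 assumes "resolves X P Q f \<kappa>"
 shows "left_module DD X" "left_module DD P" "left_module PP Q"
  "finite_dimensional DD X" "finite_dimensional DD P" "coinduced P"
  "f \<in> lmod_hom DD X P" "inj_on f (carrier X)" "f ` carrier X = etaS P"
  "semi P Q \<kappa>" "\<kappa> ` carrier P = carrier Q" "x \<in> carrier P ==> \<kappa> x = \<zero>\<^sub>Q ==> x \<in> etaS P"
 using assms unfolding resolves_def by simp_all

lemma resolves_direct_sum:
 assumes I: "finite I" and r: "\<And>i. i \<in> I ==> resolves (X i) (P i) (Q i) (f i) (\<kappa> i)"
 shows "resolves (direct_sum I X) (direct_sum I P) (direct_sum I Q)
  (\<lambda>x\<in>carrier (direct_sum I X). \<lambda>i\<in>I. f i (x i)) (\<lambda>x. \<lambda>i\<in>I. \<kappa> i (x i))"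
 unfolding resolves_def
proof (intro conjI ballI impI)
 note D = resolvesD[OF r]
 let ?X = "direct_sum I X" and ?P = "direct_sum I P" and ?Q = "direct_sum I Q"
 let ?f = "\<lambda>x\<in>carrier ?X. \<lambda>i\<in>I. f i (x i)" and ?k = "\<lambda>x. \<lambda>i\<in>I. \<kappa> i (x i)"
 show mX: "left_module DD ?X" by (rule left_module_direct_sum[OF DD.ring_axioms D(1)])
 show mP: "left_module DD ?P" by (rule left_module_direct_sum[OF DD.ring_axioms D(2)])
 show mQ: "left_module PP ?Q" by (rule left_module_direct_sum[OF PiA.ring_axioms D(3)])
 show "finite_dimensional DD ?X" by (rule finite_dimensional_direct_sum[OF DD.calg_axioms I D(1,4)])
 show "finite_dimensional DD ?P" by (rule finite_dimensional_direct_sum[OF DD.calg_axioms I D(2,5)])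
 show "coinduced ?P" by (rule coinduced_direct_sum[OF D(6)])
 show f: "?f \<in> lmod_hom DD ?X ?P" by (rule direct_sum_map_hom[OF mX D(7)])
 show "inj_on ?f (carrier ?X)" by (rule direct_sum_map_bij[OF D(8)])
 show "?f ` carrier ?X = etaS ?P"
 proof
  show "?f ` carrier ?X \<subseteq> etaS ?P"
  proof (rule image_subsetI, rule iffD2[OF etaS_direct_sum[OF D(2)]], assumption, intro conjI ballI)
   fix x assume x: "x \<in> carrier ?X"
   show "?f x \<in> carrier ?P" by (rule lmod_homD(1)[OF f x])
   fix i assume i: "i \<in> I"
   have "f i (x i) \<in> etaS (P i)" unfolding D(9)[OF i, symmetric] by (rule imageI[OF direct_sum_memD[OF x i]])
   then show "?f x i \<in> etaS (P i)" using x i by simp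
  qed
  show "etaS ?P \<subseteq> ?f ` carrier ?X"
  proof
   fix y assume y: "y \<in> etaS ?P"
   have yP: "y \<in> carrier ?P" using y by (simp add: etaS_def)
   have yi: "y i \<in> f i ` carrier (X i)" if i: "i \<in> I" for i
    unfolding D(9)[OF i] using iffD1[OF etaS_direct_sum[OF D(2)] y] i by blast
   define x where "x = (\<lambda>i\<in>I. inv_into (carrier (X i)) (f i) (y i))"
   have x: "x \<in> carrier ?X" unfolding x_def by (rule direct_sum_memI[OF inv_into_into[OF yi]])
   show "y \<in> ?f ` carrier ?X"
   proof (rule image_eqI[OF _ x], rule direct_sum_ext[OF yP lmod_homD(1)[OF f x]])
    fix i assume i: "i \<in> I"
    have "f i (x i) = y i" unfolding x_def using f_inv_into_f[OF yi[OF i]] i by simp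
    then show "y i = ?f x i" using x i by simp
   qed
  qed
 qed
 show k: "semi ?P ?Q ?k"
  unfolding semi_def
 proof (intro conjI ballI)
  fix x assume x: "x \<in> carrier ?P"
  show "?k x \<in> carrier ?Q" by (rule direct_sum_memI[OF semiD(1)[OF D(10) direct_sum_memD[OF x]]])
  fix y assume y: "y \<in> carrier ?P"
  show "?k (x \<oplus>\<^sub>?P y) = ?k x \<oplus>\<^sub>?Q ?k y"
   unfolding direct_sum_simps
  proof (rule restrict_ext)
   fix i assume i: "i \<in> I"
   show "\<kappa> i ((\<lambda>i\<in>I. x i \<oplus>\<^bsub>P i\<^esub> y i) i) = ?k x i \<oplus>\<^bsub>Q i\<^esub> ?k y i"
    using semiD(2)[OF D(10)[OF i] direct_sum_memD[OF x i] direct_sum_memD[OF y i]] i by simp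
  qed
 next
  fix d x assume d: "d \<in> carrier DD" and x: "x \<in> carrier ?P"
  show "?k (d \<odot>\<^sub>?P x) = sig d \<odot>\<^sub>?Q ?k x"
   unfolding direct_sum_simps
  proof (rule restrict_ext)
   fix i assume i: "i \<in> I"
   show "\<kappa> i ((\<lambda>i\<in>I. d \<odot>\<^bsub>P i\<^esub> x i) i) = sig d \<odot>\<^bsub>Q i\<^esub> ?k x i"
    using semiD(3)[OF D(10)[OF i] d direct_sum_memD[OF x i]] i by simp
  qed
 qed
 show "?k ` carrier ?P = carrier ?Q"
 proof
  show "?k ` carrier ?P \<subseteq> carrier ?Q" using semiD(1)[OF k] by (rule image_subsetI)
  show "carrier ?Q \<subseteq> ?k ` carrier ?P"
  proof
   fix y assume y: "y \<in> carrier ?Q"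
   have yi: "y i \<in> \<kappa> i ` carrier (P i)" if i: "i \<in> I" for i
    unfolding D(11)[OF i] by (rule direct_sum_memD[OF y i])
   define x where "x = (\<lambda>i\<in>I. inv_into (carrier (P i)) (\<kappa> i) (y i))"
   have x: "x \<in> carrier ?P" unfolding x_def by (rule direct_sum_memI[OF inv_into_into[OF yi]])
   show "y \<in> ?k ` carrier ?P"
   proof (rule image_eqI[OF _ x], rule direct_sum_ext[OF y semiD(1)[OF k x]])
    fix i assume i: "i \<in> I"
    have "\<kappa> i (x i) = y i" unfolding x_def using f_inv_into_f[OF yi[OF i]] i by simp
    then show "y i = ?k x i" using i by simp
   qed
  qed
 qed
 fix x assume x: "x \<in> carrier ?P" and z: "?k x = \<zero>\<^sub>?Q"
 show "x \<in> etaS ?P"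
 proof (rule iffD2[OF etaS_direct_sum[OF D(2)]], assumption, intro conjI ballI x)
  fix i assume i: "i \<in> I"
  show "x i \<in> etaS (P i)"
   by (rule D(12)[OF i direct_sum_memD[OF x i]]) (use fun_cong[OF z, of i] i in \<open>simp add: direct_sum_simps\<close>)
 qed
qed

text \<open>
 Right multiplication by \<open>a\<^sub>1 \<cdots> a\<^sub>i\<close>, where \<open>i = n - j\<close>, maps \<open>D\<^sub>0\<close> to \<open>D\<^sub>i\<close>. In terms of the basis of
 paths its kernel consists of the combinations of paths that climb at least to the vertex \<open>j\<close>,
 which is \<open>D\<^sub>j\<close>, and its image is \<open>D e\<^sub>0 D\<^sub>i\<close>.
\<close>

lemma T_mod_embeds:
 assumes j: "1 \<le> j" "j < n"
 shows "\<exists>f\<in>lmod_hom DD (T_mod n j) (D_proj n (n - j)).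
  inj_on f (carrier (T_mod n j)) \<and> f ` carrier (T_mod n j) = etaS (D_proj n (n - j))"
proof -
 define i where "i = n - j"
 have i: "1 \<le> i" "i < n" "i + j = n" using j by (simp_all add: i_def)
 let ?P0 = "D_proj n 0" and ?Pi = "D_proj n i" and ?H = "D_proj_in_D0 n j"
 interpret P0: dmod n ?P0 by (rule dmod[OF D_proj_module[OF zero_less_n]])
 have r: "(\<lambda>x\<in>carrier ?P0. x \<otimes>\<^sub>DD dU i 0 i) \<in> lmod_hom DD ?P0 ?Pi"
  by (rule right_mult_hom[OF zero_less_n i(2)]) simp_all
 have H: "submodule ?H DD ?P0" by (rule D_proj_in_D0_submodule)
 have kerI: "(\<lambda>x\<in>carrier ?P0. x \<otimes>\<^sub>DD dU i 0 i) x = \<zero>\<^sub>?Pi" if x: "x \<in> ?H" for x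
 proof -
  obtain y where y: "y \<in> carrier (D_proj n j)" "x = y \<otimes>\<^sub>DD dU 0 j j"
   using x unfolding D_proj_in_D0_eq[OF j(2)] by (elim imageE) simp
  have yD: "y \<in> carrier DD" using y(1) by (simp add: D_proj_mem_iff[OF j(2)])
  have "x \<otimes>\<^sub>DD dU i 0 i = y \<otimes>\<^sub>DD (dU 0 j j \<otimes>\<^sub>DD dU i 0 i)"
   unfolding y(2) by (rule DD.m_assoc[OF yD dU_closed dU_closed])
  also have "dU 0 j j \<otimes>\<^sub>DD dU i 0 i = \<zero>\<^sub>DD"
   using dU_mult[of i i 0 0 j j] i(3) by (simp add: dU_zero)
  finally show ?thesis using yD P0.submoduleD(3)[OF H x] by (simp add: D_proj_simps)
 qed
 have ii: "idx i 0 i" "idx 0 j j" using i j by (simp_all add: idx_def)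
 have kerD: "x \<in> ?H" if x0: "x \<in> carrier ?P0" and z: "x \<otimes>\<^sub>DD dU i 0 i = \<zero>\<^sub>DD" for x
 proof -
  have x: "x \<in> carrier DD" using x0 by (simp add: D_proj_mem_iff[OF zero_less_n])
  have xa: "dco x a k m = 0" if "idx a k m" "a \<noteq> 0" for a k m
   using x0 that unfolding D_proj_coordinates[OF zero_less_n] by blast
  have low: "dco x 0 k m = 0" if m: "m < j" "k \<le> m" for k m
  proof -
   have a: "idx i k (m + i)" using m i unfolding idx_def by simp
   show ?thesis using dco_mult_dU[OF x ii(1) a] unfolding z dco_zero by simp
  qed
  define y where "y = dfun (\<lambda>a k m. if a = j then dco x 0 k m else 0)"
  have y: "y \<in> carrier DD" unfolding y_def by (rule dfun_closed)
  have yc: "dco y a k m = (if idx a k m \<and> a = j then dco x 0 k m else 0)" for a k m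
   unfolding y_def dco_dfun by auto
  have yP: "y \<in> carrier (D_proj n j)" unfolding D_proj_coordinates[OF j(2)] using y by (simp add: yc)
  have "x = y \<otimes>\<^sub>DD dU 0 j j"
  proof (rule D_eqI[OF x DD.m_closed[OF y dU_closed]])
   fix a k m assume a: "idx a k m"
   show "dco x a k m = dco (y \<otimes>\<^sub>DD dU 0 j j) a k m"
   proof (cases "a = 0")
    case True
    have "k \<le> m" "m < n" using a by (simp_all add: idx_def)
    then show ?thesis unfolding dco_mult_dU[OF y ii(2) a] yc using True low
     by (cases "j \<le> m") (simp_all add: idx_def)
   next
    case False
    then show ?thesis unfolding dco_mult_dU[OF y ii(2) a] using xa[OF a] by simp
   qed
  qed
  then show ?thesis unfolding D_proj_in_D0_eq[OF j(2)]
   by (intro image_eqI[where x = y]) (simp_all add: yP)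
 qed
 obtain h where h: "h \<in> lmod_hom DD (T_mod n j) ?Pi"
  and hx: "\<forall>x\<in>carrier ?P0. h (?H +>\<^sub>?P0 x) = x \<otimes>\<^sub>DD dU i 0 i"
 proof (rule quotient_hom[OF P0.left_module_axioms D_proj_module[OF i(2)] H r kerI])
  fix h assume 1: "h \<in> lmod_hom DD (quotient_module ?P0 ?H) ?Pi"
   and 2: "\<And>x. x \<in> carrier ?P0 ==> h (?H +>\<^sub>?P0 x) = (\<lambda>x\<in>carrier ?P0. x \<otimes>\<^sub>DD dU i 0 i) x"
  show thesis
  proof (rule that, unfold T_mod_def, rule 1, rule ballI)
   fix x assume x: "x \<in> carrier ?P0"
   show "h (?H +>\<^sub>?P0 x) = x \<otimes>\<^sub>DD dU i 0 i" using 2[OF x] x by simp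
  qed
 qed
 note Q = P0.quotient_module_simps[OF H, folded T_mod_def]
 have "inj_on h (carrier (T_mod n j))"
  unfolding lmod_hom_inj_iff[OF T_mod_module D_proj_module[OF i(2)] h]
 proof (intro ballI impI)
  fix X assume "X \<in> carrier (T_mod n j)" and z: "h X = \<zero>\<^sub>?Pi"
  then obtain x where x: "x \<in> carrier ?P0" "X = ?H +>\<^sub>?P0 x" unfolding Q(1) by (elim imageE) simp
  have "x \<otimes>\<^sub>DD dU i 0 i = \<zero>\<^sub>DD" using z hx x by (simp add: D_proj_simps)
  then have "x \<in> ?H" by (rule kerD[OF x(1)])
  then show "X = \<zero>\<^bsub>T_mod n j\<^esub>" unfolding x(2) Q(2) by (rule iffD2[OF P0.coset_zero_iff[OF H x(1)]])
 qed
 moreover have "h ` carrier (T_mod n j) = etaS ?Pi"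
 proof
  show "h ` carrier (T_mod n j) \<subseteq> etaS ?Pi"
   by (rule image_subsetI, rule etaS_hom[OF h T_mod_module]) (simp add: etaS_T_mod)
  show "etaS ?Pi \<subseteq> h ` carrier (T_mod n j)"
  proof
   fix x assume x: "x \<in> etaS ?Pi"
   then have xP: "x \<in> carrier ?Pi" by (simp add: etaS_def)
   then have xD: "x \<in> carrier DD" by (simp add: D_proj_mem_iff[OF i(2)])
   have xa: "dco x a k m = 0" if "idx a k m" "a \<noteq> i" for a k m
    using xP that unfolding D_proj_coordinates[OF i(2)] by blast
   have low: "dco x i k m = 0" if a: "idx i k m" "m < i + k" for k m
   proof -
    have k: "k < n" and kk: "idx k k k" "idx 0 k k" using a by (simp_all add: idx_def)
    obtain y where y: "y \<in> carrier ?Pi" "dU k k k \<otimes>\<^sub>DD x = dU 0 k k \<otimes>\<^sub>DD y"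
     using x k unfolding etaS_def D_proj_simps by blast
    have yD: "y \<in> carrier DD" using y(1) by (simp add: D_proj_mem_iff[OF i(2)])
    have "dco x i k m = dco (dU k k k \<otimes>\<^sub>DD x) i k m" unfolding dco_dU_mult[OF xD kk(1) a(1)] by simp
    also have "\<dots> = dco y i 0 (m - k)" unfolding y(2) dco_dU_mult[OF yD kk(2) a(1)] using a(1) by (simp add: idx_def)
    also have "\<dots> = 0" using a(1,2) unfolding dco_def idx_def by auto
    finally show ?thesis .
   qed
   define d where "d = dfun (\<lambda>a k m. if a = 0 then dco x i k (m + i) else 0)"
   have d: "d \<in> carrier DD" unfolding d_def by (rule dfun_closed)
   have dc: "dco d a k m = (if idx a k m \<and> a = 0 then dco x i k (m + i) else 0)" for a k m
    unfolding d_def dco_dfun by auto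
   have dP: "d \<in> carrier ?P0" unfolding D_proj_coordinates[OF zero_less_n] using d by (simp add: dc)
   have "x = d \<otimes>\<^sub>DD dU i 0 i"
   proof (rule D_eqI[OF xD DD.m_closed[OF d dU_closed]])
    fix a k m assume a: "idx a k m"
    show "dco x a k m = dco (d \<otimes>\<^sub>DD dU i 0 i) a k m"
    proof (cases "a = i")
     case False
     then show ?thesis unfolding dco_mult_dU[OF d ii(1) a] using xa[OF a] by simp
    next
     case True
     have im: "i \<le> m" "m < n" using a True by (simp_all add: idx_def)
     have e: "dco (d \<otimes>\<^sub>DD dU i 0 i) a k m = dco d 0 k (m - i)"
      unfolding dco_mult_dU[OF d ii(1) a] using True im by simp
     show ?thesis
     proof (cases "i + k \<le> m")
      case ik: True
      then have "idx 0 k (m - i)" using im unfolding idx_def by arith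
      then show ?thesis unfolding e dc using im True by simp
     next
      case ik: False
      then have "\<not> idx 0 k (m - i)" "m < i + k" using im unfolding idx_def by auto
      then show ?thesis unfolding e dc using low a True by simp
     qed
    qed
   qed
   then have "x = h (?H +>\<^sub>?P0 d)" using hx dP by simp
   then show "x \<in> h ` carrier (T_mod n j)" unfolding Q(1) by (rule image_eqI[OF _ imageI[OF dP]])
  qed
 qed
 ultimately show ?thesis using h unfolding i_def[symmetric] by blast
qed

lemma T_mod_finite_dimensional: "finite_dimensional DD (T_mod n j)"
 using finite_dimensional_hom_image[OF DD.calg_axioms D_proj_module[OF zero_less_n] T_mod_module[unfolded T_mod_def]
   quotient_proj_hom[OF D_proj_module[OF zero_less_n] D_proj_in_D0_submodule] D_proj_finite_dimensional[OF zero_less_n]]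
 unfolding T_mod_def .

lemma Pi_proj_semi:
 assumes i: "i < n"
 shows "left_module PP (Pi_proj n i)" "semi (D_proj n i) (Pi_proj n i) sig"
  "sig ` carrier (D_proj n i) = carrier (Pi_proj n i)"
  "x \<in> carrier (D_proj n i) ==> sig x = \<zero>\<^bsub>Pi_proj n i\<^esub> ==> x \<in> etaS (D_proj n i)"
proof -
 let ?P = "D_proj n i" and ?Q = "Pi_proj n i"
 have e: "Pi_ideal n +>\<^sub>DD D_e n i = sig (dU i i i)" by (simp add: sig_def D_e_dU[OF i])
 have simps: "add ?Q = add PP" "zero ?Q = zero PP" "smult ?Q = mult PP"
  by (simp_all add: Pi_proj_def left_ideal_module_def)
 have PD: "x \<in> carrier DD" "x \<otimes>\<^sub>DD dU i i i = x" if "x \<in> carrier ?P" for x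
  using that by (simp_all add: D_proj_mem_iff[OF i])
 have cQ: "carrier ?Q = {A \<otimes>\<^sub>PP sig (dU i i i) |A. A \<in> carrier PP}"
  by (simp add: Pi_proj_def left_ideal_module_def e)
 show im: "sig ` carrier ?P = carrier ?Q"
 proof
  show "sig ` carrier ?P \<subseteq> carrier ?Q"
  proof (rule image_subsetI)
   fix x assume x: "x \<in> carrier ?P"
   have "sig x = sig x \<otimes>\<^sub>PP sig (dU i i i)"
    using ring_hom_mult[OF sig_hom PD(1)[OF x] dU_closed, of i i i] unfolding PD(2)[OF x] .
   then show "sig x \<in> carrier ?Q" unfolding cQ using sig_closed[OF PD(1)[OF x]] by blast
  qed
  show "carrier ?Q \<subseteq> sig ` carrier ?P"
  proof
   fix y assume "y \<in> carrier ?Q"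
   then obtain A where A: "A \<in> carrier PP" "y = A \<otimes>\<^sub>PP sig (dU i i i)" unfolding cQ by blast
   obtain d where d: "d \<in> carrier DD" "A = sig d" by (rule sig_cases[OF A(1)])
   have de: "d \<otimes>\<^sub>DD dU i i i \<in> carrier ?P"
    using d(1) by (simp add: D_proj_mem_iff[OF i] dU_closed DD.m_assoc dU_idem)
   have "y = sig (d \<otimes>\<^sub>DD dU i i i)" unfolding A(2) d(2) by (rule ring_hom_mult[OF sig_hom d(1) dU_closed, symmetric])
   then show "y \<in> sig ` carrier ?P" using de by (rule image_eqI)
  qed
 qed
 have sadd: "sig (x \<oplus>\<^sub>?P y) = sig x \<oplus>\<^sub>?Q sig y" if "x \<in> carrier ?P" "y \<in> carrier ?P" for x y
  unfolding D_proj_simps simps by (rule ring_hom_add[OF sig_hom PD(1)[OF that(1)] PD(1)[OF that(2)]])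
 have smul: "sig (d \<odot>\<^sub>?P x) = sig d \<odot>\<^sub>?Q sig x" if "d \<in> carrier DD" "x \<in> carrier ?P" for d x
  unfolding D_proj_simps simps by (rule ring_hom_mult[OF sig_hom that(1) PD(1)[OF that(2)]])
 have s0: "sig \<zero>\<^sub>?P = \<zero>\<^sub>?Q"
  unfolding D_proj_simps simps by (rule ring_hom_zero[OF sig_hom DD.ring_axioms PiA.ring_axioms])
 show "left_module PP ?Q"
  by (rule left_module_image[OF D_proj_module[OF i] PiA.ring_axioms sig_hom sig_surj im sadd smul s0])
 show "semi ?P ?Q sig"
  unfolding semi_def
 proof (intro conjI ballI)
  show "sig x \<in> carrier ?Q" if "x \<in> carrier ?P" for x unfolding im[symmetric] by (rule imageI[OF that])
 qed (fact sadd, fact smul)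
 assume x: "x \<in> carrier ?P" and z: "sig x = \<zero>\<^sub>?Q"
 have ei: "dU i i i \<in> carrier ?P" by (simp add: D_proj_mem_iff[OF i] dU_closed dU_idem)
 have "x \<in> Pi_ideal n" using z sig_eq_zero_iff[OF PD(1)[OF x]] unfolding simps by simp
 then have "x \<odot>\<^sub>?P dU i i i \<in> etaS ?P" by (rule Pi_ideal_act[OF D_proj_module[OF i] _ ei])
 then show "x \<in> etaS ?P" using PD(2)[OF x] by (simp add: D_proj_simps)
qed

lemma T_mod_resolves:
 assumes j: "1 \<le> j" "j < n"
 shows "\<exists>f. resolves (T_mod n j) (D_proj n (n - j)) (Pi_proj n (n - j)) f sig"
proof -
 have i: "n - j < n" using j by simp
 obtain f where f: "f \<in> lmod_hom DD (T_mod n j) (D_proj n (n - j))"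
  "inj_on f (carrier (T_mod n j))" "f ` carrier (T_mod n j) = etaS (D_proj n (n - j))"
  using T_mod_embeds[OF j] by blast
 have r: "resolves (T_mod n j) (D_proj n (n - j)) (Pi_proj n (n - j)) f sig"
  unfolding resolves_def
  by (intro conjI ballI impI f T_mod_module D_proj_module[OF i] Pi_proj_semi(1,2,3)[OF i] T_mod_finite_dimensional
    D_proj_finite_dimensional[OF i] D_proj_coinduced[OF i]) (rule Pi_proj_semi(4)[OF i])
 show ?thesis by (rule exI[where x = f]) (rule r)
qed

lemma T_sum_power_resolves:
 assumes J: "J \<subseteq> {1..n - 1}"
 obtains f \<kappa> where "resolves (direct_sum {..<k::nat} (\<lambda>_. T_sum n J))
  (direct_sum {..<k} (\<lambda>_. direct_sum J (\<lambda>j. D_proj n (n - j)))) (direct_sum {..<k} (\<lambda>_. Q_mod n J)) f \<kappa>"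
proof -
 have fin: "finite J" using J finite_subset by blast
 define f where "f j = (SOME f. resolves (T_mod n j) (D_proj n (n - j)) (Pi_proj n (n - j)) f sig)" for j
 have f: "resolves (T_mod n j) (D_proj n (n - j)) (Pi_proj n (n - j)) (f j) sig" if j: "j \<in> J" for j
 proof -
  have "j \<in> {1..n - 1}" by (rule subsetD[OF J j])
  then have "1 \<le> j" "j < n" by auto
  then show ?thesis unfolding f_def
   by (intro someI_ex[where P = "\<lambda>f. resolves (T_mod n j) (D_proj n (n - j)) (Pi_proj n (n - j)) f sig"] T_mod_resolves)
 qed
 note 1 = resolves_direct_sum[where X = "T_mod n" and P = "\<lambda>j. D_proj n (n - j)" and Q = "\<lambda>j. Pi_proj n (n - j)"
   and f = f and \<kappa> = "\<lambda>_. sig", OF fin f, folded T_sum_def Q_mod_def]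
 note 2 = resolves_direct_sum[where I = "{..<k}" and X = "\<lambda>_. T_sum n J" and Q = "\<lambda>_. Q_mod n J"
   and P = "\<lambda>_. direct_sum J (\<lambda>j. D_proj n (n - j))", OF finite_lessThan 1]
 show thesis by (rule that, rule 2)
qed

end

section \<open>The functor \<open>\<pi>\<close> on objects\<close>

lemma in_add_finite_dimensional:
 assumes A: "calg A" and X: "left_module A X" "finite_dimensional A X" and M: "left_module A M"
  and a: "in_add A X M"
 shows "finite_dimensional A M"
proof -
 from a obtain k :: nat and i p where i: "i \<in> lmod_hom A M (direct_sum {..<k} (\<lambda>_. X))"
  and p: "p \<in> lmod_hom A (direct_sum {..<k} (\<lambda>_. X)) M" and pi: "\<forall>m\<in>carrier M. p (i m) = m"
  unfolding in_add_def by blast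
 let ?S = "direct_sum {..<k} (\<lambda>_. X)"
 have S: "left_module A ?S" by (rule left_module_direct_sum[OF left_module_ring[OF M] X(1)])
 have "p ` carrier ?S = carrier M"
 proof
  show "p ` carrier ?S \<subseteq> carrier M" by (rule image_subsetI) (rule lmod_homD(1)[OF p])
  show "carrier M \<subseteq> p ` carrier ?S"
  proof
   fix m assume m: "m \<in> carrier M"
   then have "m = p (i m)" using pi by simp
   then show "m \<in> p ` carrier ?S" using lmod_homD(1)[OF i m] by (rule image_eqI)
  qed
 qed
 then show ?thesis
  by (rule finite_dimensional_hom_image[OF A S M p _ finite_dimensional_direct_sum[OF A finite_lessThan X]])
qed

context auslander
begin

lemma etaS_restrict:
 assumes P: "left_module DD P" and K: "submodule K DD P" and e: "etaS P \<subseteq> K"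
 shows "etaS (res P K) = etaS P"
proof -
 interpret P: dmod n P by (rule dmod[OF P])
 note KD = P.submoduleD[OF K]
 show ?thesis
 proof
  show "etaS (res P K) \<subseteq> etaS P"
  proof
   fix x assume "x \<in> etaS (res P K)"
   then have x: "x \<in> K" "\<forall>k<n. \<exists>y\<in>K. P.u k k k x = P.u 0 k k y" unfolding etaS_def by simp_all
   show "x \<in> etaS P" unfolding etaS_def
   proof (intro CollectI conjI allI impI)
    show "x \<in> carrier P" by (rule KD(3)[OF x(1)])
    fix k assume "k < n"
    then obtain y where y: "y \<in> K" "P.u k k k x = P.u 0 k k y" using x(2) by blast
    show "\<exists>y\<in>carrier P. P.u k k k x = P.u 0 k k y" by (rule bexI[where x = y]) (use y KD(3) in simp_all)
   qed
  qed
  show "etaS P \<subseteq> etaS (res P K)"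
  proof
   fix x assume x: "x \<in> etaS P"
   have "\<exists>y\<in>K. P.u k k k x = P.u 0 k k y" if k: "k < n" for k
   proof -
    obtain y where y: "y \<in> carrier P" "P.u k k k x = P.u 0 k k y" by (rule P.etaSE[OF x k])
    have "P.u 0 0 0 y \<in> K" by (rule subsetD[OF e P.u0_etaS[OF y(1) le_refl]])
    moreover have "P.u 0 k k (P.u 0 0 0 y) = P.u 0 k k y" by (rule P.u_src) (use y in simp_all)
    ultimately show ?thesis using y(2) by (intro bexI[where x = "P.u 0 0 0 y"]) simp_all
   qed
   then show "x \<in> etaS (res P K)" using subsetD[OF e x] unfolding etaS_def by simp
  qed
 qed
qed

text \<open>The objects of \<open>F\<^sub>\<Delta>(J)\<close>, with no restriction on the type of the carrier.\<close>

definition F_module :: "nat set => (D_elem, 'c) module => bool"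
 where "F_module J M \<longleftrightarrow> left_module DD M \<and> finite_dimensional DD M \<and> satur M {\<zero>\<^sub>M} \<and>
  in_add DD (T_sum n J) (res M (etaS M))"

lemma F_moduleD:
 assumes "F_module J M"
 shows "left_module DD M" "finite_dimensional DD M" "satur M {\<zero>\<^sub>M}"
  "in_add DD (T_sum n J) (res M (etaS M))"
 using assms unfolding F_module_def by simp_all

lemma F_Delta_Ob: "M \<in> Ob (F_Delta_cat n J) \<longleftrightarrow> F_module J M"
proof
 assume "M \<in> Ob (F_Delta_cat n J)"
 then have M: "left_module DD M" and fd: "finite_dimensional DD M" and f: "has_standard_filtration n M"
  and a: "in_add DD (T_sum n J) (res M (eta n M))"
  unfolding F_Delta_cat_def full_subcategory_def mod_category_def by simp_all
 interpret M: dmod n M by (rule dmod[OF M])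
 show "F_module J M" unfolding F_module_def
  using M fd M.filtration_satur[OF f] a[unfolded eta_eq[OF M]] by simp
next
 assume f: "F_module J M"
 note D = F_moduleD[OF f]
 interpret M: dmod n M by (rule dmod[OF D(1)])
 show "M \<in> Ob (F_Delta_cat n J)"
  using D(1,2) M.standard_filtration_exists[OF D(3,2)] D(4)
  by (simp add: F_Delta_cat_def full_subcategory_def mod_category_def eta_eq[OF D(1)])
qed

lemma etaS_restrict_hom:
 assumes M: "left_module DD M" and f: "f \<in> lmod_hom DD M N"
 shows "(\<lambda>x\<in>etaS M. f x) \<in> lmod_hom DD (res M (etaS M)) (res N (etaS N))"
proof -
 interpret M: dmod n M by (rule dmod[OF M])
 note fD = lmod_homD[OF f] and E = M.submoduleD[OF M.etaS_submodule]
 have "(\<lambda>x\<in>carrier (res M (etaS M)). f x) \<in> lmod_hom DD (res M (etaS M)) (res N (etaS N))"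
 proof (rule lmod_homI[OF _ _ _ M.left_module_restrict[OF M.etaS_submodule]])
  show "f x \<in> carrier (res N (etaS N))" if "x \<in> carrier (res M (etaS M))" for x
   using etaS_hom[OF f M] that by simp
  show "f (x \<oplus>\<^bsub>res M (etaS M)\<^esub> y) = f x \<oplus>\<^bsub>res N (etaS N)\<^esub> f y"
   if "x \<in> carrier (res M (etaS M))" "y \<in> carrier (res M (etaS M))" for x y
   using fD(2)[OF E(3) E(3)] that by simp
  show "f (a \<odot>\<^bsub>res M (etaS M)\<^esub> x) = a \<odot>\<^bsub>res N (etaS N)\<^esub> f x"
   if "a \<in> carrier DD" "x \<in> carrier (res M (etaS M))" for a x
   using fD(3)[OF that(1) E(3)] that(2) by simp
 qed
 then show ?thesis by simp
qed

lemma F_module_iso: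
 assumes L: "F_module J L" and C: "left_module DD C" and c: "c \<in> lmod_hom DD L C"
  and b: "bij_betw c (carrier L) (carrier C)"
 shows "F_module J C"
proof -
 note D = F_moduleD[OF L]
 interpret C: dmod n C by (rule dmod[OF C])
 interpret L: dmod n L by (rule dmod[OF D(1)])
 define c' where "c' = (\<lambda>y\<in>carrier C. inv_into (carrier L) c y)"
 have c': "c' \<in> lmod_hom DD C L" unfolding c'_def by (rule lmod_hom_inv[OF D(1) C c b])
 have cc': "c (c' y) = y" if "y \<in> carrier C" for y
  using bij_betw_inv_into_right[OF b that] that by (simp add: c'_def)
 have "finite_dimensional DD C"
  by (rule finite_dimensional_hom_image[OF DD.calg_axioms D(1) C c bij_betw_imp_surj_on[OF b] D(2)])
 moreover have "satur C {\<zero>\<^sub>C}"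
  unfolding satur_def
 proof (intro allI impI)
  fix k x assume k: "1 \<le> k" "k < n" and x: "x \<in> carrier C" "C.u k k k x = x" "C.u k (k - 1) k x \<in> {\<zero>\<^sub>C}"
  have "c' x \<in> {\<zero>\<^sub>L}"
  proof (rule saturD[OF D(3) k lmod_homD(1)[OF c' x(1)]])
   show "L.u k k k (c' x) = c' x" unfolding lmod_homD(3)[OF c' dU_closed x(1), symmetric] x(2) ..
   show "L.u k (k - 1) k (c' x) \<in> {\<zero>\<^sub>L}"
    unfolding lmod_homD(3)[OF c' dU_closed x(1), symmetric] using x(3) lmod_hom_zero[OF C D(1) c'] by simp
  qed
  then have "c (c' x) = \<zero>\<^sub>C" using lmod_hom_zero[OF D(1) C c] by simp
  then show "x \<in> {\<zero>\<^sub>C}" unfolding cc'[OF x(1)] by simp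
 qed
 moreover have "in_add DD (T_sum n J) (res C (etaS C))"
 proof (rule in_add_retract[OF C.left_module_restrict[OF C.etaS_submodule] etaS_restrict_hom[OF C c']
    etaS_restrict_hom[OF D(1) c] _ D(4) T_sum_module])
  fix m assume "m \<in> carrier (res C (etaS C))"
  then have m: "m \<in> etaS C" by simp
  then show "(\<lambda>x\<in>etaS L. c x) ((\<lambda>x\<in>etaS C. c' x) m) = m"
   using etaS_hom[OF c' C m] cc'[OF C.etaS_subset[OF m]] by simp
 qed
 ultimately show ?thesis unfolding F_module_def using C by simp
qed

lemma F_module_copy:
 fixes \<iota> :: "complex => 'm"
 assumes \<iota>: "inj \<iota>" and L: "F_module J L"
 obtains M :: "(D_elem, 'm) module" and c where "F_module J M" "c \<in> lmod_hom DD L M" "bij_betw c (carrier L) (carrier M)"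
proof -
 note D = F_moduleD[OF L]
 interpret L: dmod n L by (rule dmod[OF D(1)])
 obtain e :: "_ => 'm" where e: "inj_on e (carrier L)"
  by (rule finite_dimensional_embeds[OF \<iota> L.amod_axioms D(2)])
 note c = copy_mod[OF D(1) e]
 show thesis by (rule that[OF F_module_iso[OF L c] c(2,3)])
qed

text \<open>
 The composite \<open>\<eta> M \<rightarrow> X \<cong> \<eta> P\<close> extends to \<open>M \<rightarrow> P\<close>. An element sent to \<open>\<eta> P\<close> lies in \<open>\<eta> M\<close>: it
 agrees with an element of \<open>\<eta> M\<close> after applying \<open>a\<^sub>1 \<cdots> a\<^sub>k\<close>, which is injective on \<open>M\<close>.
\<close>

lemma pi_embeds:
 assumes M: "left_module DD M" and s: "satur M {\<zero>\<^sub>M}" and R: "resolves X P Q f \<kappa>"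
  and i: "i \<in> lmod_hom DD (res M (etaS M)) X" and r: "r \<in> lmod_hom DD X (res M (etaS M))"
  and ri: "\<And>m. m \<in> etaS M ==> r (i m) = m"
 shows "\<exists>h\<in>lmod_hom PP (pi_obj n M) Q. inj_on h (carrier (pi_obj n M))"
proof -
 note D = resolvesD[OF R]
 interpret M: dmod n M by (rule dmod[OF M])
 interpret P: dmod n P by (rule dmod[OF D(2)])
 interpret X: dmod n X by (rule dmod[OF D(1)])
 let ?E = "res M (etaS M)"
 have E: "left_module DD ?E" by (rule M.left_module_restrict[OF M.etaS_submodule])
 obtain G where G: "G \<in> lmod_hom DD M P" and Ge: "\<forall>x\<in>etaS M. G x = (\<lambda>x\<in>carrier ?E. f (i x)) x"
  using coinduced_extend[OF M D(2,6) lmod_hom_compose[OF i D(7) E]] by blast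
 have Ge: "G x = f (i x)" if "x \<in> etaS M" for x using Ge that by simp
 have k: "semi M Q (\<lambda>x. \<kappa> (G x))" by (rule semi_compose[OF G D(10)])
 have ker: "m \<in> etaS M" if m: "m \<in> carrier M" and z: "\<kappa> (G m) = \<zero>\<^sub>Q" for m
 proof -
  have "G m \<in> etaS P" by (rule D(12)[OF lmod_homD(1)[OF G m] z])
  then obtain t where t: "t \<in> carrier X" "G m = f t" unfolding D(9)[symmetric] by (elim imageE) simp
  have rt: "r t \<in> etaS M" using lmod_homD(1)[OF r t(1)] by simp
  have rtM: "r t \<in> carrier M" by (rule M.etaS_subset[OF rt])
  have eq: "M.u k 0 k (r t) = M.u k 0 k m" if k: "k < n" for k
  proof -
   have "M.u 0 0 0 (M.u k 0 k m) \<in> etaS M" by (rule M.u0_etaS[OF M.u_closed[OF m] le_refl])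
   moreover have "M.u 0 0 0 (M.u k 0 k m) = M.u k 0 k m" by (rule M.u_tgt) (use m in simp_all)
   ultimately have d: "M.u k 0 k m \<in> etaS M" by simp
   have "f (X.u k 0 k t) = P.u k 0 k (G m)" unfolding t(2) by (rule lmod_homD(3)[OF D(7) dU_closed t(1)])
   also have "\<dots> = G (M.u k 0 k m)" by (rule lmod_homD(3)[OF G dU_closed m, symmetric])
   also have "\<dots> = f (i (M.u k 0 k m))" by (rule Ge[OF d])
   finally have "X.u k 0 k t = i (M.u k 0 k m)"
    by (rule inj_onD[OF D(8) _ X.u_closed[OF t(1)]]) (rule lmod_homD(1)[OF i], simp add: d)
   then have "r (X.u k 0 k t) = M.u k 0 k m" using ri[OF d] by simp
   then show ?thesis using lmod_homD(3)[OF r dU_closed t(1), of k 0 k] by simp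
  qed
  let ?d = "m \<ominus>\<^sub>M r t"
  have dM: "?d \<in> carrier M" using m rtM by simp
  have "?d = \<zero>\<^sub>M"
  proof (rule M.vertex_zero[OF dM], rule satur_down_inj[OF M s])
   fix k assume k: "k < n"
   show "k < n" by (rule k)
   show "M.u k k k ?d \<in> carrier M" by (rule M.u_closed[OF dM])
   show "M.u k k k (M.u k k k ?d) = M.u k k k ?d" by (rule M.u_tgt[OF le_refl le_refl dM])
   have "M.u k 0 k (M.u k k k ?d) = M.u k 0 k ?d" by (rule M.u_src) (use dM in simp_all)
   also have "\<dots> = \<zero>\<^sub>M" unfolding M.u_diff[OF m rtM]
    by (rule iffD2[OF M.diff_zero_iff[OF M.u_closed[OF m] M.u_closed[OF rtM]] eq[OF k, symmetric]])
   finally show "M.u k 0 k (M.u k k k ?d) = \<zero>\<^sub>M" .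
  qed
  then have "m = r t" using M.diff_zero_iff[OF m rtM] by simp
  then show ?thesis using rt by simp
 qed
 obtain h where h: "h \<in> lmod_hom PP (pi_obj n M) Q" "\<forall>x\<in>carrier M. h (qpi M x) = \<kappa> (G x)"
 proof (rule semi_factor[OF M D(3) k])
  fix h assume 1: "h \<in> lmod_hom PP (pi_obj n M) Q" and 2: "\<And>x. x \<in> carrier M ==> h (qpi M x) = \<kappa> (G x)"
  show thesis by (rule that[OF 1]) (rule ballI, erule 2)
 qed
 have "inj_on h (carrier (pi_obj n M))"
  by (rule semi_factor_inj[OF M D(3) k ker]) (use h(2) in simp_all)
 then show ?thesis using h(1) by (rule bexI)
qed

text \<open>A submodule \<open>N\<close> of \<open>Q = \<pi> P\<close> is \<open>\<pi>\<close> of its preimage in \<open>P\<close>, which contains \<open>\<eta> P \<cong> X\<close>.\<close>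

lemma pi_preimage:
 assumes R: "resolves X P Q f \<kappa>" and X: "in_add DD (T_sum n J) X"
  and N: "left_module PP N" "finite_dimensional PP N"
  and j: "j \<in> lmod_hom PP N Q" "inj_on j (carrier N)"
 defines "L \<equiv> res P {x \<in> carrier P. \<kappa> x \<in> j ` carrier N}"
 shows "F_module J L"
  and "\<exists>\<phi>. semi L N \<phi> \<and> \<phi> ` carrier L = carrier N \<and> (\<forall>x\<in>carrier L. \<phi> x = \<zero>\<^sub>N --> x \<in> etaS L)"
proof -
 note D = resolvesD[OF R] and jD = lmod_homD[OF j(1)]
 interpret P: dmod n P by (rule dmod[OF D(2)])
 let ?K = "{x \<in> carrier P. \<kappa> x \<in> j ` carrier N}"
 have K: "submodule ?K DD P"
  by (rule semi_kernel_submodule[OF D(2,3,10) hom_image_submodule[OF N(1) D(3) j(1)]])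
 have L: "left_module DD L" unfolding L_def by (rule P.left_module_restrict[OF K])
 interpret L: dmod n L by (rule dmod[OF L])
 have j0: "j \<zero>\<^sub>N = \<zero>\<^sub>Q" by (rule lmod_hom_zero[OF N(1) D(3) j(1)])
 have N0: "\<zero>\<^sub>N \<in> carrier N" by (rule abelian_groupE(2)[OF left_module_abelian_group[OF N(1)]])
 have eK: "etaS P \<subseteq> ?K"
 proof
  fix x assume x: "x \<in> etaS P"
  have "\<kappa> x = j \<zero>\<^sub>N" unfolding j0 by (rule semi_eta[OF D(2,3,10) x])
  then show "x \<in> ?K" using P.etaS_subset[OF x] N0 by blast
 qed
 have eL: "etaS L = etaS P" unfolding L_def by (rule etaS_restrict[OF D(2) K eK])
 have cL: "carrier L = ?K" and aL: "add L = add P" and sL: "smult L = smult P" and zL: "\<zero>\<^sub>L = \<zero>\<^sub>P"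
  by (simp_all add: L_def)
 have LP: "x \<in> carrier P" "\<kappa> x \<in> j ` carrier N" if "x \<in> carrier L" for x using that unfolding cL by simp_all
 define \<phi> where "\<phi> x = inv_into (carrier N) j (\<kappa> x)" for x
 have p: "\<phi> x \<in> carrier N" "j (\<phi> x) = \<kappa> x" if "x \<in> carrier L" for x
  unfolding \<phi>_def using inv_into_into[OF LP(2)[OF that]] f_inv_into_f[OF LP(2)[OF that]] .
 have semi: "semi L N \<phi>"
  unfolding semi_def
 proof (intro conjI ballI)
  fix x assume x: "x \<in> carrier L"
  show "\<phi> x \<in> carrier N" by (rule p(1)[OF x])
  fix y assume y: "y \<in> carrier L"
  have xy: "x \<oplus>\<^sub>L y \<in> carrier L" using x y by simp
  have pp: "\<phi> x \<oplus>\<^sub>N \<phi> y \<in> carrier N"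
   by (rule left_module_add_closed[OF N(1) p(1)[OF x] p(1)[OF y]])
  show "\<phi> (x \<oplus>\<^sub>L y) = \<phi> x \<oplus>\<^sub>N \<phi> y"
  proof (rule inj_onD[OF j(2) _ p(1)[OF xy] pp])
   show "j (\<phi> (x \<oplus>\<^sub>L y)) = j (\<phi> x \<oplus>\<^sub>N \<phi> y)"
    unfolding p(2)[OF xy] jD(2)[OF p(1)[OF x] p(1)[OF y]] p(2)[OF x] p(2)[OF y]
    unfolding aL by (rule semiD(2)[OF D(10) LP(1)[OF x] LP(1)[OF y]])
  qed
 next
  fix d x assume d: "d \<in> carrier DD" and x: "x \<in> carrier L"
  have dx: "d \<odot>\<^sub>L x \<in> carrier L" by (rule L.smult_closed[OF d x])
  have dp: "sig d \<odot>\<^sub>N \<phi> x \<in> carrier N" by (rule left_module.smult_closed[OF N(1) sig_closed[OF d] p(1)[OF x]])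
  show "\<phi> (d \<odot>\<^sub>L x) = sig d \<odot>\<^sub>N \<phi> x"
  proof (rule inj_onD[OF j(2) _ p(1)[OF dx] dp])
   show "j (\<phi> (d \<odot>\<^sub>L x)) = j (sig d \<odot>\<^sub>N \<phi> x)"
    unfolding p(2)[OF dx] jD(3)[OF sig_closed[OF d] p(1)[OF x]] p(2)[OF x]
    unfolding sL by (rule semiD(3)[OF D(10) d LP(1)[OF x]])
  qed
 qed
 have im: "\<phi> ` carrier L = carrier N"
 proof
  show "\<phi> ` carrier L \<subseteq> carrier N" using p(1) by (rule image_subsetI)
  show "carrier N \<subseteq> \<phi> ` carrier L"
  proof
   fix y assume y: "y \<in> carrier N"
   have "j y \<in> \<kappa> ` carrier P" unfolding D(11) by (rule jD(1)[OF y])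
   then obtain x where x: "x \<in> carrier P" "j y = \<kappa> x" by (elim imageE) simp
   have "\<kappa> x \<in> j ` carrier N" unfolding x(2)[symmetric] by (rule imageI[OF y])
   then have xL: "x \<in> carrier L" unfolding cL using x(1) by simp
   have "\<phi> x = y" by (rule inj_onD[OF j(2) _ p(1)[OF xL] y]) (simp add: p(2)[OF xL] x(2))
   then show "y \<in> \<phi> ` carrier L" using xL by (intro image_eqI[where x = x]) simp_all
  qed
 qed
 have ker: "x \<in> etaS L" if x: "x \<in> carrier L" and z: "\<phi> x = \<zero>\<^sub>N" for x
  unfolding eL by (rule D(12)[OF LP(1)[OF x]]) (use p(2)[OF x] z j0 in simp)
 show "\<exists>\<phi>. semi L N \<phi> \<and> \<phi> ` carrier L = carrier N \<and> (\<forall>x\<in>carrier L. \<phi> x = \<zero>\<^sub>N --> x \<in> etaS L)"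
  using semi im ker by (intro exI[where x = \<phi>]) simp
 have rE: "res L (etaS L) = res P (etaS P)" unfolding eL by (simp add: L_def)
 let ?E = "res P (etaS P)"
 have E: "left_module DD ?E" by (rule P.left_module_restrict[OF P.etaS_submodule])
 have inc: "(\<lambda>x\<in>etaS P. (\<lambda>x\<in>carrier P. x) x) \<in> lmod_hom DD ?E P"
  by (rule lmod_hom_restrict[OF lmod_hom_ident[OF D(2)] D(2) P.etaS_submodule])
 have sub: "(\<lambda>x\<in>etaS P. (\<lambda>x\<in>carrier P. x) x) x \<in> f ` carrier X" if "x \<in> carrier ?E" for x
  unfolding D(9) using that P.etaS_subset by simp
 have lift1: "(\<lambda>x\<in>carrier ?E. inv_into (carrier X) f ((\<lambda>x\<in>etaS P. (\<lambda>x\<in>carrier P. x) x) x)) \<in> lmod_hom DD ?E X"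
  by (rule hom_lift_inj(1)[OF E D(1) inc D(7,8)]) (erule sub)
 have lift2: "f (inv_into (carrier X) f x) = x" if "x \<in> etaS P" for x
  by (rule f_inv_into_f) (simp add: D(9) that)
 have fE: "(\<lambda>x\<in>carrier X. f x) \<in> lmod_hom DD X ?E"
 proof (rule lmod_homI[OF _ _ _ D(1)])
  show "f x \<in> carrier ?E" if "x \<in> carrier X" for x using imageI[OF that, of f] unfolding D(9) by simp
 qed (simp_all add: lmod_homD[OF D(7)])
 have ia: "in_add DD (T_sum n J) (res L (etaS L))"
  unfolding rE
 proof (rule in_add_retract[OF E lift1 fE _ X T_sum_module])
  fix m assume m: "m \<in> carrier ?E"
  then have m: "m \<in> etaS P" by simp
  have "inv_into (carrier X) f m \<in> carrier X" by (rule inv_into_into) (simp add: D(9) m)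
  then show "(\<lambda>x\<in>carrier X. f x)
   ((\<lambda>x\<in>carrier ?E. inv_into (carrier X) f ((\<lambda>x\<in>etaS P. (\<lambda>x\<in>carrier P. x) x) x)) m) = m"
   using lift2[OF m] m P.etaS_subset[OF m] by simp
 qed
 have fdE: "finite_dimensional DD (res L (etaS L))"
  unfolding rE
 proof (rule finite_dimensional_hom_image[OF DD.calg_axioms D(1) E fE _ D(4)])
  have "(\<lambda>x\<in>carrier X. f x) ` carrier X = f ` carrier X" by (rule image_cong) simp_all
  then show "(\<lambda>x\<in>carrier X. f x) ` carrier X = carrier ?E" unfolding D(9) by simp
 qed
 have fd: "finite_dimensional DD L"
 proof (rule finite_dimensional_extension[OF L.amod_axioms amod_intro[OF PiA.calg_axioms N(1)] L.etaS_submodule fdE im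
    semiD(2)[OF semi] semi_scal[OF L semi] _ N(2)])
  fix x y assume x: "x \<in> carrier L" and y: "y \<in> carrier L" and e: "\<phi> x = \<phi> y"
  interpret N: amod "PP" N by (rule amod_intro[OF PiA.calg_axioms N(1)])
  have "\<phi> (x \<ominus>\<^sub>L y) = \<zero>\<^sub>N" unfolding semi_diff[OF L N(1) semi x y]
   by (rule iffD2[OF N.diff_zero_iff[OF p(1)[OF x] p(1)[OF y]] e])
  then show "x \<ominus>\<^sub>L y \<in> etaS L" by (intro ker) (simp_all add: x y)
 qed
 have "satur L {\<zero>\<^sub>L}"
  using coinduced_satur[OF D(2,6)] LP(1) unfolding satur_def sL zL by blast
 then show "F_module J L" unfolding F_module_def using L fd ia by simp
qed

end

section \<open>Module categories\<close>

lemma mod_category_simps: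
 "M \<in> Ob (mod_category A) \<longleftrightarrow> left_module A M \<and> finite_dimensional A M"
 "carrier (HomGrp (mod_category A) M N) = lmod_hom A M N"
 "f \<otimes>\<^bsub>HomGrp (mod_category A) M N\<^esub> g = (\<lambda>x\<in>carrier M. f x \<oplus>\<^sub>N g x)"
 "\<one>\<^bsub>HomGrp (mod_category A) M N\<^esub> = (\<lambda>x\<in>carrier M. \<zero>\<^sub>N)"
 "Cmp (mod_category A) L M N g' f' = (\<lambda>x\<in>carrier L. g' (f' x))"
 "Idn (mod_category A) M = (\<lambda>x\<in>carrier M. x)"
 by (simp_all add: mod_category_def compose_def)

lemma full_subcategory_simps:
 "X \<in> Ob (full_subcategory C P) \<longleftrightarrow> X \<in> Ob C \<and> P X"
 "HomGrp (full_subcategory C P) = HomGrp C" "Cmp (full_subcategory C P) = Cmp C"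
 "Idn (full_subcategory C P) = Idn C"
 by (simp_all add: full_subcategory_def)

lemma mod_category_preadditive:
 fixes A :: "(complex, 'a) module"
 shows "preadditive_category (mod_category A :: (('a, 'b) module, 'b => 'b) precat)"
proof (rule preadditive_category.intro, unfold mod_category_simps)
 fix M N :: "('a, 'b) module"
 assume "left_module A M \<and> finite_dimensional A M" "left_module A N \<and> finite_dimensional A N"
 then have M: "left_module A M" and N: "left_module A N" by simp_all
 interpret M: lmod A M by (rule lmod.intro[OF M])
 interpret N: lmod A N by (rule lmod.intro[OF N])
 let ?G = "HomGrp (mod_category A) M N"
 show "comm_group ?G"
 proof (rule comm_groupI, unfold mod_category_simps)
  fix f g assume f: "f \<in> lmod_hom A M N" and g: "g \<in> lmod_hom A M N"
  note fD = lmod_homD[OF f] and gD = lmod_homD[OF g]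
  show "(\<lambda>x\<in>carrier M. f x \<oplus>\<^sub>N g x) \<in> lmod_hom A M N"
  proof (rule lmod_homI[OF _ _ _ M])
   show "f x \<oplus>\<^sub>N g x \<in> carrier N" if "x \<in> carrier M" for x using fD(1)[OF that] gD(1)[OF that] by simp
   show "f (x \<oplus>\<^sub>M y) \<oplus>\<^sub>N g (x \<oplus>\<^sub>M y) = (f x \<oplus>\<^sub>N g x) \<oplus>\<^sub>N (f y \<oplus>\<^sub>N g y)"
    if "x \<in> carrier M" "y \<in> carrier M" for x y
    unfolding fD(2)[OF that] gD(2)[OF that]
    by (rule N.add_add_swap[OF fD(1)[OF that(1)] fD(1)[OF that(2)] gD(1)[OF that(1)] gD(1)[OF that(2)]])
   show "f (a \<odot>\<^sub>M x) \<oplus>\<^sub>N g (a \<odot>\<^sub>M x) = a \<odot>\<^sub>N (f x \<oplus>\<^sub>N g x)"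
    if "a \<in> carrier A" "x \<in> carrier M" for a x
    unfolding fD(3)[OF that] gD(3)[OF that] by (rule N.smult_r_distr[OF that(1) fD(1)[OF that(2)] gD(1)[OF that(2)], symmetric])
  qed
  show "(\<lambda>x\<in>carrier M. f x \<oplus>\<^sub>N g x) = (\<lambda>x\<in>carrier M. g x \<oplus>\<^sub>N f x)"
   by (rule restrict_ext) (rule N.M.a_comm[OF fD(1) gD(1)])
  fix h assume h: "h \<in> lmod_hom A M N"
  show "(\<lambda>x\<in>carrier M. (\<lambda>x\<in>carrier M. f x \<oplus>\<^sub>N g x) x \<oplus>\<^sub>N h x) =
   (\<lambda>x\<in>carrier M. f x \<oplus>\<^sub>N (\<lambda>x\<in>carrier M. g x \<oplus>\<^sub>N h x) x)"
   by (rule restrict_ext) (simp add: N.M.a_assoc fD(1) gD(1) lmod_homD(1)[OF h])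
 next
  show zero: "(\<lambda>x\<in>carrier M. \<zero>\<^sub>N) \<in> lmod_hom A M N" by (rule lmod_homI[OF _ _ _ M]) simp_all
  fix f assume f: "f \<in> lmod_hom A M N"
  note fD = lmod_homD[OF f]
  have fr: "f = (\<lambda>x\<in>carrier M. f x)" using f unfolding lmod_hom_def by (auto simp: PiE_def extensional_def)
  have "(\<lambda>x\<in>carrier M. (\<lambda>x\<in>carrier M. \<zero>\<^sub>N) x \<oplus>\<^sub>N f x) = (\<lambda>x\<in>carrier M. f x)"
   by (rule restrict_ext) (simp add: fD(1))
  then show "(\<lambda>x\<in>carrier M. (\<lambda>x\<in>carrier M. \<zero>\<^sub>N) x \<oplus>\<^sub>N f x) = f" using fr by simp
  have 1: "(\<lambda>x\<in>carrier M. \<ominus>\<^sub>N f x) \<in> lmod_hom A M N"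
  proof (rule lmod_homI[OF _ _ _ M])
   show "\<ominus>\<^sub>N f x \<in> carrier N" if "x \<in> carrier M" for x using fD(1)[OF that] by simp
   show "\<ominus>\<^sub>N f (x \<oplus>\<^sub>M y) = \<ominus>\<^sub>N f x \<oplus>\<^sub>N \<ominus>\<^sub>N f y" if "x \<in> carrier M" "y \<in> carrier M" for x y
    unfolding fD(2)[OF that] by (rule N.M.minus_add[OF fD(1)[OF that(1)] fD(1)[OF that(2)]])
   show "\<ominus>\<^sub>N f (a \<odot>\<^sub>M x) = a \<odot>\<^sub>N (\<ominus>\<^sub>N f x)" if "a \<in> carrier A" "x \<in> carrier M" for a x
    unfolding fD(3)[OF that] by (rule N.smult_r_minus[OF that(1) fD(1)[OF that(2)], symmetric])
  qed
  have 2: "(\<lambda>x\<in>carrier M. (\<lambda>x\<in>carrier M. \<ominus>\<^sub>N f x) x \<oplus>\<^sub>N f x) = (\<lambda>x\<in>carrier M. \<zero>\<^sub>N)"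
   by (rule restrict_ext) (simp add: fD(1) N.M.l_neg)
  show "\<exists>g\<in>lmod_hom A M N. (\<lambda>x\<in>carrier M. g x \<oplus>\<^sub>N f x) = (\<lambda>x\<in>carrier M. \<zero>\<^sub>N)"
   by (rule bexI[where x = "\<lambda>x\<in>carrier M. \<ominus>\<^sub>N f x"]) (rule 2, rule 1)
 qed
next
 show "(\<lambda>x\<in>carrier M. x) \<in> lmod_hom A M M" if "left_module A M \<and> finite_dimensional A M" for M :: "('a, 'b) module"
  using that lmod_hom_ident by blast
 show "(\<lambda>x\<in>carrier L. g (f x)) \<in> lmod_hom A L N"
  if "left_module A L \<and> finite_dimensional A L" "f \<in> lmod_hom A L M" "g \<in> lmod_hom A M N"
  for L M N :: "('a, 'b) module" and f g
  using lmod_hom_compose[OF that(2,3)] that(1) by simp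
next
 fix L M N :: "('a, 'b) module" and f
 assume L: "left_module A L \<and> finite_dimensional A L" and M: "left_module A M \<and> finite_dimensional A M"
  and N: "left_module A N \<and> finite_dimensional A N" and f: "f \<in> lmod_hom A L M"
 note fD = lmod_homD[OF f]
 have fr: "f = (\<lambda>x\<in>carrier L. f x)" using f unfolding lmod_hom_def by (auto simp: PiE_def extensional_def)
 have "(\<lambda>x\<in>carrier L. (\<lambda>x\<in>carrier M. x) (f x)) = (\<lambda>x\<in>carrier L. f x)" by (rule restrict_ext) (simp add: fD(1))
 then show "(\<lambda>x\<in>carrier L. (\<lambda>x\<in>carrier M. x) (f x)) = f" using fr by simp
 have "(\<lambda>x\<in>carrier L. f ((\<lambda>x\<in>carrier L. x) x)) = (\<lambda>x\<in>carrier L. f x)" by (rule restrict_ext) simp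
 then show "(\<lambda>x\<in>carrier L. f ((\<lambda>x\<in>carrier L. x) x)) = f" using fr by simp
 fix g g' assume g: "g \<in> lmod_hom A M N" and g': "g' \<in> lmod_hom A M N"
 show "(\<lambda>x\<in>carrier L. (\<lambda>x\<in>carrier M. g x \<oplus>\<^sub>N g' x) (f x)) =
  (\<lambda>x\<in>carrier L. (\<lambda>x\<in>carrier L. g (f x)) x \<oplus>\<^sub>N (\<lambda>x\<in>carrier L. g' (f x)) x)"
  by (rule restrict_ext) (simp add: fD(1))
next
 fix L M N :: "('a, 'b) module" and f f' g
 assume f: "f \<in> lmod_hom A L M" and f': "f' \<in> lmod_hom A L M" and g: "g \<in> lmod_hom A M N"
 show "(\<lambda>x\<in>carrier L. g ((\<lambda>x\<in>carrier L. f x \<oplus>\<^sub>M f' x) x)) =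
  (\<lambda>x\<in>carrier L. (\<lambda>x\<in>carrier L. g (f x)) x \<oplus>\<^sub>N (\<lambda>x\<in>carrier L. g (f' x)) x)"
  by (rule restrict_ext) (simp add: lmod_homD(1)[OF f] lmod_homD(1)[OF f'] lmod_homD(2)[OF g])
next
 fix K L M N :: "('a, 'b) module" and f g h
 assume f: "f \<in> lmod_hom A K L"
 show "(\<lambda>x\<in>carrier K. (\<lambda>x\<in>carrier L. h (g x)) (f x)) = (\<lambda>x\<in>carrier K. h ((\<lambda>x\<in>carrier K. g (f x)) x))"
  by (rule restrict_ext) (simp add: lmod_homD(1)[OF f])
qed

lemma iso_mor_bij:
 assumes M: "left_module A M" and N: "left_module A N" and f: "f \<in> lmod_hom A M N"
  and b: "bij_betw f (carrier M) (carrier N)"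
 shows "iso_mor (full_subcategory (mod_category A) P) M N f"
 unfolding iso_mor_def full_subcategory_simps mod_category_simps
proof (intro conjI f bexI[OF _ lmod_hom_inv[OF M N f b]])
 let ?g = "\<lambda>y\<in>carrier N. inv_into (carrier M) f y"
 show "(\<lambda>x\<in>carrier M. ?g (f x)) = (\<lambda>x\<in>carrier M. x)"
  by (rule restrict_ext) (simp add: lmod_homD(1)[OF f] bij_betw_inv_into_left[OF b])
 show "(\<lambda>x\<in>carrier N. f (?g x)) = (\<lambda>x\<in>carrier N. x)"
  by (rule restrict_ext) (simp add: bij_betw_inv_into_right[OF b])
qed

context auslander
begin

lemma T_sum_finite_dimensional: "finite J ==> finite_dimensional DD (T_sum n J)"
 unfolding T_sum_def by (rule finite_dimensional_direct_sum[OF DD.calg_axioms _ T_mod_module T_mod_finite_dimensional])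

lemma F_module_zero: "F_module J (direct_sum {..<0::nat} (\<lambda>_. T_sum n J))"
proof -
 let ?Z = "direct_sum {..<0::nat} (\<lambda>_. T_sum n J)"
 have Z: "left_module DD ?Z" by (rule left_module_direct_sum[OF DD.ring_axioms T_sum_module])
 have "finite_dimensional DD ?Z"
  by (rule finite_dimensional_direct_sum[OF DD.calg_axioms finite_lessThan T_sum_module]) simp
 moreover have "satur ?Z {\<zero>\<^sub>?Z}" unfolding satur_def by (simp add: direct_sum_simps restrict_def)
 moreover have "in_add DD (T_sum n J) (res ?Z (etaS ?Z))"
  unfolding etaS_direct_sum_full[OF T_sum_module etaS_T_sum] using in_add_power[OF T_sum_module, where k = 0] by simp
 ultimately show ?thesis unfolding F_module_def using Z by simp
qed

lemma F_module_pair: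
 assumes X: "F_module J X" and Y: "F_module J Y"
 shows "F_module J (pair_sum X Y)"
proof -
 let ?X = "\<lambda>i::nat. if i = 0 then X else Y" and ?S = "pair_sum X Y"
 note XD = F_moduleD[OF X] and YD = F_moduleD[OF Y]
 interpret X: dmod n X by (rule dmod[OF XD(1)])
 interpret Y: dmod n Y by (rule dmod[OF YD(1)])
 have m: "left_module DD (?X i)" for i using XD(1) YD(1) by simp
 have S: "left_module DD ?S" by (rule left_module_direct_sum[OF DD.ring_axioms m])
 have "finite_dimensional DD ?S"
  by (rule finite_dimensional_direct_sum[OF DD.calg_axioms finite_lessThan m]) (use XD(2) YD(2) in simp)
 moreover have "satur ?S {\<zero>\<^sub>?S}"
  unfolding satur_def
 proof (intro allI impI)
  fix k x assume k: "1 \<le> k" "k < n" and x: "x \<in> carrier ?S" and e: "dU k k k \<odot>\<^sub>?S x = x"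
   and z: "dU k (k - 1) k \<odot>\<^sub>?S x \<in> {\<zero>\<^sub>?S}"
  have s: "satur (?X i) {\<zero>\<^bsub>?X i\<^esub>}" for i using XD(3) YD(3) by simp
  have z': "dU k (k - 1) k \<odot>\<^sub>?S x = \<zero>\<^sub>?S" using z by simp
  have xi: "x i \<in> {\<zero>\<^bsub>?X i\<^esub>}" if i: "i \<in> {..<2}" for i
  proof (rule saturD[OF s k direct_sum_memD[OF x i]])
   show "dU k k k \<odot>\<^bsub>?X i\<^esub> x i = x i" using fun_cong[OF e, of i] i by (simp add: direct_sum_simps)
   show "dU k (k - 1) k \<odot>\<^bsub>?X i\<^esub> x i \<in> {\<zero>\<^bsub>?X i\<^esub>}" using fun_cong[OF z', of i] i by (simp add: direct_sum_simps)
  qed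
  have "x = \<zero>\<^sub>?S"
  proof (rule direct_sum_ext[OF x abelian_groupE(2)[OF left_module_abelian_group[OF S]]])
   fix i :: nat assume i: "i \<in> {..<2}"
   show "x i = \<zero>\<^sub>?S i" using xi[OF i] i by (simp add: direct_sum_simps)
  qed
  then show "x \<in> {\<zero>\<^sub>?S}" by simp
 qed
 moreover have "in_add DD (T_sum n J) (res ?S (etaS ?S))"
 proof -
  have "etaS ?S = (\<Pi>\<^sub>E i\<in>{..<2}. etaS (?X i))"
  proof
   show "etaS ?S \<subseteq> (\<Pi>\<^sub>E i\<in>{..<2}. etaS (?X i))"
   proof
    fix x assume "x \<in> etaS ?S"
    then have "x \<in> carrier ?S \<and> (\<forall>i\<in>{..<2}. x i \<in> etaS (?X i))" by (rule iffD1[OF etaS_direct_sum[OF m]])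
    then show "x \<in> (\<Pi>\<^sub>E i\<in>{..<2}. etaS (?X i))" unfolding direct_sum_simps PiE_def Pi_def by blast
   qed
   show "(\<Pi>\<^sub>E i\<in>{..<2}. etaS (?X i)) \<subseteq> etaS ?S"
   proof
    fix x assume x: "x \<in> (\<Pi>\<^sub>E i\<in>{..<2}. etaS (?X i))"
    have "etaS (?X i) \<subseteq> carrier (?X i)" for i by (simp add: etaS_def subset_eq)
    then have "x \<in> carrier ?S \<and> (\<forall>i\<in>{..<2}. x i \<in> etaS (?X i))"
     using x unfolding direct_sum_simps PiE_def Pi_def by blast
    then show "x \<in> etaS ?S" by (rule iffD2[OF etaS_direct_sum[OF m]])
   qed
  qed
  then have "res ?S (etaS ?S) = pair_sum (res X (etaS X)) (res Y (etaS Y))"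
   unfolding direct_sum_def by (auto simp: fun_eq_iff intro!: PiE_cong)
  then show ?thesis
   using in_add_pair_sum[OF X.left_module_restrict[OF X.etaS_submodule] Y.left_module_restrict[OF Y.etaS_submodule]
     T_sum_module XD(4) YD(4)] by simp
 qed
 ultimately show ?thesis unfolding F_module_def using S by simp
qed

lemma F_Delta_simps:
 "HomGrp (F_Delta_cat n J) = HomGrp (mod_category DD)" "Cmp (F_Delta_cat n J) = Cmp (mod_category DD)"
 "Idn (F_Delta_cat n J) = Idn (mod_category DD)"
 unfolding F_Delta_cat_def by (simp_all add: full_subcategory_simps)

lemma Sub_Q_simps:
 "HomGrp (Sub_Q_cat n J) = HomGrp (mod_category PP)" "Cmp (Sub_Q_cat n J) = Cmp (mod_category PP)"
 "Idn (Sub_Q_cat n J) = Idn (mod_category PP)"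
 unfolding Sub_Q_cat_def by (simp_all add: full_subcategory_simps)

text \<open>The direct sum of two modules has carrier in a function type; the biproduct is a copy of it.\<close>

lemma F_Delta_additive:
 fixes \<iota> :: "complex => 'm"
 assumes \<iota>: "inj \<iota>"
 shows "additive_category (F_Delta_cat n J :: ((D_elem, 'm) module, 'm => 'm) precat)"
proof -
 let ?F = "F_Delta_cat n J :: ((D_elem, 'm) module, 'm => 'm) precat"
 interpret F: preadditive_category ?F
  unfolding F_Delta_cat_def by (rule preadditive_full_subcategory[OF mod_category_preadditive])
 show ?thesis
 proof (rule additive_category.intro[OF F.preadditive_category_axioms], rule additive_category_axioms.intro)
  let ?Z = "direct_sum {..<0::nat} (\<lambda>_. T_sum n J)"
  obtain Z :: "(D_elem, 'm) module" and c where Z: "F_module J Z" and c: "c \<in> lmod_hom DD ?Z Z"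
   and b: "bij_betw c (carrier ?Z) (carrier Z)"
   by (rule F_module_copy[OF \<iota> F_module_zero[of J]])
  have "x = \<zero>\<^sub>Z" if x: "x \<in> carrier Z" for x
  proof -
   obtain y where y: "y \<in> carrier ?Z" "x = c y" using x unfolding bij_betw_imp_surj_on[OF b, symmetric] by (elim imageE) simp
   have "y = \<zero>\<^sub>?Z" using y(1) by (simp add: direct_sum_simps restrict_def)
   then show ?thesis unfolding y(2)
    using lmod_hom_zero[OF F_moduleD(1)[OF F_module_zero] F_moduleD(1)[OF Z] c] by simp
  qed
  then have "(\<lambda>x\<in>carrier Z. x) = (\<lambda>x\<in>carrier Z. \<zero>\<^sub>Z)" by (intro restrict_ext)
  then have "Idn ?F Z = \<one>\<^bsub>HomGrp ?F Z Z\<^esub>" unfolding F_Delta_simps mod_category_simps .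
  then show "\<exists>Z\<in>Ob ?F. Idn ?F Z = \<one>\<^bsub>HomGrp ?F Z Z\<^esub>" by (rule bexI) (rule iffD2[OF F_Delta_Ob Z])
 next
  fix X Y :: "(D_elem, 'm) module" assume X: "X \<in> Ob ?F" and Y: "Y \<in> Ob ?F"
  have FX: "F_module J X" and FY: "F_module J Y" using X Y by (simp_all add: F_Delta_Ob)
  note mX = F_moduleD(1)[OF FX] and mY = F_moduleD(1)[OF FY]
  let ?S = "pair_sum X Y"
  note FS = F_module_pair[OF FX FY]
  note mS = F_moduleD(1)[OF FS]
  interpret X: dmod n X by (rule dmod[OF mX])
  interpret Y: dmod n Y by (rule dmod[OF mY])
  obtain P :: "(D_elem, 'm) module" and c where FP: "F_module J P" and c: "c \<in> lmod_hom DD ?S P"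
   and b: "bij_betw c (carrier ?S) (carrier P)"
   by (rule F_module_copy[OF \<iota> FS])
  note mP = F_moduleD(1)[OF FP] and cD = lmod_homD[OF c]
  define d where "d = (\<lambda>y\<in>carrier P. inv_into (carrier ?S) c y)"
  have d: "d \<in> lmod_hom DD P ?S" unfolding d_def by (rule lmod_hom_inv[OF mS mP c b])
  note dD = lmod_homD[OF d]
  have dc: "d (c x) = x" if "x \<in> carrier ?S" for x
   using bij_betw_inv_into_left[OF b that] cD(1)[OF that] by (simp add: d_def)
  have cd: "c (d x) = x" if "x \<in> carrier P" for x
   using bij_betw_inv_into_right[OF b that] that by (simp add: d_def)
  define i0 where "i0 x = (\<lambda>k\<in>{..<2::nat}. if k = 0 then x else \<zero>\<^sub>Y)" for x
  define j0 where "j0 y = (\<lambda>k\<in>{..<2::nat}. if k = 0 then \<zero>\<^sub>X else y)" for y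
  have i0c: "i0 x \<in> carrier ?S" if "x \<in> carrier X" for x
   unfolding i0_def by (rule direct_sum_memI) (simp add: that)
  have j0c: "j0 x \<in> carrier ?S" if "x \<in> carrier Y" for x
   unfolding j0_def by (rule direct_sum_memI) (simp add: that)
  have i0: "(\<lambda>x\<in>carrier X. i0 x) \<in> lmod_hom DD X ?S"
   by (rule lmod_homI[OF i0c _ _ mX]) (auto simp: i0_def direct_sum_simps fun_eq_iff restrict_def)
  have j0: "(\<lambda>x\<in>carrier Y. j0 x) \<in> lmod_hom DD Y ?S"
   by (rule lmod_homI[OF j0c _ _ mY]) (auto simp: j0_def direct_sum_simps fun_eq_iff restrict_def)
  have p0: "(\<lambda>x\<in>carrier ?S. x 0) \<in> lmod_hom DD ?S X"
   using direct_sum_proj_hom[OF mS, of 0] by simp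
  have q0: "(\<lambda>x\<in>carrier ?S. x 1) \<in> lmod_hom DD ?S Y"
   using direct_sum_proj_hom[OF mS, of 1] by simp
  define i where "i = (\<lambda>x\<in>carrier X. c ((\<lambda>x\<in>carrier X. i0 x) x))"
  define j where "j = (\<lambda>x\<in>carrier Y. c ((\<lambda>x\<in>carrier Y. j0 x) x))"
  define p where "p = (\<lambda>x\<in>carrier P. (\<lambda>x\<in>carrier ?S. x 0) (d x))"
  define q where "q = (\<lambda>x\<in>carrier P. (\<lambda>x\<in>carrier ?S. x (1::nat)) (d x))"
  have ij: "i \<in> lmod_hom DD X P" "j \<in> lmod_hom DD Y P" "p \<in> lmod_hom DD P X" "q \<in> lmod_hom DD P Y"
   unfolding i_def j_def p_def q_def
   by (rule lmod_hom_compose[OF i0 c mX] lmod_hom_compose[OF j0 c mY] lmod_hom_compose[OF d p0 mP]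
     lmod_hom_compose[OF d q0 mP])+
  have ix: "i x = c (i0 x)" if "x \<in> carrier X" for x using that by (simp add: i_def)
  have jx: "j x = c (j0 x)" if "x \<in> carrier Y" for x using that by (simp add: j_def)
  have px: "p x = d x 0" and qx: "q x = d x 1" if "x \<in> carrier P" for x
   using that dD(1)[OF that] by (simp_all add: p_def q_def)
  have pi: "(\<lambda>x\<in>carrier X. p (i x)) = (\<lambda>x\<in>carrier X. x)"
  proof (rule restrict_ext)
   fix x assume x: "x \<in> carrier X"
   show "p (i x) = x" unfolding ix[OF x] px[OF cD(1)[OF i0c[OF x]]] dc[OF i0c[OF x]] by (simp add: i0_def)
  qed
  have qi: "(\<lambda>x\<in>carrier X. q (i x)) = (\<lambda>x\<in>carrier X. \<zero>\<^sub>Y)"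
  proof (rule restrict_ext)
   fix x assume x: "x \<in> carrier X"
   show "q (i x) = \<zero>\<^sub>Y" unfolding ix[OF x] qx[OF cD(1)[OF i0c[OF x]]] dc[OF i0c[OF x]] by (simp add: i0_def)
  qed
  have qj: "(\<lambda>x\<in>carrier Y. q (j x)) = (\<lambda>x\<in>carrier Y. x)"
  proof (rule restrict_ext)
   fix x assume x: "x \<in> carrier Y"
   show "q (j x) = x" unfolding jx[OF x] qx[OF cD(1)[OF j0c[OF x]]] dc[OF j0c[OF x]] by (simp add: j0_def)
  qed
  have pj: "(\<lambda>x\<in>carrier Y. p (j x)) = (\<lambda>x\<in>carrier Y. \<zero>\<^sub>X)"
  proof (rule restrict_ext)
   fix x assume x: "x \<in> carrier Y"
   show "p (j x) = \<zero>\<^sub>X" unfolding jx[OF x] px[OF cD(1)[OF j0c[OF x]]] dc[OF j0c[OF x]] by (simp add: j0_def)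
  qed
  have sum: "(\<lambda>x\<in>carrier P. (\<lambda>x\<in>carrier P. i (p x)) x \<oplus>\<^sub>P (\<lambda>x\<in>carrier P. j (q x)) x) = (\<lambda>x\<in>carrier P. x)"
  proof (rule restrict_ext)
   fix x assume x: "x \<in> carrier P"
   note dx = dD(1)[OF x]
   have d0: "d x 0 \<in> carrier X" and d1: "d x 1 \<in> carrier Y"
    using direct_sum_memD[OF dx, of 0] direct_sum_memD[OF dx, of 1] by simp_all
   have "i0 (d x 0) \<oplus>\<^sub>?S j0 (d x 1) = d x"
   proof (rule direct_sum_ext[OF left_module_add_closed[OF mS i0c[OF d0] j0c[OF d1]] dx])
    fix k :: nat assume "k \<in> {..<2}"
    then consider "k = 0" | "k = 1" by fastforce
    then show "(i0 (d x 0) \<oplus>\<^sub>?S j0 (d x 1)) k = d x k"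
     by cases (use d0 d1 in \<open>simp_all add: direct_sum_simps i0_def j0_def\<close>)
   qed
   then have "c (i0 (d x 0)) \<oplus>\<^sub>P c (j0 (d x 1)) = x"
    using cD(2)[OF i0c[OF d0] j0c[OF d1]] cd[OF x] by simp
   then show "(\<lambda>x\<in>carrier P. i (p x)) x \<oplus>\<^sub>P (\<lambda>x\<in>carrier P. j (q x)) x = x"
    unfolding restrict_apply'[OF x] px[OF x] qx[OF x] ix[OF d0] jx[OF d1] .
  qed
  show "\<exists>P\<in>Ob ?F. \<exists>i\<in>Mor ?F X P. \<exists>j\<in>Mor ?F Y P. \<exists>p\<in>Mor ?F P X. \<exists>q\<in>Mor ?F P Y.
     Cmp ?F X P X p i = Idn ?F X \<and> Cmp ?F Y P Y q j = Idn ?F Y \<and>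
     Cmp ?F Y P X p j = \<one>\<^bsub>HomGrp ?F Y X\<^esub> \<and> Cmp ?F X P Y q i = \<one>\<^bsub>HomGrp ?F X Y\<^esub> \<and>
     Cmp ?F P X P i p \<otimes>\<^bsub>HomGrp ?F P P\<^esub> Cmp ?F P Y P j q = Idn ?F P"
   unfolding F_Delta_simps mod_category_simps
  proof (rule bexI[where x = P], rule bexI[where x = i], rule bexI[where x = j], rule bexI[where x = p],
    rule bexI[where x = q], intro conjI)
   show "P \<in> Ob ?F" by (rule iffD2[OF F_Delta_Ob FP])
  qed (fact pi qj pj qi sum ij)+
 qed
qed

end

section \<open>The equivalence\<close>

context auslander
begin

text \<open>The power of \<open>Q\<^sub>J\<close> that contains \<open>\<pi> M\<close> has carrier in another type and is replaced by a copy.\<close>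

lemma pi_obj_Sub_Q:
 fixes M :: "(D_elem, 'm) module" and \<iota> :: "complex => 'm"
 assumes \<iota>: "inj \<iota>" and J: "J \<subseteq> {1..n - 1}" and F: "F_module J M"
 shows "pi_obj n M \<in> Ob (Sub_Q_cat n J)"
proof -
 note D = F_moduleD[OF F]
 from D(4) obtain k :: nat and i r where
  i: "i \<in> lmod_hom DD (res M (etaS M)) (direct_sum {..<k} (\<lambda>_. T_sum n J))"
  and r: "r \<in> lmod_hom DD (direct_sum {..<k} (\<lambda>_. T_sum n J)) (res M (etaS M))"
  and ri: "\<forall>m\<in>carrier (res M (etaS M)). r (i m) = m"
  unfolding in_add_def by blast
 let ?Q = "direct_sum {..<k} (\<lambda>_. Q_mod n J)"
 obtain f \<kappa> where R: "resolves (direct_sum {..<k} (\<lambda>_. T_sum n J))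
  (direct_sum {..<k} (\<lambda>_. direct_sum J (\<lambda>j. D_proj n (n - j)))) ?Q f \<kappa>"
  by (rule T_sum_power_resolves[OF J])
 note RD = resolvesD[OF R]
 have "\<exists>h\<in>lmod_hom PP (pi_obj n M) ?Q. inj_on h (carrier (pi_obj n M))"
  by (rule pi_embeds[OF D(1,3) R i r]) (use ri in simp)
 then obtain h where h: "h \<in> lmod_hom PP (pi_obj n M) ?Q" "inj_on h (carrier (pi_obj n M))" by blast
 interpret P: dmod n "direct_sum {..<k} (\<lambda>_. direct_sum J (\<lambda>j. D_proj n (n - j)))" by (rule dmod[OF RD(2)])
 interpret Q: amod "PP" ?Q by (rule amod_intro[OF PiA.calg_axioms RD(3)])
 have fdQ: "finite_dimensional PP ?Q"
  by (rule finite_dimensional_image[OF P.amod_axioms Q.amod_axioms RD(11) semiD(2)[OF RD(10)]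
     semi_scal[OF RD(2,10)] RD(5)])
 have "inj (\<lambda>c. {\<iota> c})" using \<iota> by (simp add: inj_def)
 then obtain e :: "_ => 'm set" where e: "inj_on e (carrier ?Q)"
  by (rule finite_dimensional_embeds[OF _ Q.amod_axioms fdQ])
 let ?Y = "copy_mod e ?Q"
 note c = copy_mod[OF RD(3) e]
 have Qm: "left_module PP (Q_mod n J)"
 proof -
  have "j \<in> J ==> n - j < n" for j using J zero_less_n by fastforce
  then show ?thesis unfolding Q_mod_def by (intro left_module_direct_sum[OF PiA.ring_axioms Pi_proj_semi(1)])
 qed
 have "in_add PP (Q_mod n J) ?Y"
  by (rule in_add_retract[OF c(1) lmod_hom_inv[OF RD(3) c] c(2) _ in_add_power[OF Qm] Qm])
   (use bij_betw_inv_into_right[OF c(3)] inv_into_into[of _ "\<lambda>x\<in>carrier ?Q. e x"] bij_betw_imp_surj_on[OF c(3)] in simp)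
 moreover have "finite_dimensional PP ?Y"
  by (rule finite_dimensional_hom_image[OF PiA.calg_axioms RD(3) c(1,2) bij_betw_imp_surj_on[OF c(3)] fdQ])
 moreover have "(\<lambda>x\<in>carrier (pi_obj n M). (\<lambda>x\<in>carrier ?Q. e x) (h x)) \<in> lmod_hom PP (pi_obj n M) ?Y"
  by (rule lmod_hom_compose[OF h(1) c(2) pi_module[OF D(1)]])
 moreover have "inj_on (\<lambda>x\<in>carrier (pi_obj n M). (\<lambda>x\<in>carrier ?Q. e x) (h x)) (carrier (pi_obj n M))"
 proof (rule inj_onI)
  fix x y assume x: "x \<in> carrier (pi_obj n M)" and y: "y \<in> carrier (pi_obj n M)"
   and "(\<lambda>x\<in>carrier (pi_obj n M). (\<lambda>x\<in>carrier ?Q. e x) (h x)) x = (\<lambda>x\<in>carrier (pi_obj n M). (\<lambda>x\<in>carrier ?Q. e x) (h x)) y"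
  then have "e (h x) = e (h y)" using lmod_homD(1)[OF h(1)] by simp
  then have "h x = h y" by (rule inj_onD[OF e _ lmod_homD(1)[OF h(1) x] lmod_homD(1)[OF h(1) y]])
  then show "x = y" by (rule inj_onD[OF h(2) _ x y])
 qed
 ultimately show ?thesis
  unfolding Sub_Q_cat_def full_subcategory_simps mod_category_simps
  using pi_module[OF D(1)] pi_finite_dimensional[OF D(1,2)] c(1)
  by (intro conjI bexI[where x = ?Y] bexI[where x = "\<lambda>x\<in>carrier (pi_obj n M). (\<lambda>x\<in>carrier ?Q. e x) (h x)"])
   (simp_all add: mod_category_simps)
qed

lemma pi_mor_eq_zero_iff:
 assumes M: "left_module DD M" and N: "left_module DD N" and f: "f \<in> lmod_hom DD M N"
 shows "pi_mor n M N f = (\<lambda>X\<in>carrier (pi_obj n M). \<zero>\<^bsub>pi_obj n N\<^esub>) \<longleftrightarrow> (\<forall>x\<in>carrier M. f x \<in> etaS N)"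
proof -
 interpret N: dmod n N by (rule dmod[OF N])
 note fD = lmod_homD[OF f] and Z = pi_obj_simps(2)[OF N]
 have eq: "pi_mor n M N f (qpi M x) = \<zero>\<^bsub>pi_obj n N\<^esub> \<longleftrightarrow> f x \<in> etaS N" if x: "x \<in> carrier M" for x
  unfolding pi_mor_qpi[OF M N f x] Z qpi_eq_iff[OF N fD(1)[OF x] N.M.zero_closed] N.diff_zero[OF fD(1)[OF x]] ..
 show ?thesis
 proof
  assume e: "pi_mor n M N f = (\<lambda>X\<in>carrier (pi_obj n M). \<zero>\<^bsub>pi_obj n N\<^esub>)"
  show "\<forall>x\<in>carrier M. f x \<in> etaS N"
  proof
   fix x assume x: "x \<in> carrier M"
   show "f x \<in> etaS N" by (rule iffD1[OF eq[OF x]]) (simp add: e qpi_closed[OF M x])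
  qed
 next
  assume z: "\<forall>x\<in>carrier M. f x \<in> etaS N"
  show "pi_mor n M N f = (\<lambda>X\<in>carrier (pi_obj n M). \<zero>\<^bsub>pi_obj n N\<^esub>)"
  proof (rule extensionalityI[of _ "carrier (pi_obj n M)"])
   show "pi_mor n M N f \<in> extensional (carrier (pi_obj n M))" by (simp add: pi_mor_def)
   show "(\<lambda>X\<in>carrier (pi_obj n M). \<zero>\<^bsub>pi_obj n N\<^esub>) \<in> extensional (carrier (pi_obj n M))" by simp
   fix X assume X: "X \<in> carrier (pi_obj n M)"
   obtain x where x: "x \<in> carrier M" "X = qpi M x" by (rule pi_cases[OF M X])
   have "pi_mor n M N f X = \<zero>\<^bsub>pi_obj n N\<^esub>" unfolding x(2) by (rule iffD2[OF eq[OF x(1)]]) (simp add: z x(1))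
   then show "pi_mor n M N f X = (\<lambda>X\<in>carrier (pi_obj n M). \<zero>\<^bsub>pi_obj n N\<^esub>) X" using X by simp
  qed
 qed
qed

text \<open>
 A map with image in \<open>\<eta> N\<close> factors through \<open>\<eta> N\<close>, which is in \<open>add T\<^sub>J\<close>; conversely modules in
 \<open>add T\<^sub>J\<close> coincide with their trace, which every map sends to the trace.
\<close>

lemma add_T_ideal_kernel:
 fixes M N :: "(D_elem, 'c) module"
 assumes J: "finite J" and M: "F_module J M" and N: "F_module J N"
 shows "add_T_ideal n J M N = {f \<in> lmod_hom DD M N. pi_mor n M N f = (\<lambda>X\<in>carrier (pi_obj n M). \<zero>\<^bsub>pi_obj n N\<^esub>)}"
proof
 note MD = F_moduleD[OF M] and ND = F_moduleD[OF N]
 interpret N: dmod n N by (rule dmod[OF ND(1)])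
 note E = N.submoduleD[OF N.etaS_submodule]
 show "add_T_ideal n J M N \<subseteq> {f \<in> lmod_hom DD M N. pi_mor n M N f = (\<lambda>X\<in>carrier (pi_obj n M). \<zero>\<^bsub>pi_obj n N\<^esub>)}"
 proof
  fix f assume "f \<in> add_T_ideal n J M N"
  then have "\<exists>(Z :: (D_elem, 'c) module) g h. f = (\<lambda>x\<in>carrier M. h (g x)) \<and> (left_module DD Z \<and> finite_dimensional DD Z) \<and>
    in_add DD (T_sum n J) Z \<and> g \<in> lmod_hom DD M Z \<and> h \<in> lmod_hom DD Z N"
   unfolding add_T_ideal_def factoring_mor_def mod_category_simps mem_Collect_eq .
  then obtain Z :: "(D_elem, 'c) module" where "\<exists>g h. f = (\<lambda>x\<in>carrier M. h (g x)) \<and> (left_module DD Z \<and> finite_dimensional DD Z) \<and>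
    in_add DD (T_sum n J) Z \<and> g \<in> lmod_hom DD M Z \<and> h \<in> lmod_hom DD Z N" by (rule exE)
  then obtain g where "\<exists>h. f = (\<lambda>x\<in>carrier M. h (g x)) \<and> (left_module DD Z \<and> finite_dimensional DD Z) \<and>
    in_add DD (T_sum n J) Z \<and> g \<in> lmod_hom DD M Z \<and> h \<in> lmod_hom DD Z N" by (rule exE)
  then obtain h where "f = (\<lambda>x\<in>carrier M. h (g x)) \<and> (left_module DD Z \<and> finite_dimensional DD Z) \<and>
    in_add DD (T_sum n J) Z \<and> g \<in> lmod_hom DD M Z \<and> h \<in> lmod_hom DD Z N" by (rule exE)
  then have Z: "left_module DD Z" "in_add DD (T_sum n J) Z" and g: "g \<in> lmod_hom DD M Z"
   and h: "h \<in> lmod_hom DD Z N" and f: "f = (\<lambda>x\<in>carrier M. h (g x))" by simp_all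
  have "h (g x) \<in> etaS N" if "x \<in> carrier M" for x
   by (rule etaS_hom[OF h Z(1)]) (simp add: etaS_in_add[OF Z] lmod_homD(1)[OF g that])
  moreover have fh: "f \<in> lmod_hom DD M N" unfolding f by (rule lmod_hom_compose[OF g h MD(1)])
  ultimately show "f \<in> {f \<in> lmod_hom DD M N. pi_mor n M N f = (\<lambda>X\<in>carrier (pi_obj n M). \<zero>\<^bsub>pi_obj n N\<^esub>)}"
   using pi_mor_eq_zero_iff[OF MD(1) ND(1) fh] f by simp
 qed
 show "{f \<in> lmod_hom DD M N. pi_mor n M N f = (\<lambda>X\<in>carrier (pi_obj n M). \<zero>\<^bsub>pi_obj n N\<^esub>)} \<subseteq> add_T_ideal n J M N"
 proof
  fix f assume "f \<in> {f \<in> lmod_hom DD M N. pi_mor n M N f = (\<lambda>X\<in>carrier (pi_obj n M). \<zero>\<^bsub>pi_obj n N\<^esub>)}"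
  then have f: "f \<in> lmod_hom DD M N" and "pi_mor n M N f = (\<lambda>X\<in>carrier (pi_obj n M). \<zero>\<^bsub>pi_obj n N\<^esub>)" by simp_all
  then have fe: "f x \<in> etaS N" if "x \<in> carrier M" for x using pi_mor_eq_zero_iff[OF MD(1) ND(1) f] that by simp
  let ?Z = "res N (etaS N)"
  have Z: "left_module DD ?Z" by (rule N.left_module_restrict[OF N.etaS_submodule])
  have fd: "finite_dimensional DD ?Z"
   by (rule in_add_finite_dimensional[OF DD.calg_axioms T_sum_module T_sum_finite_dimensional[OF J] Z ND(4)])
  have g: "(\<lambda>x\<in>carrier M. f x) \<in> lmod_hom DD M ?Z"
   by (rule lmod_homI[OF _ _ _ MD(1)]) (simp_all add: fe lmod_homD[OF f])
  have h: "(\<lambda>x\<in>etaS N. (\<lambda>x\<in>carrier N. x) x) \<in> lmod_hom DD ?Z N"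
   by (rule lmod_hom_restrict[OF lmod_hom_ident[OF ND(1)] ND(1) N.etaS_submodule])
  have fgh: "f = (\<lambda>x\<in>carrier M. (\<lambda>x\<in>etaS N. (\<lambda>x\<in>carrier N. x) x) ((\<lambda>x\<in>carrier M. f x) x))"
  proof (rule lmod_hom_ext[OF f lmod_hom_compose[OF g h MD(1)]])
   fix x assume x: "x \<in> carrier M"
   show "f x = (\<lambda>x\<in>carrier M. (\<lambda>x\<in>etaS N. (\<lambda>x\<in>carrier N. x) x) ((\<lambda>x\<in>carrier M. f x) x)) x"
    using x fe[OF x] E(3)[OF fe[OF x]] by simp
  qed
  show "f \<in> add_T_ideal n J M N"
   unfolding add_T_ideal_def factoring_mor_def mod_category_simps
   by (rule CollectI, rule exI[where x = ?Z], rule exI[where x = "\<lambda>x\<in>carrier M. f x"],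
     rule exI[where x = "\<lambda>x\<in>etaS N. (\<lambda>x\<in>carrier N. x) x"], intro conjI fgh Z fd ND(4) g h)
 qed
qed

lemma pi_additive_functor:
 fixes \<iota> :: "complex => 'm"
 assumes \<iota>: "inj \<iota>" and J: "J \<subseteq> {1..n - 1}"
 shows "additive_functor (F_Delta_cat n J :: ((D_elem, 'm) module, 'm => 'm) precat) (Sub_Q_cat n J) (pi_obj n) (pi_mor n)"
 unfolding additive_functor_def F_Delta_simps Sub_Q_simps mod_category_simps F_Delta_Ob
proof (intro conjI ballI)
 fix M :: "(D_elem, 'm) module" assume "M \<in> Ob (F_Delta_cat n J)"
 then have M: "F_module J M" by (rule iffD1[OF F_Delta_Ob])
 note mM = F_moduleD(1)[OF M]
 show "pi_obj n M \<in> Ob (Sub_Q_cat n J)" by (rule pi_obj_Sub_Q[OF \<iota> J M])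
 have idM: "(\<lambda>x\<in>carrier M. x) \<in> lmod_hom DD M M" by (rule lmod_hom_ident[OF mM])
 show "pi_mor n M M (\<lambda>x\<in>carrier M. x) = (\<lambda>X\<in>carrier (pi_obj n M). X)"
 proof (rule lmod_hom_ext[OF pi_mor_hom[OF mM mM idM] lmod_hom_ident[OF pi_module[OF mM]]])
  fix X assume X: "X \<in> carrier (pi_obj n M)"
  obtain x where x: "x \<in> carrier M" "X = qpi M x" by (rule pi_cases[OF mM X])
  show "pi_mor n M M (\<lambda>x\<in>carrier M. x) X = (\<lambda>X\<in>carrier (pi_obj n M). X) X"
   using pi_mor_qpi[OF mM mM idM x(1)] x X by simp
 qed
 fix N :: "(D_elem, 'm) module" assume "N \<in> Ob (F_Delta_cat n J)"
 then have N: "F_module J N" by (rule iffD1[OF F_Delta_Ob])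
 note mN = F_moduleD(1)[OF N]
 show "pi_mor n M N \<in> hom (HomGrp (mod_category DD) M N) (HomGrp (mod_category PP) (pi_obj n M) (pi_obj n N))"
  unfolding hom_def mod_category_simps
 proof (intro CollectI conjI ballI Pi_I)
  show "pi_mor n M N f \<in> lmod_hom PP (pi_obj n M) (pi_obj n N)" if "f \<in> lmod_hom DD M N" for f
   by (rule pi_mor_hom[OF mM mN that])
  fix f g assume f: "f \<in> lmod_hom DD M N" and g: "g \<in> lmod_hom DD M N"
  note P = pi_obj_simps[OF mN]
  interpret C: preadditive_category "F_Delta_cat n J :: ((D_elem, 'm) module, 'm => 'm) precat"
   unfolding F_Delta_cat_def by (rule preadditive_full_subcategory[OF mod_category_preadditive])
  have fg: "(\<lambda>x\<in>carrier M. f x \<oplus>\<^sub>N g x) \<in> lmod_hom DD M N"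
   using comm_groupE(1)[OF C.hom_comm_group[OF iffD2[OF F_Delta_Ob M] iffD2[OF F_Delta_Ob N]], of f g] f g
   unfolding F_Delta_simps mod_category_simps by simp
  show "pi_mor n M N (\<lambda>x\<in>carrier M. f x \<oplus>\<^sub>N g x) =
   (\<lambda>X\<in>carrier (pi_obj n M). pi_mor n M N f X \<oplus>\<^bsub>pi_obj n N\<^esub> pi_mor n M N g X)"
  proof (rule extensionalityI[of _ "carrier (pi_obj n M)"])
   show "pi_mor n M N (\<lambda>x\<in>carrier M. f x \<oplus>\<^sub>N g x) \<in> extensional (carrier (pi_obj n M))" by (simp add: pi_mor_def)
   show "(\<lambda>X\<in>carrier (pi_obj n M). pi_mor n M N f X \<oplus>\<^bsub>pi_obj n N\<^esub> pi_mor n M N g X) \<in> extensional (carrier (pi_obj n M))"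
    by simp
   fix X assume X: "X \<in> carrier (pi_obj n M)"
   obtain x where x: "x \<in> carrier M" "X = qpi M x" by (rule pi_cases[OF mM X])
   show "pi_mor n M N (\<lambda>x\<in>carrier M. f x \<oplus>\<^sub>N g x) X =
    (\<lambda>X\<in>carrier (pi_obj n M). pi_mor n M N f X \<oplus>\<^bsub>pi_obj n N\<^esub> pi_mor n M N g X) X"
    unfolding restrict_apply'[OF X]
    unfolding x(2) pi_mor_qpi[OF mM mN f x(1)] pi_mor_qpi[OF mM mN g x(1)] pi_mor_qpi[OF mM mN fg x(1)]
     P(3)[OF lmod_homD(1)[OF f x(1)] lmod_homD(1)[OF g x(1)]]
    using x(1) by simp
  qed
 qed
 fix L :: "(D_elem, 'm) module" assume "L \<in> Ob (F_Delta_cat n J)"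
 then have L: "F_module J L" by (rule iffD1[OF F_Delta_Ob])
 note mL = F_moduleD(1)[OF L]
 fix f g assume f: "f \<in> lmod_hom DD M N" and g: "g \<in> lmod_hom DD N L"
 have gf: "(\<lambda>x\<in>carrier M. g (f x)) \<in> lmod_hom DD M L" by (rule lmod_hom_compose[OF f g mM])
 show "pi_mor n M L (\<lambda>x\<in>carrier M. g (f x)) = (\<lambda>X\<in>carrier (pi_obj n M). pi_mor n N L g (pi_mor n M N f X))"
 proof (rule lmod_hom_ext[OF pi_mor_hom[OF mM mL gf]
    lmod_hom_compose[OF pi_mor_hom[OF mM mN f] pi_mor_hom[OF mN mL g] pi_module[OF mM]]])
  fix X assume X: "X \<in> carrier (pi_obj n M)"
  obtain x where x: "x \<in> carrier M" "X = qpi M x" by (rule pi_cases[OF mM X])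
  show "pi_mor n M L (\<lambda>x\<in>carrier M. g (f x)) X = (\<lambda>X\<in>carrier (pi_obj n M). pi_mor n N L g (pi_mor n M N f X)) X"
   unfolding restrict_apply'[OF X]
   unfolding x(2) pi_mor_qpi[OF mM mN f x(1)] pi_mor_qpi[OF mM mL gf x(1)]
    pi_mor_qpi[OF mN mL g lmod_homD(1)[OF f x(1)]]
   using x(1) by simp
 qed
qed

text \<open>An embedding of \<open>N\<close> into a module in \<open>add Q\<^sub>J\<close> gives one into a power of \<open>Q\<^sub>J\<close>.\<close>

lemma pi_dense:
 fixes \<iota> :: "complex => 'm" and N :: "(Pi_elem, 'm set) module"
 assumes \<iota>: "inj \<iota>" and J: "J \<subseteq> {1..n - 1}" and N: "N \<in> Ob (Sub_Q_cat n J)"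
 shows "\<exists>M\<in>Ob (F_Delta_cat n J :: ((D_elem, 'm) module, 'm => 'm) precat). \<exists>h. iso_mor (Sub_Q_cat n J) (pi_obj n M) N h"
proof -
 from N have mN: "left_module PP N" "finite_dimensional PP N"
  unfolding Sub_Q_cat_def full_subcategory_simps mod_category_simps by simp_all
 from N have "N \<in> Ob (mod_category PP) \<and>
  (\<exists>Y\<in>Ob (mod_category PP :: ((Pi_elem, 'm set) module, 'm set => 'm set) precat).
   in_add PP (Q_mod n J) Y \<and> (\<exists>f\<in>lmod_hom PP N Y. inj_on f (carrier N)))"
  unfolding Sub_Q_cat_def full_subcategory_simps .
 from conjunct2[OF this] obtain Y :: "(Pi_elem, 'm set) module" where Y0: "Y \<in> Ob (mod_category PP)"
  and Yf: "in_add PP (Q_mod n J) Y \<and> (\<exists>f\<in>lmod_hom PP N Y. inj_on f (carrier N))" by (rule bexE)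
 have Y: "left_module PP Y" "in_add PP (Q_mod n J) Y" using Y0 Yf unfolding mod_category_simps by simp_all
 from conjunct2[OF Yf] obtain f where f: "f \<in> lmod_hom PP N Y" "inj_on f (carrier N)" by (rule bexE)
 from Y(2) obtain k :: nat and i p where i: "i \<in> lmod_hom PP Y (direct_sum {..<k} (\<lambda>_. Q_mod n J))"
  and pi: "\<forall>m\<in>carrier Y. p (i m) = m"
  unfolding in_add_def by blast
 let ?Q = "direct_sum {..<k} (\<lambda>_. Q_mod n J)" and ?X = "direct_sum {..<k} (\<lambda>_. T_sum n J)"
 let ?P = "direct_sum {..<k} (\<lambda>_. direct_sum J (\<lambda>j. D_proj n (n - j)))"
 obtain g \<kappa> where R: "resolves ?X ?P ?Q g \<kappa>" by (rule T_sum_power_resolves[OF J])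
 define j where "j = (\<lambda>x\<in>carrier N. i (f x))"
 have j: "j \<in> lmod_hom PP N ?Q" unfolding j_def by (rule lmod_hom_compose[OF f(1) i mN(1)])
 have ji: "inj_on j (carrier N)"
 proof (rule inj_onI)
  fix x y assume x: "x \<in> carrier N" and y: "y \<in> carrier N" and "j x = j y"
  then have "p (i (f x)) = p (i (f y))" by (simp add: j_def)
  then have "f x = f y" using pi lmod_homD(1)[OF f(1) x] lmod_homD(1)[OF f(1) y] by simp
  then show "x = y" by (rule inj_onD[OF f(2) _ x y])
 qed
 define L where "L = res ?P {x \<in> carrier ?P. \<kappa> x \<in> j ` carrier N}"
 note pre = pi_preimage[OF R in_add_power[OF T_sum_module] mN j ji, folded L_def]
 from pre(2) obtain \<phi> where *: "semi L N \<phi> \<and> \<phi> ` carrier L = carrier N \<and>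
  (\<forall>x\<in>carrier L. \<phi> x = \<zero>\<^sub>N --> x \<in> etaS L)" by (rule exE)
 have \<phi>: "semi L N \<phi>" "\<phi> ` carrier L = carrier N" by (rule conjunct1[OF *], rule conjunct1[OF conjunct2[OF *]])
 note ker = conjunct2[OF conjunct2[OF *]]
 obtain M :: "(D_elem, 'm) module" and c where M: "F_module J M" and c: "c \<in> lmod_hom DD L M"
  and b: "bij_betw c (carrier L) (carrier M)"
  by (rule F_module_copy[OF \<iota> pre(1)])
 note mL = F_moduleD(1)[OF pre(1)] and mM = F_moduleD(1)[OF M]
 define d where "d = (\<lambda>y\<in>carrier M. inv_into (carrier L) c y)"
 have d: "d \<in> lmod_hom DD M L" unfolding d_def by (rule lmod_hom_inv[OF mL mM c b])
 have cd: "c (d y) = y" if "y \<in> carrier M" for y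
  using bij_betw_inv_into_right[OF b that] that by (simp add: d_def)
 have dc: "d (c x) = x" if "x \<in> carrier L" for x
  using bij_betw_inv_into_left[OF b that] lmod_homD(1)[OF c that] by (simp add: d_def)
 have s: "semi M N (\<lambda>x. \<phi> (d x))" by (rule semi_compose[OF d \<phi>(1)])
 have kerM: "x \<in> etaS M" if x: "x \<in> carrier M" and z: "\<phi> (d x) = \<zero>\<^sub>N" for x
 proof -
  have "d x \<in> etaS L" using ker lmod_homD(1)[OF d x] z by blast
  then have "c (d x) \<in> etaS M" by (rule etaS_hom[OF c mL])
  then show ?thesis unfolding cd[OF x] .
 qed
 obtain h where h: "h \<in> lmod_hom PP (pi_obj n M) N" "\<forall>x\<in>carrier M. h (qpi M x) = \<phi> (d x)"
 proof (rule semi_factor[OF mM mN(1) s])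
  fix h assume 1: "h \<in> lmod_hom PP (pi_obj n M) N" and 2: "\<And>x. x \<in> carrier M ==> h (qpi M x) = \<phi> (d x)"
  show thesis by (rule that[OF 1]) (rule ballI, erule 2)
 qed
 have "inj_on h (carrier (pi_obj n M))"
  by (rule semi_factor_inj[OF mM mN(1) s kerM]) (use h(2) in simp_all)
 moreover have "h ` carrier (pi_obj n M) = carrier N"
 proof
  show "h ` carrier (pi_obj n M) \<subseteq> carrier N" using lmod_homD(1)[OF h(1)] by (rule image_subsetI)
  show "carrier N \<subseteq> h ` carrier (pi_obj n M)"
  proof
   fix y assume "y \<in> carrier N"
   then have "y \<in> \<phi> ` carrier L" by (subst \<phi>(2))
   then obtain x where x: "x \<in> carrier L" "y = \<phi> x" by (elim imageE) simp
   have cx: "c x \<in> carrier M" by (rule lmod_homD(1)[OF c x(1)])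
   have "y = h (qpi M (c x))" using h(2) cx dc[OF x(1)] x(2) by simp
   then show "y \<in> h ` carrier (pi_obj n M)" using qpi_closed[OF mM cx] by (rule image_eqI)
  qed
 qed
 ultimately have "bij_betw h (carrier (pi_obj n M)) (carrier N)" unfolding bij_betw_def by simp
 then have "iso_mor (Sub_Q_cat n J) (pi_obj n M) N h"
  unfolding Sub_Q_cat_def by (rule iso_mor_bij[OF pi_module[OF mM] mN(1) h(1)])
 then show ?thesis 
  by (intro bexI[where x = M] exI[where x = h]) (assumption | rule iffD2[OF F_Delta_Ob M])+
qed

end

theorem proposition3p6:
  fixes n :: nat and J :: "nat set"
    and F :: "((D_elem, 'm) module, 'm \<Rightarrow> 'm) precat"
    and S :: "((Pi_elem, 'm set) module, 'm set \<Rightarrow> 'm set) precat"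
  assumes "n > 1" and "J \<subseteq> {1..n-1}"
    and "\<exists>\<iota> :: complex \<Rightarrow> 'm. inj \<iota>"
    and "F = F_Delta_cat n J" and "S = Sub_Q_cat n J"
  shows "\<exists>\<Phi>.
    (\<forall>M\<in>Ob F. \<forall>N\<in>Ob F. \<forall>f\<in>Mor F M N.
      \<Phi> M N (add_T_ideal n J M N #>\<^bsub>HomGrp F M N\<^esub> f) = pi_mor n M N f) \<and>
    additive_equivalence (quotient_category F (add_T_ideal n J)) S (pi_obj n) \<Phi>"
proof -
  interpret auslander n by (rule auslander.intro[OF assms(1)])
  obtain \<iota> :: "complex \<Rightarrow> 'm" where \<iota>: "inj \<iota>" using assms(3) by blast
  have fin: "finite J" using assms(2) finite_subset by blast
  note J = assms(2)
  show ?thesis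
    unfolding assms(4,5)
  proof (rule quotient_by_kernel_equivalence)
    show "additive_category (F_Delta_cat n J :: ((D_elem, 'm) module, 'm \<Rightarrow> 'm) precat)"
      by (rule F_Delta_additive[OF \<iota>])
    show "preadditive_category (Sub_Q_cat n J :: ((Pi_elem, 'm set) module, 'm set \<Rightarrow> 'm set) precat)"
      unfolding Sub_Q_cat_def by (rule preadditive_full_subcategory[OF mod_category_preadditive])
    show "additive_functor (F_Delta_cat n J :: ((D_elem, 'm) module, 'm \<Rightarrow> 'm) precat) (Sub_Q_cat n J) (pi_obj n) (pi_mor n)"
      by (rule pi_additive_functor[OF \<iota> J])
    show "\<exists>X\<in>Ob (F_Delta_cat n J :: ((D_elem, 'm) module, 'm \<Rightarrow> 'm) precat). \<exists>f. iso_mor (Sub_Q_cat n J) (pi_obj n X) Y f"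
      if "Y \<in> Ob (Sub_Q_cat n J)" for Y
      by (rule pi_dense[OF \<iota> J that])
  next
    fix M N :: "(D_elem, 'm) module"
    assume M: "M \<in> Ob (F_Delta_cat n J)" and N: "N \<in> Ob (F_Delta_cat n J)"
    have FM: "F_module J M" and FN: "F_module J N" using M N by (simp_all add: F_Delta_Ob)
    note mM = F_moduleD(1)[OF FM] and mN = F_moduleD(1)[OF FN]
    show "add_T_ideal n J M N =
      {f \<in> Mor (F_Delta_cat n J) M N. pi_mor n M N f = \<one>\<^bsub>HomGrp (Sub_Q_cat n J) (pi_obj n M) (pi_obj n N)\<^esub>}"
      unfolding F_Delta_simps Sub_Q_simps mod_category_simps by (rule add_T_ideal_kernel[OF fin FM FN])
    fix g assume "g \<in> Mor (Sub_Q_cat n J) (pi_obj n M) (pi_obj n N)"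
    then have g: "g \<in> lmod_hom (Pi_alg n) (pi_obj n M) (pi_obj n N)" unfolding Sub_Q_simps mod_category_simps .
    have fil: "has_standard_filtration n M"
      using M unfolding F_Delta_cat_def full_subcategory_simps by simp
    obtain G where G: "G \<in> lmod_hom DD M N" "pi_mor n M N G = g" by (rule lift_hom[OF mM mN fil g])
    show "\<exists>f\<in>Mor (F_Delta_cat n J) M N. pi_mor n M N f = g"
      unfolding F_Delta_simps mod_category_simps by (rule bexI[where x = G]) (rule G(2), rule G(1))
  qed
qed

end
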